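(* Let $([V],\phi):[M,A]\to[N,B]$ be a symplectic micromorphism between two symplectic microfolds. Then, for any lagrangian fibration $\mathcal{F}B$ of $[N,B]$, there exists a unique corresponding lagrangian fibration $\mathcal{F}A$ of $[M,A]$ along $\phi$ such that, for suitable representatives, $$\operatorname{gr}\Psi_y=V\cap(M\times\mathcal{F}_yB)\quad (y\in B),\qquad V=\bigcup_{y\in B}\operatorname{gr}\Psi_y,$$ where $[\Psi_y]:[\mathcal{F}_yA,\{\phi(y)\}]\to[\mathcal{F}_yB,\{y\}]$, $y\in B$, is a collection of smooth map germs indexed by $B$.
   Context: A microfold $[G,A]$ is a germ of a manifold $G$ around a closed submanifold $A$ (the core). A submicrofold $[H,B]\subset[G,A]$ is a microfold with representatives such that $B\subset A$, $H\subset G$ are submanifolds and $H\cap A=B$. A symplectic microfold is a microfold $[M,A]$ with $M$ symplectic and $A$ lagrangian in $M$; a submicrofold $[L,C]$ of it is lagrangian if $L$ is lagrangian in $M$. A lagrangian splitting of $[M,A]$ is a lagrangian subbundle $K\to A$ of $TM|_A$ transverse to $TA$. $\overline{M}$ denotes $M$ with the opposite symplectic form; for $\phi:B\to A$, $\operatorname{gr}\phi=\{(\phi(y),y)\}\subset A\times B$. A symplectic micromorphism $([V],\phi):[M,A]\to[N,B]$ is a lagrangian submicrofold $[V,\operatorname{gr}\phi]\subset[\overline{M}\times N,A\times B]$, with $\phi:B\to A$ smooth, such that $TV$ is transverse along $\operatorname{gr}\phi$ to a (equivalently, any) lagrangian subbundle of the form $TA\times K$, with $K$ a lagrangian splitting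 of $[N,B]$. A lagrangian submicrofold $[L,\{x\}]$ of $[M,A]$ is transverse if $T_xL+T_xA=T_xM$. A lagrangian fibration $\mathcal{F}A$ of $[M,A]$ is a collection, smoothly parametrized by $x\in A$, of transverse lagrangian submicrofolds $[\mathcal{F}_xA,\{x\}]\subset[M,A]$. A lagrangian fibration of $[M,A]$ along a smooth map $\phi:B\to A$ is a collection, smoothly indexed by $y\in B$, of transverse lagrangian submicrofolds $[\mathcal{F}_yA,\{\phi(y)\}]\subset[M,A]$. *)

theory Defs
  imports "HOL-Analysis.Analysis"
begin

section \<open>Smooth maps between subsets of Euclidean spaces\<close>

primrec Ck_on :: "nat \<Rightarrow> ('a::euclidean_space \<Rightarrow> 'b::euclidean_space) \<Rightarrow> 'a set \<Rightarrow> bool" where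
  "Ck_on 0 f W = continuous_on W f"
| "Ck_on (Suc k) f W = (\<exists>f'. (\<forall>x\<in>W. (f has_derivative f' x) (at x)) \<and>
      (\<forall>v. Ck_on k (\<lambda>x. f' x v) W))"

text \<open>Smoothness on an arbitrary set means the local existence of smooth extensions to open sets.\<close>

definition smooth_on :: "'a::euclidean_space set \<Rightarrow> ('a \<Rightarrow> 'b::euclidean_space) \<Rightarrow> bool" where
  "smooth_on S f \<longleftrightarrow> (\<forall>x\<in>S. \<exists>W g. open W \<and> x \<in> W \<and> (\<forall>k. Ck_on k g W) \<and>
      (\<forall>y\<in>S \<inter> W. g y = f y))"


section \<open>Smooth manifolds\<close>

text \<open>The underlying set of a manifold is a whole (Hausdorff, second countable) type.  Charts are
  homeomorphisms onto relatively open subsets of a linear subspace \<^term>\<open>E\<close> of a Euclidean space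
  rather than of the Euclidean space itself, because types of class
  \<^class>\<open>euclidean_space\<close> have positive dimension and manifolds of dimension 0 are to be
  included.  Only the values of a chart on its domain matter.\<close>

type_synonym ('m, 'e) chart = "'m set \<times> ('m \<Rightarrow> 'e)"

record ('m, 'e) manifold =
  model :: "'e set"
  atlas :: "('m, 'e) chart set"

definition chart_on ::
  "'e::euclidean_space set \<Rightarrow> ('m::topological_space, 'e) chart \<Rightarrow> bool" where
  "chart_on E = (\<lambda>(U, c). open U \<and> openin (top_of_set E) (c ` U) \<and>
      homeomorphism U (c ` U) c (inv_into U c))"

definition compatible ::
  "('m, 'e::euclidean_space) chart \<Rightarrow> ('m, 'e) chart \<Rightarrow> bool" where
  "compatible = (\<lambda>(U, c) (U', c').
      smooth_on (c ` (U \<inter> U')) (c' \<circ> inv_into U c) \<and>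
      smooth_on (c' ` (U \<inter> U')) (c \<circ> inv_into U' c'))"

text \<open>The maximal atlas.\<close>

definition charts :: "('m::topological_space, 'e::euclidean_space) manifold \<Rightarrow> ('m, 'e) chart set"
  where
  "charts M = {\<kappa>. chart_on (model M) \<kappa> \<and> (\<forall>\<kappa>'\<in>atlas M. compatible \<kappa> \<kappa>')}"

definition smooth_manifold ::
  "('m::{t2_space,second_countable_topology}, 'e::euclidean_space) manifold \<Rightarrow> bool" where
  "smooth_manifold M \<longleftrightarrow> subspace (model M) \<and> atlas M \<subseteq> charts M \<and> (\<Union>(U, c)\<in>atlas M. U) = UNIV"

definition prod_manifold ::
  "('m, 'e) manifold \<Rightarrow> ('n, 'f) manifold \<Rightarrow> ('m \<times> 'n, 'e \<times> 'f) manifold"  (infixr \<open>\<times>\<^sub>M\<close> 80)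
  where
  "M \<times>\<^sub>M N = \<lparr>model = model M \<times> model N,
     atlas = {(U \<times> V, map_prod c d) | U c V d. (U, c) \<in> atlas M \<and> (V, d) \<in> atlas N}\<rparr>"

definition real_line :: "(real, real) manifold" where
  "real_line = \<lparr>model = UNIV, atlas = {(UNIV, id)}\<rparr>"

definition smooth_map_on ::
  "('m::topological_space, 'e::euclidean_space) manifold \<Rightarrow>
   ('n::topological_space, 'f::euclidean_space) manifold \<Rightarrow> 'm set \<Rightarrow> ('m \<Rightarrow> 'n) \<Rightarrow> bool" where
  "smooth_map_on M N S f \<longleftrightarrow> continuous_on S f \<and>
     (\<forall>(U, c)\<in>charts M. \<forall>(V, d)\<in>charts N.
        smooth_on (c ` (S \<inter> U \<inter> f -` V)) (d \<circ> f \<circ> inv_into U c))"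

text \<open>Embedded submanifolds, described by slice charts.\<close>

definition submanifold ::
  "('m::topological_space, 'e::euclidean_space) manifold \<Rightarrow> 'm set \<Rightarrow> bool" where
  "submanifold M L \<longleftrightarrow> (\<forall>x\<in>L. \<exists>(U, c)\<in>charts M. x \<in> U \<and>
     (\<exists>F. subspace F \<and> F \<subseteq> model M \<and> c ` (U \<inter> L) = c ` U \<inter> F))"


section \<open>Tangent vectors\<close>

text \<open>A tangent vector at \<^term>\<open>x\<close> is the derivation along a smooth curve through
  \<^term>\<open>x\<close>, acting on the functions that are smooth near \<^term>\<open>x\<close>; it is set to 0 on all
  other functions, so that equality of tangent vectors is equality of functionals.  The vector space
  operations are the pointwise ones.\<close>

type_synonym 'm tangent = "('m \<Rightarrow> real) \<Rightarrow> real"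

definition velocity ::
  "('m::topological_space, 'e::euclidean_space) manifold \<Rightarrow> (real \<Rightarrow> 'm) \<Rightarrow> 'm tangent" where
  "velocity M \<gamma> = (\<lambda>f. if \<exists>W. open W \<and> \<gamma> 0 \<in> W \<and> smooth_map_on M real_line W f
                      then deriv (\<lambda>t. f (\<gamma> t)) 0 else 0)"

definition tangent_space ::
  "('m::topological_space, 'e::euclidean_space) manifold \<Rightarrow> 'm set \<Rightarrow> 'm \<Rightarrow> 'm tangent set" where
  "tangent_space M L x = {velocity M \<gamma> | \<gamma>. \<gamma> 0 = x \<and>
     (\<exists>\<epsilon>>0. \<gamma> ` {-\<epsilon><..<\<epsilon>} \<subseteq> L \<and> smooth_map_on real_line M {-\<epsilon><..<\<epsilon>} \<gamma>)}"

definition pushforward :: "('m \<Rightarrow> 'n) \<Rightarrow> 'm tangent \<Rightarrow> 'n tangent" where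
  "pushforward f u = (\<lambda>g. u (g \<circ> f))"

definition transverse_at ::
  "('m::topological_space, 'e::euclidean_space) manifold \<Rightarrow> 'm \<Rightarrow> 'm tangent set \<Rightarrow>
   'm tangent set \<Rightarrow> bool" where
  "transverse_at M x S T \<longleftrightarrow>
     {(\<lambda>f. u f + v f) | u v. u \<in> S \<and> v \<in> T} = tangent_space M UNIV x"

text \<open>The tangent vector with coordinates \<^term>\<open>u\<close> at the point with coordinates
  \<^term>\<open>z\<close>.\<close>

definition coord_vector ::
  "('m::topological_space, 'e::euclidean_space) manifold \<Rightarrow> ('m, 'e) chart \<Rightarrow> 'e \<Rightarrow> 'e \<Rightarrow> 'm tangent"
  where
  "coord_vector M \<kappa> z u = velocity M (\<lambda>t. inv_into (fst \<kappa>) (snd \<kappa>) (z + t *\<^sub>R u))"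


section \<open>Symplectic forms and lagrangian submanifolds\<close>

type_synonym 'm two_form = "'m \<Rightarrow> 'm tangent \<Rightarrow> 'm tangent \<Rightarrow> real"

definition form_coeff ::
  "('m::topological_space, 'e::euclidean_space) manifold \<Rightarrow> 'm two_form \<Rightarrow> ('m, 'e) chart \<Rightarrow>
   'e \<Rightarrow> 'e \<Rightarrow> 'e \<Rightarrow> real" where
  "form_coeff M \<omega> \<kappa> u v z =
     \<omega> (inv_into (fst \<kappa>) (snd \<kappa>) z) (coord_vector M \<kappa> z u) (coord_vector M \<kappa> z v)"

definition differential_two_form ::
  "('m::topological_space, 'e::euclidean_space) manifold \<Rightarrow> 'm two_form \<Rightarrow> bool" where
  "differential_two_form M \<omega> \<longleftrightarrow>
     (\<forall>x. \<forall>u\<in>tangent_space M UNIV x. \<forall>v\<in>tangent_space M UNIV x. \<forall>w\<in>tangent_space M UNIV x. \<forall>a.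
        \<omega> x (\<lambda>f. a * u f + v f) w = a * \<omega> x u w + \<omega> x v w \<and> \<omega> x u v = - \<omega> x v u) \<and>
     (\<forall>(U, c)\<in>charts M. \<forall>u\<in>model M. \<forall>v\<in>model M.
        smooth_on (c ` U) (form_coeff M \<omega> (U, c) u v))"

text \<open>The vanishing of the exterior derivative in coordinates, evaluated on coordinate vector
  fields with constant coefficients, whose Lie brackets vanish.\<close>

definition closed_form ::
  "('m::topological_space, 'e::euclidean_space) manifold \<Rightarrow> 'm two_form \<Rightarrow> bool" where
  "closed_form M \<omega> \<longleftrightarrow> (\<forall>(U, c)\<in>charts M. \<forall>z\<in>c ` U. \<forall>u\<in>model M. \<forall>v\<in>model M. \<forall>w\<in>model M.
     deriv (\<lambda>t. form_coeff M \<omega> (U, c) v w (z + t *\<^sub>R u)) 0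
   - deriv (\<lambda>t. form_coeff M \<omega> (U, c) u w (z + t *\<^sub>R v)) 0
   + deriv (\<lambda>t. form_coeff M \<omega> (U, c) u v (z + t *\<^sub>R w)) 0 = 0)"

definition symplectic_form ::
  "('m::topological_space, 'e::euclidean_space) manifold \<Rightarrow> 'm two_form \<Rightarrow> bool" where
  "symplectic_form M \<omega> \<longleftrightarrow> differential_two_form M \<omega> \<and> closed_form M \<omega> \<and>
     (\<forall>x. \<forall>u\<in>tangent_space M UNIV x.
        (\<forall>v\<in>tangent_space M UNIV x. \<omega> x u v = 0) \<longrightarrow> u = (\<lambda>f. 0))"

definition opposite_form :: "'m two_form \<Rightarrow> 'm two_form" where
  "opposite_form \<omega> = (\<lambda>x u v. - \<omega> x u v)"

definition prod_form :: "'m two_form \<Rightarrow> 'n two_form \<Rightarrow> ('m \<times> 'n) two_form" where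
  "prod_form \<omega> \<omega>' = (\<lambda>(x, y) u v. \<omega> x (pushforward fst u) (pushforward fst v) +
                                 \<omega>' y (pushforward snd u) (pushforward snd v))"

definition lagrangian_subspace ::
  "('m::topological_space, 'e::euclidean_space) manifold \<Rightarrow> 'm two_form \<Rightarrow> 'm \<Rightarrow>
   'm tangent set \<Rightarrow> bool" where
  "lagrangian_subspace M \<omega> x S \<longleftrightarrow> S = {u \<in> tangent_space M UNIV x. \<forall>v\<in>S. \<omega> x u v = 0}"

definition lagrangian ::
  "('m::topological_space, 'e::euclidean_space) manifold \<Rightarrow> 'm two_form \<Rightarrow> 'm set \<Rightarrow> bool" where
  "lagrangian M \<omega> L \<longleftrightarrow> submanifold M L \<and>
     (\<forall>x\<in>L. lagrangian_subspace M \<omega> x (tangent_space M L x))"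

text \<open>A smooth subbundle of \<open>TM\<close> restricted to \<^term>\<open>A\<close>, given by its fibres and described by
  smooth local frames.\<close>

definition smooth_subbundle ::
  "('m::topological_space, 'e::euclidean_space) manifold \<Rightarrow> 'm set \<Rightarrow> ('m \<Rightarrow> 'm tangent set) \<Rightarrow> bool"
  where
  "smooth_subbundle M A K \<longleftrightarrow> (\<forall>x\<in>A. \<exists>(U, c)\<in>charts M. x \<in> U \<and>
     (\<exists>(k::nat) X. (\<forall>i<k. smooth_on (c ` (U \<inter> A)) (X i \<circ> inv_into U c)) \<and>
        (\<forall>y\<in>U \<inter> A. (\<lambda>i. X i y) ` {..<k} \<subseteq> model M \<and>
           inj_on (\<lambda>i. X i y) {..<k} \<and> independent ((\<lambda>i. X i y) ` {..<k}) \<and>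
           K y = coord_vector M (U, c) (c y) ` span ((\<lambda>i. X i y) ` {..<k}))))"


section \<open>Symplectic microfolds\<close>

text \<open>A microfold \<open>[M, A]\<close> is given by a representative.  The germ of a subset around a core
  \<^term>\<open>C\<close> is the class of all subsets that coincide with it on a neighbourhood of
  \<^term>\<open>C\<close>.\<close>

definition germ :: "'a::topological_space set \<Rightarrow> 'a set \<Rightarrow> 'a set set" where
  "germ C S = {S'. \<exists>W. open W \<and> C \<subseteq> W \<and> S \<inter> W = S' \<inter> W}"

definition symplectic_microfold ::
  "('m::{t2_space,second_countable_topology}, 'e::euclidean_space) manifold \<Rightarrow> 'm two_form \<Rightarrow>
   'm set \<Rightarrow> bool" where
  "symplectic_microfold M \<omega> A \<longleftrightarrow>
     smooth_manifold M \<and> symplectic_form M \<omega> \<and> closed A \<and> lagrangian M \<omega> A"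

text \<open>\<^term>\<open>L\<close> is a representative of a lagrangian submicrofold \<open>[L, C]\<close> of \<open>[M, A]\<close>.\<close>

definition lagrangian_submicrofold ::
  "('m::topological_space, 'e::euclidean_space) manifold \<Rightarrow> 'm two_form \<Rightarrow> 'm set \<Rightarrow>
   'm set \<Rightarrow> 'm set \<Rightarrow> bool" where
  "lagrangian_submicrofold M \<omega> A L C \<longleftrightarrow> lagrangian M \<omega> L \<and> submanifold M C \<and>
     closedin (top_of_set L) C \<and> C \<subseteq> A \<and> L \<inter> A = C"

definition lagrangian_splitting ::
  "('m::topological_space, 'e::euclidean_space) manifold \<Rightarrow> 'm two_form \<Rightarrow> 'm set \<Rightarrow>
   ('m \<Rightarrow> 'm tangent set) \<Rightarrow> bool" where
  "lagrangian_splitting M \<omega> A K \<longleftrightarrow> smooth_subbundle M A K \<and>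
     (\<forall>x\<in>A. lagrangian_subspace M \<omega> x (K x) \<and> transverse_at M x (K x) (tangent_space M A x))"

text \<open>The graph of a map \<open>B \<rightarrow> A\<close>, as a subset of \<open>A \<times> B\<close>.\<close>

definition gr :: "('n \<Rightarrow> 'm) \<Rightarrow> 'n set \<Rightarrow> ('m \<times> 'n) set" where
  "gr \<phi> B = (\<lambda>y. (\<phi> y, y)) ` B"

text \<open>\<^term>\<open>\<V>\<close> is the germ \<open>[V]\<close> of a lagrangian submanifold around the graph of
  \<^term>\<open>\<phi>\<close>.\<close>

definition symplectic_micromorphism ::
  "('m::topological_space, 'e::euclidean_space) manifold \<Rightarrow> 'm two_form \<Rightarrow> 'm set \<Rightarrow>
   ('n::topological_space, 'f::euclidean_space) manifold \<Rightarrow> 'n two_form \<Rightarrow> 'n set \<Rightarrow>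
   ('m \<times> 'n) set set \<Rightarrow> ('n \<Rightarrow> 'm) \<Rightarrow> bool" where
  "symplectic_micromorphism M \<omega>\<^sub>M A N \<omega>\<^sub>N B \<V> \<phi> \<longleftrightarrow>
     smooth_map_on N M B \<phi> \<and> \<phi> ` B \<subseteq> A \<and>
     (\<exists>V K. \<V> = germ (gr \<phi> B) V \<and>
        lagrangian_submicrofold (M \<times>\<^sub>M N) (prod_form (opposite_form \<omega>\<^sub>M) \<omega>\<^sub>N) (A \<times> B) V (gr \<phi> B) \<and>
        lagrangian_splitting N \<omega>\<^sub>N B K \<and>
        (\<forall>y\<in>B. transverse_at (M \<times>\<^sub>M N) (\<phi> y, y)
           (tangent_space (M \<times>\<^sub>M N) V (\<phi> y, y))
           {u \<in> tangent_space (M \<times>\<^sub>M N) UNIV (\<phi> y, y).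
              pushforward fst u \<in> tangent_space M A (\<phi> y) \<and> pushforward snd u \<in> K y}))"


section \<open>Lagrangian fibrations\<close>

text \<open>\<^term>\<open>F\<close> is a family of representatives of a lagrangian fibration of \<open>[M, A]\<close> along
  \<open>\<phi> : B \<rightarrow> A\<close>.  Smooth dependence on \<open>y \<in> B\<close> means that the total space is a submanifold of
  \<open>B \<times> M\<close> which is mapped to \<^term>\<open>B\<close> by a submersion.\<close>

definition lagrangian_fibration_rep ::
  "('m::topological_space, 'e::euclidean_space) manifold \<Rightarrow> 'm two_form \<Rightarrow> 'm set \<Rightarrow>
   ('n::topological_space, 'f::euclidean_space) manifold \<Rightarrow> 'n set \<Rightarrow> ('n \<Rightarrow> 'm) \<Rightarrow>
   ('n \<Rightarrow> 'm set) \<Rightarrow> bool" where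
  "lagrangian_fibration_rep M \<omega> A N B \<phi> F \<longleftrightarrow>
     (\<forall>y\<in>B. lagrangian_submicrofold M \<omega> A (F y) {\<phi> y} \<and>
        transverse_at M (\<phi> y) (tangent_space M (F y) (\<phi> y)) (tangent_space M A (\<phi> y))) \<and>
     submanifold (N \<times>\<^sub>M M) (Sigma B F) \<and>
     (\<forall>p\<in>Sigma B F.
        pushforward fst ` tangent_space (N \<times>\<^sub>M M) (Sigma B F) p = tangent_space N B (fst p))"

text \<open>A collection of germs indexed by \<^term>\<open>B\<close> is a function that is arbitrary but fixed outside
  \<^term>\<open>B\<close>.\<close>

definition germs_along ::
  "('n \<Rightarrow> 'm::topological_space) \<Rightarrow> 'n set \<Rightarrow> ('n \<Rightarrow> 'm set) \<Rightarrow> 'n \<Rightarrow> 'm set set" where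
  "germs_along \<phi> B F = (\<lambda>y\<in>B. germ {\<phi> y} (F y))"

definition lagrangian_fibration_along ::
  "('m::topological_space, 'e::euclidean_space) manifold \<Rightarrow> 'm two_form \<Rightarrow> 'm set \<Rightarrow>
   ('n::topological_space, 'f::euclidean_space) manifold \<Rightarrow> 'n set \<Rightarrow> ('n \<Rightarrow> 'm) \<Rightarrow>
   ('n \<Rightarrow> 'm set set) \<Rightarrow> bool" where
  "lagrangian_fibration_along M \<omega> A N B \<phi> \<F> \<longleftrightarrow>
     (\<exists>F. lagrangian_fibration_rep M \<omega> A N B \<phi> F \<and> \<F> = germs_along \<phi> B F)"

definition lagrangian_fibration ::
  "('m::topological_space, 'e::euclidean_space) manifold \<Rightarrow> 'm two_form \<Rightarrow> 'm set \<Rightarrow>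
   ('m \<Rightarrow> 'm set set) \<Rightarrow> bool" where
  "lagrangian_fibration M \<omega> A \<F> \<longleftrightarrow> lagrangian_fibration_along M \<omega> A M A (\<lambda>x. x) \<F>"

end

theory Submission
  imports Defs
begin

text \<open>Near the core the total space of \<open>\<F>B\<close> is mapped diffeomorphically onto a neighbourhood of
  \<open>B\<close> in \<open>N\<close>, so the fibration is given by a smooth retraction \<open>r\<close> onto \<open>B\<close> with fibres
  \<open>\<F>\<^sub>yB\<close>.  Let \<open>E\<close> be a complement of \<open>TA\<close>.  The differential at a core point of the map
  \<open>V \<rightarrow> B \<times> E\<close>, \<open>(p, q) \<mapsto> (r q, pr\<^sub>E p)\<close>, is injective: a vector \<open>(a, l)\<close> in its
  kernel has \<open>a \<in> TA\<close>, hence \<open>l\<close> is orthogonal to \<open>TB\<close> because \<open>TV\<close> is lagrangian and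
  contains the tangent space of the graph of \<open>\<phi>\<close>; so \<open>l \<in> TB\<close>, where \<open>dr\<close> is the identity,
  and \<open>l = 0\<close>; finally \<open>(a, 0)\<close> is orthogonal to \<open>TV + (TA \<times> K)\<close>, which is everything.  The
  dimensions agree, so \<open>V\<close> is locally a graph over \<open>B \<times> E\<close>, the map
  \<open>(p, q) \<mapsto> (r q, p)\<close> embeds a neighbourhood of the core in \<open>B \<times> M\<close>, and its image is the
  total space of \<open>\<F>A\<close>.  Its fibres are isotropic as reductions of \<open>V\<close> and have half the
  dimension of \<open>M\<close>.  Uniqueness of the germs holds because every \<open>\<Psi>\<^sub>y\<close> is continuous at
  \<open>\<phi> y\<close>.\<close>

section \<open>Calculus of smooth maps\<close>

text \<open>Two obstacles shape the proof. The linear algebra lives at single core points and yields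
  charts around them, whereas a representative needs one neighbourhood of the whole core, which may
  be noncompact; local diffeomorphisms must be glued to a map that is injective with continuous
  inverse. Moreover submanifolds carry no prescribed dimension, so dimensions are computed from the
  lagrangian conditions: half of the dimension of \<open>N\<close> for \<open>B\<close> and half of
  that of \<open>M\<close> for the complement of \<open>TA\<close> add up to the dimension of
  \<open>V\<close>, and the given total space has the dimension of \<open>N\<close> because it
  submerses onto \<open>B\<close> with lagrangian fibres. Finally a new fibre may meet
  \<open>A\<close> only in \<open>\<phi> y\<close>; for this the coordinate domain around a point of
  \<open>V\<close> is chosen to contain also the core point of its fibre.\<close>

lemma Ck_on_continuous: "Ck_on k f W \<Longrightarrow> continuous_on W f"
  by (cases k) (auto intro!: continuous_at_imp_continuous_on dest: has_derivative_continuous)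

lemma Ck_on_Suc: "Ck_on (Suc k) f W \<Longrightarrow> Ck_on k f W"
proof (induction k arbitrary: f)
  case 0
  then show ?case using Ck_on_continuous by fastforce
next
  case (Suc k)
  then show ?case by (metis Ck_on.simps(2))
qed

lemma Ck_on_subset: "Ck_on k f W \<Longrightarrow> W' \<subseteq> W \<Longrightarrow> Ck_on k f W'"
proof (induction k arbitrary: f)
  case 0
  then show ?case by (simp add: continuous_on_subset)
next
  case (Suc k)
  then obtain f' where "\<forall>x\<in>W. (f has_derivative f' x) (at x)" "\<forall>v. Ck_on k (\<lambda>x. f' x v) W"
    by auto
  with Suc show ?case by (auto intro!: exI[of _ f'])
qed

lemma Ck_on_cong:
  assumes W: "open W" and eq: "\<And>x. x \<in> W \<Longrightarrow> f x = g x" and f: "Ck_on k f W"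
  shows "Ck_on k g W"
proof (cases k)
  case 0
  then show ?thesis using f eq continuous_on_cong by force
next
  case (Suc m)
  obtain f' where f': "\<forall>x\<in>W. (f has_derivative f' x) (at x)" "\<forall>v. Ck_on m (\<lambda>x. f' x v) W"
    using f unfolding Suc Ck_on.simps by blast
  have "\<forall>x\<in>W. (g has_derivative f' x) (at x)"
    using has_derivative_transform_within_open[OF _ W] f'(1) eq by blast
  with f' Suc show ?thesis by auto
qed

lemma Ck_on_const: "Ck_on k (\<lambda>x. c) W"
proof (induction k arbitrary: c)
  case (Suc k)
  then show ?case by (auto intro!: exI[of _ "\<lambda>x v. 0"])
qed simp

lemma Ck_on_linear:
  assumes "bounded_linear h" shows "Ck_on k h W"
proof (cases k)
  case (Suc m)
  then show ?thesis
    using assms by (auto intro!: exI[of _ "\<lambda>x. h"] Ck_on_const bounded_linear_imp_has_derivative)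
qed (use assms in \<open>simp add: linear_continuous_on\<close>)

lemma Ck_on_linear_comp: "bounded_linear h \<Longrightarrow> Ck_on k f W \<Longrightarrow> Ck_on k (\<lambda>x. h (f x)) W"
proof (induction k arbitrary: f)
  case 0
  then show ?case by (simp add: bounded_linear.continuous_on)
next
  case (Suc k)
  obtain f' where f': "\<forall>x\<in>W. (f has_derivative f' x) (at x)" "\<forall>v. Ck_on k (\<lambda>x. f' x v) W"
    using Suc.prems(2) unfolding Ck_on.simps by blast
  have "\<forall>x\<in>W. ((\<lambda>x. h (f x)) has_derivative (\<lambda>v. h (f' x v))) (at x)"
    using f'(1) bounded_linear.has_derivative[OF Suc.prems(1)] by blast
  moreover have "Ck_on k (\<lambda>x. h (f' x v)) W" for v
    using f'(2) Suc.IH[OF Suc.prems(1)] by blast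
  ultimately show ?case
    unfolding Ck_on.simps by (intro exI[of _ "\<lambda>x v. h (f' x v)"]) blast
qed

lemma Ck_on_Pair: "Ck_on k f W \<Longrightarrow> Ck_on k g W \<Longrightarrow> Ck_on k (\<lambda>x. (f x, g x)) W"
proof (induction k arbitrary: f g)
  case 0
  then show ?case by (simp add: continuous_on_Pair)
next
  case (Suc k)
  obtain f' where f': "\<forall>x\<in>W. (f has_derivative f' x) (at x)" "\<forall>v. Ck_on k (\<lambda>x. f' x v) W"
    using Suc.prems(1) unfolding Ck_on.simps by blast
  obtain g' where g': "\<forall>x\<in>W. (g has_derivative g' x) (at x)" "\<forall>v. Ck_on k (\<lambda>x. g' x v) W"
    using Suc.prems(2) unfolding Ck_on.simps by blast
  have "\<forall>x\<in>W. ((\<lambda>x. (f x, g x)) has_derivative (\<lambda>v. (f' x v, g' x v))) (at x)"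
    using f'(1) g'(1) has_derivative_Pair by blast
  moreover have "Ck_on k (\<lambda>x. (f' x v, g' x v)) W" for v
    using f'(2) g'(2) Suc.IH by blast
  ultimately show ?case
    unfolding Ck_on.simps by (intro exI[of _ "\<lambda>x v. (f' x v, g' x v)"]) blast
qed

lemma Ck_on_add:
  fixes f g :: "'a::euclidean_space \<Rightarrow> 'b::euclidean_space"
  assumes "Ck_on k f W" "Ck_on k g W" shows "Ck_on k (\<lambda>x. f x + g x) W"
proof -
  have "bounded_linear (\<lambda>p::'b \<times> 'b. fst p + snd p)"
    by (intro bounded_linear_add bounded_linear_fst bounded_linear_snd)
  from Ck_on_linear_comp[OF this Ck_on_Pair[OF assms]] show ?thesis by (simp only: fst_conv snd_conv)
qed

lemma Ck_on_scaleR: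
  fixes f :: "'a::euclidean_space \<Rightarrow> real" and g :: "'a \<Rightarrow> 'b::euclidean_space"
  shows "Ck_on k f W \<Longrightarrow> Ck_on k g W \<Longrightarrow> Ck_on k (\<lambda>x. f x *\<^sub>R g x) W"
proof (induction k arbitrary: f g)
  case 0
  then show ?case by (auto intro: continuous_on_scaleR)
next
  case (Suc k)
  obtain f' where f': "\<forall>x\<in>W. (f has_derivative f' x) (at x)" "\<forall>v. Ck_on k (\<lambda>x. f' x v) W"
    using Suc.prems(1) unfolding Ck_on.simps by blast
  obtain g' where g': "\<forall>x\<in>W. (g has_derivative g' x) (at x)" "\<forall>v. Ck_on k (\<lambda>x. g' x v) W"
    using Suc.prems(2) unfolding Ck_on.simps by blast
  have f: "Ck_on k f W" and g: "Ck_on k g W" using Suc.prems Ck_on_Suc by blast+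
  have "Ck_on k (\<lambda>x. f x *\<^sub>R g' x v + f' x v *\<^sub>R g x) W" for v
    using f'(2) g'(2) by (intro Ck_on_add Suc.IH[OF f] Suc.IH[OF _ g]) auto
  moreover have "((\<lambda>x. f x *\<^sub>R g x) has_derivative (\<lambda>v. f x *\<^sub>R g' x v + f' x v *\<^sub>R g x)) (at x)"
    if "x \<in> W" for x
    using has_derivative_scaleR[of f "f' x" x UNIV g "g' x"] f'(1) g'(1) that by blast
  ultimately show ?case
    unfolding Ck_on.simps by (intro exI[of _ "\<lambda>x v. f x *\<^sub>R g' x v + f' x v *\<^sub>R g x"]) blast
qed

lemma Ck_on_sum: "finite I \<Longrightarrow> (\<And>i. i \<in> I \<Longrightarrow> Ck_on k (f i) W) \<Longrightarrow> Ck_on k (\<lambda>x. \<Sum>i\<in>I. f i x) W"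
proof (induction I rule: finite_induct)
  case empty
  show ?case unfolding sum.empty by (rule Ck_on_const)
next
  case (insert i I)
  have "Ck_on k (\<lambda>x. f i x + (\<Sum>i\<in>I. f i x)) W" using insert by (intro Ck_on_add) blast+
  then show ?case unfolding sum.insert[OF insert.hyps] .
qed

text \<open>\<open>Ck_on\<close> controls derivatives in fixed directions only; expanding over
  \<open>Basis\<close> turns a linear map applied to a moving vector into a finite combination of
  fixed directions.\<close>

lemma linear_Basis_sum:
  fixes h :: "'a::euclidean_space \<Rightarrow> 'b::real_vector"
  assumes "linear h" shows "h v = (\<Sum>b\<in>Basis. (v \<bullet> b) *\<^sub>R h b)"
proof -
  have "h v = h (\<Sum>b\<in>Basis. (v \<bullet> b) *\<^sub>R b)" by (simp add: euclidean_representation)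
  also have "\<dots> = (\<Sum>b\<in>Basis. (v \<bullet> b) *\<^sub>R h b)"
    using assms by (simp add: linear_sum linear_scale)
  finally show ?thesis .
qed

text \<open>The induction generalises \<open>g\<close> alone: a directional derivative of the
  composite is built from \<open>f'\<close> and from \<open>\<lambda>x. g' (f x) b\<close>, to which
  the hypothesis applies with the same inner map \<open>f\<close>.\<close>

lemma Ck_on_compose:
  "Ck_on k f W \<Longrightarrow> Ck_on k g W' \<Longrightarrow> f ` W \<subseteq> W' \<Longrightarrow> Ck_on k (\<lambda>x. g (f x)) W"
proof (induction k arbitrary: g)
  case 0
  then show ?case by (auto intro: continuous_on_compose2)
next
  case (Suc k)
  obtain f' where f': "\<forall>x\<in>W. (f has_derivative f' x) (at x)" "\<forall>v. Ck_on k (\<lambda>x. f' x v) W"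
    using Suc.prems(1) unfolding Ck_on.simps by blast
  obtain g' where g': "\<forall>x\<in>W'. (g has_derivative g' x) (at x)" "\<forall>v. Ck_on k (\<lambda>x. g' x v) W'"
    using Suc.prems(2) unfolding Ck_on.simps by blast
  note * = f' g'
  have f: "Ck_on k f W" using Suc.prems Ck_on_Suc by blast
  \<comment> \<open>The chain rule gives \<open>g' (f x) (f' x v)\<close>, whose direction depends
    on \<open>x\<close>; it is rewritten over \<open>Basis\<close> so that the directions fed to
    \<open>g'\<close> are constant.\<close>
  have 1: "((\<lambda>x. g (f x)) has_derivative (\<lambda>v. \<Sum>b\<in>Basis. (f' x v \<bullet> b) *\<^sub>R g' (f x) b)) (at x)"
    if "x \<in> W" for x
  proof -
    have "f x \<in> W'" using that Suc.prems by auto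
    then have "(g has_derivative g' (f x)) (at (f x))" using * by auto
    then have "((\<lambda>x. g (f x)) has_derivative (\<lambda>v. g' (f x) (f' x v))) (at x)"
      using * that diff_chain_at[of f "f' x" x g "g' (f x)"] by (simp add: o_def)
    moreover have "linear (g' (f x))"
      using \<open>(g has_derivative g' (f x)) _\<close> has_derivative_linear by blast
    ultimately show ?thesis by (subst (asm) linear_Basis_sum) auto
  qed
  have 2: "Ck_on k (\<lambda>x. \<Sum>b\<in>Basis. (f' x v \<bullet> b) *\<^sub>R g' (f x) b) W" for v
    using * Suc.IH[OF f _ Suc.prems(3)]
    by (intro Ck_on_sum Ck_on_scaleR Ck_on_linear_comp[of "\<lambda>v. v \<bullet> _"] bounded_linear_inner_left finite_Basis) blast+
  show ?case using 1 2 unfolding Ck_on.simps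
    by (intro exI[of _ "\<lambda>x v. \<Sum>b\<in>Basis. (f' x v \<bullet> b) *\<^sub>R g' (f x) b"]) blast
qed

text \<open>\<open>Ck_on\<close> may use another derivative family for each order; uniqueness of
  derivatives shows that a single family serves all orders.\<close>

lemma smooth_derivE:
  fixes f :: "'a::euclidean_space \<Rightarrow> 'b::euclidean_space"
  assumes W: "open W" and f: "\<And>k. Ck_on k f W"
  obtains f' where "\<And>x. x \<in> W \<Longrightarrow> (f has_derivative f' x) (at x)" "\<And>k v. Ck_on k (\<lambda>x. f' x v) W"
proof -
  from f[of "Suc 0"] obtain f' where f': "\<And>x. x \<in> W \<Longrightarrow> (f has_derivative f' x) (at x)" by auto
  have "Ck_on k (\<lambda>x. f' x v) W" for k v
  proof -
    from f[of "Suc k"] obtain g' where g': "\<And>x. x \<in> W \<Longrightarrow> (f has_derivative g' x) (at x)"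
      "Ck_on k (\<lambda>x. g' x v) W" by auto
    then show ?thesis
      using has_derivative_unique[OF f' g'(1)] by (metis (no_types, lifting) Ck_on_cong W)
  qed
  with f' that show ?thesis by blast
qed

section \<open>Inverses of linear maps with parameters and the smooth inverse function
  theorem\<close>

text \<open>Perturbation argument:
  \<open>R y v - R y0 v = R y0 (T y0 (R y v) - T y (R y v))\<close>, so it is enough to bound
  \<open>R y v\<close> uniformly for \<open>y\<close> near \<open>y0\<close>.\<close>

lemma continuous_on_linear_inverse:
  fixes T R :: "'b::topological_space \<Rightarrow> 'a::euclidean_space \<Rightarrow> 'a"
  assumes lin: "\<And>y. y \<in> V \<Longrightarrow> linear (T y)" "\<And>y. y \<in> V \<Longrightarrow> linear (R y)"
    and RT: "\<And>y u. y \<in> V \<Longrightarrow> R y (T y u) = u" and TR: "\<And>y u. y \<in> V \<Longrightarrow> T y (R y u) = u"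
    and cont: "\<And>b. continuous_on V (\<lambda>y. T y b)"
  shows "continuous_on V (\<lambda>y. R y v)"
  unfolding continuous_on_def
proof
  fix y0 assume y0: "y0 \<in> V"
  define d where "d y = (\<Sum>b\<in>Basis. norm (T y b - T y0 b))" for y
  have d: "(d \<longlongrightarrow> 0) (at y0 within V)"
  proof -
    have "(d \<longlongrightarrow> (\<Sum>b\<in>Basis. norm (T y0 b - T y0 b))) (at y0 within V)"
      unfolding d_def using cont y0 by (intro tendsto_intros) (auto simp: continuous_on_def)
    then show ?thesis by simp
  qed
  obtain c where c: "c > 0" "\<And>u. norm (R y0 u) \<le> c * norm u"
    using linear_bounded_pos[OF lin(2)[OF y0]] by blast
  have TT: "norm (T y u - T y0 u) \<le> norm u * d y" if "y \<in> V" for y u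
  proof -
    have "T y u - T y0 u = (\<Sum>b\<in>Basis. (u \<bullet> b) *\<^sub>R (T y b - T y0 b))"
      using linear_Basis_sum[OF lin(1)[OF that], of u] linear_Basis_sum[OF lin(1)[OF y0], of u]
      unfolding scaleR_diff_right sum_subtractf by (metis (no_types, lifting))
    also have "norm \<dots> \<le> (\<Sum>b\<in>Basis. norm u * norm (T y b - T y0 b))"
      by (intro sum_norm_le) (auto intro!: mult_right_mono simp: Basis_le_norm)
    finally show ?thesis by (simp add: d_def sum_distrib_left)
  qed
  \<comment> \<open>The bound 1/2 lets the term \<open>c * d y * norm (R y v)\<close> be absorbed
    into the left side, which yields \<open>norm (R y v) \<le> 2 * c * norm v\<close>.\<close>
  have ev: "\<forall>\<^sub>F y in at y0 within V. c * d y < 1/2"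
    using tendsto_mult_right_zero[OF d, of c] by (rule order_tendstoD) auto
  have "\<forall>\<^sub>F y in at y0 within V. norm (R y v - R y0 v) \<le> c * (2 * c * norm v) * d y"
    using ev unfolding eventually_at_filter
  proof eventually_elim
    case (elim y)
    have "norm (R y v - R y0 v) \<le> c * (2 * c * norm v) * d y" if y: "y \<in> V" and e: "c * d y < 1/2"
    proof -
      let ?u = "R y v"
      have "norm ?u \<le> c * norm (T y0 ?u)" using c(2)[of "T y0 ?u"] RT[OF y0] by simp
      also have "\<dots> \<le> c * (norm (T y ?u) + norm ?u * d y)"
        using TT[OF y, of ?u] c(1) norm_triangle_sub[of "T y0 ?u" "T y ?u"]
        by (intro mult_left_mono) (auto simp: norm_minus_commute)
      also have "\<dots> = c * norm v + (c * d y) * norm ?u" using TR[OF y] by (simp add: algebra_simps)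
      also have "\<dots> \<le> c * norm v + 1/2 * norm ?u"
        using e by (intro add_mono mult_right_mono) auto
      finally have u: "norm ?u \<le> 2 * c * norm v" by simp
      have d0: "d y \<ge> 0" unfolding d_def by (intro sum_nonneg) auto
      have "?u - R y0 v = R y0 (T y0 ?u - T y ?u)"
        using RT[OF y0] TR[OF y] by (simp add: linear_diff[OF lin(2)[OF y0]])
      then have "norm (?u - R y0 v) \<le> c * norm (T y0 ?u - T y ?u)" using c(2) by simp
      also have "\<dots> \<le> c * (norm ?u * d y)"
        using TT[OF y, of ?u] c(1) by (simp add: norm_minus_commute)
      also have "\<dots> \<le> c * ((2 * c * norm v) * d y)"
        using u c(1) d0 by (intro mult_left_mono mult_right_mono) auto
      finally show "norm (R y v - R y0 v) \<le> c * (2 * c * norm v) * d y" by (simp add: mult.assoc)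
    qed
    then show ?case using elim by blast
  qed
  then have "((\<lambda>y. R y v - R y0 v) \<longlongrightarrow> 0) (at y0 within V)"
    by (rule Lim_null_comparison) (rule tendsto_mult_right_zero[OF d])
  then show "((\<lambda>y. R y v) \<longlongrightarrow> R y0 v) (at y0 within V)" by (simp add: LIM_zero_iff)
qed

text \<open>A product rule whose second factor is only continuous: since \<open>f x = 0\<close>, the
  increment of \<open>g\<close> is multiplied by a factor that is already small of first order. It
  serves to differentiate the inverse of a family of linear maps before its differentiability is
  known.\<close>

lemma has_derivative_scaleR_vanishing:
  fixes g :: "'a::real_normed_vector \<Rightarrow> 'b::real_normed_vector"
  assumes f: "(f has_derivative f') (at x)" and 0: "f x = (0::real)" and g: "isCont g x"
  shows "((\<lambda>y. f y *\<^sub>R g y) has_derivative (\<lambda>h. f' h *\<^sub>R g x)) (at x)"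
proof -
  have bl: "bounded_linear f'" using f by (rule has_derivative_bounded_linear)
  obtain K where K: "K > 0" "\<And>h. \<bar>f' h\<bar> \<le> norm h * K"
    using bounded_linear.pos_bounded[OF bl] by auto
  have 1: "((\<lambda>y. (f y - f x - f' (y - x)) / norm (y - x)) \<longlongrightarrow> 0) (at x)"
    using f unfolding has_derivative_at_within by (simp add: divide_inverse mult.commute)
  have gt: "(g \<longlongrightarrow> g x) (at x)" using g by (simp add: isCont_def)
  have 2: "((\<lambda>y. ((f y - f x - f' (y - x)) / norm (y - x)) *\<^sub>R g y) \<longlongrightarrow> 0) (at x)"
    using tendsto_scaleR[OF 1 gt] by simp
  have 3: "((\<lambda>y. (f' (y - x) / norm (y - x)) *\<^sub>R (g y - g x)) \<longlongrightarrow> 0) (at x)"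
  proof (rule Lim_null_comparison)
    show "\<forall>\<^sub>F y in at x. norm ((f' (y - x) / norm (y - x)) *\<^sub>R (g y - g x)) \<le> K * norm (g y - g x)"
    proof (rule always_eventually, rule allI)
      fix y
      have "\<bar>f' (y - x)\<bar> / norm (y - x) \<le> K"
        using K(2)[of "y - x"] K(1) by (cases "y = x") (auto simp: field_simps)
      then have "\<bar>f' (y - x)\<bar> / norm (y - x) * norm (g y - g x) \<le> K * norm (g y - g x)"
        by (rule mult_right_mono) simp
      then show "norm ((f' (y - x) / norm (y - x)) *\<^sub>R (g y - g x)) \<le> K * norm (g y - g x)"
        by simp
    qed
    show "((\<lambda>y. K * norm (g y - g x)) \<longlongrightarrow> 0) (at x)"
      using gt by (intro tendsto_mult_right_zero tendsto_norm_zero) (simp add: LIM_zero_iff)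
  qed
  have "((\<lambda>y. (f y *\<^sub>R g y - f x *\<^sub>R g x - f' (y - x) *\<^sub>R g x) /\<^sub>R norm (y - x)) \<longlongrightarrow> 0) (at x)"
    using tendsto_add[OF 2 3]
    by (simp add: 0 algebra_simps divide_inverse scaleR_diff_right)
  then show ?thesis
    unfolding has_derivative_at_within using bl by (auto intro: bounded_linear_scaleR_const)
qed

text \<open>With \<open>w = R y0 v\<close> one has \<open>R y v = w - R y (T y w - v)\<close>, and
  \<open>T y w - v\<close> vanishes at \<open>y0\<close>; so continuity of \<open>R\<close> suffices
  to differentiate there. The derivative involves only \<open>R\<close> and derivatives of
  \<open>T\<close>, which closes the induction on \<open>k\<close>.\<close>

lemma Ck_on_linear_inverse:
  fixes T R :: "'b::euclidean_space \<Rightarrow> 'a::euclidean_space \<Rightarrow> 'a"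
  assumes V: "open V"
    and lin: "\<And>y. y \<in> V \<Longrightarrow> linear (T y)" "\<And>y. y \<in> V \<Longrightarrow> linear (R y)"
    and RT: "\<And>y u. y \<in> V \<Longrightarrow> R y (T y u) = u" and TR: "\<And>y u. y \<in> V \<Longrightarrow> T y (R y u) = u"
  shows "(\<And>b. Ck_on k (\<lambda>y. T y b) V) \<Longrightarrow> Ck_on k (\<lambda>y. R y v) V"
proof (induction k arbitrary: v)
  case 0
  then have "continuous_on V (\<lambda>y. T y b)" for b by simp
  then have "continuous_on V (\<lambda>y. R y v)"
    by (intro continuous_on_linear_inverse[where T = T and R = R and V = V] lin RT TR)
  then show ?case by simp
next
  case (Suc k)
  have Tk: "Ck_on k (\<lambda>y. T y b) V" for b using Suc.prems Ck_on_Suc by blast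
  have Rk: "Ck_on k (\<lambda>y. R y b) V" for b using Suc.IH Tk by blast
  have "\<forall>b. \<exists>T'. (\<forall>y\<in>V. ((\<lambda>y. T y b) has_derivative T' y) (at y)) \<and> (\<forall>w. Ck_on k (\<lambda>y. T' y w) V)"
    using Suc.prems unfolding Ck_on.simps by blast
  from choice[OF this] obtain T' where T': "\<And>y b. y \<in> V \<Longrightarrow> ((\<lambda>y. T y b) has_derivative T' b y) (at y)"
    "\<And>b w. Ck_on k (\<lambda>y. T' b y w) V" by blast
  \<comment> \<open>The classical derivative of an inverse, namely minus \<open>R\<close> composed
    with the derivative of \<open>T\<close> composed with \<open>R\<close>, written out over
    \<open>Basis\<close>.\<close>
  define R' where "R' y h = - (\<Sum>c\<in>Basis. ((\<Sum>b\<in>Basis. (R y v \<bullet> b) *\<^sub>R T' b y h) \<bullet> c) *\<^sub>R R y c)" for y h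
  have "((\<lambda>y. R y v) has_derivative R' y0) (at y0)" if y0: "y0 \<in> V" for y0
  proof -
    let ?w = "R y0 v"
    have Tw: "((\<lambda>y. T y ?w) has_derivative (\<lambda>h. \<Sum>b\<in>Basis. (?w \<bullet> b) *\<^sub>R T' b y0 h)) (at y0)"
    proof (rule has_derivative_transform_within_open[OF _ V y0])
      show "((\<lambda>y. \<Sum>b\<in>Basis. (?w \<bullet> b) *\<^sub>R T y b) has_derivative
          (\<lambda>h. \<Sum>b\<in>Basis. (?w \<bullet> b) *\<^sub>R T' b y0 h)) (at y0)"
        using T'(1)[OF y0] by (intro derivative_intros)
      show "(\<Sum>b\<in>Basis. (?w \<bullet> b) *\<^sub>R T y b) = T y ?w" if "y \<in> V" for y
        by (rule linear_Basis_sum[OF lin(1)[OF that], symmetric])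
    qed
    have e: "((\<lambda>y. (T y ?w - v) \<bullet> c) has_derivative
        (\<lambda>h. (\<Sum>b\<in>Basis. (?w \<bullet> b) *\<^sub>R T' b y0 h) \<bullet> c)) (at y0)" for c
      using Tw by (auto intro!: derivative_eq_intros)
    have cont: "isCont (\<lambda>y. R y c) y0" for c
      using Ck_on_continuous[OF Rk] V y0 continuous_on_eq_continuous_at by blast
    have "((\<lambda>y. ((T y ?w - v) \<bullet> c) *\<^sub>R R y c) has_derivative
        (\<lambda>h. ((\<Sum>b\<in>Basis. (?w \<bullet> b) *\<^sub>R T' b y0 h) \<bullet> c) *\<^sub>R R y0 c)) (at y0)" for c
      by (rule has_derivative_scaleR_vanishing[OF e _ cont]) (simp add: TR y0)
    then have "((\<lambda>y. ?w - (\<Sum>c\<in>Basis. ((T y ?w - v) \<bullet> c) *\<^sub>R R y c)) has_derivative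
        (\<lambda>h. 0 - (\<Sum>c\<in>Basis. ((\<Sum>b\<in>Basis. (?w \<bullet> b) *\<^sub>R T' b y0 h) \<bullet> c) *\<^sub>R R y0 c))) (at y0)"
      by (intro has_derivative_diff has_derivative_const has_derivative_sum)
    then have "((\<lambda>y. ?w - (\<Sum>c\<in>Basis. ((T y ?w - v) \<bullet> c) *\<^sub>R R y c)) has_derivative R' y0) (at y0)"
      unfolding R'_def diff_0 .
    then show ?thesis
    proof (rule has_derivative_transform_within_open[OF _ V y0])
      fix y assume y: "y \<in> V"
      have "(\<Sum>c\<in>Basis. ((T y ?w - v) \<bullet> c) *\<^sub>R R y c) = R y (T y ?w - v)"
        by (rule linear_Basis_sum[OF lin(2)[OF y], symmetric])
      then show "?w - (\<Sum>c\<in>Basis. ((T y ?w - v) \<bullet> c) *\<^sub>R R y c) = R y v"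
        using RT[OF y] by (simp add: linear_diff[OF lin(2)[OF y]])
    qed
  qed
  moreover have "Ck_on k (\<lambda>y. R' y h) V" for h
  proof -
    have 1: "Ck_on k (\<lambda>y. (\<Sum>b\<in>Basis. (R y v \<bullet> b) *\<^sub>R T' b y h) \<bullet> c) V" for c
      using Rk T'(2)
      by (intro Ck_on_linear_comp[of "\<lambda>v. v \<bullet> _"] bounded_linear_inner_left Ck_on_sum Ck_on_scaleR finite_Basis) blast+
    have "Ck_on k (\<lambda>y. \<Sum>c\<in>Basis. ((\<Sum>b\<in>Basis. (R y v \<bullet> b) *\<^sub>R T' b y h) \<bullet> c) *\<^sub>R R y c) V"
      by (intro Ck_on_sum Ck_on_scaleR 1 Rk finite_Basis)
    from Ck_on_linear_comp[OF bounded_linear_minus[OF bounded_linear_ident] this]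
    show ?thesis unfolding R'_def .
  qed
  ultimately show ?case by auto
qed

text \<open>Bootstrapping from a once differentiable inverse \<open>g\<close>, where
  \<open>g' y\<close> is inverse to \<open>f' (g y)\<close>: if \<open>g\<close> is of class C^k,
  then so is \<open>f' (g y) b\<close>, hence so is \<open>g' y v\<close>, and \<open>g\<close> is
  of class C^(k+1).\<close>

lemma smooth_inverse:
  fixes f :: "'a::euclidean_space \<Rightarrow> 'a"
  assumes W: "open W" and f: "\<And>k. Ck_on k f W" and x0: "x0 \<in> W"
    and f0: "(f has_derivative f0) (at x0)" and inj: "inj f0"
  obtains U V g where "open U" "x0 \<in> U" "U \<subseteq> W" "open V" "homeomorphism U V f g" "\<And>k. Ck_on k g V"
proof -
  obtain f' where f': "\<And>x. x \<in> W \<Longrightarrow> (f has_derivative f' x) (at x)" "\<And>k v. Ck_on k (\<lambda>x. f' x v) W"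
    using smooth_derivE[OF W f] by blast
  have bl: "bounded_linear (f' x)" if "x \<in> W" for x
    using f'(1)[OF that] has_derivative_bounded_linear by blast
  define F where "F x = Blinfun (f' x)" for x
  have F: "blinfun_apply (F x) = f' x" if "x \<in> W" for x
    using bl[OF that] by (simp add: F_def bounded_linear_Blinfun_apply)
  have f0': "f0 = f' x0" using has_derivative_unique[OF f0 f'(1)[OF x0]] .
  have lf: "linear f0" using f0 has_derivative_linear by blast
  obtain h where h: "linear h" "h \<circ> f0 = id"
    using linear_injective_left_inverse[OF lf inj] by blast
  have contF: "continuous_on W F"
  proof (rule continuous_on_blinfun_componentwise)
    fix i :: 'a
    have "continuous_on W (\<lambda>x. f' x i)" using f'(2)[of 0 i] by simp
    then show "continuous_on W (\<lambda>x. blinfun_apply (F x) i)"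
      by (subst continuous_on_cong[OF refl, of _ _ "\<lambda>x. f' x i"]) (auto simp: F)
  qed
  have "Blinfun h o\<^sub>L F x0 = id_blinfun"
    by (rule blinfun_eqI)
      (use h x0 F f0' in \<open>auto simp: bounded_linear_Blinfun_apply linear_conv_bounded_linear o_def id_def fun_eq_iff\<close>)
  then obtain U V g g' where *: "open U" "U \<subseteq> W" "x0 \<in> U" "open V" "f x0 \<in> V" "homeomorphism U V f g"
    "\<And>y. y \<in> V \<Longrightarrow> (g has_derivative (g' y)) (at y)"
    "\<And>y. y \<in> V \<Longrightarrow> g' y = inv (blinfun_apply (F (g y)))"
    "\<And>y. y \<in> V \<Longrightarrow> bij (blinfun_apply (F (g y)))"
    using inverse_function_theorem[OF W _ contF x0, of f "Blinfun h"] f'(1) F by metis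
  have gW: "g ` V \<subseteq> W" using *(6,2) by (auto simp: homeomorphism_def)
  have b: "bij (f' (g y))" if "y \<in> V" for y
    using *(9)[OF that] F that gW by (metis image_subset_iff)
  have g': "g' y = inv (f' (g y))" if "y \<in> V" for y
    using *(8)[OF that] F that gW by (metis image_subset_iff)
  have Ck: "Ck_on k g V" for k
  proof (induction k)
    case 0
    then show ?case using *(6) by (simp add: homeomorphism_def)
  next
    case (Suc k)
    have "Ck_on k (\<lambda>y. g' y v) V" for v
    proof (rule Ck_on_linear_inverse[OF *(4), where T = "\<lambda>y. f' (g y)"])
      fix y assume y: "y \<in> V"
      show "linear (f' (g y))" using bl y gW linear_conv_bounded_linear by blast
      show "linear (g' y)" using *(7)[OF y] has_derivative_linear by blast
      show "g' y (f' (g y) u) = u" "f' (g y) (g' y u) = u" for u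
        using b[OF y] by (auto simp: g'[OF y] bij_is_inj bij_is_surj surj_f_inv_f)
    next
      show "Ck_on k (\<lambda>y. f' (g y) b) V" for b
        by (rule Ck_on_compose[OF Suc f'(2) gW])
    qed
    with *(7) show ?case by auto
  qed
  show ?thesis using that[OF *(1,3,2,4,6) Ck] .
qed

section \<open>Smooth maps on arbitrary subsets\<close>

lemma smooth_on_subset: "smooth_on S f \<Longrightarrow> T \<subseteq> S \<Longrightarrow> smooth_on T f"
  unfolding smooth_on_def
proof
  fix x assume *: "\<forall>x\<in>S. \<exists>W g. open W \<and> x \<in> W \<and> (\<forall>k. Ck_on k g W) \<and> (\<forall>y\<in>S \<inter> W. g y = f y)"
    and T: "T \<subseteq> S" "x \<in> T"
  then have "x \<in> S" by blast
  with * obtain W g where "open W" "x \<in> W" "\<forall>k. Ck_on k g W" "\<forall>y\<in>S \<inter> W. g y = f y" by blast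
  then show "\<exists>W g. open W \<and> x \<in> W \<and> (\<forall>k. Ck_on k g W) \<and> (\<forall>y\<in>T \<inter> W. g y = f y)"
    using T(1) by blast
qed

lemma smooth_on_cong: "smooth_on S f \<Longrightarrow> (\<And>x. x \<in> S \<Longrightarrow> f x = g x) \<Longrightarrow> smooth_on S g"
  unfolding smooth_on_def by (metis Int_iff)

lemma smooth_on_local:
  assumes "\<And>x. x \<in> S \<Longrightarrow> \<exists>W. open W \<and> x \<in> W \<and> smooth_on (S \<inter> W) f"
  shows "smooth_on S f"
  unfolding smooth_on_def
proof
  fix x assume "x \<in> S"
  then obtain W where W: "open W" "x \<in> W" "smooth_on (S \<inter> W) f" using assms by blast
  then obtain W' g where "open W'" "x \<in> W'" "\<forall>k. Ck_on k g W'" "\<forall>y\<in>(S \<inter> W) \<inter> W'. g y = f y"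
    using \<open>x \<in> S\<close> unfolding smooth_on_def by blast
  then show "\<exists>W g. open W \<and> x \<in> W \<and> (\<forall>k. Ck_on k g W) \<and> (\<forall>y\<in>S \<inter> W. g y = f y)"
    using W Ck_on_subset[of _ g W' "W \<inter> W'"]
    by (intro exI[of _ "W \<inter> W'"] exI[of _ g]) (auto intro: open_Int)
qed

lemma smooth_onI: "open W \<Longrightarrow> S \<subseteq> W \<Longrightarrow> (\<And>k. Ck_on k f W) \<Longrightarrow> smooth_on S f"
  unfolding smooth_on_def by blast

lemma smooth_on_compose:
  assumes f: "smooth_on S f" and g: "smooth_on T g" and fS: "f ` S \<subseteq> T"
  shows "smooth_on S (\<lambda>x. g (f x))"
  unfolding smooth_on_def
proof
  fix x assume x: "x \<in> S"
  then obtain W f1 where W: "open W" "x \<in> W" "\<And>k. Ck_on k f1 W" "\<forall>y\<in>S \<inter> W. f1 y = f y"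
    using f unfolding smooth_on_def by metis
  have "f x \<in> T" using x fS by auto
  then obtain W' g1 where W': "open W'" "f x \<in> W'" "\<And>k. Ck_on k g1 W'" "\<forall>y\<in>T \<inter> W'. g1 y = g y"
    using g unfolding smooth_on_def by metis
  let ?W = "W \<inter> f1 -` W'"
  have "continuous_on W f1" using W(3)[of 0] by simp
  then have o: "open ?W" using W(1) W'(1) by (simp add: continuous_on_open_vimage Int_commute)
  have "Ck_on k (\<lambda>x. g1 (f1 x)) ?W" for k
    by (rule Ck_on_compose[OF Ck_on_subset[OF W(3)] W'(3)]) auto
  moreover have "x \<in> ?W" using W W' x by auto
  moreover have "\<forall>y\<in>S \<inter> ?W. g1 (f1 y) = g (f y)" using W(4) W'(4) fS by auto
  ultimately show "\<exists>W h. open W \<and> x \<in> W \<and> (\<forall>k. Ck_on k h W) \<and> (\<forall>y\<in>S \<inter> W. h y = g (f y))"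
    using o by (intro exI[of _ ?W] exI[of _ "\<lambda>x. g1 (f1 x)"]) blast
qed

lemma smooth_on_linear: "linear h \<Longrightarrow> smooth_on S h"
  by (rule smooth_onI[of UNIV]) (auto intro: Ck_on_linear simp: linear_conv_bounded_linear)

lemma smooth_on_const: "smooth_on S (\<lambda>x. c)"
  by (rule smooth_onI[of UNIV]) (auto intro: Ck_on_const)

lemma smooth_on_id: "smooth_on S (\<lambda>x. x)"
  by (rule smooth_on_linear) (rule linear_ident)

lemma smooth_on_Pair:
  assumes f: "smooth_on S f" and g: "smooth_on S g" shows "smooth_on S (\<lambda>x. (f x, g x))"
  unfolding smooth_on_def
proof
  fix x assume x: "x \<in> S"
  obtain W f1 where W: "open W" "x \<in> W" "\<And>k. Ck_on k f1 W" "\<forall>y\<in>S \<inter> W. f1 y = f y"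
    using f x unfolding smooth_on_def by metis
  obtain W' g1 where W': "open W'" "x \<in> W'" "\<And>k. Ck_on k g1 W'" "\<forall>y\<in>S \<inter> W'. g1 y = g y"
    using g x unfolding smooth_on_def by metis
  have "Ck_on k (\<lambda>x. (f1 x, g1 x)) (W \<inter> W')" for k
    by (rule Ck_on_Pair) (use W(3) W'(3) Ck_on_subset in blast)+
  then show "\<exists>W h. open W \<and> x \<in> W \<and> (\<forall>k. Ck_on k h W) \<and> (\<forall>y\<in>S \<inter> W. h y = (f y, g y))"
    using W W' by (intro exI[of _ "W \<inter> W'"] exI[of _ "\<lambda>x. (f1 x, g1 x)"]) auto
qed

lemma smooth_on_add:
  fixes f g :: "'a::euclidean_space \<Rightarrow> 'b::euclidean_space"
  assumes "smooth_on S f" "smooth_on S g" shows "smooth_on S (\<lambda>x. f x + g x)"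
proof -
  have "linear (\<lambda>p::'b \<times> 'b. fst p + snd p)"
    by (intro bounded_linear.linear bounded_linear_add bounded_linear_fst bounded_linear_snd)
  from smooth_on_compose[OF smooth_on_Pair[OF assms] smooth_on_linear[OF this] subset_UNIV]
  show ?thesis by simp
qed

lemma smooth_on_linear_comp: "smooth_on S f \<Longrightarrow> linear h \<Longrightarrow> smooth_on S (\<lambda>x. h (f x))"
  using smooth_on_compose[of S f UNIV h] smooth_on_linear[of h UNIV] by simp

lemma smooth_on_diff:
  fixes f g :: "'a::euclidean_space \<Rightarrow> 'b::euclidean_space"
  assumes "smooth_on S f" "smooth_on S g" shows "smooth_on S (\<lambda>x. f x - g x)"
  using smooth_on_add[OF assms(1) smooth_on_linear_comp[OF assms(2), of uminus]]
  by (simp add: bounded_linear.linear bounded_linear_minus)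

lemma smooth_on_continuous: 
  assumes "smooth_on S f" shows "continuous_on S f"
  unfolding continuous_on_eq_continuous_within
proof
  fix x assume x: "x \<in> S"
  obtain W f1 where W: "open W" "x \<in> W" "\<And>k. Ck_on k f1 W" "\<forall>y\<in>S \<inter> W. f1 y = f y"
    using assms x unfolding smooth_on_def by metis
  have "isCont f1 x" using Ck_on_continuous[OF W(3)] W(1,2) continuous_on_eq_continuous_at by blast
  then have c: "continuous (at x within S) f1" by (rule continuous_at_imp_continuous_at_within)
  obtain e where e: "e > 0" "ball x e \<subseteq> W" using W(1,2) open_contains_ball by blast
  show "continuous (at x within S) f"
    by (rule continuous_transform_within[OF c e(1) x]) (use e(2) W(4) in \<open>auto simp: dist_commute subset_iff\<close>)
qed

lemma smooth_on_has_derivative: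
  fixes f :: "'a::euclidean_space \<Rightarrow> 'b::euclidean_space"
  assumes "smooth_on S f" and x: "x \<in> S"
  obtains f' where "(f has_derivative f') (at x within S)"
proof -
  obtain W f1 where W: "open W" "x \<in> W" "\<And>k. Ck_on k f1 W" "\<forall>y\<in>S \<inter> W. f1 y = f y"
    using assms x unfolding smooth_on_def by metis
  from W(3)[of "Suc 0"] W(2) obtain f' where "(f1 has_derivative f') (at x)" by auto
  then have d: "(f1 has_derivative f') (at x within S)" by (rule has_derivative_at_withinI)
  obtain e where e: "e > 0" "ball x e \<subseteq> W" using W(1,2) open_contains_ball by blast
  have "(f has_derivative f') (at x within S)"
    by (rule has_derivative_transform_within[OF d e(1) x]) (use e W(4) in \<open>auto simp: dist_commute subset_iff\<close>)
  then show ?thesis by (rule that)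
qed

section \<open>Derivatives relative to a linear subspace\<close>

lemma at_within_openin:
  assumes "openin (top_of_set E) P" "x \<in> P" shows "at x within P = at x within E"
proof -
  obtain T where T: "open T" "P = E \<inter> T" using assms(1) openin_open by blast
  show ?thesis by (rule at_within_nhd[of x T]) (use T assms(2) in auto)
qed

lemma has_derivative_directional:
  fixes f :: "'a::real_normed_vector \<Rightarrow> 'b::real_normed_vector"
  assumes f: "(f has_derivative f') (at x within E)" and E: "subspace E" "x \<in> E" "v \<in> E"
  shows "((\<lambda>t. f (x + t *\<^sub>R v)) has_vector_derivative f' v) (at 0)"
proof -
  have 1: "((\<lambda>t. x + t *\<^sub>R v) has_derivative (\<lambda>t. t *\<^sub>R v)) (at 0 within UNIV)"
    by (auto intro!: derivative_eq_intros)
  have 2: "(f has_derivative f') (at (x + 0 *\<^sub>R v) within range (\<lambda>t. x + t *\<^sub>R v))"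
    using has_derivative_subset[OF f, of "range (\<lambda>t. x + t *\<^sub>R v)"] E
    by (auto simp: subspace_add subspace_scale image_subset_iff)
  have "linear f'" using f has_derivative_linear by blast
  then show ?thesis
    using diff_chain_within[OF 1 2] by (simp add: o_def has_vector_derivative_def linear_scale)
qed

lemma linear_projection:
  assumes "subspace (F :: 'a::euclidean_space set)"
  obtains p where "linear p" "\<And>x. p x \<in> F" "\<And>x. x \<in> F \<Longrightarrow> p x = x"
  using linear_exists_left_inverse_on[OF linear_ident assms] by (auto simp: inj_on_def)

text \<open>For a projection \<open>p\<close> onto \<open>F\<close> the curve
  \<open>g t - p (g t)\<close> vanishes near 0, hence so does its derivative
  \<open>u - p u\<close>.\<close>

lemma has_vector_derivative_in_subspace:
  fixes g :: "real \<Rightarrow> 'a::euclidean_space"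
  assumes g: "(g has_vector_derivative u) (at 0)" and F: "subspace F"
    and ev: "\<forall>\<^sub>F t in nhds 0. g t \<in> F"
  shows "u \<in> F"
proof -
  obtain p where p: "linear p" "\<And>x. p x \<in> F" "\<And>x. x \<in> F \<Longrightarrow> p x = x"
    using linear_projection[OF F] by metis
  have "bounded_linear (\<lambda>x. x - p x)"
    using p(1) by (intro bounded_linear_sub bounded_linear_ident) (simp add: linear_conv_bounded_linear)
  then have "((\<lambda>t. g t - p (g t)) has_vector_derivative (u - p u)) (at 0)"
    by (rule bounded_linear.has_vector_derivative[OF _ g])
  moreover obtain T where "open T" "0 \<in> T" "\<And>t. t \<in> T \<Longrightarrow> g t \<in> F"
    using ev unfolding eventually_nhds by blast
  then have "((\<lambda>t. g t - p (g t)) has_vector_derivative 0) (at 0)"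
    by (intro has_vector_derivative_transform_within_open[OF has_vector_derivative_const[of 0]])
       (auto simp: p(3))
  ultimately have "u - p u = 0" using vector_derivative_unique_at by blast
  then show ?thesis using p(2)[of u] by simp
qed

text \<open>The map is extended to an endomorphism of the ambient space: along \<open>F\<close> it
  is \<open>f\<close> transported back to \<open>F\<close> by a linear map \<open>J\<close> that is
  isometric on \<open>G\<close>, and transversally it is the identity. The full-dimensional inverse
  function theorem applies to the extension and is then restricted to \<open>F\<close>.\<close>

lemma smooth_inverse_subspace:
  fixes f :: "'a::euclidean_space \<Rightarrow> 'b::euclidean_space"
  assumes F: "subspace F" and G: "subspace G" and dim: "dim F = dim G"
    and P: "openin (top_of_set F) P" and f: "smooth_on P f" and fG: "f ` P \<subseteq> G" and x0: "x0 \<in> P"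
    and f': "(f has_derivative f') (at x0 within F)" and inj: "\<And>v. v \<in> F \<Longrightarrow> f' v = 0 \<Longrightarrow> v = 0"
  obtains P' where "openin (top_of_set F) P'" "x0 \<in> P'" "P' \<subseteq> P" "inj_on f P'"
    "openin (top_of_set G) (f ` P')" "smooth_on (f ` P') (inv_into P' f)"
proof -
  obtain p where p: "linear p" "\<And>x. p x \<in> F" "\<And>x. x \<in> F \<Longrightarrow> p x = x"
    using linear_projection[OF F] by metis
  obtain I J where J: "linear I" "linear J" "I ` F = G" "J ` G = F" "\<And>y. y \<in> G \<Longrightarrow> norm (J y) = norm y"
    by (rule isometries_subspaces[OF F G dim]) blast
  have J0: "y = 0" if "y \<in> G" "J y = 0" for y using J(5)[OF that(1)] that(2) by simp
  have Jinj: "y = z" if "y \<in> G" "z \<in> G" "J y = J z" for y z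
    using J0[of "y - z"] that G linear_diff[OF J(2)] by (auto simp: subspace_diff)
  obtain T where T: "open T" "P = F \<inter> T" using P openin_open by blast
  have x0F: "x0 \<in> F" using x0 T by auto
  obtain W f1 where W: "open W" "x0 \<in> W" "\<And>k. Ck_on k f1 W" "\<forall>y\<in>P \<inter> W. f1 y = f y"
    using f x0 unfolding smooth_on_def by metis
  obtain f1' where f1': "(f1 has_derivative f1') (at x0)" using W(3)[of "Suc 0"] W(2) by auto
  \<comment> \<open>The local extension \<open>f1\<close> is arbitrary off \<open>F\<close>; only
    its derivative in directions of \<open>F\<close> is determined by \<open>f\<close>.\<close>
  have f1f': "f1' v = f' v" if v: "v \<in> F" for v
  proof -
    have 1: "((\<lambda>t. f (x0 + t *\<^sub>R v)) has_vector_derivative f' v) (at 0)"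
      by (rule has_derivative_directional[OF f' F x0F v])
    have 2: "((\<lambda>t. f1 (x0 + t *\<^sub>R v)) has_vector_derivative f1' v) (at 0)"
      by (rule has_derivative_directional[OF f1' subspace_UNIV]) auto
    have "open ((\<lambda>t. x0 + t *\<^sub>R v) -` (W \<inter> T))"
      using W(1) T(1) by (intro open_vimage open_Int) (auto intro!: continuous_intros)
    from has_vector_derivative_transform_within_open[OF 1 this, of "\<lambda>t. f1 (x0 + t *\<^sub>R v)"]
    have "((\<lambda>t. f1 (x0 + t *\<^sub>R v)) has_vector_derivative f' v) (at 0)"
      using W(2,4) T(2) x0 v F x0F by (auto simp: subspace_add subspace_scale)
    then show ?thesis using 2 vector_derivative_at by metis
  qed
  have f'G: "f' v \<in> G" if v: "v \<in> F" for v
  proof (rule has_vector_derivative_in_subspace[OF has_derivative_directional[OF f' F x0F v] G])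
    have "open ((\<lambda>t. x0 + t *\<^sub>R v) -` T)"
      using T(1) by (intro open_vimage) (auto intro!: continuous_intros)
    moreover have "0 \<in> (\<lambda>t. x0 + t *\<^sub>R v) -` T" using x0 T by auto
    ultimately have "\<forall>\<^sub>F t in nhds 0. t \<in> (\<lambda>t. x0 + t *\<^sub>R v) -` T"
      using eventually_nhds_in_open by blast
    then show "\<forall>\<^sub>F t in nhds 0. f (x0 + t *\<^sub>R v) \<in> G"
      by (rule eventually_mono) (use fG T v F x0F in \<open>auto simp: subspace_add subspace_scale\<close>)
  qed
  define h where "h x = J (f1 (p x)) + (x - p x)" for x
  define W1 where "W1 = p -` (W \<inter> T)"
  have bp: "bounded_linear p" using p(1) linear_conv_bounded_linear by blast
  have bJ: "bounded_linear J" using J(2) linear_conv_bounded_linear by blast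
  have W1: "open W1" unfolding W1_def
    using W(1) T(1) linear_continuous_on[OF bp] by (intro open_vimage open_Int) auto
  have hk: "Ck_on k h W1" for k
  proof -
    have "Ck_on k (\<lambda>x. f1 (p x)) W1"
      by (rule Ck_on_compose[OF Ck_on_linear[OF bp] W(3)]) (auto simp: W1_def)
    from Ck_on_linear_comp[OF bJ this] 
      Ck_on_linear[OF bounded_linear_sub[OF bounded_linear_ident bp], of k W1]
    have "Ck_on k (\<lambda>x. J (f1 (p x)) + (x - p x)) W1" by (rule Ck_on_add)
    then show ?thesis unfolding h_def .
  qed
  have x0W1: "x0 \<in> W1" using x0F W(2) x0 T p by (auto simp: W1_def)
  have h': "(h has_derivative (\<lambda>v. J (f1' (p v)) + (v - p v))) (at x0)"
  proof -
    have "(f1 has_derivative f1') (at (p x0))" using f1' p(3)[OF x0F] by simp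
    then have "((\<lambda>x. f1 (p x)) has_derivative (\<lambda>v. f1' (p v))) (at x0)"
      using diff_chain_at[OF bounded_linear_imp_has_derivative[OF bp]] by (metis (no_types, lifting) comp_apply has_derivative_eq_rhs has_derivative_transform_within_open ext o_def)
    then have "((\<lambda>x. J (f1 (p x))) has_derivative (\<lambda>v. J (f1' (p v)))) (at x0)"
      by (rule bounded_linear.has_derivative[OF bJ])
    then show ?thesis unfolding h_def
      by (intro has_derivative_add has_derivative_diff has_derivative_ident bounded_linear_imp_has_derivative[OF bp])
  qed
  have lh': "linear (\<lambda>v. J (f1' (p v)) + (v - p v))" using h' has_derivative_linear by blast
  have "inj (\<lambda>v. J (f1' (p v)) + (v - p v))"
    unfolding linear_injective_0[OF lh']
  proof (intro allI impI)
    fix v assume v: "J (f1' (p v)) + (v - p v) = 0"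
    have JF: "J (f1' (p v)) \<in> F" using f1f'[OF p(2)] f'G[OF p(2)] J(4) by auto
    have "v = p v - J (f1' (p v))" using v by (simp add: algebra_simps eq_neg_iff_add_eq_0)
    then have vF: "v \<in> F" using JF p(2) F by (metis subspace_diff)
    then have "J (f' v) = 0" using v p(3) f1f' by auto
    then show "v = 0" using inj vF J0 f'G by blast
  qed
  from smooth_inverse[OF W1 hk x0W1 h' this]
  obtain U V g where U: "open U" "x0 \<in> U" "U \<subseteq> W1" "open V" "homeomorphism U V h g" "\<And>k. Ck_on k g V"
    by blast
  let ?P = "F \<inter> U"
  have hf: "f x \<in> G" "h x = J (f x)" "x \<in> P" if x: "x \<in> ?P" for x
  proof -
    have "p x \<in> W \<inter> T" using x U(3) by (auto simp: W1_def)
    then have "x \<in> W \<inter> T" using x p(3) by auto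
    then show "f x \<in> G" "h x = J (f x)" "x \<in> P" using x p(3) W(4) T fG by (auto simp: h_def)
  qed
  have gh: "g (h x) = x" if "x \<in> U" for x using U(5) that by (auto simp: homeomorphism_def)
  have hg: "h (g y) = y" "g y \<in> U" if "y \<in> V" for y using U(5) that by (auto simp: homeomorphism_def)
  have inj: "inj_on f ?P" by (rule inj_onI) (metis hf(2) gh IntD2)
  have im: "f ` ?P = G \<inter> J -` V"
  proof (intro subset_antisym subsetI)
    fix y assume "y \<in> f ` ?P"
    then obtain x where x: "x \<in> ?P" "y = f x" by blast
    have "h x \<in> V" using x(1) U(5) by (auto simp: homeomorphism_def)
    then show "y \<in> G \<inter> J -` V" using hf(1,2)[OF x(1)] x(2) by auto
  next
    fix y assume y: "y \<in> G \<inter> J -` V"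
    let ?x = "g (J y)"
    have x: "?x \<in> U" "h ?x = J y" using hg y by auto
    have px: "p ?x \<in> P" "f1 (p ?x) = f (p ?x)" using x(1) U(3) p(2) T W(4) by (auto simp: W1_def)
    then have "J (f (p ?x)) \<in> F" using fG J(4) by auto
    moreover have "J y \<in> F" using y J(4) by auto
    \<comment> \<open>Since \<open>J\<close> maps \<open>G\<close> into \<open>F\<close>, the
      transversal part of the preimage of \<open>J y\<close> lies in \<open>F\<close>, so the
      preimage itself does.\<close>
    moreover have "?x - p ?x = J y - J (f (p ?x))" using x(2) px(2) by (simp add: h_def algebra_simps)
    ultimately have "?x - p ?x \<in> F" using F by (simp add: subspace_diff)
    then have xF: "?x \<in> F" using p(2) F by (metis diff_add_cancel subspace_add)
    then have "J (f ?x) = J y" "f ?x \<in> G" using hf[of ?x] x by auto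
    then have "f ?x = y" using Jinj y by auto
    then show "y \<in> f ` ?P" using xF x(1) by (metis IntI image_eqI)
  qed
  have "open (J -` V)" using U(4) linear_continuous_on[OF bJ] by (intro open_vimage) auto
  then have op: "openin (top_of_set G) (f ` ?P)" using im by auto
  have "smooth_on (f ` ?P) (\<lambda>y. g (J y))"
  proof (rule smooth_on_compose[OF smooth_on_linear[OF J(2)]])
    show "smooth_on V g" by (rule smooth_onI[OF U(4) order_refl U(6)])
  qed (use im in auto)
  then have sm: "smooth_on (f ` ?P) (inv_into ?P f)"
  proof (rule smooth_on_cong)
    fix y assume "y \<in> f ` ?P"
    then obtain x where "x \<in> ?P" "y = f x" by blast
    then show "g (J y) = inv_into ?P f y" using inj hf(2) gh by (metis IntD2 inv_into_f_f)
  qed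
  show ?thesis
    by (rule that[OF _ _ _ inj op sm]) (use U x0F hf in auto)
qed

section \<open>Charts and smooth maps between manifolds\<close>

lemma chartsD:
  assumes "(U, c) \<in> charts M"
  shows "open U" "openin (top_of_set (model M)) (c ` U)" "continuous_on U c"
    "continuous_on (c ` U) (inv_into U c)" "inj_on c U"
proof -
  have h: "homeomorphism U (c ` U) c (inv_into U c)" "open U" "openin (top_of_set (model M)) (c ` U)"
    using assms by (auto simp: charts_def chart_on_def)
  then show "open U" "openin (top_of_set (model M)) (c ` U)" "continuous_on U c"
    "continuous_on (c ` U) (inv_into U c)" by (auto simp: homeomorphism_def)
  show "inj_on c U" using h(1) by (metis homeomorphism_def inj_on_inverseI)
qed

lemma chart_onI:
  assumes "open U" "openin (top_of_set E) (c ` U)" "continuous_on U c"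
    "continuous_on (c ` U) (inv_into U c)" "inj_on c U"
  shows "chart_on E (U, c)"
proof -
  have "inv_into U c ` c ` U = U" using assms(5) by (simp add: inv_into_image_cancel)
  then show ?thesis using assms by (auto simp: chart_on_def homeomorphism_def)
qed

lemma chart_in_model: "(U, c) \<in> charts M \<Longrightarrow> x \<in> U \<Longrightarrow> c x \<in> model M"
  using chartsD(2) openin_imp_subset by blast

lemma chart_inv: "(U, c) \<in> charts M \<Longrightarrow> x \<in> U \<Longrightarrow> inv_into U c (c x) = x"
  using chartsD(5) by (metis inv_into_f_f)

lemma chart_image_open:
  assumes c: "(U, c) \<in> charts M" and G: "open G"
  shows "openin (top_of_set (model M)) (c ` (U \<inter> G))"
proof -
  have "c ` (U \<inter> G) = c ` U \<inter> inv_into U c -` G" using chart_inv[OF c] by auto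
  moreover have "openin (top_of_set (c ` U)) (c ` U \<inter> inv_into U c -` G)"
    using chartsD(4)[OF c] G by (rule continuous_openin_preimage_gen)
  ultimately show ?thesis using chartsD(2)[OF c] openin_trans by metis
qed

lemma charts_cover:
  assumes "smooth_manifold M" obtains U c where "(U, c) \<in> atlas M" "(U, c) \<in> charts M" "x \<in> U"
proof -
  have "x \<in> (\<Union>(U, c)\<in>atlas M. U)" using assms by (simp add: smooth_manifold_def)
  then obtain U c where "(U, c) \<in> atlas M" "x \<in> U" by auto
  then show ?thesis using assms that by (auto simp: smooth_manifold_def)
qed

lemma subspace_model: "smooth_manifold M \<Longrightarrow> subspace (model M)"
  by (simp add: smooth_manifold_def)

text \<open>By definition a chart of the maximal atlas is compatible with the atlas charts only;
  near each point the transition is factored through an atlas chart \<open>c0\<close>.\<close>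

lemma chart_transition:
  assumes M: "smooth_manifold M" and c: "(U, c) \<in> charts M" and c': "(U', c') \<in> charts M"
  shows "smooth_on (c ` (U \<inter> U')) (\<lambda>z. c' (inv_into U c z))"
proof (rule smooth_on_local)
  fix z assume "z \<in> c ` (U \<inter> U')"
  then obtain x where x: "x \<in> U" "x \<in> U'" "z = c x" by blast
  obtain U0 c0 where c0: "(U0, c0) \<in> atlas M" "(U0, c0) \<in> charts M" "x \<in> U0"
    using charts_cover[OF M] by metis
  have 1: "smooth_on (c ` (U \<inter> U0)) (\<lambda>z. c0 (inv_into U c z))"
    using c c0(1) unfolding charts_def compatible_def by (auto simp: o_def)
  have 2: "smooth_on (c0 ` (U' \<inter> U0)) (\<lambda>z. c' (inv_into U0 c0 z))"
    using c' c0(1) unfolding charts_def compatible_def by (auto simp: o_def)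
  have 3: "smooth_on (c ` (U \<inter> U' \<inter> U0)) (\<lambda>z. c' (inv_into U0 c0 (c0 (inv_into U c z))))"
    by (rule smooth_on_compose[OF smooth_on_subset[OF 1] 2]) (auto simp: chart_inv[OF c])
  have 4: "smooth_on (c ` (U \<inter> U' \<inter> U0)) (\<lambda>z. c' (inv_into U c z))"
    by (rule smooth_on_cong[OF 3]) (auto simp: chart_inv[OF c] chart_inv[OF c0(2)])
  \<comment> \<open>\<open>smooth_on_local\<close> asks for neighbourhoods open in the ambient
    space, hence the set \<open>W\<close> that cuts the overlap out of the model.\<close>
  obtain W where W: "open W" "c ` (U \<inter> U0) = model M \<inter> W"
    using chart_image_open[OF c chartsD(1)[OF c0(2)]] openin_open by blast
  have "c ` (U \<inter> U') \<inter> W \<subseteq> c ` (U \<inter> U' \<inter> U0)"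
  proof
    fix w assume "w \<in> c ` (U \<inter> U') \<inter> W"
    then obtain y where y: "y \<in> U" "y \<in> U'" "w = c y" "w \<in> W" by blast
    then have "c y \<in> c ` (U \<inter> U0)" using W(2) chart_in_model[OF c] by auto
    then have "y \<in> U0" using y(1) inj_onD[OF chartsD(5)[OF c]] by auto
    then show "w \<in> c ` (U \<inter> U' \<inter> U0)" using y by auto
  qed
  moreover have "z \<in> W" using W(2) x c0(3) by blast
  ultimately show "\<exists>W. open W \<and> z \<in> W \<and> smooth_on (c ` (U \<inter> U') \<inter> W) (\<lambda>z. c' (inv_into U c z))"
    using W(1) smooth_on_subset[OF 4] by blast
qed

lemma chartI:
  assumes M: "smooth_manifold M" and c: "(U, c) \<in> charts M"
    and op: "openin (top_of_set (model M)) (c' ` U)" and inj: "inj_on c' U"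
    and s: "smooth_on (c ` U) (\<lambda>z. c' (inv_into U c z))"
    and s': "smooth_on (c' ` U) (\<lambda>z. c (inv_into U c' z))"
  shows "(U, c') \<in> charts M"
proof -
  have inv': "inv_into U c' (c' x) = x" if "x \<in> U" for x using inj that by simp
  have 1: "continuous_on U c'"
    using continuous_on_compose2[OF smooth_on_continuous[OF s] chartsD(3)[OF c] order_refl]
    by (rule continuous_on_eq) (simp add: chart_inv[OF c])
  have 2: "continuous_on (c' ` U) (inv_into U c')"
    using continuous_on_compose2[OF chartsD(4)[OF c] smooth_on_continuous[OF s']]
    by (rule continuous_on_eq) (auto simp: inv' chart_inv[OF c])
  have 3: "chart_on (model M) (U, c')"
    by (rule chart_onI[OF chartsD(1)[OF c] op 1 2 inj])
  have "compatible (U, c') (U0, c0)" if c0: "(U0, c0) \<in> atlas M" for U0 c0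
  proof -
    have c0': "(U0, c0) \<in> charts M" using that M unfolding smooth_manifold_def by blast
    have a: "smooth_on (c' ` (U \<inter> U0)) (\<lambda>z. c0 (inv_into U c (c (inv_into U c' z))))"
      by (rule smooth_on_compose[OF smooth_on_subset[OF s'] chart_transition[OF M c c0']]) (auto simp: inv')
    have b: "smooth_on (c0 ` (U \<inter> U0)) (\<lambda>z. c' (inv_into U c (c (inv_into U0 c0 z))))"
      by (rule smooth_on_compose[OF smooth_on_subset[OF chart_transition[OF M c0' c]] s])
        (auto simp: chart_inv[OF c0'])
    have a': "smooth_on (c' ` (U \<inter> U0)) (c0 \<circ> inv_into U c')"
      by (rule smooth_on_cong[OF a]) (auto simp: inv' chart_inv[OF c])
    have b': "smooth_on (c0 ` (U \<inter> U0)) (c' \<circ> inv_into U0 c0)"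
      by (rule smooth_on_cong[OF b]) (auto simp: chart_inv[OF c0'] chart_inv[OF c])
    show ?thesis using a' b' by (simp add: compatible_def)
  qed
  then show ?thesis using 3 by (auto simp: charts_def)
qed

lemma chart_restrict:
  assumes c: "(U, c) \<in> charts M" and G: "open G"
  shows "(U \<inter> G, c) \<in> charts M"
proof -
  have inj: "inj_on c (U \<inter> G)" using chartsD(5)[OF c] by (rule inj_on_subset) auto
  have inv: "inv_into (U \<inter> G) c (c x) = x" if "x \<in> U \<inter> G" for x using inj that by simp
  have "continuous_on (c ` (U \<inter> G)) (inv_into U c)"
    using chartsD(4)[OF c] by (rule continuous_on_subset) auto
  then have "continuous_on (c ` (U \<inter> G)) (inv_into (U \<inter> G) c)"
    by (rule continuous_on_eq) (use inv chart_inv[OF c] in fastforce)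
  then have 1: "chart_on (model M) (U \<inter> G, c)"
    using chart_image_open[OF c G] chartsD(1)[OF c] G continuous_on_subset[OF chartsD(3)[OF c], of "U \<inter> G"] inj
    by (intro chart_onI) auto
  have "compatible (U \<inter> G, c) (U0, c0)" if c0: "(U0, c0) \<in> atlas M" for U0 c0
  proof -
    have *: "smooth_on (c ` (U \<inter> U0)) (c0 \<circ> inv_into U c)" "smooth_on (c0 ` (U \<inter> U0)) (c \<circ> inv_into U0 c0)"
      using c c0 unfolding charts_def compatible_def by (auto)
    have "smooth_on (c ` (U \<inter> G \<inter> U0)) (c0 \<circ> inv_into U c)"
      by (rule smooth_on_subset[OF *(1)]) auto
    then have "smooth_on (c ` (U \<inter> G \<inter> U0)) (c0 \<circ> inv_into (U \<inter> G) c)"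
      by (rule smooth_on_cong) (use inv chart_inv[OF c] in fastforce)
    moreover have "smooth_on (c0 ` (U \<inter> G \<inter> U0)) (c \<circ> inv_into U0 c0)"
      by (rule smooth_on_subset[OF *(2)]) auto
    ultimately show ?thesis by (simp add: compatible_def)
  qed
  then show ?thesis using 1 by (auto simp: charts_def)
qed

lemma smooth_map_on_continuous: "smooth_map_on M N S f \<Longrightarrow> continuous_on S f"
  by (simp add: smooth_map_on_def)

lemma smooth_map_onD:
  assumes "smooth_map_on M N S f" "(U, c) \<in> charts M" "(V, d) \<in> charts N"
  shows "smooth_on (c ` (S \<inter> U \<inter> f -` V)) (\<lambda>z. d (f (inv_into U c z)))"
proof -
  have "smooth_on (c ` (S \<inter> U \<inter> f -` V)) (d \<circ> f \<circ> inv_into U c)"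
    using assms unfolding smooth_map_on_def by blast
  then show ?thesis by (simp add: o_def)
qed

text \<open>Smoothness is defined by all pairs of charts; transition maps on both sides reduce it to
  one pair around each point. The set \<open>G\<close> allows the domain to be shrunk near that
  point.\<close>

lemma smooth_map_onI:
  assumes M: "smooth_manifold M" and N: "smooth_manifold N" and cont: "continuous_on S f"
    and loc: "\<And>x. x \<in> S \<Longrightarrow> \<exists>U c V d G. (U, c) \<in> charts M \<and> (V, d) \<in> charts N \<and> x \<in> U \<and> f x \<in> V \<and>
      open G \<and> x \<in> G \<and> smooth_on (c ` (S \<inter> G \<inter> U \<inter> f -` V)) (\<lambda>z. d (f (inv_into U c z)))"
  shows "smooth_map_on M N S f"
proof -
  have "smooth_on (c ` (S \<inter> U \<inter> f -` V)) (\<lambda>z. d (f (inv_into U c z)))"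
    if c: "(U, c) \<in> charts M" and d: "(V, d) \<in> charts N" for U c V d
  proof (rule smooth_on_local)
    fix z assume "z \<in> c ` (S \<inter> U \<inter> f -` V)"
    then obtain x where x: "x \<in> S" "x \<in> U" "f x \<in> V" "z = c x" by blast
    obtain U' c' V' d' G where c': "(U', c') \<in> charts M" and d': "(V', d') \<in> charts N"
      and x': "x \<in> U'" "f x \<in> V'" "open G" "x \<in> G"
      and s: "smooth_on (c' ` (S \<inter> G \<inter> U' \<inter> f -` V')) (\<lambda>z. d' (f (inv_into U' c' z)))"
      using loc[OF x(1)] by blast
    obtain H where H: "open H" "S \<inter> f -` V' = S \<inter> H"
      using cont chartsD(1)[OF d'] by (metis continuous_on_open_invariant Int_commute)
    let ?X = "S \<inter> U \<inter> f -` V \<inter> (G \<inter> U' \<inter> H)"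
    have fV': "f y \<in> V'" if "y \<in> ?X" for y using that H(2) by blast
    have 1: "smooth_on (c ` ?X) (\<lambda>z. c' (inv_into U c z))"
      by (rule smooth_on_subset[OF chart_transition[OF M c c']]) auto
    have 2: "smooth_on (c ` ?X) (\<lambda>z. d' (f (inv_into U' c' (c' (inv_into U c z)))))"
      by (rule smooth_on_compose[OF 1 s]) (use fV' chart_inv[OF c] in auto)
    have 3: "smooth_on (c ` ?X) (\<lambda>z. d (inv_into V' d' (d' (f (inv_into U' c' (c' (inv_into U c z)))))))"
      by (rule smooth_on_compose[OF 2 chart_transition[OF N d' d]])
        (use fV' chart_inv[OF c] chart_inv[OF c'] in auto)
    have 4: "smooth_on (c ` ?X) (\<lambda>z. d (f (inv_into U c z)))"
      by (rule smooth_on_cong[OF 3]) (use fV' chart_inv[OF c] chart_inv[OF c'] chart_inv[OF d'] in auto)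
    have "open (G \<inter> U' \<inter> H)" using x' H chartsD(1)[OF c'] by auto
    then obtain W where W: "open W" "c ` (U \<inter> (G \<inter> U' \<inter> H)) = model M \<inter> W"
      using chart_image_open[OF c] openin_open by metis
    have "c ` (S \<inter> U \<inter> f -` V) \<inter> W \<subseteq> c ` ?X"
    proof
      fix w assume "w \<in> c ` (S \<inter> U \<inter> f -` V) \<inter> W"
      then obtain y where y: "y \<in> S \<inter> U \<inter> f -` V" "w = c y" "w \<in> W" by blast
      then have "c y \<in> c ` (U \<inter> (G \<inter> U' \<inter> H))" using W(2) chart_in_model[OF c] by auto
      then have "y \<in> G \<inter> U' \<inter> H" using y(1) inj_onD[OF chartsD(5)[OF c]] by auto
      then show "w \<in> c ` ?X" using y by auto
    qed
    moreover have "x \<in> H" using H(2) x x' by blast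
    then have "z \<in> W" using W(2) x x' by blast
    ultimately show "\<exists>W. open W \<and> z \<in> W \<and>
        smooth_on (c ` (S \<inter> U \<inter> f -` V) \<inter> W) (\<lambda>z. d (f (inv_into U c z)))"
      using W(1) smooth_on_subset[OF 4] by blast
  qed
  then show ?thesis using cont unfolding smooth_map_on_def by (auto simp: o_def)
qed

lemma smooth_map_onI_chart:
  assumes M: "smooth_manifold M" and N: "smooth_manifold N" and cont: "continuous_on S f"
    and c: "(U, c) \<in> charts M" "S \<subseteq> U" and d: "(V, d) \<in> charts N" "f ` S \<subseteq> V"
    and s: "smooth_on (c ` S) (\<lambda>z. d (f (inv_into U c z)))"
  shows "smooth_map_on M N S f"
proof (rule smooth_map_onI[OF M N cont])
  have "S \<inter> UNIV \<inter> U \<inter> f -` V = S" using c d by auto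
  then show "\<exists>U c V d G. (U, c) \<in> charts M \<and> (V, d) \<in> charts N \<and> x \<in> U \<and> f x \<in> V \<and>
      open G \<and> x \<in> G \<and> smooth_on (c ` (S \<inter> G \<inter> U \<inter> f -` V)) (\<lambda>z. d (f (inv_into U c z)))"
    if "x \<in> S" for x
    using that c d s by (intro exI[of _ U] exI[of _ c] exI[of _ V] exI[of _ d] exI[of _ UNIV]) auto
qed

lemma smooth_map_on_subset: "smooth_map_on M N S f \<Longrightarrow> T \<subseteq> S \<Longrightarrow> smooth_map_on M N T f"
  unfolding smooth_map_on_def by (fastforce intro: continuous_on_subset smooth_on_subset)

lemma smooth_map_on_cong:
  assumes M: "smooth_manifold M" and N: "smooth_manifold N"
    and f: "smooth_map_on M N S f" and eq: "\<And>x. x \<in> S \<Longrightarrow> f x = g x"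
  shows "smooth_map_on M N S g"
proof (rule smooth_map_onI[OF M N])
  show "continuous_on S g" using smooth_map_on_continuous[OF f] eq by (rule continuous_on_eq)
  fix x assume x: "x \<in> S"
  obtain U c where c: "(U, c) \<in> charts M" "x \<in> U" using charts_cover[OF M] by metis
  obtain V d where d: "(V, d) \<in> charts N" "f x \<in> V" using charts_cover[OF N] by metis
  have "smooth_on (c ` (S \<inter> UNIV \<inter> U \<inter> g -` V)) (\<lambda>z. d (g (inv_into U c z)))"
    by (rule smooth_on_cong[OF smooth_on_subset[OF smooth_map_onD[OF f c(1) d(1)]]])
      (auto simp: eq chart_inv[OF c(1)])
  then show "\<exists>U c V d G. (U, c) \<in> charts M \<and> (V, d) \<in> charts N \<and> x \<in> U \<and> g x \<in> V \<and>
      open G \<and> x \<in> G \<and> smooth_on (c ` (S \<inter> G \<inter> U \<inter> g -` V)) (\<lambda>z. d (g (inv_into U c z)))"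
    using c d eq[OF x] open_UNIV UNIV_I by metis
qed

lemma continuous_on_local:
  assumes "\<And>x. x \<in> S \<Longrightarrow> \<exists>G. open G \<and> x \<in> G \<and> continuous_on (S \<inter> G) f"
  shows "continuous_on S f"
  unfolding continuous_on_topological
proof (intro ballI allI impI)
  fix x B assume x: "x \<in> S" and B: "open B" "f x \<in> B"
  obtain G where G: "open G" "x \<in> G" "continuous_on (S \<inter> G) f" using assms x by blast
  obtain A where "open A" "x \<in> A" "\<forall>y\<in>S \<inter> G. y \<in> A \<longrightarrow> f y \<in> B"
    using G x B unfolding continuous_on_topological by (metis IntI)
  then show "\<exists>A. open A \<and> x \<in> A \<and> (\<forall>y\<in>S. y \<in> A \<longrightarrow> f y \<in> B)"
    using G by (intro exI[of _ "A \<inter> G"]) auto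
qed

lemma smooth_map_on_local:
  assumes M: "smooth_manifold M" and N: "smooth_manifold N"
    and loc: "\<And>x. x \<in> S \<Longrightarrow> \<exists>G. open G \<and> x \<in> G \<and> smooth_map_on M N (S \<inter> G) f"
  shows "smooth_map_on M N S f"
proof (rule smooth_map_onI[OF M N])
  show "continuous_on S f" using loc smooth_map_on_continuous continuous_on_local by metis
  fix x assume x: "x \<in> S"
  then obtain G where G: "open G" "x \<in> G" "smooth_map_on M N (S \<inter> G) f" using loc by blast
  obtain U c where c: "(U, c) \<in> charts M" "x \<in> U" using charts_cover[OF M] by metis
  obtain V d where d: "(V, d) \<in> charts N" "f x \<in> V" using charts_cover[OF N] by metis
  from smooth_map_onD[OF G(3) c(1) d(1)] G c d
  show "\<exists>U c V d G. (U, c) \<in> charts M \<and> (V, d) \<in> charts N \<and> x \<in> U \<and> f x \<in> V \<and>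
      open G \<and> x \<in> G \<and> smooth_on (c ` (S \<inter> G \<inter> U \<inter> f -` V)) (\<lambda>z. d (f (inv_into U c z)))"
    by blast
qed

lemma smooth_map_on_compose:
  assumes M: "smooth_manifold M" and N: "smooth_manifold N" and P: "smooth_manifold P"
    and f: "smooth_map_on M N S f" and g: "smooth_map_on N P T g" and sub: "f ` S \<subseteq> T"
  shows "smooth_map_on M P S (\<lambda>x. g (f x))"
proof (rule smooth_map_onI[OF M P])
  show "continuous_on S (\<lambda>x. g (f x))"
    using continuous_on_compose2[OF smooth_map_on_continuous[OF g] smooth_map_on_continuous[OF f] sub] .
  fix x assume x: "x \<in> S"
  obtain U c where c: "(U, c) \<in> charts M" "x \<in> U" using charts_cover[OF M] by metis
  obtain V d where d: "(V, d) \<in> charts N" "f x \<in> V" using charts_cover[OF N] by metis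
  obtain W e where e: "(W, e) \<in> charts P" "g (f x) \<in> W" using charts_cover[OF P] by metis
  obtain G where G: "open G" "S \<inter> f -` V = S \<inter> G"
    using smooth_map_on_continuous[OF f] chartsD(1)[OF d(1)] 
    by (metis continuous_on_open_invariant Int_commute)
  let ?X = "S \<inter> G \<inter> U \<inter> (\<lambda>x. g (f x)) -` W"
  have fV: "f y \<in> V" if "y \<in> ?X" for y using that G by blast
  have "smooth_on (c ` ?X) (\<lambda>z. e (g (inv_into V d (d (f (inv_into U c z))))))"
    by (rule smooth_on_compose[OF smooth_on_subset[OF smooth_map_onD[OF f c(1) d(1)]]
          smooth_map_onD[OF g d(1) e(1)]]) (use fV chart_inv[OF c(1)] sub in auto)
  then have "smooth_on (c ` ?X) (\<lambda>z. e (g (f (inv_into U c z))))"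
    by (rule smooth_on_cong) (use fV chart_inv[OF c(1)] chart_inv[OF d(1)] in auto)
  moreover have "x \<in> G" using G(2) x d by blast
  ultimately show "\<exists>U c V d G. (U, c) \<in> charts M \<and> (V, d) \<in> charts P \<and> x \<in> U \<and> g (f x) \<in> V \<and>
      open G \<and> x \<in> G \<and> smooth_on (c ` (S \<inter> G \<inter> U \<inter> (\<lambda>x. g (f x)) -` V)) (\<lambda>z. d (g (f (inv_into U c z))))"
    using c e G by blast
qed

section \<open>Euclidean spaces and products as manifolds\<close>

text \<open>With Euclidean spaces as manifolds, charts, their inverses and curves all become smooth
  maps in the sense of \<open>smooth_map_on\<close>, and one composition lemma covers every
  case.\<close>

definition euclid :: "('e::euclidean_space, 'e) manifold" where
  "euclid = \<lparr>model = UNIV, atlas = {(UNIV, id)}\<rparr>"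

lemma real_line_eq: "real_line = euclid"
  by (simp add: real_line_def euclid_def)

lemma euclid_chart: "(UNIV, \<lambda>x. x) \<in> charts euclid"
  by (auto simp: charts_def euclid_def chart_on_def compatible_def homeomorphism_def id_def o_def
      inv_id[unfolded id_def] intro: smooth_on_id)

lemma smooth_manifold_euclid: "smooth_manifold euclid"
  using euclid_chart by (auto simp: smooth_manifold_def euclid_def id_def)

lemma smooth_map_on_euclid_iff: "smooth_map_on euclid euclid S f \<longleftrightarrow> smooth_on S f"
proof
  assume "smooth_map_on euclid euclid S f"
  from smooth_map_onD[OF this euclid_chart euclid_chart] show "smooth_on S f"
    by (simp add: inv_id[unfolded id_def])
next
  assume f: "smooth_on S f"
  show "smooth_map_on euclid euclid S f"
    by (rule smooth_map_onI_chart[OF smooth_manifold_euclid smooth_manifold_euclid smooth_on_continuous[OF f]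
          euclid_chart _ euclid_chart]) (use f in \<open>auto simp: inv_id[unfolded id_def]\<close>)
qed

lemma smooth_map_on_chart:
  assumes M: "smooth_manifold M" and c: "(U, c) \<in> charts M"
  shows "smooth_map_on M euclid U c"
proof (rule smooth_map_onI_chart[OF M smooth_manifold_euclid chartsD(3)[OF c] c order_refl euclid_chart])
  show "smooth_on (c ` U) (\<lambda>z. c (inv_into U c z))"
    by (rule smooth_on_cong[OF smooth_on_id]) (auto simp: chart_inv[OF c])
qed simp

lemma smooth_map_on_chart_inv:
  assumes M: "smooth_manifold M" and c: "(U, c) \<in> charts M"
  shows "smooth_map_on euclid M (c ` U) (inv_into U c)"
proof (rule smooth_map_onI_chart[OF smooth_manifold_euclid M chartsD(4)[OF c] euclid_chart subset_UNIV c])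
  show "smooth_on ((\<lambda>x. x) ` c ` U) (\<lambda>z. c (inv_into U c (inv_into UNIV (\<lambda>x. x) z)))"
    by (rule smooth_on_cong[OF smooth_on_id]) (auto simp: chart_inv[OF c] inv_id[unfolded id_def])
qed (auto simp: inv_into_into)

lemma smooth_map_on_id: 
  assumes M: "smooth_manifold M" shows "smooth_map_on M M S (\<lambda>x. x)"
proof (rule smooth_map_onI[OF M M continuous_on_id])
  fix x assume "x \<in> S"
  obtain U c where c: "(U, c) \<in> charts M" "x \<in> U" using charts_cover[OF M] by metis
  have "smooth_on (c ` (S \<inter> UNIV \<inter> U \<inter> (\<lambda>x. x) -` U)) (\<lambda>z. c (inv_into U c z))"
    by (rule smooth_on_cong[OF smooth_on_id]) (auto simp: chart_inv[OF c(1)])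
  then show "\<exists>U c V d G. (U, c) \<in> charts M \<and> (V, d) \<in> charts M \<and> x \<in> U \<and> x \<in> V \<and>
      open G \<and> x \<in> G \<and> smooth_on (c ` (S \<inter> G \<inter> U \<inter> (\<lambda>x. x) -` V)) (\<lambda>z. d (inv_into U c z))"
    using c open_UNIV UNIV_I by metis
qed

lemma smooth_map_on_const: 
  assumes M: "smooth_manifold M" and N: "smooth_manifold N" shows "smooth_map_on M N S (\<lambda>x. a)"
proof (rule smooth_map_onI[OF M N continuous_on_const])
  fix x assume "x \<in> S"
  obtain U c where c: "(U, c) \<in> charts M" "x \<in> U" using charts_cover[OF M] by metis
  obtain V d where d: "(V, d) \<in> charts N" "a \<in> V" using charts_cover[OF N] by metis
  show "\<exists>U c V d G. (U, c) \<in> charts M \<and> (V, d) \<in> charts N \<and> x \<in> U \<and> a \<in> V \<and>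
      open G \<and> x \<in> G \<and> smooth_on (c ` (S \<inter> G \<inter> U \<inter> (\<lambda>x. a) -` V)) (\<lambda>z. d a)"
    using c d open_UNIV UNIV_I smooth_on_const by metis
qed

lemma prod_chart_inv:
  assumes "inj_on c U" "inj_on d V" "x \<in> U" "y \<in> V"
  shows "inv_into (U \<times> V) (map_prod c d) (c x, d y) = (x, y)"
proof -
  have "inj_on (map_prod c d) (U \<times> V)" using assms by (auto simp: inj_on_def)
  from inv_into_f_f[OF this, of "(x, y)"] show ?thesis using assms by simp
qed

lemma prod_transition:
  assumes M: "smooth_manifold M" and N: "smooth_manifold N"
    and c: "(U, c) \<in> charts M" "(U', c') \<in> charts M" and d: "(V, d) \<in> charts N" "(V', d') \<in> charts N"
  shows "smooth_on (map_prod c d ` ((U \<times> V) \<inter> (U' \<times> V')))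
    (map_prod c' d' \<circ> inv_into (U \<times> V) (map_prod c d))"
proof -
  let ?X = "map_prod c d ` ((U \<times> V) \<inter> (U' \<times> V'))"
  have 1: "smooth_on ?X (\<lambda>z. c' (inv_into U c (fst z)))"
    by (rule smooth_on_compose[OF smooth_on_linear[OF linear_fst] chart_transition[OF M c]]) auto
  have 2: "smooth_on ?X (\<lambda>z. d' (inv_into V d (snd z)))"
    by (rule smooth_on_compose[OF smooth_on_linear[OF linear_snd] chart_transition[OF N d]]) auto
  show ?thesis
    by (rule smooth_on_cong[OF smooth_on_Pair[OF 1 2]])
      (auto simp: prod_chart_inv chartsD(5)[OF c(1)] chartsD(5)[OF d(1)])
qed

lemma prod_chart:
  assumes M: "smooth_manifold M" and N: "smooth_manifold N"
    and c: "(U, c) \<in> charts M" and d: "(V, d) \<in> charts N"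
  shows "(U \<times> V, map_prod c d) \<in> charts (M \<times>\<^sub>M N)"
proof -
  note inv = prod_chart_inv[OF chartsD(5)[OF c] chartsD(5)[OF d]]
  have im: "map_prod c d ` (U \<times> V) = c ` U \<times> d ` V" by auto
  have op: "openin (top_of_set (model M \<times> model N)) (map_prod c d ` (U \<times> V))"
    unfolding im using chartsD(2)[OF c] chartsD(2)[OF d] by (rule openin_Times)
  have c1: "continuous_on (U \<times> V) (map_prod c d)"
    unfolding map_prod_def case_prod_beta
    by (intro continuous_on_Pair continuous_on_compose2[OF chartsD(3)[OF c]]
        continuous_on_compose2[OF chartsD(3)[OF d]] continuous_on_fst continuous_on_snd continuous_on_id) auto
  have "continuous_on (c ` U \<times> d ` V) (\<lambda>z. (inv_into U c (fst z), inv_into V d (snd z)))"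
    by (intro continuous_on_Pair continuous_on_compose2[OF chartsD(4)[OF c]]
        continuous_on_compose2[OF chartsD(4)[OF d]] continuous_on_fst continuous_on_snd continuous_on_id) auto
  then have c2: "continuous_on (map_prod c d ` (U \<times> V)) (inv_into (U \<times> V) (map_prod c d))"
    unfolding im by (rule continuous_on_eq) (auto simp: inv chart_inv[OF c] chart_inv[OF d])
  have "chart_on (model (M \<times>\<^sub>M N)) (U \<times> V, map_prod c d)"
    unfolding prod_manifold_def manifold.simps using op c1 c2 chartsD(1,5)[OF c] chartsD(1,5)[OF d]
    by (intro chart_onI) (auto simp: open_Times inj_on_def)
  moreover have "compatible (U \<times> V, map_prod c d) \<kappa>" if \<kappa>: "\<kappa> \<in> atlas (M \<times>\<^sub>M N)" for \<kappa>
  proof -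
    obtain U' c' V' d' where k: "\<kappa> = (U' \<times> V', map_prod c' d')" "(U', c') \<in> atlas M" "(V', d') \<in> atlas N"
      using \<kappa> unfolding prod_manifold_def by auto
    then have k': "(U', c') \<in> charts M" "(V', d') \<in> charts N"
      using M N unfolding smooth_manifold_def by blast+
    show ?thesis unfolding k(1) compatible_def
      using prod_transition[OF M N c k'(1) d k'(2)] prod_transition[OF M N k'(1) c k'(2) d]
      by (simp add: Int_commute)
  qed
  ultimately show ?thesis by (auto simp: charts_def)
qed

lemma smooth_manifold_prod:
  assumes M: "smooth_manifold M" and N: "smooth_manifold N"
  shows "smooth_manifold (M \<times>\<^sub>M N)"
  unfolding smooth_manifold_def
proof (intro conjI)
  show "subspace (model (M \<times>\<^sub>M N))"
    using M N by (auto simp: prod_manifold_def smooth_manifold_def intro: subspace_Times)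
  show "atlas (M \<times>\<^sub>M N) \<subseteq> charts (M \<times>\<^sub>M N)"
  proof
    fix \<kappa> assume "\<kappa> \<in> atlas (M \<times>\<^sub>M N)"
    then obtain U' c' V' d' where k: "\<kappa> = (U' \<times> V', map_prod c' d')" "(U', c') \<in> atlas M" "(V', d') \<in> atlas N"
      unfolding prod_manifold_def by auto
    then show "\<kappa> \<in> charts (M \<times>\<^sub>M N)"
      using M N prod_chart[OF M N] unfolding smooth_manifold_def by blast
  qed
  have "\<exists>\<kappa>\<in>atlas (M \<times>\<^sub>M N). (x, y) \<in> fst \<kappa>" for x y
  proof -
    obtain U c where c: "(U, c) \<in> atlas M" "x \<in> U" using charts_cover[OF M] by metis
    obtain V d where d: "(V, d) \<in> atlas N" "y \<in> V" using charts_cover[OF N] by metis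
    have "(U \<times> V, map_prod c d) \<in> atlas (M \<times>\<^sub>M N)" using c d by (auto simp: prod_manifold_def)
    then show ?thesis using c d by force
  qed
  then show "(\<Union>(U, c)\<in>atlas (M \<times>\<^sub>M N). U) = UNIV" by (fastforce simp: case_prod_beta)
qed

lemma model_prod: "model (M \<times>\<^sub>M N) = model M \<times> model N"
  by (simp add: prod_manifold_def)

lemma smooth_map_on_fst:
  assumes M: "smooth_manifold M" and N: "smooth_manifold N"
  shows "smooth_map_on (M \<times>\<^sub>M N) M S fst"
proof (rule smooth_map_onI[OF smooth_manifold_prod[OF M N] M continuous_on_fst[OF continuous_on_id]])
  fix p :: "'a \<times> 'c" assume "p \<in> S"
  obtain U c where c: "(U, c) \<in> charts M" "fst p \<in> U" using charts_cover[OF M] by metis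
  obtain V d where d: "(V, d) \<in> charts N" "snd p \<in> V" using charts_cover[OF N] by metis
  have "smooth_on (map_prod c d ` (S \<inter> UNIV \<inter> (U \<times> V) \<inter> fst -` U))
      (\<lambda>z. c (fst (inv_into (U \<times> V) (map_prod c d) z)))"
    by (rule smooth_on_cong[OF smooth_on_linear[OF linear_fst]])
      (auto simp: prod_chart_inv chartsD(5)[OF c(1)] chartsD(5)[OF d(1)])
  then show "\<exists>U c V d G. (U, c) \<in> charts (M \<times>\<^sub>M N) \<and> (V, d) \<in> charts M \<and> p \<in> U \<and> fst p \<in> V \<and>
      open G \<and> p \<in> G \<and> smooth_on (c ` (S \<inter> G \<inter> U \<inter> fst -` V)) (\<lambda>z. d (fst (inv_into U c z)))"
    using c d prod_chart[OF M N c(1) d(1)] open_UNIV UNIV_I mem_Times_iff by metis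
qed

lemma smooth_map_on_snd:
  assumes M: "smooth_manifold M" and N: "smooth_manifold N"
  shows "smooth_map_on (M \<times>\<^sub>M N) N S snd"
proof (rule smooth_map_onI[OF smooth_manifold_prod[OF M N] N continuous_on_snd[OF continuous_on_id]])
  fix p :: "'a \<times> 'c" assume "p \<in> S"
  obtain U c where c: "(U, c) \<in> charts M" "fst p \<in> U" using charts_cover[OF M] by metis
  obtain V d where d: "(V, d) \<in> charts N" "snd p \<in> V" using charts_cover[OF N] by metis
  have "smooth_on (map_prod c d ` (S \<inter> UNIV \<inter> (U \<times> V) \<inter> snd -` V))
      (\<lambda>z. d (snd (inv_into (U \<times> V) (map_prod c d) z)))"
    by (rule smooth_on_cong[OF smooth_on_linear[OF linear_snd]])
      (auto simp: prod_chart_inv chartsD(5)[OF c(1)] chartsD(5)[OF d(1)])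
  then show "\<exists>U c V d G. (U, c) \<in> charts (M \<times>\<^sub>M N) \<and> (V, d) \<in> charts N \<and> p \<in> U \<and> snd p \<in> V \<and>
      open G \<and> p \<in> G \<and> smooth_on (c ` (S \<inter> G \<inter> U \<inter> snd -` V)) (\<lambda>z. d (snd (inv_into U c z)))"
    using c d prod_chart[OF M N c(1) d(1)] open_UNIV UNIV_I mem_Times_iff by metis
qed

lemma smooth_map_on_Pair:
  assumes P: "smooth_manifold P" and M: "smooth_manifold M" and N: "smooth_manifold N"
    and f: "smooth_map_on P M S f" and g: "smooth_map_on P N S g"
  shows "smooth_map_on P (M \<times>\<^sub>M N) S (\<lambda>x. (f x, g x))"
proof (rule smooth_map_onI[OF P smooth_manifold_prod[OF M N]])
  show "continuous_on S (\<lambda>x. (f x, g x))"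
    using f g by (intro continuous_on_Pair smooth_map_on_continuous)
  fix x assume "x \<in> S"
  obtain W e where e: "(W, e) \<in> charts P" "x \<in> W" using charts_cover[OF P] by metis
  obtain U c where c: "(U, c) \<in> charts M" "f x \<in> U" using charts_cover[OF M] by metis
  obtain V d where d: "(V, d) \<in> charts N" "g x \<in> V" using charts_cover[OF N] by metis
  let ?X = "S \<inter> UNIV \<inter> W \<inter> (\<lambda>x. (f x, g x)) -` (U \<times> V)"
  have "smooth_on (e ` ?X) (\<lambda>z. c (f (inv_into W e z)))" "smooth_on (e ` ?X) (\<lambda>z. d (g (inv_into W e z)))"
    by (rule smooth_on_subset[OF smooth_map_onD[OF f e(1) c(1)]], force)
       (rule smooth_on_subset[OF smooth_map_onD[OF g e(1) d(1)]], force)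
  from smooth_on_Pair[OF this]
  have "smooth_on (e ` ?X) (\<lambda>z. map_prod c d (f (inv_into W e z), g (inv_into W e z)))" by simp
  moreover have "(f x, g x) \<in> U \<times> V" using c d by simp
  ultimately show "\<exists>U c V d G. (U, c) \<in> charts P \<and> (V, d) \<in> charts (M \<times>\<^sub>M N) \<and> x \<in> U \<and> (f x, g x) \<in> V \<and>
      open G \<and> x \<in> G \<and>
      smooth_on (c ` (S \<inter> G \<inter> U \<inter> (\<lambda>x. (f x, g x)) -` V)) (\<lambda>z. d (f (inv_into U c z), g (inv_into U c z)))"
    using e prod_chart[OF M N c(1) d(1)] open_UNIV UNIV_I by blast
qed

section \<open>Curves and tangent vectors\<close>

text \<open>The condition on curves inside \<open>tangent_space\<close>, named because tangent maps
  of locally defined maps are computed by composing curves with them.\<close>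

definition curve_in ::
  "('m::topological_space, 'e::euclidean_space) manifold \<Rightarrow> 'm set \<Rightarrow> 'm \<Rightarrow> (real \<Rightarrow> 'm) \<Rightarrow> bool" where
  "curve_in M L x \<gamma> \<longleftrightarrow> \<gamma> 0 = x \<and>
     (\<exists>\<epsilon>>0. \<gamma> ` {-\<epsilon><..<\<epsilon>} \<subseteq> L \<and> smooth_map_on real_line M {-\<epsilon><..<\<epsilon>} \<gamma>)"

lemma tangent_space_curves: "tangent_space M L x = {velocity M \<gamma> | \<gamma>. curve_in M L x \<gamma>}"
  by (simp add: tangent_space_def curve_in_def)

lemma tangent_space_mono: "L \<subseteq> L' \<Longrightarrow> tangent_space M L x \<subseteq> tangent_space M L' x"
  unfolding tangent_space_curves curve_in_def by blast

lemma curve_in_mono: "curve_in M L x \<gamma> \<Longrightarrow> L \<subseteq> L' \<Longrightarrow> curve_in M L' x \<gamma>"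
  unfolding curve_in_def by blast

lemma curve_inI:
  assumes "smooth_map_on euclid M T \<gamma>" "open T" "0 \<in> T" "\<gamma> 0 = x" "\<And>t. t \<in> T \<Longrightarrow> \<gamma> t \<in> L"
  shows "curve_in M L x \<gamma>"
proof -
  obtain \<epsilon> where e: "\<epsilon> > 0" "ball 0 \<epsilon> \<subseteq> T" using assms(2,3) open_contains_ball by blast
  have "{-\<epsilon><..<\<epsilon>} = ball 0 \<epsilon>" by (auto simp: dist_real_def)
  then have sub: "{-\<epsilon><..<\<epsilon>} \<subseteq> T" using e by simp
  then show ?thesis unfolding curve_in_def real_line_eq
    using e(1) assms(4,5) smooth_map_on_subset[OF assms(1) sub] by blast
qed

lemma curve_inE:
  assumes "curve_in M L x \<gamma>" "open G" "x \<in> G"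
  obtains T where "open T" "0 \<in> T" "smooth_map_on euclid M T \<gamma>" "\<gamma> ` T \<subseteq> L \<inter> G" "\<gamma> 0 = x"
proof -
  obtain \<epsilon> where e: "\<epsilon> > 0" "\<gamma> ` {-\<epsilon><..<\<epsilon>} \<subseteq> L" "smooth_map_on euclid M {-\<epsilon><..<\<epsilon>} \<gamma>" "\<gamma> 0 = x"
    using assms(1) unfolding curve_in_def real_line_eq by blast
  have "continuous_on {-\<epsilon><..<\<epsilon>} \<gamma>" using e(3) by (rule smooth_map_on_continuous)
  then have o: "open ({-\<epsilon><..<\<epsilon>} \<inter> \<gamma> -` G)"
    using continuous_open_preimage[OF _ open_greaterThanLessThan assms(2)] by blast
  show ?thesis
    by (rule that[OF o _ smooth_map_on_subset[OF e(3)]]) (use e assms(3) in auto)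
qed

lemma curve_in_open:
  assumes "curve_in M L x \<gamma>" "open G" "x \<in> G" shows "curve_in M (L \<inter> G) x \<gamma>"
  using curve_inE[OF assms] curve_inI by (metis image_subset_iff)

lemma tangent_space_open:
  assumes "open G" "x \<in> G" "L \<inter> G = L' \<inter> G"
  shows "tangent_space M L x = tangent_space M L' x"
proof -
  have "curve_in M L x \<gamma> \<longleftrightarrow> curve_in M L' x \<gamma>" for \<gamma>
    using curve_in_open[OF _ assms(1,2)] curve_in_mono[OF _ Int_lower1] assms(3) by metis
  then show ?thesis by (simp add: tangent_space_curves)
qed

lemma curve_in_compose:
  assumes M: "smooth_manifold M" and N: "smooth_manifold N"
    and g: "curve_in M L x \<gamma>" and G: "open G" "x \<in> G" and f: "smooth_map_on M N (L \<inter> G) f"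
    and sub: "f ` (L \<inter> G) \<subseteq> L'"
  shows "curve_in N L' (f x) (\<lambda>t. f (\<gamma> t))"
proof -
  obtain T where T: "open T" "0 \<in> T" "smooth_map_on euclid M T \<gamma>" "\<gamma> ` T \<subseteq> L \<inter> G" "\<gamma> 0 = x"
    using curve_inE[OF g G] by metis
  show ?thesis
    by (rule curve_inI[OF smooth_map_on_compose[OF smooth_manifold_euclid M N T(3) f T(4)] T(1,2)])
      (use T sub in \<open>auto simp: image_subset_iff\<close>)
qed

lemma curve_in_Pair:
  assumes M: "smooth_manifold M" and N: "smooth_manifold N"
    and g: "curve_in M L x \<gamma>" and h: "curve_in N L' y \<delta>"
  shows "curve_in (M \<times>\<^sub>M N) (L \<times> L') (x, y) (\<lambda>t. (\<gamma> t, \<delta> t))"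
proof -
  obtain S where S: "open S" "0 \<in> S" "smooth_map_on euclid M S \<gamma>" "\<gamma> ` S \<subseteq> L \<inter> UNIV" "\<gamma> 0 = x"
    using curve_inE[OF g open_UNIV UNIV_I] by metis
  obtain T where T: "open T" "0 \<in> T" "smooth_map_on euclid N T \<delta>" "\<delta> ` T \<subseteq> L' \<inter> UNIV" "\<delta> 0 = y"
    using curve_inE[OF h open_UNIV UNIV_I] by metis
  have 1: "smooth_map_on euclid M (S \<inter> T) \<gamma>" by (rule smooth_map_on_subset[OF S(3)]) auto
  have 2: "smooth_map_on euclid N (S \<inter> T) \<delta>" by (rule smooth_map_on_subset[OF T(3)]) auto
  show ?thesis
    by (rule curve_inI[OF smooth_map_on_Pair[OF smooth_manifold_euclid M N 1 2], of "(x, y)"])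
      (use S T in auto)
qed

lemma smooth_map_curve_deriv:
  assumes M: "smooth_manifold M" and g: "curve_in M L x \<gamma>"
    and f: "smooth_map_on M euclid (L \<inter> G) f" and G: "open G" "x \<in> G"
  obtains u where "((\<lambda>t. f (\<gamma> t)) has_vector_derivative u) (at 0)"
proof -
  obtain T where T: "open T" "0 \<in> T" "smooth_map_on euclid M T \<gamma>" "\<gamma> ` T \<subseteq> L \<inter> G"
    using curve_inE[OF g G] by metis
  have "smooth_on T (\<lambda>t. f (\<gamma> t))"
    using smooth_map_on_compose[OF smooth_manifold_euclid M smooth_manifold_euclid T(3) f T(4)]
    by (simp add: smooth_map_on_euclid_iff)
  then obtain f' where f': "((\<lambda>t. f (\<gamma> t)) has_derivative f') (at 0 within T)"
    using T(2) by (rule smooth_on_has_derivative)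
  then have "((\<lambda>t. f (\<gamma> t)) has_derivative f') (at 0)" using at_within_open[OF T(2,1)] by simp
  moreover have "f' = (\<lambda>t. t *\<^sub>R f' 1)"
  proof
    fix t :: real
    have "f' (t *\<^sub>R 1) = t *\<^sub>R f' 1" using has_derivative_linear[OF f'] by (rule linear_scale)
    then show "f' t = t *\<^sub>R f' 1" by simp
  qed
  ultimately show ?thesis using that[of "f' 1"] by (simp add: has_vector_derivative_def)
qed

lemma eventually_chart_line:
  assumes M: "smooth_manifold M" and c: "(U, c) \<in> charts M" and z: "z \<in> c ` (U \<inter> G)" and G: "open G"
    and u: "u \<in> model M"
  obtains T where "open T" "0 \<in> T" "\<And>t. t \<in> T \<Longrightarrow> z + t *\<^sub>R u \<in> c ` (U \<inter> G)"
proof -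
  obtain W where W: "open W" "c ` (U \<inter> G) = model M \<inter> W"
    using chart_image_open[OF c G] openin_open by blast
  have "open ((\<lambda>t. z + t *\<^sub>R u) -` W)" by (intro open_vimage W(1)) (auto intro!: continuous_intros)
  moreover have "0 \<in> (\<lambda>t. z + t *\<^sub>R u) -` W" using z W by auto
  moreover have "z + t *\<^sub>R u \<in> c ` (U \<inter> G)" if "t \<in> (\<lambda>t. z + t *\<^sub>R u) -` W" for t
    using that z W u subspace_model[OF M] by (auto simp: subspace_add subspace_scale)
  ultimately show ?thesis by (rule that)
qed

lemma smooth_on_line: "smooth_on S (\<lambda>t. z + t *\<^sub>R u)"
  by (intro smooth_on_add smooth_on_const smooth_on_linear) (simp add: bounded_linear.linear bounded_linear_scaleR_left)

lemma line_has_vector_derivative: "((\<lambda>t. z + t *\<^sub>R u) has_vector_derivative u) (at 0)"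
  by (auto intro!: derivative_eq_intros)

lemma curve_in_coord_line:
  assumes M: "smooth_manifold M" and c: "(U, c) \<in> charts M" and x: "x \<in> U" and u: "u \<in> model M"
    and sub: "\<And>z. z \<in> L' \<Longrightarrow> z \<in> c ` U \<Longrightarrow> inv_into U c z \<in> L" and line: "\<And>t. c x + t *\<^sub>R u \<in> L'"
  shows "curve_in M L x (\<lambda>t. inv_into U c (c x + t *\<^sub>R u))"
proof -
  obtain T where T: "open T" "0 \<in> T" "\<And>t. t \<in> T \<Longrightarrow> c x + t *\<^sub>R u \<in> c ` (U \<inter> UNIV)"
    using eventually_chart_line[OF M c _ open_UNIV u, of "c x"] x by blast
  have "smooth_map_on euclid M T (\<lambda>t. inv_into U c (c x + t *\<^sub>R u))"
    by (rule smooth_map_on_compose[OF smooth_manifold_euclid smooth_manifold_euclid M _ smooth_map_on_chart_inv[OF M c]])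
      (use T in \<open>auto simp: smooth_map_on_euclid_iff smooth_on_line\<close>)
  then show ?thesis
    by (rule curve_inI[OF _ T(1,2)]) (use T(3) sub line x in \<open>auto simp: chart_inv[OF c]\<close>)
qed

lemma coord_line_deriv:
  assumes M: "smooth_manifold M" and c: "(U, c) \<in> charts M" and x: "x \<in> U" and u: "u \<in> model M"
  shows "((\<lambda>t. c (inv_into U c (c x + t *\<^sub>R u))) has_vector_derivative u) (at 0)"
proof -
  obtain T where T: "open T" "0 \<in> T" "\<And>t. t \<in> T \<Longrightarrow> c x + t *\<^sub>R u \<in> c ` (U \<inter> UNIV)"
    using eventually_chart_line[OF M c _ open_UNIV u, of "c x"] x by blast
  show ?thesis
    by (rule has_vector_derivative_transform_within_open[OF line_has_vector_derivative T(1,2)])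
      (use T(3) in \<open>auto simp: f_inv_into_f\<close>)
qed

section \<open>Velocities in coordinates\<close>

lemma velocity_nonsmooth:
  assumes "\<gamma> 0 = x" "\<not> (\<exists>W. open W \<and> x \<in> W \<and> smooth_map_on M real_line W f)"
  shows "velocity M \<gamma> f = 0"
  unfolding velocity_def assms(1) by (rule if_not_P[OF assms(2)])

text \<open>\<open>D\<close> is the differential of \<open>f\<close> in the chart. It depends on
  \<open>f\<close> but not on the curve, which is why a velocity depends only, and linearly, on its
  coordinates \<open>u\<close>.\<close>

lemma velocity_apply:
  assumes M: "smooth_manifold M" and c: "(U, c) \<in> charts M" and x: "x \<in> U"
    and W: "open W" "x \<in> W" "smooth_map_on M real_line W f"
  obtains D where "linear D" "\<And>\<gamma> u. \<gamma> 0 = x \<Longrightarrow> \<forall>\<^sub>F t in nhds 0. \<gamma> t \<in> U \<Longrightarrow>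
    ((\<lambda>t. c (\<gamma> t)) has_vector_derivative u) (at 0) \<Longrightarrow> velocity M \<gamma> f = D u"
proof -
  let ?g = "\<lambda>z. f (inv_into U c z)"
  have "smooth_map_on euclid euclid (c ` (U \<inter> W)) ?g"
    by (rule smooth_map_on_compose[OF smooth_manifold_euclid M smooth_manifold_euclid
          smooth_map_on_subset[OF smooth_map_on_chart_inv[OF M c]] W(3)[unfolded real_line_eq]])
      (auto simp: chart_inv[OF c])
  then have "smooth_on (c ` (U \<inter> W)) ?g" by (simp add: smooth_map_on_euclid_iff)
  then obtain D where "(?g has_derivative D) (at (c x) within c ` (U \<inter> W))"
    by (rule smooth_on_has_derivative[of _ _ "c x"]) (use x W in auto)
  then have D: "(?g has_derivative D) (at (c x) within model M)"
    using at_within_openin[OF chart_image_open[OF c W(1)], of "c x"] x W(2) by auto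
  show ?thesis
  proof (rule that[OF has_derivative_linear[OF D]])
    fix \<gamma> u assume 0: "\<gamma> 0 = x" and ev: "\<forall>\<^sub>F t in nhds 0. \<gamma> t \<in> U"
      and d: "((\<lambda>t. c (\<gamma> t)) has_vector_derivative u) (at 0)"
    obtain T where T: "open T" "0 \<in> T" "\<And>t. t \<in> T \<Longrightarrow> \<gamma> t \<in> U" using ev unfolding eventually_nhds by blast
    have 1: "((\<lambda>t. c (\<gamma> t)) has_derivative (\<lambda>t. t *\<^sub>R u)) (at 0 within T)"
      using d unfolding has_vector_derivative_def by (rule has_derivative_at_withinI)
    have 2: "(?g has_derivative D) (at (c (\<gamma> 0)) within (\<lambda>t. c (\<gamma> t)) ` T)"
      unfolding 0 by (rule has_derivative_subset[OF D]) (use T(3) chart_in_model[OF c] in auto)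
    have "((\<lambda>t. ?g (c (\<gamma> t))) has_derivative (\<lambda>t. D (t *\<^sub>R u))) (at 0 within T)"
      using diff_chain_within[OF 1 2] by (simp add: o_def)
    then have "((\<lambda>t. ?g (c (\<gamma> t))) has_derivative (\<lambda>t. D (t *\<^sub>R u))) (at 0)"
      using at_within_open[OF T(2,1)] by simp
    then have "((\<lambda>t. f (\<gamma> t)) has_derivative (\<lambda>t. D (t *\<^sub>R u))) (at 0)"
      by (rule has_derivative_transform_within_open[OF _ T(1,2)]) (simp add: T(3) chart_inv[OF c])
    moreover have "(\<lambda>t. D (t *\<^sub>R u)) = (*) (D u)"
      using linear_scale[OF has_derivative_linear[OF D]] by (auto simp: mult.commute)
    ultimately have "((\<lambda>t. f (\<gamma> t)) has_field_derivative D u) (at 0)"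
      by (simp add: has_field_derivative_def)
    then show "velocity M \<gamma> f = D u"
      unfolding velocity_def using W 0 DERIV_imp_deriv by auto
  qed
qed

text \<open>On functions smooth near \<open>x\<close> the two functionals agree through the common
  differential \<open>D\<close>; on all other functions both are 0 by convention.\<close>

lemma velocity_eq_coord:
  assumes M: "smooth_manifold M" and c: "(U, c) \<in> charts M" and x: "x \<in> U"
    and 0: "\<gamma> 0 = x" and ev: "\<forall>\<^sub>F t in nhds 0. \<gamma> t \<in> U"
    and d: "((\<lambda>t. c (\<gamma> t)) has_vector_derivative u) (at 0)"
  shows "velocity M \<gamma> = coord_vector M (U, c) (c x) u" "u \<in> model M"
proof -
  have "\<forall>\<^sub>F t in nhds 0. c (\<gamma> t) \<in> model M"
    using ev by (rule eventually_mono) (rule chart_in_model[OF c])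
  then show u: "u \<in> model M" by (rule has_vector_derivative_in_subspace[OF d subspace_model[OF M]])
  let ?l = "\<lambda>t. inv_into U c (c x + t *\<^sub>R u)"
  have l0: "?l 0 = x" using x by (simp add: chart_inv[OF c])
  obtain T where T: "open T" "0 \<in> T" "\<And>t. t \<in> T \<Longrightarrow> c x + t *\<^sub>R u \<in> c ` (U \<inter> UNIV)"
    using eventually_chart_line[OF M c _ open_UNIV u, of "c x"] x by blast
  have lev: "\<forall>\<^sub>F t in nhds 0. ?l t \<in> U"
    unfolding eventually_nhds using T by (metis Int_UNIV_right inv_into_into)
  show "velocity M \<gamma> = coord_vector M (U, c) (c x) u"
  proof
    fix f
    show "velocity M \<gamma> f = coord_vector M (U, c) (c x) u f"
    proof (cases "\<exists>W. open W \<and> x \<in> W \<and> smooth_map_on M real_line W f")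
      case True
      then obtain W where "open W" "x \<in> W" "smooth_map_on M real_line W f" by blast
      from velocity_apply[OF M c x this] obtain D where
        D: "\<And>\<gamma> u. \<gamma> 0 = x \<Longrightarrow> \<forall>\<^sub>F t in nhds 0. \<gamma> t \<in> U \<Longrightarrow>
          ((\<lambda>t. c (\<gamma> t)) has_vector_derivative u) (at 0) \<Longrightarrow> velocity M \<gamma> f = D u" by metis
      show ?thesis unfolding coord_vector_def fst_conv snd_conv
        using D[OF 0 ev d] D[OF l0 lev coord_line_deriv[OF M c x u]] by simp
    next
      case False
      then show ?thesis unfolding coord_vector_def fst_conv snd_conv
        using velocity_nonsmooth[of \<gamma> x M f, OF 0 False] velocity_nonsmooth[of ?l x M f, OF l0 False] by simp
    qed
  qed
qed

lemma curve_velocity: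
  assumes M: "smooth_manifold M" and c: "(U, c) \<in> charts M" and x: "x \<in> U" and g: "curve_in M L x \<gamma>"
  obtains u where "u \<in> model M" "((\<lambda>t. c (\<gamma> t)) has_vector_derivative u) (at 0)"
    "velocity M \<gamma> = coord_vector M (U, c) (c x) u"
proof -
  have U: "open U" using c by (rule chartsD)
  obtain u where u: "((\<lambda>t. c (\<gamma> t)) has_vector_derivative u) (at 0)"
    using smooth_map_curve_deriv[OF M g smooth_map_on_subset[OF smooth_map_on_chart[OF M c]] U x] by blast
  obtain T where "open T" "0 \<in> T" "\<gamma> ` T \<subseteq> L \<inter> U" "\<gamma> 0 = x" using curve_inE[OF g U x] by metis
  then have "\<gamma> 0 = x" "\<forall>\<^sub>F t in nhds 0. \<gamma> t \<in> U" unfolding eventually_nhds by blast+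
  from velocity_eq_coord[OF M c x this u] u show ?thesis by (rule that[rotated 2])
qed

lemma coord_vector_linear:
  assumes M: "smooth_manifold M" and c: "(U, c) \<in> charts M" and x: "x \<in> U"
    and u: "u \<in> model M" and v: "v \<in> model M"
  shows "coord_vector M (U, c) (c x) (a *\<^sub>R u + v) =
    (\<lambda>f. a * coord_vector M (U, c) (c x) u f + coord_vector M (U, c) (c x) v f)"
proof
  fix f
  have lev: "\<forall>\<^sub>F t in nhds 0. inv_into U c (c x + t *\<^sub>R w) \<in> U" if w: "w \<in> model M" for w
  proof -
    obtain T where T: "open T" "0 \<in> T" "\<And>t. t \<in> T \<Longrightarrow> c x + t *\<^sub>R w \<in> c ` (U \<inter> UNIV)"
      using eventually_chart_line[OF M c _ open_UNIV w, of "c x"] x by blast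
    then show ?thesis unfolding eventually_nhds by (metis Int_UNIV_right inv_into_into)
  qed
  have l0: "inv_into U c (c x + 0 *\<^sub>R w) = x" for w using x by (simp add: chart_inv[OF c])
  have uv: "a *\<^sub>R u + v \<in> model M" using u v subspace_model[OF M] by (simp add: subspace_add subspace_scale)
  show "coord_vector M (U, c) (c x) (a *\<^sub>R u + v) f =
    a * coord_vector M (U, c) (c x) u f + coord_vector M (U, c) (c x) v f"
  proof (cases "\<exists>W. open W \<and> x \<in> W \<and> smooth_map_on M real_line W f")
    case True
    then obtain W where "open W" "x \<in> W" "smooth_map_on M real_line W f" by blast
    from velocity_apply[OF M c x this] obtain D where D: "linear D"
      "\<And>\<gamma> u. \<gamma> 0 = x \<Longrightarrow> \<forall>\<^sub>F t in nhds 0. \<gamma> t \<in> U \<Longrightarrow>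
        ((\<lambda>t. c (\<gamma> t)) has_vector_derivative u) (at 0) \<Longrightarrow> velocity M \<gamma> f = D u" by metis
    have "coord_vector M (U, c) (c x) w f = D w" if "w \<in> model M" for w
      unfolding coord_vector_def fst_conv snd_conv
      using D(2)[OF l0 lev[OF that] coord_line_deriv[OF M c x that]] .
    then show ?thesis using u v uv D(1) by (simp add: linear_add linear_scale)
  next
    case False
    have "coord_vector M (U, c) (c x) w f = 0" for w
      unfolding coord_vector_def fst_conv snd_conv by (rule velocity_nonsmooth[of _ x, OF _ False]) (rule l0)
    then show ?thesis by simp
  qed
qed

lemma coord_vector_0:
  assumes M: "smooth_manifold M" and c: "(U, c) \<in> charts M" and x: "x \<in> U"
  shows "coord_vector M (U, c) (c x) 0 = (\<lambda>f. 0)"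
proof -
  have 0: "0 \<in> model M" using subspace_model[OF M] by (rule subspace_0)
  have "coord_vector M (U, c) (c x) 0 f = 0" for f
    using fun_cong[OF coord_vector_linear[OF M c x 0 0, of 1], of f] by simp
  then show ?thesis by blast
qed

lemma smooth_map_on_inner_chart:
  assumes M: "smooth_manifold M" and c: "(U, c) \<in> charts M"
  shows "smooth_map_on M real_line U (\<lambda>x. c x \<bullet> b)"
  unfolding real_line_eq
proof (rule smooth_map_on_compose[OF M smooth_manifold_euclid smooth_manifold_euclid smooth_map_on_chart[OF M c]])
  show "smooth_map_on euclid euclid UNIV (\<lambda>z. z \<bullet> b)"
    unfolding smooth_map_on_euclid_iff by (rule smooth_on_linear) (simp add: bounded_linear.linear bounded_linear_inner_left)
qed auto

text \<open>The components of the chart serve as test functions that recover \<open>u\<close> from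
  the functional. They are smooth on \<open>U\<close> only, which suffices because tangent vectors
  are local.\<close>

lemma coord_vector_test:
  assumes M: "smooth_manifold M" and c: "(U, c) \<in> charts M" and x: "x \<in> U" and u: "u \<in> model M"
  shows "coord_vector M (U, c) (c x) u (\<lambda>x. c x \<bullet> b) = u \<bullet> b"
proof -
  have "((\<lambda>t. c (inv_into U c (c x + t *\<^sub>R u)) \<bullet> b) has_vector_derivative u \<bullet> b) (at 0)"
    using bounded_linear.has_vector_derivative[OF bounded_linear_inner_left coord_line_deriv[OF M c x u]] .
  then have "deriv (\<lambda>t. c (inv_into U c (c x + t *\<^sub>R u)) \<bullet> b) 0 = u \<bullet> b"
    by (simp add: DERIV_imp_deriv has_real_derivative_iff_has_vector_derivative)
  moreover have "inv_into U c (c x + 0 *\<^sub>R u) = x" using x by (simp add: chart_inv[OF c])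
  ultimately show ?thesis
    unfolding coord_vector_def velocity_def fst_conv snd_conv
    using smooth_map_on_inner_chart[OF M c, of b] chartsD(1)[OF c] x by auto
qed

lemma coord_vector_inj:
  assumes M: "smooth_manifold M" and c: "(U, c) \<in> charts M" and x: "x \<in> U"
    and u: "u \<in> model M" and v: "v \<in> model M"
    and eq: "coord_vector M (U, c) (c x) u = coord_vector M (U, c) (c x) v"
  shows "u = v"
proof -
  have "u \<bullet> b = v \<bullet> b" for b
    using coord_vector_test[OF M c x u] coord_vector_test[OF M c x v] eq by metis
  then show ?thesis by (metis vector_eq_rdot)
qed

lemma coord_vector_tangent:
  assumes M: "smooth_manifold M" and c: "(U, c) \<in> charts M" and x: "x \<in> U" and u: "u \<in> model M"
  shows "coord_vector M (U, c) (c x) u \<in> tangent_space M UNIV x"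
  unfolding tangent_space_curves coord_vector_def fst_conv snd_conv
  using curve_in_coord_line[OF M c x u, of UNIV UNIV] by auto

lemma tangent_space_coord:
  assumes M: "smooth_manifold M" and c: "(U, c) \<in> charts M" and x: "x \<in> U"
  shows "tangent_space M UNIV x = coord_vector M (U, c) (c x) ` model M"
proof (intro subset_antisym subsetI)
  fix u assume "u \<in> tangent_space M UNIV x"
  then obtain \<gamma> where "curve_in M UNIV x \<gamma>" "u = velocity M \<gamma>" unfolding tangent_space_curves by blast
  then show "u \<in> coord_vector M (U, c) (c x) ` model M"
    using curve_velocity[OF M c x] by (metis image_eqI)
qed (use coord_vector_tangent[OF M c x] in auto)

text \<open>Through this identification tangent spaces of submanifolds become linear subspaces of
  the model, so that their dimensions can be counted.\<close>

lemma tangent_space_slice: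
  assumes M: "smooth_manifold M" and c: "(U, c) \<in> charts M" and x: "x \<in> U" "x \<in> L"
    and F: "subspace F" "F \<subseteq> model M" and sl: "c ` (U \<inter> L) = c ` U \<inter> F"
  shows "tangent_space M L x = coord_vector M (U, c) (c x) ` F"
proof (intro subset_antisym subsetI)
  fix u assume "u \<in> tangent_space M L x"
  then obtain \<gamma> where g: "curve_in M L x \<gamma>" "u = velocity M \<gamma>" unfolding tangent_space_curves by blast
  obtain v where v: "((\<lambda>t. c (\<gamma> t)) has_vector_derivative v) (at 0)" "velocity M \<gamma> = coord_vector M (U, c) (c x) v"
    using curve_velocity[OF M c x(1) g(1)] by metis
  obtain T where "open T" "0 \<in> T" "\<gamma> ` T \<subseteq> L \<inter> U" using curve_inE[OF g(1) chartsD(1)[OF c] x(1)] by metis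
  then have "\<forall>\<^sub>F t in nhds 0. c (\<gamma> t) \<in> F" unfolding eventually_nhds using sl by blast
  then have "v \<in> F" by (rule has_vector_derivative_in_subspace[OF v(1) F(1)])
  then show "u \<in> coord_vector M (U, c) (c x) ` F" using v g by auto
next
  fix u assume "u \<in> coord_vector M (U, c) (c x) ` F"
  then obtain v where v: "v \<in> F" "u = coord_vector M (U, c) (c x) v" by auto
  have "c x \<in> F" using sl x by blast
  then have "c x + t *\<^sub>R v \<in> F" for t using F(1) v(1) by (simp add: subspace_add subspace_scale)
  moreover have "inv_into U c z \<in> L" if "z \<in> F" "z \<in> c ` U" for z
  proof -
    have "z \<in> c ` (U \<inter> L)" using that sl by blast
    then show ?thesis using chart_inv[OF c] by auto
  qed
  ultimately have "curve_in M L x (\<lambda>t. inv_into U c (c x + t *\<^sub>R v))"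
    using F(2) v(1) by (intro curve_in_coord_line[OF M c x(1), where L' = F]) auto
  then show "u \<in> tangent_space M L x"
    unfolding tangent_space_curves v(2) coord_vector_def by auto
qed

text \<open>The point is the default value 0: \<open>g\<close> has to be smooth near
  \<open>x\<close> exactly when \<open>g \<circ> fst\<close> is smooth near
  \<open>(x, y)\<close>.\<close>

lemma pushforward_fst_velocity:
  assumes M: "smooth_manifold M" and N: "smooth_manifold N"
  shows "pushforward fst (velocity (M \<times>\<^sub>M N) \<gamma>) = velocity M (\<lambda>t. fst (\<gamma> t))"
proof
  fix g
  note P = smooth_manifold_prod[OF M N]
  obtain x y where xy: "\<gamma> 0 = (x, y)" by fastforce
  have "(\<exists>W. open W \<and> (x, y) \<in> W \<and> smooth_map_on (M \<times>\<^sub>M N) real_line W (g \<circ> fst)) \<longleftrightarrow>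
    (\<exists>W. open W \<and> x \<in> W \<and> smooth_map_on M real_line W g)"
  proof safe
    fix W assume W: "open W" "(x, y) \<in> W" "smooth_map_on (M \<times>\<^sub>M N) real_line W (g \<circ> fst)"
    \<comment> \<open>Restriction to the slice through \<open>y\<close> recovers \<open>g\<close>
      from \<open>g \<circ> fst\<close>.\<close>
    have s: "smooth_map_on M (M \<times>\<^sub>M N) UNIV (\<lambda>x. (x, y))"
      by (intro smooth_map_on_Pair[OF M M N] smooth_map_on_id smooth_map_on_const M N)
    have "open ((\<lambda>x. (x, y)) -` W)" by (intro open_vimage W(1)) (auto intro!: continuous_intros)
    moreover have "smooth_map_on M real_line ((\<lambda>x. (x, y)) -` W) (\<lambda>x. (g \<circ> fst) (x, y))"
      unfolding real_line_eq
      by (rule smooth_map_on_compose[OF M P smooth_manifold_euclid smooth_map_on_subset[OF s] W(3)[unfolded real_line_eq]]) auto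
    ultimately show "\<exists>W. open W \<and> x \<in> W \<and> smooth_map_on M real_line W g"
      using W(2) by (intro exI[of _ "(\<lambda>x. (x, y)) -` W"]) simp
  next
    fix W assume W: "open W" "x \<in> W" "smooth_map_on M real_line W g"
    have "smooth_map_on (M \<times>\<^sub>M N) real_line (fst -` W) (\<lambda>p. g (fst p))"
      unfolding real_line_eq
      by (rule smooth_map_on_compose[OF P M smooth_manifold_euclid smooth_map_on_fst[OF M N] W(3)[unfolded real_line_eq]]) auto
    then show "\<exists>W. open W \<and> (x, y) \<in> W \<and> smooth_map_on (M \<times>\<^sub>M N) real_line W (g \<circ> fst)"
      using open_vimage_fst[OF W(1)] W(2) by (auto simp: o_def)
  qed
  then show "pushforward fst (velocity (M \<times>\<^sub>M N) \<gamma>) g = velocity M (\<lambda>t. fst (\<gamma> t)) g"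
    unfolding pushforward_def velocity_def xy fst_conv snd_conv by (simp only: o_def)
qed

lemma pushforward_snd_velocity:
  assumes M: "smooth_manifold M" and N: "smooth_manifold N"
  shows "pushforward snd (velocity (M \<times>\<^sub>M N) \<gamma>) = velocity N (\<lambda>t. snd (\<gamma> t))"
proof
  fix g
  note P = smooth_manifold_prod[OF M N]
  obtain x y where xy: "\<gamma> 0 = (x, y)" by fastforce
  have "(\<exists>W. open W \<and> (x, y) \<in> W \<and> smooth_map_on (M \<times>\<^sub>M N) real_line W (g \<circ> snd)) \<longleftrightarrow>
    (\<exists>W. open W \<and> y \<in> W \<and> smooth_map_on N real_line W g)"
  proof safe
    fix W assume W: "open W" "(x, y) \<in> W" "smooth_map_on (M \<times>\<^sub>M N) real_line W (g \<circ> snd)"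
    have s: "smooth_map_on N (M \<times>\<^sub>M N) UNIV (\<lambda>y. (x, y))"
      by (intro smooth_map_on_Pair[OF N M N] smooth_map_on_id smooth_map_on_const M N)
    have "open ((\<lambda>y. (x, y)) -` W)" by (intro open_vimage W(1)) (auto intro!: continuous_intros)
    moreover have "smooth_map_on N real_line ((\<lambda>y. (x, y)) -` W) (\<lambda>y. (g \<circ> snd) (x, y))"
      unfolding real_line_eq
      by (rule smooth_map_on_compose[OF N P smooth_manifold_euclid smooth_map_on_subset[OF s] W(3)[unfolded real_line_eq]]) auto
    ultimately show "\<exists>W. open W \<and> y \<in> W \<and> smooth_map_on N real_line W g" using W(2) by auto
  next
    fix W assume W: "open W" "y \<in> W" "smooth_map_on N real_line W g"
    have "smooth_map_on (M \<times>\<^sub>M N) real_line (snd -` W) (\<lambda>p. g (snd p))"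
      unfolding real_line_eq
      by (rule smooth_map_on_compose[OF P N smooth_manifold_euclid smooth_map_on_snd[OF M N] W(3)[unfolded real_line_eq]]) auto
    then show "\<exists>W. open W \<and> (x, y) \<in> W \<and> smooth_map_on (M \<times>\<^sub>M N) real_line W (g \<circ> snd)"
      using open_vimage_snd[OF W(1)] W(2) by (auto simp: o_def)
  qed
  then show "pushforward snd (velocity (M \<times>\<^sub>M N) \<gamma>) g = velocity N (\<lambda>t. snd (\<gamma> t)) g"
    unfolding pushforward_def velocity_def xy fst_conv snd_conv by (simp only: o_def)
qed

section \<open>Lagrangian subspaces and dimension\<close>

text \<open>On \<open>E\<close> the form can be written as \<open>J u \<bullet> v\<close> with a
  linear map \<open>J\<close>. Nondegeneracy makes \<open>J\<close> a bijection of \<open>E\<close>,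
  and it carries the complement with respect to \<open>W\<close> to the Euclidean orthogonal
  complement of \<open>S\<close>.\<close>

lemma form_complement_dim:
  fixes W :: "'e::euclidean_space \<Rightarrow> 'e \<Rightarrow> real"
  assumes E: "subspace E" and S: "subspace S" "S \<subseteq> E"
    and lin: "\<And>a u v w. u \<in> E \<Longrightarrow> v \<in> E \<Longrightarrow> w \<in> E \<Longrightarrow> W (a *\<^sub>R u + v) w = a * W u w + W v w"
    and anti: "\<And>u v. u \<in> E \<Longrightarrow> v \<in> E \<Longrightarrow> W u v = - W v u"
    and nondeg: "\<And>u. u \<in> E \<Longrightarrow> (\<And>v. v \<in> E \<Longrightarrow> W u v = 0) \<Longrightarrow> u = 0"
  shows "subspace {u \<in> E. \<forall>v\<in>S. W u v = 0}" "dim {u \<in> E. \<forall>v\<in>S. W u v = 0} + dim S = dim E"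
proof -
  have 0: "0 \<in> E" using E by (rule subspace_0)
  have W0: "W 0 w = 0" if "w \<in> E" for w using lin[OF 0 0 that, of 1] by simp
  have add: "W (u + v) w = W u w + W v w" if "u \<in> E" "v \<in> E" "w \<in> E" for u v w
    using lin[OF that, of 1] by simp
  have scale: "W (a *\<^sub>R u) w = a * W u w" if "u \<in> E" "w \<in> E" for a u w
    using lin[OF that(1) 0 that(2), of a] W0[OF that(2)] by simp
  let ?K = "{u \<in> E. \<forall>v\<in>S. W u v = 0}"
  show K: "subspace ?K"
    unfolding subspace_def using S(2) E W0 add scale by (auto simp: subspace_add subspace_scale subspace_0 subset_iff)
  obtain B where B: "B \<subseteq> E" "pairwise orthogonal B" "\<And>x. x \<in> B \<Longrightarrow> norm x = 1" "independent B" "span B = E"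
    using orthonormal_basis_subspace[OF E] by metis
  have fB: "finite B" using B(4) by (rule independent_imp_finite)
  obtain p where p: "linear p" "\<And>x. p x \<in> E" "\<And>x. x \<in> E \<Longrightarrow> p x = x" using linear_projection[OF E] by metis
  define J where "J u = (\<Sum>b\<in>B. W (p u) b *\<^sub>R b)" for u
  have J: "linear J"
    by (rule linearI) (use p B(1) in \<open>auto simp: J_def linear_add linear_scale add scale subset_iff
      sum.distrib scaleR_left_distrib scaleR_sum_right\<close>)
  have JE: "J u \<in> E" for u unfolding J_def using B(1) E by (auto intro!: subspace_sum subspace_scale)
  have JW: "J u \<bullet> v = W u v" if u: "u \<in> E" and v: "v \<in> E" for u v
  proof -
    have "\<forall>v\<in>E. J u \<bullet> v = W u v"
    proof -
      \<comment> \<open>Linearity of \<open>W\<close> in the second argument comes only from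
        antisymmetry and only inside \<open>E\<close>, so membership in \<open>E\<close> is carried
        through the induction.\<close>
      have "v \<in> span B \<Longrightarrow> v \<in> E \<and> J u \<bullet> v = W u v" for v
      proof (induction rule: span_induct_alt)
        case base
        show ?case using 0 anti[OF u 0] W0[OF u] by simp
      next
        case (step c x y)
        have "J u \<bullet> x = (\<Sum>b\<in>B. W u b * (b \<bullet> x))" by (simp add: J_def inner_sum_left p(3) u)
        also have "\<dots> = (\<Sum>b\<in>B. if b = x then W u b else 0)"
        proof (rule sum.cong[OF refl])
          fix b assume b: "b \<in> B"
          show "W u b * (b \<bullet> x) = (if b = x then W u b else 0)"
          proof (cases "b = x")
            case True
            then show ?thesis using B(3)[OF b] by (simp add: norm_eq_1)
          next
            case False
            then show ?thesis using B(2) b step(1) by (auto simp: pairwise_def orthogonal_def)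
          qed
        qed
        also have "\<dots> = W u x" using step(1) fB by simp
        finally have x: "J u \<bullet> x = W u x" .
        have xE: "x \<in> E" "c *\<^sub>R x \<in> E" using step(1) B(1) E by (auto simp: subspace_scale)
        have yE: "y \<in> E" "J u \<bullet> y = W u y" using step(2) by auto
        have "W u (c *\<^sub>R x + y) = - (c * W x u + W y u)"
          using anti[OF u, of "c *\<^sub>R x + y"] lin[OF xE(1) yE(1) u, of c] xE yE E by (simp add: subspace_add)
        also have "\<dots> = c * W u x + W u y" using anti[OF u xE(1)] anti[OF u yE(1)] by (simp add: algebra_simps)
        finally show ?case using x yE xE E by (simp add: inner_add_right subspace_add)
      qed
      then show ?thesis using B(5) by blast
    qed
    then show ?thesis using v by blast
  qed
  have inj: "inj_on J E"
  proof (rule linear_inj_on_iff_eq_0[OF J E, THEN iffD2], intro ballI impI)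
    fix u assume "u \<in> E" "J u = 0"
    then show "u = 0" using nondeg JW by (metis inner_zero_left)
  qed
  have "J ` E = E"
  proof (rule subspace_dim_equal[OF linear_subspace_image[OF J E] E])
    show "J ` E \<subseteq> E" using JE by auto
    show "dim E \<le> dim (J ` E)" using dim_image_eq[OF J, of E] inj span_eq_iff[THEN iffD2, OF E] by simp
  qed
  then have im: "J ` ?K = {y \<in> E. \<forall>x\<in>S. orthogonal x y}"
    using JW S(2) by (auto simp: orthogonal_def inner_commute image_iff subset_iff, metis (no_types, lifting) imageE)
  have "dim (J ` ?K) = dim ?K"
    using K by (intro dim_image_eq[OF J] inj_on_subset[OF inj]) (auto simp: span_eq_iff[THEN iffD2])
  then show "dim ?K + dim S = dim E"
    using dim_subspace_orthogonal_to_vectors[OF S(1) E S(2)] im by simp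
qed

text \<open>The linear algebra of a symplectic form at one point, isolated so that it can be
  transferred to opposite and product forms point by point.\<close>

definition symplectic_at ::
  "('m::topological_space, 'e::euclidean_space) manifold \<Rightarrow> 'm two_form \<Rightarrow> 'm \<Rightarrow> bool" where
  "symplectic_at M \<omega> x \<longleftrightarrow>
     (\<forall>u\<in>tangent_space M UNIV x. \<forall>v\<in>tangent_space M UNIV x. \<forall>w\<in>tangent_space M UNIV x. \<forall>a.
        \<omega> x (\<lambda>f. a * u f + v f) w = a * \<omega> x u w + \<omega> x v w \<and> \<omega> x u v = - \<omega> x v u) \<and>
     (\<forall>u\<in>tangent_space M UNIV x. (\<forall>v\<in>tangent_space M UNIV x. \<omega> x u v = 0) \<longrightarrow> u = (\<lambda>f. 0))"

lemma symplectic_form_at: "symplectic_form M \<omega> \<Longrightarrow> symplectic_at M \<omega> x"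
  unfolding symplectic_form_def differential_two_form_def symplectic_at_def by blast

lemma zero_tangent:
  assumes M: "smooth_manifold M" shows "(\<lambda>f. 0) \<in> tangent_space M UNIV x"
proof -
  obtain U c where c: "(U, c) \<in> charts M" "x \<in> U" using charts_cover[OF M] by metis
  show ?thesis
    using coord_vector_tangent[OF M c, of 0] coord_vector_0[OF M c] subspace_0[OF subspace_model[OF M]] by simp
qed

lemma symplectic_at_0:
  assumes M: "smooth_manifold M" and w: "symplectic_at M \<omega> x" and v: "v \<in> tangent_space M UNIV x"
  shows "\<omega> x (\<lambda>f. 0) v = 0" "\<omega> x v (\<lambda>f. 0) = 0"
proof -
  note z = zero_tangent[OF M, of x]
  show "\<omega> x (\<lambda>f. 0) v = 0"
    using w[unfolded symplectic_at_def, THEN conjunct1, rule_format, OF z z v, of 1] by simp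
  moreover have "\<omega> x v (\<lambda>f. 0) = - \<omega> x (\<lambda>f. 0) v" using w z v unfolding symplectic_at_def by blast
  ultimately show "\<omega> x v (\<lambda>f. 0) = 0" by simp
qed

lemma symplectic_at_coord:
  assumes M: "smooth_manifold M" and w: "symplectic_at M \<omega> x" and c: "(U, c) \<in> charts M" and x: "x \<in> U"
  defines "W \<equiv> \<lambda>u v. \<omega> x (coord_vector M (U, c) (c x) u) (coord_vector M (U, c) (c x) v)"
  shows "\<And>a u v w. u \<in> model M \<Longrightarrow> v \<in> model M \<Longrightarrow> w \<in> model M \<Longrightarrow> W (a *\<^sub>R u + v) w = a * W u w + W v w"
    and "\<And>u v. u \<in> model M \<Longrightarrow> v \<in> model M \<Longrightarrow> W u v = - W v u"
    and "\<And>u. u \<in> model M \<Longrightarrow> (\<And>v. v \<in> model M \<Longrightarrow> W u v = 0) \<Longrightarrow> u = 0"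
proof -
  note t = coord_vector_tangent[OF M c x]
  show "W (a *\<^sub>R u + v) w = a * W u w + W v w" if "u \<in> model M" "v \<in> model M" "w \<in> model M" for a u v w
    unfolding W_def coord_vector_linear[OF M c x that(1,2)]
    using assms(2) t[OF that(1)] t[OF that(2)] t[OF that(3)] unfolding symplectic_at_def by blast
  show "W u v = - W v u" if "u \<in> model M" "v \<in> model M" for u v
    unfolding W_def using assms(2) t[OF that(1)] t[OF that(2)] unfolding symplectic_at_def by blast
  show "u = 0" if u: "u \<in> model M" and z: "\<And>v. v \<in> model M \<Longrightarrow> W u v = 0" for u
  proof -
    have "\<forall>v\<in>tangent_space M UNIV x. \<omega> x (coord_vector M (U, c) (c x) u) v = 0"
      unfolding tangent_space_coord[OF M c x] using z by (auto simp: W_def)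
    then have "coord_vector M (U, c) (c x) u = (\<lambda>f. 0)"
      using w t[OF u] unfolding symplectic_at_def by blast
    then show ?thesis
      using coord_vector_inj[OF M c x u subspace_0[OF subspace_model[OF M]]] coord_vector_0[OF M c x] by simp
  qed
qed

text \<open>In coordinates \<open>F\<close> equals its own complement under the form, so the
  dimension formula counts \<open>F\<close> twice.\<close>

lemma lagrangian_subspace_dim:
  assumes M: "smooth_manifold M" and w: "symplectic_at M \<omega> x" and c: "(U, c) \<in> charts M" and x: "x \<in> U"
    and F: "subspace F" "F \<subseteq> model M" and l: "lagrangian_subspace M \<omega> x (coord_vector M (U, c) (c x) ` F)"
  shows "2 * dim F = dim (model M)"
proof -
  let ?W = "\<lambda>u v. \<omega> x (coord_vector M (U, c) (c x) u) (coord_vector M (U, c) (c x) v)"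
  let ?k = "coord_vector M (U, c) (c x)"
  have l': "?k ` F = {u \<in> ?k ` model M. \<forall>v\<in>?k ` F. \<omega> x u v = 0}"
    using l unfolding lagrangian_subspace_def tangent_space_coord[OF M c x] .
  have "F = {u \<in> model M. \<forall>v\<in>F. ?W u v = 0}"
  proof (intro subset_antisym subsetI)
    fix u assume u: "u \<in> F"
    then have "?k u \<in> {u \<in> ?k ` model M. \<forall>v\<in>?k ` F. \<omega> x u v = 0}" using l' by blast
    then show "u \<in> {u \<in> model M. \<forall>v\<in>F. ?W u v = 0}" using u F by auto
  next
    fix u assume u: "u \<in> {u \<in> model M. \<forall>v\<in>F. ?W u v = 0}"
    then have "?k u \<in> ?k ` F" using l' by blast
    then obtain v where "v \<in> F" "?k u = ?k v" by blast
    then show "u \<in> F" using u F coord_vector_inj[OF M c x] by blast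
  qed
  moreover have "dim {u \<in> model M. \<forall>v\<in>F. ?W u v = 0} + dim F = dim (model M)"
    using symplectic_at_coord[OF M w c x] by (intro form_complement_dim(2) subspace_model[OF M] F) blast+
  ultimately show ?thesis by simp
qed

text \<open>Isotropy puts \<open>F\<close> inside its complement, and both have half the dimension
  of the model.\<close>

lemma lagrangian_subspace_isotropic:
  assumes M: "smooth_manifold M" and w: "symplectic_at M \<omega> x" and c: "(U, c) \<in> charts M" and x: "x \<in> U"
    and F: "subspace F" "F \<subseteq> model M" and S: "S = coord_vector M (U, c) (c x) ` F"
    and iso: "\<And>u v. u \<in> S \<Longrightarrow> v \<in> S \<Longrightarrow> \<omega> x u v = 0" and d: "2 * dim F = dim (model M)"
  shows "lagrangian_subspace M \<omega> x S"
proof -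
  let ?k = "coord_vector M (U, c) (c x)"
  let ?W = "\<lambda>u v. \<omega> x (?k u) (?k v)"
  let ?K = "{u \<in> model M. \<forall>v\<in>F. ?W u v = 0}"
  have K: "subspace ?K" "dim ?K + dim F = dim (model M)"
    using symplectic_at_coord[OF M w c x]
    by (intro form_complement_dim[where W = ?W and E = "model M"] subspace_model[OF M] F; blast)+
  have "F = ?K"
    by (rule subspace_dim_equal[OF F(1) K(1)]) (use iso F S K(2) d in auto)
  then show ?thesis
    unfolding lagrangian_subspace_def tangent_space_coord[OF M c x] S by auto
qed

lemma pushforward_tangent:
  assumes M: "smooth_manifold M" and N: "smooth_manifold N"
    and u: "u \<in> tangent_space (M \<times>\<^sub>M N) L (x, y)"
  shows "pushforward fst u \<in> tangent_space M (fst ` L) x" "pushforward snd u \<in> tangent_space N (snd ` L) y"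
proof -
  note P = smooth_manifold_prod[OF M N]
  obtain \<gamma> where g: "curve_in (M \<times>\<^sub>M N) L (x, y) \<gamma>" "u = velocity (M \<times>\<^sub>M N) \<gamma>"
    using u unfolding tangent_space_curves by blast
  have "curve_in M (fst ` L) (fst (x, y)) (\<lambda>t. fst (\<gamma> t))"
    by (rule curve_in_compose[OF P M g(1) open_UNIV UNIV_I smooth_map_on_fst[OF M N]]) auto
  then show "pushforward fst u \<in> tangent_space M (fst ` L) x"
    unfolding g(2) pushforward_fst_velocity[OF M N] tangent_space_curves by auto
  have "curve_in N (snd ` L) (snd (x, y)) (\<lambda>t. snd (\<gamma> t))"
    by (rule curve_in_compose[OF P N g(1) open_UNIV UNIV_I smooth_map_on_snd[OF M N]]) auto
  then show "pushforward snd u \<in> tangent_space N (snd ` L) y"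
    unfolding g(2) pushforward_snd_velocity[OF M N] tangent_space_curves by auto
qed

lemma pushforward_tangent_UNIV:
  assumes M: "smooth_manifold M" and N: "smooth_manifold N"
    and u: "u \<in> tangent_space (M \<times>\<^sub>M N) UNIV (x, y)"
  shows "pushforward fst u \<in> tangent_space M UNIV x" "pushforward snd u \<in> tangent_space N UNIV y"
  using pushforward_tangent[OF M N u] tangent_space_mono[OF subset_UNIV] by blast+

lemma pushforward_coord:
  assumes M: "smooth_manifold M" and N: "smooth_manifold N" and c: "(U, c) \<in> charts M" and d: "(V, d) \<in> charts N"
    and x: "x \<in> U" "y \<in> V" and a: "a \<in> model M" "b \<in> model N"
  shows "pushforward fst (coord_vector (M \<times>\<^sub>M N) (U \<times> V, map_prod c d) (c x, d y) (a, b)) = coord_vector M (U, c) (c x) a"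
    and "pushforward snd (coord_vector (M \<times>\<^sub>M N) (U \<times> V, map_prod c d) (c x, d y) (a, b)) = coord_vector N (V, d) (d y) b"
proof -
  let ?l = "\<lambda>t. inv_into (U \<times> V) (map_prod c d) ((c x, d y) + t *\<^sub>R (a, b))"
  note P = smooth_manifold_prod[OF M N] and k = prod_chart[OF M N c d]
  have ab: "(a, b) \<in> model (M \<times>\<^sub>M N)" using a by (simp add: model_prod)
  have "(c x, d y) \<in> map_prod c d ` ((U \<times> V) \<inter> UNIV)" using x by force
  from eventually_chart_line[OF P k this open_UNIV ab]
  obtain T where T: "open T" "0 \<in> T" "\<And>t. t \<in> T \<Longrightarrow> (c x, d y) + t *\<^sub>R (a, b) \<in> map_prod c d ` ((U \<times> V) \<inter> UNIV)" by blast
  have l: "fst (?l t) \<in> U \<and> snd (?l t) \<in> V \<and> c (fst (?l t)) = c x + t *\<^sub>R a \<and> d (snd (?l t)) = d y + t *\<^sub>R b"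
    if t: "t \<in> T" for t
  proof -
    obtain x' y' where xy: "x' \<in> U" "y' \<in> V" "c x + t *\<^sub>R a = c x'" "d y + t *\<^sub>R b = d y'" using T(3)[OF t] by auto
    then show ?thesis using prod_chart_inv[OF chartsD(5)[OF c] chartsD(5)[OF d] xy(1,2)] by simp
  qed
  have l0: "?l 0 = (x, y)" using prod_chart_inv[OF chartsD(5)[OF c] chartsD(5)[OF d] x] by simp
  have 1: "\<forall>\<^sub>F t in nhds 0. fst (?l t) \<in> U" "\<forall>\<^sub>F t in nhds 0. snd (?l t) \<in> V"
    unfolding eventually_nhds using T l by blast+
  have 2: "((\<lambda>t. c (fst (?l t))) has_vector_derivative a) (at 0)"
    by (rule has_vector_derivative_transform_within_open[OF line_has_vector_derivative[of "c x"] T(1,2)]) (use l in auto)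
  have 3: "((\<lambda>t. d (snd (?l t))) has_vector_derivative b) (at 0)"
    by (rule has_vector_derivative_transform_within_open[OF line_has_vector_derivative[of "d y"] T(1,2)]) (use l in auto)
  show "pushforward fst (coord_vector (M \<times>\<^sub>M N) (U \<times> V, map_prod c d) (c x, d y) (a, b)) = coord_vector M (U, c) (c x) a"
    unfolding coord_vector_def[of "M \<times>\<^sub>M N"] fst_conv snd_conv pushforward_fst_velocity[OF M N]
    by (rule velocity_eq_coord(1)[OF M c x(1) _ 1(1) 2]) (simp only: l0 fst_conv)
  show "pushforward snd (coord_vector (M \<times>\<^sub>M N) (U \<times> V, map_prod c d) (c x, d y) (a, b)) = coord_vector N (V, d) (d y) b"
    unfolding coord_vector_def[of "M \<times>\<^sub>M N"] fst_conv snd_conv pushforward_snd_velocity[OF M N]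
    by (rule velocity_eq_coord(1)[OF N d x(2) _ 1(2) 3]) (simp only: l0 snd_conv)
qed

lemma tangent_prod_eqI:
  assumes M: "smooth_manifold M" and N: "smooth_manifold N"
    and u: "u \<in> tangent_space (M \<times>\<^sub>M N) UNIV (x, y)"
    and 1: "pushforward fst u = (\<lambda>f. 0)" and 2: "pushforward snd u = (\<lambda>f. 0)"
  shows "u = (\<lambda>f. 0)"
proof -
  obtain U c where c: "(U, c) \<in> charts M" "x \<in> U" using charts_cover[OF M] by metis
  obtain V d where d: "(V, d) \<in> charts N" "y \<in> V" using charts_cover[OF N] by metis
  note P = smooth_manifold_prod[OF M N] and k = prod_chart[OF M N c(1) d(1)]
  have xy: "(x, y) \<in> U \<times> V" using c d by simp
  obtain a b where ab: "a \<in> model M" "b \<in> model N" "u = coord_vector (M \<times>\<^sub>M N) (U \<times> V, map_prod c d) (c x, d y) (a, b)"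
    using u unfolding tangent_space_coord[OF P k xy] model_prod by auto
  note pc = pushforward_coord[OF M N c(1) d(1) c(2) d(2) ab(1,2)]
  have "a = 0"
    by (rule coord_vector_inj[OF M c ab(1) subspace_0[OF subspace_model[OF M]]])
      (use 1 ab(3) pc(1) coord_vector_0[OF M c] in simp)
  moreover have "b = 0"
    by (rule coord_vector_inj[OF N d ab(2) subspace_0[OF subspace_model[OF N]]])
      (use 2 ab(3) pc(2) coord_vector_0[OF N d] in simp)
  ultimately show ?thesis using ab(3) coord_vector_0[OF P k xy] by (simp add: zero_prod_def)
qed

lemma tangent_prod_ex:
  assumes M: "smooth_manifold M" and N: "smooth_manifold N"
    and u: "u \<in> tangent_space M UNIV x" and v: "v \<in> tangent_space N UNIV y"
  obtains w where "w \<in> tangent_space (M \<times>\<^sub>M N) UNIV (x, y)" "pushforward fst w = u" "pushforward snd w = v"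
proof -
  obtain \<gamma> where g: "curve_in M UNIV x \<gamma>" "u = velocity M \<gamma>" using u unfolding tangent_space_curves by blast
  obtain \<delta> where d: "curve_in N UNIV y \<delta>" "v = velocity N \<delta>" using v unfolding tangent_space_curves by blast
  have "curve_in (M \<times>\<^sub>M N) UNIV (x, y) (\<lambda>t. (\<gamma> t, \<delta> t))" using curve_in_Pair[OF M N g(1) d(1)] by simp
  then show ?thesis
    using that[of "velocity (M \<times>\<^sub>M N) (\<lambda>t. (\<gamma> t, \<delta> t))"] g(2) d(2)
    by (auto simp: tangent_space_curves pushforward_fst_velocity[OF M N] pushforward_snd_velocity[OF M N])
qed

lemma symplectic_at_opposite:
  assumes w: "symplectic_at M \<omega> x" shows "symplectic_at M (opposite_form \<omega>) x"
  unfolding symplectic_at_def opposite_form_def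
proof (intro conjI ballI allI impI)
  fix u v z a
  assume t: "u \<in> tangent_space M UNIV x" "v \<in> tangent_space M UNIV x"
  have "\<omega> x u v = - \<omega> x v u" using w t unfolding symplectic_at_def by blast
  then show "- \<omega> x u v = - (- \<omega> x v u)" by simp
  assume "z \<in> tangent_space M UNIV x"
  then have "\<omega> x (\<lambda>f. a * u f + v f) z = a * \<omega> x u z + \<omega> x v z"
    using w t unfolding symplectic_at_def by blast
  then show "- \<omega> x (\<lambda>f. a * u f + v f) z = a * - \<omega> x u z + - \<omega> x v z" by simp
next
  fix u assume "u \<in> tangent_space M UNIV x" "\<forall>v\<in>tangent_space M UNIV x. - \<omega> x u v = 0"
  then show "u = (\<lambda>f. 0)" using w unfolding symplectic_at_def by (simp only: neg_equal_0_iff_equal)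
qed

text \<open>For nondegeneracy each component is tested against tangent vectors of the product whose
  other component is zero.\<close>

lemma symplectic_at_prod:
  assumes M: "smooth_manifold M" and N: "smooth_manifold N"
    and w: "symplectic_at M \<omega> x" and w': "symplectic_at N \<omega>' y"
  shows "symplectic_at (M \<times>\<^sub>M N) (prod_form \<omega> \<omega>') (x, y)"
  unfolding symplectic_at_def
proof (intro conjI ballI allI impI)
  fix u v z a
  assume u: "u \<in> tangent_space (M \<times>\<^sub>M N) UNIV (x, y)" and v: "v \<in> tangent_space (M \<times>\<^sub>M N) UNIV (x, y)"
  note u' = pushforward_tangent_UNIV[OF M N u] and v' = pushforward_tangent_UNIV[OF M N v]
  have "\<omega> x (pushforward fst u) (pushforward fst v) = - \<omega> x (pushforward fst v) (pushforward fst u)"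
    "\<omega>' y (pushforward snd u) (pushforward snd v) = - \<omega>' y (pushforward snd v) (pushforward snd u)"
    using w w' u' v' unfolding symplectic_at_def by blast+
  then show "prod_form \<omega> \<omega>' (x, y) u v = - prod_form \<omega> \<omega>' (x, y) v u" by (simp add: prod_form_def)
  assume z: "z \<in> tangent_space (M \<times>\<^sub>M N) UNIV (x, y)"
  note z' = pushforward_tangent_UNIV[OF M N z]
  have lin: "pushforward fst (\<lambda>f. a * u f + v f) = (\<lambda>g. a * pushforward fst u g + pushforward fst v g)"
    "pushforward snd (\<lambda>f. a * u f + v f) = (\<lambda>g. a * pushforward snd u g + pushforward snd v g)"
    by (simp_all add: pushforward_def)
  have "\<omega> x (\<lambda>g. a * pushforward fst u g + pushforward fst v g) (pushforward fst z) =
      a * \<omega> x (pushforward fst u) (pushforward fst z) + \<omega> x (pushforward fst v) (pushforward fst z)"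
    using w u' v' z' unfolding symplectic_at_def by blast
  moreover have "\<omega>' y (\<lambda>g. a * pushforward snd u g + pushforward snd v g) (pushforward snd z) =
      a * \<omega>' y (pushforward snd u) (pushforward snd z) + \<omega>' y (pushforward snd v) (pushforward snd z)"
    using w' u' v' z' unfolding symplectic_at_def by blast
  ultimately show "prod_form \<omega> \<omega>' (x, y) (\<lambda>f. a * u f + v f) z =
      a * prod_form \<omega> \<omega>' (x, y) u z + prod_form \<omega> \<omega>' (x, y) v z"
    unfolding prod_form_def split lin by (simp only: ring_distribs)
next
  fix u assume u: "u \<in> tangent_space (M \<times>\<^sub>M N) UNIV (x, y)"
    and z: "\<forall>v\<in>tangent_space (M \<times>\<^sub>M N) UNIV (x, y). prod_form \<omega> \<omega>' (x, y) u v = 0"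
  note u' = pushforward_tangent_UNIV[OF M N u]
  have "pushforward fst u = (\<lambda>f. 0)"
  proof -
    have "\<omega> x (pushforward fst u) v = 0" if v: "v \<in> tangent_space M UNIV x" for v
    proof -
      obtain q where q: "q \<in> tangent_space (M \<times>\<^sub>M N) UNIV (x, y)" "pushforward fst q = v" "pushforward snd q = (\<lambda>f. 0)"
        using tangent_prod_ex[OF M N v zero_tangent[OF N]] by metis
      then show ?thesis using z symplectic_at_0(2)[OF N w' u'(2)] by (auto simp: prod_form_def)
    qed
    then show ?thesis using w u'(1) unfolding symplectic_at_def by blast
  qed
  moreover have "pushforward snd u = (\<lambda>f. 0)"
  proof -
    have "\<omega>' y (pushforward snd u) v = 0" if v: "v \<in> tangent_space N UNIV y" for v
    proof -
      obtain q where q: "q \<in> tangent_space (M \<times>\<^sub>M N) UNIV (x, y)" "pushforward fst q = (\<lambda>f. 0)" "pushforward snd q = v"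
        using tangent_prod_ex[OF M N zero_tangent[OF M] v] by metis
      then show ?thesis using z symplectic_at_0(2)[OF M w u'(1)] by (auto simp: prod_form_def)
    qed
    then show ?thesis using w' u'(2) unfolding symplectic_at_def by blast
  qed
  ultimately show "u = (\<lambda>f. 0)" by (rule tangent_prod_eqI[OF M N u])
qed

section \<open>Submanifolds\<close>

lemma submanifoldE:
  assumes "submanifold M L" "x \<in> L"
  obtains U c F where "(U, c) \<in> charts M" "x \<in> U" "subspace F" "F \<subseteq> model M" "c ` (U \<inter> L) = c ` U \<inter> F"
  using assms unfolding submanifold_def by blast

lemma submanifold_open:
  assumes L: "submanifold M L" and G: "open G" shows "submanifold M (L \<inter> G)"
  unfolding submanifold_def
proof
  fix x assume x: "x \<in> L \<inter> G"
  then obtain U c F where c: "(U, c) \<in> charts M" "x \<in> U" "subspace F" "F \<subseteq> model M" "c ` (U \<inter> L) = c ` U \<inter> F"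
    using submanifoldE[OF L] by blast
  have "c ` (U \<inter> G \<inter> (L \<inter> G)) = c ` (U \<inter> G) \<inter> F"
  proof (intro subset_antisym subsetI)
    fix z assume "z \<in> c ` (U \<inter> G) \<inter> F"
    then obtain y where y: "y \<in> U" "y \<in> G" "z = c y" "c y \<in> F" by blast
    then have "c y \<in> c ` (U \<inter> L)" using c(5) by blast
    then have "y \<in> L" using y inj_onD[OF chartsD(5)[OF c(1)]] by blast
    then show "z \<in> c ` (U \<inter> G \<inter> (L \<inter> G))" using y by blast
  qed (use c(5) in blast)
  moreover have "(U \<inter> G, c) \<in> charts M" using chart_restrict[OF c(1) G] .
  ultimately show "\<exists>(U, c)\<in>charts M. x \<in> U \<and> (\<exists>F. subspace F \<and> F \<subseteq> model M \<and> c ` (U \<inter> (L \<inter> G)) = c ` U \<inter> F)"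
    using c(2-4) x by blast
qed

lemma lagrangian_open:
  assumes L: "lagrangian M \<omega> L" and G: "open G" shows "lagrangian M \<omega> (L \<inter> G)"
proof -
  have "tangent_space M (L \<inter> G) x = tangent_space M L x" if "x \<in> L \<inter> G" for x
    using that by (intro tangent_space_open[OF G]) auto
  then show ?thesis using L submanifold_open[OF _ G] unfolding lagrangian_def by auto
qed

lemma slice_mem:
  assumes c: "(U, c) \<in> charts M" and sl: "c ` (U \<inter> L) = c ` U \<inter> F" and x: "x \<in> U"
  shows "x \<in> L \<longleftrightarrow> c x \<in> F"
proof
  assume "c x \<in> F"
  then have "c x \<in> c ` (U \<inter> L)" using sl x by blast
  then show "x \<in> L" using x inj_onD[OF chartsD(5)[OF c]] by blast
qed (use sl x in blast)

text \<open>Slices are linear subspaces, so a chart around \<open>x\<close> is translated to send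
  \<open>x\<close> to 0.\<close>

lemma submanifold_point:
  assumes M: "smooth_manifold M" shows "submanifold M {x}"
proof -
  obtain U c where c: "(U, c) \<in> charts M" "x \<in> U" using charts_cover[OF M] by metis
  let ?c = "\<lambda>y. c y - c x"
  have E: "subspace (model M)" using subspace_model[OF M] .
  have inj: "inj_on ?c U" using chartsD(5)[OF c(1)] by (auto simp: inj_on_def)
  have "(U, ?c) \<in> charts M"
  proof (rule chartI[OF M c(1) _ inj])
    obtain W where W: "open W" "c ` U = model M \<inter> W" using chartsD(2)[OF c(1)] openin_open by blast
    have "?c ` U = model M \<inter> (\<lambda>z. z + c x) -` W"
    proof (intro subset_antisym subsetI)
      fix z assume z: "z \<in> model M \<inter> (\<lambda>z. z + c x) -` W"
      then have "z + c x \<in> c ` U" using W(2) E chart_in_model[OF c] by (auto simp: subspace_add)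
      then show "z \<in> ?c ` U" by (force simp: algebra_simps)
    qed (use W E chart_in_model[OF c(1)] c(2) in \<open>auto simp: subspace_diff\<close>)
    moreover have "open ((\<lambda>z. z + c x) -` W)" by (intro open_vimage W(1)) (auto intro!: continuous_intros)
    ultimately show "openin (top_of_set (model M)) (?c ` U)" by auto
    show "smooth_on (c ` U) (\<lambda>z. c (inv_into U c z) - c x)"
      by (rule smooth_on_cong[OF smooth_on_diff[OF smooth_on_id smooth_on_const]]) (auto simp: chart_inv[OF c(1)])
    show "smooth_on (?c ` U) (\<lambda>z. c (inv_into U ?c z))"
      by (rule smooth_on_cong[OF smooth_on_add[OF smooth_on_id smooth_on_const[of _ "c x"]]]) (auto simp: inv_into_f_f[OF inj])
  qed
  moreover have "?c ` (U \<inter> {x}) = ?c ` U \<inter> {0}" using c chartsD(5)[OF c(1)] by (auto simp: inj_on_def)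
  moreover have "subspace {0 :: 'b}" "{0} \<subseteq> model M" using subspace_0[OF E] by (auto simp: subspace_single_0)
  ultimately have "\<exists>(U, c)\<in>charts M. x \<in> U \<and> (\<exists>F. subspace F \<and> F \<subseteq> model M \<and> c ` (U \<inter> {x}) = c ` U \<inter> F)"
    using c(2) by blast
  then show ?thesis unfolding submanifold_def by simp
qed

text \<open>The inverse function theorem on a submanifold. Injectivity of the differential of
  \<open>\<eta>\<close> is phrased through curves, so that it can be verified by symplectic
  arguments on velocities; surjectivity is replaced by the equality of dimensions.\<close>

lemma local_diffeo:
  assumes M: "smooth_manifold M" and c: "(U, c) \<in> charts M" and x: "x \<in> U" "x \<in> L"
    and F: "subspace F" "F \<subseteq> model M" and sl: "c ` (U \<inter> L) = c ` U \<inter> F"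
    and H: "open H" "x \<in> H" and \<eta>: "smooth_map_on M euclid (L \<inter> H) \<eta>" "\<eta> ` (L \<inter> H) \<subseteq> G"
    and G: "subspace G" "dim F = dim G"
    and inj: "\<And>\<gamma>. curve_in M L x \<gamma> \<Longrightarrow> ((\<lambda>t. \<eta> (\<gamma> t)) has_vector_derivative 0) (at 0) \<Longrightarrow>
      velocity M \<gamma> = (\<lambda>f. 0)"
  obtains D where "open D" "x \<in> D" "D \<subseteq> H" "inj_on \<eta> (L \<inter> D)"
    "openin (top_of_set G) (\<eta> ` (L \<inter> D))" "smooth_map_on euclid M (\<eta> ` (L \<inter> D)) (inv_into (L \<inter> D) \<eta>)"
proof -
  define h where "h = (\<lambda>z. \<eta> (inv_into U c z))"
  define P where "P = c ` (U \<inter> H \<inter> L)"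
  obtain W where W: "open W" "c ` (U \<inter> H) = model M \<inter> W"
    using chart_image_open[OF c H(1)] openin_open by blast
  have P: "P = F \<inter> W"
    unfolding P_def
  proof (intro subset_antisym subsetI)
    fix z assume z: "z \<in> F \<inter> W"
    have "z \<in> c ` (U \<inter> H)" unfolding W(2) using z F(2) by blast
    then obtain y where y: "y \<in> U" "y \<in> H" "z = c y" by blast
    then show "z \<in> c ` (U \<inter> H \<inter> L)" using z slice_mem[OF c sl y(1)] by blast
  qed (use W(2) slice_mem[OF c sl] in blast)
  have oP: "openin (top_of_set F) P" unfolding P using W(1) by auto
  have s: "smooth_map_on euclid euclid P h"
    by (rule smooth_map_on_compose[OF smooth_manifold_euclid M smooth_manifold_euclid
          smooth_map_on_subset[OF smooth_map_on_chart_inv[OF M c]] \<eta>(1), folded h_def]) (auto simp: chart_inv[OF c] P_def)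
  then have s: "smooth_on P h" by (simp add: smooth_map_on_euclid_iff)
  have hG: "h ` P \<subseteq> G" using \<eta>(2) by (auto simp: chart_inv[OF c] h_def P_def)
  have xP: "c x \<in> P" unfolding P_def using x H by blast
  obtain h' where "(h has_derivative h') (at (c x) within P)" using smooth_on_has_derivative[OF s xP] .
  then have h': "(h has_derivative h') (at (c x) within F)" using at_within_openin[OF oP xP] by simp
  have xF: "c x \<in> F" using P xP by blast
  \<comment> \<open>A kernel vector of \<open>h'\<close> is realised by a coordinate line in the
    slice, to which the hypothesis on curves applies.\<close>
  have "v = 0" if v: "v \<in> F" "h' v = 0" for v
  proof -
    have vE: "v \<in> model M" using v F by blast
    have line: "c x + t *\<^sub>R v \<in> F" for t using xF v F(1) by (simp add: subspace_add subspace_scale)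
    have mem: "inv_into U c z \<in> L" if z: "z \<in> F" "z \<in> c ` U" for z
      using z slice_mem[OF c sl] chart_inv[OF c] by auto
    have g: "curve_in M L x (\<lambda>t. inv_into U c (c x + t *\<^sub>R v))"
      by (rule curve_in_coord_line[OF M c x(1) vE mem line])
    have "((\<lambda>t. h (c x + t *\<^sub>R v)) has_vector_derivative 0) (at 0)"
      using has_derivative_directional[OF h' F(1) xF v(1)] v(2) by simp
    from inj[OF g this[unfolded h_def]] have "coord_vector M (U, c) (c x) v = (\<lambda>f. 0)"
      by (simp add: coord_vector_def)
    then show ?thesis
      using coord_vector_inj[OF M c x(1) vE subspace_0[OF subspace_model[OF M]]] coord_vector_0[OF M c x(1)] by simp
  qed
  from smooth_inverse_subspace[OF F(1) G oP s hG xP h' this]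
  obtain P' where P': "openin (top_of_set F) P'" "c x \<in> P'" "P' \<subseteq> P" "inj_on h P'"
    "openin (top_of_set G) (h ` P')" "smooth_on (h ` P') (inv_into P' h)" by blast
  obtain T where T: "open T" "P' = F \<inter> T" using P'(1) openin_open by blast
  let ?D = "U \<inter> H \<inter> c -` T"
  have "open (U \<inter> c -` T)" using continuous_open_preimage[OF chartsD(3)[OF c] chartsD(1)[OF c] T(1)] .
  then have D: "open ?D" using H(1) by (metis Int_assoc Int_commute open_Int)
  have cD: "c ` (L \<inter> ?D) = P'"
  proof (intro subset_antisym subsetI)
    fix z assume z: "z \<in> P'"
    then obtain y where "y \<in> U \<inter> H \<inter> L" "z = c y" using P'(3) unfolding P_def by blast
    then show "z \<in> c ` (L \<inter> ?D)" using z T by blast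
  qed (use T slice_mem[OF c sl] in auto)
  have \<eta>h: "\<eta> y = h (c y)" if "y \<in> L \<inter> ?D" for y using that by (simp add: chart_inv[OF c] h_def)
  have injD: "inj_on \<eta> (L \<inter> ?D)"
  proof (rule inj_onI)
    fix y y' assume y: "y \<in> L \<inter> ?D" "y' \<in> L \<inter> ?D" "\<eta> y = \<eta> y'"
    then have "c y = c y'" using inj_onD[OF P'(4)] \<eta>h cD by (metis imageI)
    then show "y = y'" using y inj_onD[OF chartsD(5)[OF c]] by blast
  qed
  have im: "\<eta> ` (L \<inter> ?D) = h ` P'" unfolding cD[symmetric] image_image using \<eta>h by (rule image_cong[OF refl])
  have "smooth_map_on euclid M (h ` P') (\<lambda>z. inv_into U c (inv_into P' h z))"
    by (rule smooth_map_on_compose[OF smooth_manifold_euclid smooth_manifold_euclid M _ smooth_map_on_chart_inv[OF M c]])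
      (use P'(3,4,6) in \<open>auto simp: smooth_map_on_euclid_iff inv_into_f_f P_def\<close>)
  then have "smooth_map_on euclid M (\<eta> ` (L \<inter> ?D)) (inv_into (L \<inter> ?D) \<eta>)"
    unfolding im
  proof (rule smooth_map_on_cong[OF smooth_manifold_euclid M])
    fix z assume "z \<in> h ` P'"
    then obtain y where y: "y \<in> L \<inter> ?D" "z = \<eta> y" using im by blast
    then have "inv_into P' h z = c y" using \<eta>h cD P'(4) inv_into_f_f[of h P' "c y"] by auto
    then show "inv_into U c (inv_into P' h z) = inv_into (L \<inter> ?D) \<eta> z"
      using y injD chart_inv[OF c] by (simp add: inv_into_f_f)
  qed
  then show ?thesis using that[OF D _ _ injD] P'(2,5) x H T im by auto
qed

section \<open>Submanifolds given as graphs over the range of a projection\<close>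

text \<open>The shear that sends \<open>z\<close> to \<open>z - \<alpha> (p z)\<close> straightens
  the graph of \<open>\<alpha>\<close> to the range of \<open>p\<close> on the model, which becomes
  the slice.\<close>

lemma graph_slice:
  assumes M: "smooth_manifold M" and c: "(U, c) \<in> charts M" and p: "linear p" "p ` model M \<subseteq> model M"
    and idem: "\<And>z. z \<in> model M \<Longrightarrow> p (p z) = p z"
    and Q: "openin (top_of_set (p ` model M)) Q" and \<alpha>: "smooth_on Q \<alpha>"
    and \<alpha>E: "\<And>q. q \<in> Q \<Longrightarrow> \<alpha> q \<in> model M" and p\<alpha>: "\<And>q. q \<in> Q \<Longrightarrow> p (\<alpha> q) = 0"
    and H: "open H" "H \<subseteq> U"
    and LH: "\<And>y. y \<in> H \<Longrightarrow> y \<in> L \<longleftrightarrow> p (c y) \<in> Q \<and> c y - p (c y) = \<alpha> (p (c y))"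
    and x: "x \<in> L" "x \<in> H"
  shows "\<exists>(U, c)\<in>charts M. x \<in> U \<and> (\<exists>F. subspace F \<and> F \<subseteq> model M \<and> c ` (U \<inter> L) = c ` U \<inter> F)"
proof -
  let ?E = "model M"
  have E: "subspace ?E" using subspace_model[OF M] .
  have bp: "bounded_linear p" using p(1) by (simp add: linear_conv_bounded_linear)
  obtain T where T: "open T" "Q = p ` ?E \<inter> T" using Q openin_open by blast
  define V where "V = U \<inter> H \<inter> c -` (p -` T)"
  have V: "y \<in> V \<longleftrightarrow> y \<in> U \<and> y \<in> H \<and> p (c y) \<in> T" for y by (auto simp: V_def)
  have "open (p -` T)" using T(1) linear_continuous_on[OF bp] by (intro open_vimage) auto
  then have "open (U \<inter> c -` (p -` T))" by (rule continuous_open_preimage[OF chartsD(3)[OF c] chartsD(1)[OF c]])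
  then have oV: "open V" unfolding V_def using H(1) by (metis Int_assoc Int_commute open_Int)
  have "(U \<inter> V, c) \<in> charts M" by (rule chart_restrict[OF c oV])
  moreover have "U \<inter> V = V" by (auto simp: V_def)
  ultimately have cV: "(V, c) \<in> charts M" by simp
  have pQ: "p (c y) \<in> Q" if "y \<in> V" for y
    using that T chart_in_model[OF c] by (auto simp: V)
  \<comment> \<open>Because \<open>p\<close> kills the values of \<open>\<alpha>\<close>, the shear
    preserves \<open>p\<close> components and is inverted by
    \<open>w + \<alpha> (p w)\<close>.\<close>
  let ?g = "\<lambda>y. c y - \<alpha> (p (c y))"
  have pg: "p (?g y) = p (c y)" if "y \<in> V" for y using p\<alpha>[OF pQ[OF that]] by (simp add: linear_diff[OF p(1)])
  have gE: "?g y \<in> ?E" if "y \<in> V" for y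
    using \<alpha>E[OF pQ[OF that]] chart_in_model[OF cV that] E by (simp add: subspace_diff)
  have cg: "c y = ?g y + \<alpha> (p (?g y))" if "y \<in> V" for y using pg[OF that] by simp
  have inj: "inj_on ?g V"
  proof (rule inj_onI)
    fix y y' assume y: "y \<in> V" "y' \<in> V" "?g y = ?g y'"
    then have "c y = c y'" using cg by metis
    then show "y = y'" using y inj_onD[OF chartsD(5)[OF cV]] by blast
  qed
  obtain W where W: "open W" "c ` V = ?E \<inter> W"
    using chartsD(2)[OF cV] unfolding openin_open by (elim exE conjE)
  let ?X = "?E \<inter> p -` T" and ?\<phi> = "\<lambda>w. w + \<alpha> (p w)"
  have XQ: "p w \<in> Q" if "w \<in> ?X" for w using that T by auto
  have s\<phi>: "smooth_on ?X ?\<phi>"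
    by (intro smooth_on_add smooth_on_id smooth_on_compose[OF smooth_on_linear[OF p(1)] \<alpha>]) (use XQ in auto)
  have gV: "?g ` V = ?X \<inter> ?\<phi> -` W"
  proof (intro subset_antisym subsetI)
    fix w assume "w \<in> ?g ` V"
    then obtain y where y: "y \<in> V" "w = ?g y" by blast
    then show "w \<in> ?X \<inter> ?\<phi> -` W" using gE[OF y(1)] pg[OF y(1)] cg[OF y(1)] W(2) V[of y] by auto
  next
    fix w assume w: "w \<in> ?X \<inter> ?\<phi> -` W"
    then have "?\<phi> w \<in> model M" using \<alpha>E[OF XQ] E by (auto simp: subspace_add)
    then have "?\<phi> w \<in> c ` V" unfolding W(2) using w by blast
    then obtain y where y: "y \<in> V" "?\<phi> w = c y" by (rule imageE)
    have "p (c y) = p w + p (\<alpha> (p w))" unfolding y(2)[symmetric] by (rule linear_add[OF p(1)])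
    then have "p (c y) = p w" using p\<alpha>[OF XQ, of w] w by simp
    then have "?g y = w" using y(2)[symmetric] by simp
    then show "w \<in> ?g ` V" using y(1) by blast
  qed
  have "openin (top_of_set ?X) (?X \<inter> ?\<phi> -` W)"
    by (rule continuous_openin_preimage_gen[OF smooth_on_continuous[OF s\<phi>] W(1)])
  moreover have "openin (top_of_set ?E) ?X" using \<open>open (p -` T)\<close> by auto
  ultimately have op: "openin (top_of_set ?E) (?g ` V)" unfolding gV by (rule openin_trans)
  have chart: "(V, ?g) \<in> charts M"
  proof (rule chartI[OF M cV op inj])
    have "smooth_on (c ` V) (\<lambda>z. z - \<alpha> (p z))"
      by (intro smooth_on_diff smooth_on_id smooth_on_compose[OF smooth_on_linear[OF p(1)] \<alpha>]) (use pQ in auto)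
    then show "smooth_on (c ` V) (\<lambda>z. ?g (inv_into V c z))"
      by (rule smooth_on_cong) (auto simp: chart_inv[OF cV])
    have "smooth_on (?g ` V) ?\<phi>" by (rule smooth_on_subset[OF s\<phi>]) (use gV in blast)
    then show "smooth_on (?g ` V) (\<lambda>z. c (inv_into V ?g z))"
    proof (rule smooth_on_cong)
      fix w assume "w \<in> ?g ` V"
      then obtain y where y: "y \<in> V" "w = ?g y" by blast
      then have "inv_into V ?g w = y" using inv_into_f_f[OF inj y(1)] by simp
      then show "?\<phi> w = c (inv_into V ?g w)" using y cg[OF y(1)] by simp
    qed
  qed
  have sl: "?g ` (V \<inter> L) = ?g ` V \<inter> p ` ?E"
  proof (intro subset_antisym subsetI)
    fix w assume "w \<in> ?g ` (V \<inter> L)"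
    then obtain y where y: "y \<in> V" "y \<in> L" "w = ?g y" by blast
    have "\<alpha> (p (c y)) = c y - p (c y)" using LH[of y] V[of y] y(1,2) by (metis (no_types))
    then have "w = p (c y)" unfolding y(3) by simp
    then show "w \<in> ?g ` V \<inter> p ` ?E" using y chart_in_model[OF cV y(1)] by blast
  next
    fix w assume w: "w \<in> ?g ` V \<inter> p ` ?E"
    then obtain y where y: "y \<in> V" "w = ?g y" by blast
    obtain z where "z \<in> ?E" "w = p z" using w by blast
    then have "p w = w" using idem by simp
    then have "p (c y) = ?g y" using pg[OF y(1)] y(2) by simp
    then have "c y - p (c y) = \<alpha> (p (c y))" by (simp add: algebra_simps)
    then have "y \<in> L" using LH[of y] V[of y] y(1) pQ[OF y(1)] by blast
    then show "w \<in> ?g ` (V \<inter> L)" using y by blast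
  qed
  have "p (c x) \<in> Q" using LH[OF x(2)] x(1) by blast
  then have "x \<in> V" using x H T by (auto simp: V)
  moreover have "subspace (p ` ?E)" using linear_subspace_image[OF p(1) E] .
  ultimately show ?thesis using chart sl p(2) by blast
qed

text \<open>The tangent space of a graph is the graph of the derivative \<open>\<alpha>'\<close>:
  velocities of curves in \<open>L\<close> satisfy the linearised graph equation, and conversely
  lines in \<open>Q\<close> lift to curves in \<open>L\<close>. Applying \<open>p\<close> recovers
  the base vector, so the dimension is that of the range of \<open>p\<close>.\<close>

lemma graph_tangent:
  assumes M: "smooth_manifold M" and c: "(U, c) \<in> charts M" and p: "linear p" "p ` model M \<subseteq> model M"
    and idem: "\<And>z. z \<in> model M \<Longrightarrow> p (p z) = p z"
    and Q: "openin (top_of_set (p ` model M)) Q" and \<alpha>: "smooth_on Q \<alpha>"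
    and \<alpha>E: "\<And>q. q \<in> Q \<Longrightarrow> \<alpha> q \<in> model M" and p\<alpha>: "\<And>q. q \<in> Q \<Longrightarrow> p (\<alpha> q) = 0"
    and H: "open H" "H \<subseteq> U"
    and LH: "\<And>y. y \<in> H \<Longrightarrow> y \<in> L \<longleftrightarrow> p (c y) \<in> Q \<and> c y - p (c y) = \<alpha> (p (c y))"
    and x: "x \<in> L" "x \<in> H"
  obtains \<alpha>' where "linear \<alpha>'" "\<And>v. v \<in> p ` model M \<Longrightarrow> \<alpha>' v \<in> model M \<and> p (\<alpha>' v) = 0"
    "tangent_space M L x = coord_vector M (U, c) (c x) ` (\<lambda>v. v + \<alpha>' v) ` p ` model M"
    "subspace ((\<lambda>v. v + \<alpha>' v) ` p ` model M)" "dim ((\<lambda>v. v + \<alpha>' v) ` p ` model M) = dim (p ` model M)"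
proof -
  let ?E = "model M" and ?R = "p ` model M"
  have E: "subspace ?E" using subspace_model[OF M] .
  have R: "subspace ?R" using linear_subspace_image[OF p(1) E] .
  have bp: "bounded_linear p" using p(1) by (simp add: linear_conv_bounded_linear)
  have xU: "x \<in> U" using x H by blast
  have pR: "p v = v" if "v \<in> ?R" for v using that idem by auto
  let ?q = "p (c x)"
  have q: "?q \<in> Q" "c x - ?q = \<alpha> ?q" using LH[OF x(2)] x(1) by auto
  have qR: "?q \<in> ?R" using chart_in_model[OF c xU] by blast
  obtain \<alpha>' where "(\<alpha> has_derivative \<alpha>') (at ?q within Q)" using smooth_on_has_derivative[OF \<alpha> q(1)] .
  then have \<alpha>': "(\<alpha> has_derivative \<alpha>') (at ?q within ?R)" using at_within_openin[OF Q q(1)] by simp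
  have l\<alpha>': "linear \<alpha>'" using \<alpha>' by (rule has_derivative_linear)
  obtain T where T: "open T" "Q = ?R \<inter> T" using Q openin_open by blast
  have near: "\<exists>S. open S \<and> 0 \<in> S \<and> (\<forall>t\<in>S. ?q + t *\<^sub>R v \<in> Q)" if v: "v \<in> ?R" for v
  proof (intro exI conjI ballI)
    show "open ((\<lambda>t. ?q + t *\<^sub>R v) -` T)" by (intro open_vimage T(1)) (auto intro!: continuous_intros)
    show "0 \<in> (\<lambda>t. ?q + t *\<^sub>R v) -` T" using q T by auto
    show "?q + t *\<^sub>R v \<in> Q" if "t \<in> (\<lambda>t. ?q + t *\<^sub>R v) -` T" for t
      using that T qR v R by (auto simp: subspace_add subspace_scale)
  qed
  have \<alpha>'v: "\<alpha>' v \<in> ?E \<and> p (\<alpha>' v) = 0" if v: "v \<in> ?R" for v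
  proof -
    have sub: "subspace (?E \<inter> {z. p z = 0})"
      using E by (auto simp: subspace_def linear_add[OF p(1)] linear_scale[OF p(1)] linear_0[OF p(1)])
    have ev: "\<forall>\<^sub>F t in nhds 0. \<alpha> (?q + t *\<^sub>R v) \<in> ?E \<inter> {z. p z = 0}"
      unfolding eventually_nhds using near[OF v] \<alpha>E p\<alpha> by blast
    show ?thesis
      using has_vector_derivative_in_subspace[OF has_derivative_directional[OF \<alpha>' R qR v] sub ev] by simp
  qed
  let ?f = "\<lambda>v. v + \<alpha>' v"
  have lf: "linear ?f" by (intro linear_compose_add linear_ident l\<alpha>')
  have injf: "inj_on ?f ?R"
  proof (rule inj_onI)
    fix v w assume v: "v \<in> ?R" "w \<in> ?R" "?f v = ?f w"
    have "p (?f v) = v" "p (?f w) = w"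
      unfolding linear_add[OF p(1)] pR[OF v(1)] pR[OF v(2)]
        \<alpha>'v[OF v(1), THEN conjunct2] \<alpha>'v[OF v(2), THEN conjunct2] by (rule add_0_right)+
    then show "v = w" unfolding v(3) by (rule box_equals[OF refl])
  qed
  have "tangent_space M L x = coord_vector M (U, c) (c x) ` ?f ` ?R"
  proof (intro subset_antisym subsetI)
    fix u assume "u \<in> tangent_space M L x"
    then obtain \<gamma> where g: "curve_in M L x \<gamma>" "u = velocity M \<gamma>" unfolding tangent_space_curves by blast
    obtain w where w: "w \<in> ?E" "((\<lambda>t. c (\<gamma> t)) has_vector_derivative w) (at 0)"
      "velocity M \<gamma> = coord_vector M (U, c) (c x) w" using curve_velocity[OF M c xU g(1)] by metis
    obtain S where S: "open S" "0 \<in> S" "\<gamma> ` S \<subseteq> L \<inter> H" "\<gamma> 0 = x" using curve_inE[OF g(1) H(1) x(2)] by metis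
    have pw: "((\<lambda>t. p (c (\<gamma> t))) has_vector_derivative p w) (at 0)"
      by (rule bounded_linear.has_vector_derivative[OF bp w(2)])
    have pS: "p (c (\<gamma> t)) \<in> ?R" if "t \<in> S" for t using that S H chart_in_model[OF c] by blast
    have 1: "((\<lambda>t. p (c (\<gamma> t))) has_derivative (\<lambda>t. t *\<^sub>R p w)) (at 0 within S)"
      using pw unfolding has_vector_derivative_def by (rule has_derivative_at_withinI)
    have 2: "(\<alpha> has_derivative \<alpha>') (at (p (c (\<gamma> 0))) within (\<lambda>t. p (c (\<gamma> t))) ` S)"
      unfolding S(4) by (rule has_derivative_subset[OF \<alpha>']) (use pS in auto)
    have "((\<lambda>t. \<alpha> (p (c (\<gamma> t)))) has_derivative (\<lambda>t. \<alpha>' (t *\<^sub>R p w))) (at 0 within S)"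
      using diff_chain_within[OF 1 2] by (simp add: o_def)
    then have 3: "((\<lambda>t. \<alpha> (p (c (\<gamma> t)))) has_vector_derivative \<alpha>' (p w)) (at 0)"
      using at_within_open[OF S(2,1)] by (simp add: has_vector_derivative_def linear_scale[OF l\<alpha>'])
    have "((\<lambda>t. c (\<gamma> t)) has_vector_derivative (p w + \<alpha>' (p w))) (at 0)"
    proof (rule has_vector_derivative_transform_within_open[OF has_vector_derivative_add[OF pw 3] S(1,2)])
      fix t assume "t \<in> S"
      then have "c (\<gamma> t) - p (c (\<gamma> t)) = \<alpha> (p (c (\<gamma> t)))" using S(3) LH by blast
      then show "p (c (\<gamma> t)) + \<alpha> (p (c (\<gamma> t))) = c (\<gamma> t)" by (simp add: algebra_simps)
    qed
    then have "w = ?f (p w)" using w(2) vector_derivative_unique_at by blast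
    then show "u \<in> coord_vector M (U, c) (c x) ` ?f ` ?R" using g(2) w(1,3) by blast
  next
    fix u assume "u \<in> coord_vector M (U, c) (c x) ` ?f ` ?R"
    then obtain v where v: "v \<in> ?R" "u = coord_vector M (U, c) (c x) (?f v)" by blast
    obtain S where S: "open S" "0 \<in> S" "\<And>t. t \<in> S \<Longrightarrow> ?q + t *\<^sub>R v \<in> Q" using near[OF v(1)] by blast
    let ?z = "\<lambda>t. (?q + t *\<^sub>R v) + \<alpha> (?q + t *\<^sub>R v)"
    have sz: "smooth_on S ?z"
      by (intro smooth_on_add[OF smooth_on_line] smooth_on_compose[OF smooth_on_line \<alpha>]) (use S in auto)
    have zE: "?z t \<in> ?E" "p (?z t) = ?q + t *\<^sub>R v" if "t \<in> S" for t
    proof -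
      have r: "?q + t *\<^sub>R v \<in> ?R" using S(3)[OF that] T by blast
      then have "?q + t *\<^sub>R v \<in> ?E" using p(2) by blast
      then show "?z t \<in> ?E" using \<alpha>E[OF S(3)[OF that]] by (rule subspace_add[OF E])
      have "p (?z t) = p (?q + t *\<^sub>R v) + p (\<alpha> (?q + t *\<^sub>R v))" by (rule linear_add[OF p(1)])
      then show "p (?z t) = ?q + t *\<^sub>R v" using pR[OF r] p\<alpha>[OF S(3)[OF that]] by simp
    qed
    have z0: "?z 0 = c x" using q(2) by (simp add: algebra_simps)
    obtain W where W: "open W" "c ` (U \<inter> H) = ?E \<inter> W" using chart_image_open[OF c H(1)] openin_open by blast
    let ?S = "S \<inter> ?z -` W"
    have oS: "open ?S" by (rule continuous_open_preimage[OF smooth_on_continuous[OF sz] S(1) W(1)])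
    have S0: "0 \<in> ?S" using S(2) z0 W(2) xU x(2) by auto
    have zc: "?z t \<in> c ` (U \<inter> H)" if "t \<in> ?S" for t unfolding W(2) using that zE(1) by blast
    let ?\<gamma> = "\<lambda>t. inv_into U c (?z t)"
    have "smooth_map_on euclid M ?S ?\<gamma>"
      by (rule smooth_map_on_compose[OF smooth_manifold_euclid smooth_manifold_euclid M _ smooth_map_on_chart_inv[OF M c]])
        (use zc smooth_on_subset[OF sz, of ?S] in \<open>auto simp: smooth_map_on_euclid_iff\<close>)
    moreover have g0: "?\<gamma> 0 = x" unfolding z0 using chart_inv[OF c xU] .
    moreover have "?\<gamma> t \<in> L" if t: "t \<in> ?S" for t
    proof -
      obtain y where y: "y \<in> U" "y \<in> H" "?z t = c y" using zc[OF t] by blast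
      then have "?\<gamma> t = y" using chart_inv[OF c] by simp
      moreover have pc: "p (c y) = ?q + t *\<^sub>R v" using zE(2)[of t] t y(3) by simp
      have "c y - p (c y) = \<alpha> (p (c y))" unfolding pc by (simp add: y(3)[symmetric])
      then have "y \<in> L" using LH[OF y(2)] pc S(3)[of t] t by simp
      ultimately show ?thesis by simp
    qed
    ultimately have cur: "curve_in M L x ?\<gamma>" by (rule curve_inI[OF _ oS S0])
    have der: "((\<lambda>t. ?z t) has_vector_derivative (v + \<alpha>' v)) (at 0)"
      by (intro has_vector_derivative_add[OF line_has_vector_derivative] has_derivative_directional[OF \<alpha>' R qR v(1)])
    have eq: "?z t = c (?\<gamma> t)" if "t \<in> ?S" for t
      by (rule f_inv_into_f[symmetric]) (use zc[OF that] in blast)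
    have d: "((\<lambda>t. c (?\<gamma> t)) has_vector_derivative (?f v)) (at 0)"
      by (rule has_vector_derivative_transform_within_open[OF der oS S0 eq])
    have "?\<gamma> t \<in> U" if "t \<in> ?S" for t
      by (rule inv_into_into) (use zc[OF that] in blast)
    then have "\<forall>\<^sub>F t in nhds 0. ?\<gamma> t \<in> U"
      unfolding eventually_nhds by (intro exI[of _ ?S] conjI ballI oS S0)
    then have "velocity M ?\<gamma> = u" using velocity_eq_coord(1)[OF M c xU g0 _ d] v(2) by simp
    then show "u \<in> tangent_space M L x" unfolding tangent_space_curves using cur by blast
  qed
  moreover have "subspace (?f ` ?R)" using linear_subspace_image[OF lf R] .
  moreover have "dim (?f ` ?R) = dim ?R"
    using injf by (intro dim_image_eq[OF lf]) (simp add: span_eq_iff[THEN iffD2, OF R])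
  ultimately show ?thesis using that l\<alpha>' \<alpha>'v by blast
qed

section \<open>Extending embeddings from a closed set to a neighbourhood\<close>

text \<open>A homeomorphism onto its image, with continuity of the inverse expressed by
  neighbourhoods. No inverse map has to be named, so the notion can be glued from pieces;
  injectivity follows when points are closed.\<close>

definition top_embedding :: "'a::topological_space set \<Rightarrow> ('a \<Rightarrow> 'b::topological_space) \<Rightarrow> bool" where
  "top_embedding X f \<longleftrightarrow> continuous_on X f \<and>
     (\<forall>x\<in>X. \<forall>D. open D \<and> x \<in> D \<longrightarrow> (\<exists>G. open G \<and> f x \<in> G \<and> X \<inter> f -` G \<subseteq> D))"

lemma top_embeddingD:
  assumes "top_embedding X f" "x \<in> X" "open D" "x \<in> D"
  obtains G where "open G" "f x \<in> G" "X \<inter> f -` G \<subseteq> D"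
  using assms unfolding top_embedding_def by meson

lemma top_embedding_subset:
  assumes "top_embedding X f" "Y \<subseteq> X" shows "top_embedding Y f"
  unfolding top_embedding_def
proof (intro conjI ballI allI impI)
  show "continuous_on Y f" using assms continuous_on_subset unfolding top_embedding_def by blast
  fix x D assume "x \<in> Y" "open D \<and> x \<in> D"
  then obtain G where "open G" "f x \<in> G" "X \<inter> f -` G \<subseteq> D" using top_embeddingD[OF assms(1)] assms(2) by blast
  then show "\<exists>G. open G \<and> f x \<in> G \<and> Y \<inter> f -` G \<subseteq> D" using assms(2) by blast
qed

lemma top_embedding_inj:
  fixes f :: "'a::t1_space \<Rightarrow> 'b::topological_space"
  assumes "top_embedding X f" shows "inj_on f X"
proof (rule inj_onI, rule ccontr)
  fix x y assume xy: "x \<in> X" "y \<in> X" "f x = f y" "x \<noteq> y"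
  obtain G where "open G" "f x \<in> G" "X \<inter> f -` G \<subseteq> - {y}"
    using top_embeddingD[OF assms xy(1), of "- {y}"] xy(4) by auto
  then show False using xy by auto
qed

text \<open>The sort of a manifold type gives a Hausdorff, second countable topology; regularity is
  a consequence of the charts and is handed to the gluing lemma as a hypothesis.\<close>

definition regular_type :: "'a::topological_space itself \<Rightarrow> bool" where
  "regular_type _ \<longleftrightarrow> (\<forall>(x::'a) G. open G \<and> x \<in> G \<longrightarrow>
     (\<exists>H D. open H \<and> closed D \<and> x \<in> H \<and> H \<subseteq> D \<and> D \<subseteq> G))"

text \<open>A closed coordinate ball inside the model is compact, because linear subspaces are
  closed; its image is compact and therefore closed in the Hausdorff space.\<close>

lemma regular_manifold:
  fixes M :: "('m::{t2_space,second_countable_topology}, 'e::euclidean_space) manifold"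
  assumes M: "smooth_manifold M" shows "regular_type TYPE('m)"
  unfolding regular_type_def
proof (intro allI impI)
  fix x :: 'm and G assume G: "open G \<and> x \<in> G"
  obtain U c where c: "(U, c) \<in> charts M" "x \<in> U" using charts_cover[OF M] by metis
  obtain W where W: "open W" "c ` (U \<inter> G) = model M \<inter> W"
    using chart_image_open[OF c(1)] G openin_open by metis
  have "c x \<in> W" using W(2) c G by blast
  then obtain e where e: "e > 0" "cball (c x) e \<subseteq> W" using W(1) open_contains_cball by blast
  let ?K = "model M \<inter> cball (c x) e"
  let ?D = "inv_into U c ` ?K" and ?H = "U \<inter> c -` ball (c x) e"
  have KU: "?K \<subseteq> c ` (U \<inter> G)" using e W by blast
  have "compact ?K" using closed_subspace[OF subspace_model[OF M]] by (simp add: closed_Int_compact)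
  moreover have "continuous_on ?K (inv_into U c)" using chartsD(4)[OF c(1)] by (rule continuous_on_subset) (use KU in blast)
  ultimately have "closed ?D" by (intro compact_imp_closed compact_continuous_image)
  moreover have "open ?H" by (rule continuous_open_preimage[OF chartsD(3,1)[OF c(1)]]) simp
  moreover have "?H \<subseteq> ?D"
  proof
    fix y assume y: "y \<in> ?H"
    then have "c y \<in> ?K" using chart_in_model[OF c(1)] by (auto simp: less_imp_le)
    then show "y \<in> ?D" using y chart_inv[OF c(1)] by (metis IntD1 image_eqI)
  qed
  moreover have "?D \<subseteq> G" using KU chart_inv[OF c(1)] by auto
  ultimately show "\<exists>H D. open H \<and> closed D \<and> x \<in> H \<and> H \<subseteq> D \<and> D \<subseteq> G"
    using c(2) e(1) by (intro exI[of _ ?H] exI[of _ ?D]) auto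
qed

text \<open>The closed sets \<open>C\<^sub>i\<close> minus the interiors of their predecessors form a locally finite cover, which
  lets one impose on the points over each of them the requirement of lying in the corresponding
  neighbourhood.\<close>

lemma embedding_neighbourhood:
  fixes f :: "'a::t1_space \<Rightarrow> 'b::second_countable_topology"
  assumes reg: "regular_type TYPE('b)" and cont: "continuous_on X f"
    and C: "C \<subseteq> X" "closed (f ` C)" and emb: "top_embedding C f"
    and loc: "\<And>x. x \<in> C \<Longrightarrow> \<exists>D. open D \<and> x \<in> D \<and> top_embedding (X \<inter> D) f"
  obtains Z where "open Z" "C \<subseteq> Z" "top_embedding (X \<inter> Z) f"
proof -
  \<comment> \<open>An admissible piece: all core points over the closed set \<open>K\<close> lie in
    \<open>D\<close>, on which \<open>f\<close> already embeds. The open set \<open>H\<close> inside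
    \<open>K\<close> serves for covering.\<close>
  define good where "good H K D \<longleftrightarrow> open H \<and> closed K \<and> H \<subseteq> K \<and> open D \<and> top_embedding (X \<inter> D) f \<and>
    (\<forall>x\<in>C. f x \<in> K \<longrightarrow> x \<in> D)" for H K D
  have ex: "\<exists>H K D. y \<in> H \<and> good H K D" for y
  proof (cases "y \<in> f ` C")
    case True
    then obtain x where x: "x \<in> C" "y = f x" by blast
    obtain D where D: "open D" "x \<in> D" "top_embedding (X \<inter> D) f" using loc[OF x(1)] by blast
    obtain G where G: "open G" "f x \<in> G" "C \<inter> f -` G \<subseteq> D" using top_embeddingD[OF emb x(1) D(1,2)] .
    obtain H K where "open H" "closed K" "f x \<in> H" "H \<subseteq> K" "K \<subseteq> G"
      using reg G(1,2) unfolding regular_type_def by metis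
    then show ?thesis using D G x by (intro exI[of _ H] exI[of _ K] exI[of _ D]) (auto simp: good_def)
  next
    \<comment> \<open>Off the closed image of the core \<open>D\<close> is taken empty, which will
      discard all points of \<open>X\<close> lying over the corresponding
      \<open>E i\<close>.\<close>
    case False
    then obtain H K where "open H" "closed K" "y \<in> H" "H \<subseteq> K" "K \<subseteq> - f ` C"
      using reg C(2) unfolding regular_type_def by (metis ComplI open_Compl)
    moreover have "top_embedding (X \<inter> {}) f" by (simp add: top_embedding_def)
    ultimately show ?thesis by (intro exI[of _ H] exI[of _ K] exI[of _ "{}"]) (auto simp: good_def)
  qed
  obtain \<H> where H: "\<H> \<subseteq> {H. \<exists>K D. good H K D}" "countable \<H>" "\<Union>\<H> = \<Union>{H. \<exists>K D. good H K D}"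
    using Lindelof[of "{H. \<exists>K D. good H K D}"] by (auto simp: good_def)
  have cover: "\<exists>H\<in>\<H>. y \<in> H" for y using ex[of y] H(3) by blast
  then have "\<H> \<noteq> {}" by blast
  then obtain h :: "nat \<Rightarrow> 'b set" where h: "range h = \<H>" using H(2) uncountable_def by blast
  have "\<forall>i. \<exists>K D. good (h i) K D" using h H(1) by blast
  then obtain K D where KD: "\<And>i. good (h i) (K i) (D i)" by metis
  then have D: "open (D i)" "top_embedding (X \<inter> D i) f" "\<And>x. x \<in> C \<Longrightarrow> f x \<in> K i \<Longrightarrow> x \<in> D i"
    and h': "open (h i)" "h i \<subseteq> K i" and K: "closed (K i)" for i
    unfolding good_def by blast+
  define E where "E i = K i - (\<Union>j<i. h j)" for i
  have E: "open (- E i)" for i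
  proof -
    have "- E i = - K i \<union> (\<Union>j<i. h j)" by (auto simp: E_def)
    then show ?thesis using K h'(1) by (auto intro!: open_Un open_Compl open_UN)
  qed
  \<comment> \<open>Local finiteness: the open set \<open>h m\<close> meets \<open>E i\<close> only
    for \<open>i \<le> m\<close>.\<close>
  have hE: "i \<le> m" if "y \<in> h m" "y \<in> E i" for y i m
    using that unfolding E_def by (metis DiffD2 UN_I lessThan_iff not_le)
  have coverE: "\<exists>i. y \<in> E i" for y
  proof -
    have "\<exists>i. y \<in> h i" using cover[of y] h by blast
    then have "y \<in> h (LEAST i. y \<in> h i)" by (rule LeastI_ex)
    then have "y \<in> E (LEAST i. y \<in> h i)" unfolding E_def using h'(2) not_less_Least by fastforce
    then show ?thesis by blast
  qed
  \<comment> \<open>Two points with values in the same \<open>E i\<close> now lie in a common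
    \<open>D i\<close> on which \<open>f\<close> embeds.\<close>
  define X0 where "X0 = {x \<in> X. \<forall>i. f x \<in> E i \<longrightarrow> x \<in> D i}"
  have "\<exists>T. open T \<and> x \<in> T \<and> X \<inter> T \<subseteq> X0" if x: "x \<in> X0" for x
  proof -
    obtain m where m: "f x \<in> h m" using cover[of "f x"] h by blast
    \<comment> \<open>Over \<open>G\<close> only finitely many \<open>E i\<close> occur, and each of
      them contains \<open>f x\<close>.\<close>
    define G where "G = h m \<inter> (\<Inter>i\<in>{i. i \<le> m \<and> f x \<notin> E i}. - E i)"
    have "open G" unfolding G_def using h' E by (intro open_Int open_INT) auto
    then obtain T where T: "open T" "X \<inter> f -` G = X \<inter> T"
      using cont by (metis continuous_on_open_invariant Int_commute)
    let ?T = "T \<inter> (\<Inter>i\<in>{i. i \<le> m \<and> f x \<in> E i}. D i)"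
    have "open ?T" using T(1) D(1) by (intro open_Int open_INT) auto
    moreover have "x \<in> ?T"
    proof -
      have "x \<in> X" "f x \<in> G" using x m by (auto simp: X0_def G_def)
      then show ?thesis using x T(2) by (auto simp: X0_def)
    qed
    moreover have "X \<inter> ?T \<subseteq> X0"
    proof
      fix y assume y: "y \<in> X \<inter> ?T"
      then have "f y \<in> G" using T(2) by blast
      then have "y \<in> D i" if "f y \<in> E i" for i
        using hE[of "f y" m i] that y unfolding G_def by blast
      then show "y \<in> X0" using y by (auto simp: X0_def)
    qed
    ultimately show ?thesis by blast
  qed
  then obtain T where T: "\<And>x. x \<in> X0 \<Longrightarrow> open (T x) \<and> x \<in> T x \<and> X \<inter> T x \<subseteq> X0" by metis
  define Z where "Z = (\<Union>x\<in>X0. T x)"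
  have Z: "open Z" "X \<inter> Z = X0" using T by (auto simp: Z_def X0_def)
  have CX0: "C \<subseteq> X0" using C(1) D(3) by (auto simp: X0_def E_def)
  have "top_embedding X0 f"
    unfolding top_embedding_def
  proof (intro conjI ballI allI impI)
    show "continuous_on X0 f" using cont by (rule continuous_on_subset) (auto simp: X0_def)
    fix x D' assume x: "x \<in> X0" and D': "open D' \<and> x \<in> D'"
    obtain m where m: "f x \<in> h m" using cover[of "f x"] h by blast
    have "\<forall>i. f x \<in> E i \<longrightarrow> (\<exists>G. open G \<and> f x \<in> G \<and> X \<inter> D i \<inter> f -` G \<subseteq> D')"
    proof (intro allI impI)
      fix i assume "f x \<in> E i"
      then have "x \<in> X \<inter> D i" using x by (auto simp: X0_def)
      then show "\<exists>G. open G \<and> f x \<in> G \<and> X \<inter> D i \<inter> f -` G \<subseteq> D'"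
        using top_embeddingD[OF D(2)] D' by metis
    qed
    then obtain G where G: "\<And>i. f x \<in> E i \<Longrightarrow> open (G i) \<and> f x \<in> G i \<and> X \<inter> D i \<inter> f -` G i \<subseteq> D'"
      by metis
    let ?G = "h m \<inter> (\<Inter>i\<in>{i. i \<le> m \<and> f x \<in> E i}. G i) \<inter> (\<Inter>i\<in>{i. i \<le> m \<and> f x \<notin> E i}. - E i)"
    have "open ?G" using h' E G by (intro open_Int open_INT) auto
    moreover have "f x \<in> ?G" using m G by auto
    moreover have "X0 \<inter> f -` ?G \<subseteq> D'"
    proof
      fix y assume y: "y \<in> X0 \<inter> f -` ?G"
      obtain i where i: "f y \<in> E i" using coverE by blast
      then have "i \<le> m" using hE y by blast
      then have "f x \<in> E i" using y i by blast
      moreover have "y \<in> X \<inter> D i" using y i by (auto simp: X0_def)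
      ultimately show "y \<in> D'" using G[of i] y \<open>i \<le> m\<close> by blast
    qed
    ultimately show "\<exists>G. open G \<and> f x \<in> G \<and> X0 \<inter> f -` G \<subseteq> D'" by blast
  qed
  then show ?thesis using that[OF Z(1)] CX0 Z by auto
qed

section \<open>Rank, tangent maps and transversality in coordinates\<close>

text \<open>On the orthogonal complement of its kernel in \<open>F\<close> the map \<open>A\<close>
  is injective and has the same image as on \<open>F\<close>.\<close>

lemma rank_nullity_on:
  fixes A :: "'a::euclidean_space \<Rightarrow> 'b::euclidean_space"
  assumes A: "linear A" and F: "subspace F"
  shows "subspace {v \<in> F. A v = 0}" "dim {v \<in> F. A v = 0} + dim (A ` F) = dim F"
proof -
  define K where "K = {v \<in> F. A v = 0}"
  have K: "subspace K" using F unfolding K_def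
    by (auto simp: subspace_def linear_add[OF A] linear_scale[OF A] linear_0[OF A])
  then show "subspace {v \<in> F. A v = 0}" by (simp add: K_def)
  define R where "R = {y \<in> F. \<forall>x\<in>K. orthogonal x y}"
  have R: "subspace R" using F unfolding R_def subspace_def by (auto simp: orthogonal_clauses)
  have KF: "K \<subseteq> F" by (auto simp: K_def)
  have d: "dim R + dim K = dim F" unfolding R_def by (rule dim_subspace_orthogonal_to_vectors[OF K F KF])
  have inj: "inj_on A R"
  proof (rule linear_inj_on_iff_eq_0[OF A R, THEN iffD2], intro ballI impI)
    fix v assume "v \<in> R" "A v = 0"
    then have "orthogonal v v" by (auto simp: R_def K_def)
    then show "v = 0" by (simp add: orthogonal_self)
  qed
  have "A ` R = A ` F"
  proof (intro subset_antisym subsetI)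
    fix z assume "z \<in> A ` F"
    then obtain v where v: "v \<in> F" "z = A v" by blast
    obtain a b where ab: "a \<in> span K" "\<And>w. w \<in> span K \<Longrightarrow> orthogonal b w" "v = a + b"
      using orthogonal_subspace_decomp_exists[of K v] by blast
    have aK: "a \<in> K" using ab(1) K by (simp add: span_eq_iff[THEN iffD2])
    have "b = v - a" using ab(3) by simp
    then have "b \<in> F" using v(1) aK KF F by (auto intro: subspace_diff)
    moreover have "orthogonal x b" if "x \<in> K" for x using ab(2)[OF span_base[OF that]] by (simp add: orthogonal_commute)
    ultimately have "b \<in> R" by (simp add: R_def)
    moreover have "A b = z" using ab(3) aK v(2) by (simp add: K_def linear_add[OF A])
    ultimately show "z \<in> A ` R" by blast
  qed (auto simp: R_def)
  moreover have "dim (A ` R) = dim R" using inj R by (intro dim_image_eq[OF A]) (simp add: span_eq_iff[THEN iffD2])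
  ultimately show "dim {v \<in> F. A v = 0} + dim (A ` F) = dim F" using d by (simp add: K_def)
qed

lemma smooth_map_on_euclid_Pair:
  assumes M: "smooth_manifold M" and f: "smooth_map_on M euclid S f" and g: "smooth_map_on M euclid S g"
  shows "smooth_map_on M euclid S (\<lambda>x. (f x, g x))"
proof (rule smooth_map_onI[OF M smooth_manifold_euclid])
  show "continuous_on S (\<lambda>x. (f x, g x))" using f g by (intro continuous_on_Pair smooth_map_on_continuous)
  fix x assume "x \<in> S"
  obtain U c where c: "(U, c) \<in> charts M" "x \<in> U" using charts_cover[OF M] by metis
  have "smooth_on (c ` (S \<inter> UNIV \<inter> U \<inter> (\<lambda>x. (f x, g x)) -` UNIV)) (\<lambda>z. (f (inv_into U c z), g (inv_into U c z)))"
    using smooth_on_Pair[of "c ` (S \<inter> U)"] smooth_map_onD[OF f c(1) euclid_chart] smooth_map_onD[OF g c(1) euclid_chart]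
    by simp
  then show "\<exists>U c V d G. (U, c) \<in> charts M \<and> (V, d) \<in> charts euclid \<and> x \<in> U \<and> (f x, g x) \<in> V \<and>
      open G \<and> x \<in> G \<and> smooth_on (c ` (S \<inter> G \<inter> U \<inter> (\<lambda>x. (f x, g x)) -` V)) (\<lambda>z. d (f (inv_into U c z), g (inv_into U c z)))"
    using c euclid_chart open_UNIV UNIV_I by blast
qed

lemma smooth_map_on_euclid_linear:
  assumes M: "smooth_manifold M" and f: "smooth_map_on M euclid S f" and h: "linear h"
  shows "smooth_map_on M euclid S (\<lambda>x. h (f x))"
  by (rule smooth_map_on_compose[OF M smooth_manifold_euclid smooth_manifold_euclid f _ subset_UNIV])
    (simp add: smooth_map_on_euclid_iff smooth_on_linear h)

text \<open>\<open>A\<close> is the tangent map at \<open>x\<close> read in the two charts; it is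
  used for the projections of a product.\<close>

lemma tangent_map_coord:
  assumes P: "smooth_manifold P" and M: "smooth_manifold M"
    and e: "(Ue, e) \<in> charts P" "x \<in> Ue" and c: "(U, c) \<in> charts M" "f x \<in> U"
    and f: "smooth_map_on P M UNIV f"
  obtains A where "linear A" "\<And>w. w \<in> model P \<Longrightarrow> A w \<in> model M"
    "\<And>w. w \<in> model P \<Longrightarrow>
      velocity M (\<lambda>t. f (inv_into Ue e (e x + t *\<^sub>R w))) = coord_vector M (U, c) (c (f x)) (A w)"
proof -
  define g where "g = (\<lambda>\<xi>. c (f (inv_into Ue e \<xi>)))"
  define G where "G = f -` U"
  have G: "open G" unfolding G_def using smooth_map_on_continuous[OF f] chartsD(1)[OF c(1)]
    by (metis open_vimage)
  have "smooth_map_on euclid euclid (e ` (Ue \<inter> G)) g"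
    unfolding g_def
  proof (rule smooth_map_on_compose[OF smooth_manifold_euclid M smooth_manifold_euclid _ smooth_map_on_chart[OF M c(1)]])
    show "smooth_map_on euclid M (e ` (Ue \<inter> G)) (\<lambda>\<xi>. f (inv_into Ue e \<xi>))"
      by (rule smooth_map_on_compose[OF smooth_manifold_euclid P M
            smooth_map_on_subset[OF smooth_map_on_chart_inv[OF P e(1)]] f subset_UNIV]) auto
  qed (auto simp: chart_inv[OF e(1)] G_def)
  then have s: "smooth_on (e ` (Ue \<inter> G)) g" by (simp add: smooth_map_on_euclid_iff)
  have xG: "e x \<in> e ` (Ue \<inter> G)" using e c by (auto simp: G_def)
  obtain A where "(g has_derivative A) (at (e x) within e ` (Ue \<inter> G))" using smooth_on_has_derivative[OF s xG] .
  then have A: "(g has_derivative A) (at (e x) within model P)"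
    using at_within_openin[OF chart_image_open[OF e(1) G] xG] by simp
  have main: "A w \<in> model M \<and>
      velocity M (\<lambda>t. f (inv_into Ue e (e x + t *\<^sub>R w))) = coord_vector M (U, c) (c (f x)) (A w)"
    if w: "w \<in> model P" for w
  proof -
    obtain T where T: "open T" "0 \<in> T" "\<And>t. t \<in> T \<Longrightarrow> e x + t *\<^sub>R w \<in> e ` (Ue \<inter> G)"
      using eventually_chart_line[OF P e(1) xG G w] by blast
    have "f (inv_into Ue e (e x + t *\<^sub>R w)) \<in> U" if "t \<in> T" for t
      using T(3)[OF that] chart_inv[OF e(1)] by (auto simp: G_def)
    then have ev: "\<forall>\<^sub>F t in nhds 0. f (inv_into Ue e (e x + t *\<^sub>R w)) \<in> U"
      unfolding eventually_nhds using T(1,2) by blast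
    have d: "((\<lambda>t. c (f (inv_into Ue e (e x + t *\<^sub>R w)))) has_vector_derivative A w) (at 0)"
      using has_derivative_directional[OF A subspace_model[OF P] chart_in_model[OF e] w] by (simp add: g_def)
    have 0: "f (inv_into Ue e (e x + 0 *\<^sub>R w)) = f x" using chart_inv[OF e] by simp
    show ?thesis using velocity_eq_coord[OF M c 0 ev d] by blast
  qed
  show ?thesis using that[of A] has_derivative_linear[OF A] main by blast
qed

lemma curve_in_const:
  assumes M: "smooth_manifold M" and x: "x \<in> L" shows "curve_in M L x (\<lambda>t. x)"
  by (rule curve_inI[OF smooth_map_on_const[OF smooth_manifold_euclid M] open_UNIV]) (use x in auto)

lemma velocity_const:
  assumes M: "smooth_manifold M" shows "velocity M (\<lambda>t. x) = (\<lambda>f. 0)"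
proof -
  obtain U c where c: "(U, c) \<in> charts M" "x \<in> U" using charts_cover[OF M] by metis
  have "velocity M (\<lambda>t. x) = coord_vector M (U, c) (c x) 0"
    by (rule velocity_eq_coord(1)[OF M c]) (use c(2) in auto)
  then show ?thesis using coord_vector_0[OF M c] by simp
qed

lemma coord_vector_inj_on:
  assumes M: "smooth_manifold M" and c: "(U, c) \<in> charts M" and x: "x \<in> U"
  shows "inj_on (coord_vector M (U, c) (c x)) (model M)"
  using coord_vector_inj[OF M c x] by (intro inj_onI) blast

text \<open>Such a \<open>u\<close> is orthogonal to both lagrangian subspaces, hence to their sum,
  which is the whole tangent space; nondegeneracy does the rest.\<close>

lemma lagrangian_transverse_Int:
  assumes M: "smooth_manifold M" and w: "symplectic_at M \<omega> x"
    and S: "lagrangian_subspace M \<omega> x S" and T: "lagrangian_subspace M \<omega> x T"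
    and tr: "transverse_at M x S T" and u: "u \<in> S" "u \<in> T"
  shows "u = (\<lambda>f. 0)"
proof -
  have St: "S \<subseteq> tangent_space M UNIV x" "T \<subseteq> tangent_space M UNIV x"
    using S T unfolding lagrangian_subspace_def by blast+
  have 0: "\<omega> x s u = 0" if "s \<in> S \<or> s \<in> T" for s
    using that S T u unfolding lagrangian_subspace_def by blast
  have "\<omega> x u v = 0" if v: "v \<in> tangent_space M UNIV x" for v
  proof -
    obtain s t where st: "s \<in> S" "t \<in> T" "v = (\<lambda>f. s f + t f)" using tr v unfolding transverse_at_def by blast
    have "\<omega> x (\<lambda>f. 1 * s f + t f) u = 1 * \<omega> x s u + \<omega> x t u"
      using w[unfolded symplectic_at_def, THEN conjunct1, rule_format, of s t u 1] st St u by blast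
    then have "\<omega> x v u = 0" using st 0 by simp
    moreover have "\<omega> x u v = - \<omega> x v u"
      using w[unfolded symplectic_at_def, THEN conjunct1, rule_format, of u v u 1] v St u by blast
    ultimately show ?thesis by simp
  qed
  then show ?thesis using w u St unfolding symplectic_at_def by blast
qed

lemma openin_lineE:
  fixes G :: "'a::real_normed_vector set"
  assumes Q: "openin (top_of_set G) Q" and z: "z \<in> Q" and G: "subspace G" and v: "v \<in> G"
  obtains T where "open T" "0 \<in> T" "\<And>t. t \<in> T \<Longrightarrow> z + t *\<^sub>R v \<in> Q"
proof -
  obtain W where W: "open W" "Q = G \<inter> W" using Q openin_open by blast
  have "open ((\<lambda>t. z + t *\<^sub>R v) -` W)" by (intro open_vimage W(1)) (auto intro!: continuous_intros)
  moreover have "0 \<in> (\<lambda>t. z + t *\<^sub>R v) -` W" using z W by auto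
  moreover have "z + t *\<^sub>R v \<in> Q" if "t \<in> (\<lambda>t. z + t *\<^sub>R v) -` W" for t
    using that z W v G by (auto simp: subspace_add subspace_scale)
  ultimately show ?thesis by (rule that)
qed

section \<open>The retraction defined by a lagrangian fibration\<close>

text \<open>The dimension of the total space must be found before the inverse function theorem
  applies to \<open>snd\<close>: the differential of \<open>fst\<close> maps its tangent space onto
  \<open>TB\<close>, with the tangent space of the fibre as kernel. If \<open>(u, 0)\<close> is
  tangent to the total space, subtracting it from the diagonal vector \<open>(u, u)\<close> leaves
  the vertical vector \<open>(0, u)\<close>; so \<open>u\<close> is tangent to the fibre as well as
  to \<open>B\<close>, and vanishes by transversality.\<close>

lemma fibration_local:
  fixes N :: "('n::{t2_space,second_countable_topology}, 'f::euclidean_space) manifold"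
  assumes N: "smooth_manifold N" and symp: "\<And>y. symplectic_at N \<omega> y" and B: "lagrangian N \<omega> B"
    and rep: "lagrangian_fibration_rep N \<omega> B N B (\<lambda>y. y) F" and y0: "y0 \<in> B"
  obtains D where "open D" "(y0, y0) \<in> D" "inj_on snd (Sigma B F \<inter> D)" "open (snd ` (Sigma B F \<inter> D))"
    "smooth_map_on N (N \<times>\<^sub>M N) (snd ` (Sigma B F \<inter> D)) (inv_into (Sigma B F \<inter> D) snd)"
proof -
  define P where "P = N \<times>\<^sub>M N"
  define S where "S = Sigma B F"
  have P: "smooth_manifold P" unfolding P_def by (rule smooth_manifold_prod[OF N N])
  note rep' = rep[unfolded lagrangian_fibration_rep_def lagrangian_submicrofold_def]
  have rFy: "lagrangian N \<omega> (F y)" "F y \<inter> B = {y}"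
    "transverse_at N y (tangent_space N (F y) y) (tangent_space N B y)" if "y \<in> B" for y
    using rep'[THEN conjunct1, rule_format, OF that] by simp_all
  have rS: "submanifold P S" unfolding P_def S_def using rep'[THEN conjunct2, THEN conjunct1] .
  have push: "pushforward fst ` tangent_space P S p = tangent_space N B (fst p)" if "p \<in> S" for p
    using rep'[THEN conjunct2, THEN conjunct2] that unfolding P_def S_def by (rule bspec)
  have diag: "(y, y) \<in> S" if "y \<in> B" for y using rFy(2)[OF that] that by (auto simp: S_def)
  define x0 where "x0 = (y0, y0)"
  have x0: "x0 \<in> S" "fst x0 = y0" "snd x0 = y0" using diag[OF y0] by (simp_all add: x0_def)
  obtain V d FB where d: "(V, d) \<in> charts N" "y0 \<in> V" and FB: "subspace FB" "FB \<subseteq> model N"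
    and slB: "d ` (V \<inter> B) = d ` V \<inter> FB"
    by (rule submanifoldE[OF B[unfolded lagrangian_def, THEN conjunct1] y0])
  have yF: "y0 \<in> F y0" using rFy(2)[OF y0] by blast
  obtain V' d' FF where d': "(V', d') \<in> charts N" "y0 \<in> V'" and FF: "subspace FF" "FF \<subseteq> model N"
    and slF: "d' ` (V' \<inter> F y0) = d' ` V' \<inter> FF"
    by (rule submanifoldE[OF rFy(1)[OF y0, unfolded lagrangian_def, THEN conjunct1] yF])
  obtain Ue e Fe where e: "(Ue, e) \<in> charts P" "x0 \<in> Ue" and Fe: "subspace Fe" "Fe \<subseteq> model P"
    and slS: "e ` (Ue \<inter> S) = e ` Ue \<inter> Fe"
    by (rule submanifoldE[OF rS x0(1)])
  define ce where "ce = coord_vector P (Ue, e) (e x0)"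
  define cd where "cd = coord_vector N (V, d) (d y0)"
  define cd' where "cd' = coord_vector N (V', d') (d' y0)"
  have TS: "tangent_space P S x0 = ce ` Fe"
    unfolding ce_def by (rule tangent_space_slice[OF P e x0(1) Fe slS])
  have TB: "tangent_space N B y0 = cd ` FB"
    unfolding cd_def by (rule tangent_space_slice[OF N d y0 FB slB])
  have TF: "tangent_space N (F y0) y0 = cd' ` FF"
    unfolding cd'_def by (rule tangent_space_slice[OF N d' yF FF slF])
  have lB: "lagrangian_subspace N \<omega> y0 (tangent_space N B y0)" using B y0 unfolding lagrangian_def by blast
  have lF: "lagrangian_subspace N \<omega> y0 (tangent_space N (F y0) y0)"
    using rFy(1)[OF y0] yF unfolding lagrangian_def by blast
  have dFB: "2 * dim FB = dim (model N)"
    by (rule lagrangian_subspace_dim[OF N symp d FB]) (use lB TB in \<open>simp add: cd_def\<close>)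
  have dFF: "2 * dim FF = dim (model N)"
    by (rule lagrangian_subspace_dim[OF N symp d' FF]) (use lF TF in \<open>simp add: cd'_def\<close>)
  have ice: "inj_on ce (model P)" unfolding ce_def by (rule coord_vector_inj_on[OF P e])
  have icd: "inj_on cd (model N)" unfolding cd_def by (rule coord_vector_inj_on[OF N d])
  have icd': "inj_on cd' (model N)" unfolding cd'_def by (rule coord_vector_inj_on[OF N d'])
  have z: "ce 0 = (\<lambda>f. 0)" "cd 0 = (\<lambda>f. 0)" "cd' 0 = (\<lambda>f. 0)"
    unfolding ce_def cd_def cd'_def
    by (rule coord_vector_0[OF P e], rule coord_vector_0[OF N d], rule coord_vector_0[OF N d'])
  have z0: "0 \<in> model N" "0 \<in> model P" using subspace_0 subspace_model N P by blast+
  have pv: "pushforward fst (velocity P \<gamma>) = velocity N (\<lambda>t. fst (\<gamma> t))"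
    "pushforward snd (velocity P \<gamma>) = velocity N (\<lambda>t. snd (\<gamma> t))" for \<gamma>
    unfolding P_def by (rule pushforward_fst_velocity[OF N N], rule pushforward_snd_velocity[OF N N])
  have sfst: "smooth_map_on P N L fst" and ssnd: "smooth_map_on P N L snd" for L
    unfolding P_def by (rule smooth_map_on_fst[OF N N], rule smooth_map_on_snd[OF N N])
  \<comment> \<open>\<open>A\<close> and \<open>A'\<close> are the differentials of
    \<open>fst\<close> and \<open>snd\<close>; the second is read in the chart \<open>d'\<close>
    adapted to the fibre.\<close>
  obtain A where A: "linear A" "\<And>w. w \<in> model P \<Longrightarrow> A w \<in> model N"
    "\<And>w. w \<in> model P \<Longrightarrow> velocity N (\<lambda>t. fst (inv_into Ue e (e x0 + t *\<^sub>R w))) = coord_vector N (V, d) (d (fst x0)) (A w)"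
    using tangent_map_coord[OF P N e d(1), of fst] d(2) x0(2) sfst by metis
  obtain A' where A': "linear A'" "\<And>w. w \<in> model P \<Longrightarrow> A' w \<in> model N"
    "\<And>w. w \<in> model P \<Longrightarrow> velocity N (\<lambda>t. snd (inv_into Ue e (e x0 + t *\<^sub>R w))) = coord_vector N (V', d') (d' (snd x0)) (A' w)"
    using tangent_map_coord[OF P N e d'(1), of snd] d'(2) x0(3) ssnd by metis
  have Ap: "pushforward fst (ce w) = cd (A w)" "pushforward snd (ce w) = cd' (A' w)" if "w \<in> model P" for w
    using A(3)[OF that] A'(3)[OF that] pv by (simp_all add: ce_def cd_def cd'_def coord_vector_def x0)
  have AFe: "A ` Fe = FB"
  proof -
    have "cd ` A ` Fe = pushforward fst ` ce ` Fe"
      unfolding image_image by (rule image_cong[OF refl]) (use Ap(1) Fe(2) in auto)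
    also have "\<dots> = cd ` FB" using push[OF x0(1)] unfolding TS x0(2) TB .
    finally have 1: "cd ` A ` Fe = cd ` FB" .
    have 2: "A ` Fe \<subseteq> model N" using A(2) Fe(2) by blast
    show ?thesis using inj_on_image_eq_iff[OF icd 2 FB(2)] 1 by simp
  qed
  \<comment> \<open>The vertical vectors of the total space, in coordinates.\<close>
  define K where "K = {v \<in> Fe. A v = 0}"
  have K: "subspace K" "dim K + dim FB = dim Fe"
    using rank_nullity_on[OF A(1) Fe(1)] AFe by (simp_all add: K_def)
  have KP: "K \<subseteq> model P" using Fe(2) by (auto simp: K_def)
  have zeroI: "velocity P \<gamma> = (\<lambda>f. 0)"
    if "curve_in P S x0 \<gamma>" "pushforward fst (velocity P \<gamma>) = (\<lambda>f. 0)" "pushforward snd (velocity P \<gamma>) = (\<lambda>f. 0)" for \<gamma>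
  proof -
    have "velocity P \<gamma> \<in> tangent_space (N \<times>\<^sub>M N) UNIV (y0, y0)"
      using that(1) tangent_space_mono[of S UNIV] unfolding tangent_space_curves P_def x0_def by blast
    then show ?thesis using tangent_prod_eqI[OF N N] that(2,3) by blast
  qed
  \<comment> \<open>A tangent vector of the fibre is by definition the velocity of a curve inside
    it, so a curve in \<open>F y0\<close> with the given vertical velocity has to be produced.
    Coordinates on the total space made of \<open>d (fst x)\<close> and the vertical component
    \<open>p (e x)\<close> provide it.\<close>
  have kernel: "A' v \<in> FF" if v: "v \<in> K" for v
  proof -
    obtain p where p: "linear p" "\<And>x. p x \<in> K" "\<And>x. x \<in> K \<Longrightarrow> p x = x" using linear_projection[OF K(1)] by metis
    have bp: "bounded_linear p" using p(1) by (simp add: linear_conv_bounded_linear)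
    define H where "H = Ue \<inter> fst -` V"
    have H: "open H" "x0 \<in> H"
      unfolding H_def using chartsD(1)[OF e(1)] open_vimage_fst[OF chartsD(1)[OF d(1)]] e(2) d(2) x0(2) by auto
    define \<eta> where "\<eta> = (\<lambda>x. (d (fst x), p (e x)))"
    have s\<eta>: "smooth_map_on P euclid (S \<inter> H) \<eta>"
      unfolding \<eta>_def
    proof (rule smooth_map_on_euclid_Pair[OF P])
      show "smooth_map_on P euclid (S \<inter> H) (\<lambda>x. d (fst x))"
        by (rule smooth_map_on_compose[OF P N smooth_manifold_euclid sfst smooth_map_on_chart[OF N d(1)]])
          (auto simp: H_def)
      show "smooth_map_on P euclid (S \<inter> H) (\<lambda>x. p (e x))"
        by (rule smooth_map_on_euclid_linear[OF P smooth_map_on_subset[OF smooth_map_on_chart[OF P e(1)]] p(1)])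
          (auto simp: H_def)
    qed
    have \<eta>G: "\<eta> ` (S \<inter> H) \<subseteq> FB \<times> K"
    proof
      fix z assume "z \<in> \<eta> ` (S \<inter> H)"
      then obtain x where x: "x \<in> S" "x \<in> H" "z = \<eta> x" by blast
      have "fst x \<in> B" "fst x \<in> V" using x by (auto simp: S_def H_def)
      then have "d (fst x) \<in> FB" using slice_mem[OF d(1) slB] by blast
      then show "z \<in> FB \<times> K" unfolding x(3) \<eta>_def using p(2) by (intro SigmaI)
    qed
    \<comment> \<open>Used twice: \<open>v' = 0\<close> gives the injectivity required by
      \<open>local_diffeo\<close>, and the general case identifies the velocity of the curve
      constructed afterwards.\<close>
    have vel: "v' \<in> K \<and> velocity P \<gamma> = ce v'"
      if g: "curve_in P S x0 \<gamma>" and d\<eta>: "((\<lambda>t. \<eta> (\<gamma> t)) has_vector_derivative (0, v')) (at 0)" for \<gamma> v'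
    proof -
      obtain w where w: "w \<in> model P" "((\<lambda>t. e (\<gamma> t)) has_vector_derivative w) (at 0)" "velocity P \<gamma> = ce w"
        unfolding ce_def using curve_velocity[OF P e g] by metis
      have "velocity P \<gamma> \<in> ce ` Fe" using g unfolding TS[symmetric] tangent_space_curves by blast
      then have wFe: "w \<in> Fe" using w ice Fe(2) by (auto dest: inj_onD)
      have g': "curve_in N UNIV y0 (\<lambda>t. fst (\<gamma> t))"
        using curve_in_compose[OF P N g open_UNIV UNIV_I sfst] x0(2) by auto
      have "((\<lambda>t. fst (\<eta> (\<gamma> t))) has_vector_derivative fst (0, v')) (at 0)"
        by (rule bounded_linear.has_vector_derivative[OF bounded_linear_fst d\<eta>])
      then have 1: "((\<lambda>t. d (fst (\<gamma> t))) has_vector_derivative 0) (at 0)" by (simp add: \<eta>_def)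
      obtain b where b: "((\<lambda>t. d (fst (\<gamma> t))) has_vector_derivative b) (at 0)" "velocity N (\<lambda>t. fst (\<gamma> t)) = cd b"
        unfolding cd_def using curve_velocity[OF N d g'] by metis
      have "b = 0" using 1 b(1) vector_derivative_unique_at by blast
      then have "cd (A w) = cd 0" using b(2) pv(1) w Ap(1)[OF w(1)] by metis
      then have "A w = 0" using icd A(2)[OF w(1)] z0 by (auto dest: inj_onD)
      then have wK: "w \<in> K" using wFe by (simp add: K_def)
      have "((\<lambda>t. snd (\<eta> (\<gamma> t))) has_vector_derivative snd (0::'f, v')) (at 0)"
        by (rule bounded_linear.has_vector_derivative[OF bounded_linear_snd d\<eta>])
      then have 2: "((\<lambda>t. p (e (\<gamma> t))) has_vector_derivative v') (at 0)" by (simp add: \<eta>_def)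
      have "((\<lambda>t. p (e (\<gamma> t))) has_vector_derivative p w) (at 0)"
        by (rule bounded_linear.has_vector_derivative[OF bp w(2)])
      then have "v' = p w" using 2 vector_derivative_unique_at by blast
      then show ?thesis using wK w(3) p(3) by simp
    qed
    have inj: "velocity P \<gamma> = (\<lambda>f. 0)"
      if "curve_in P S x0 \<gamma>" "((\<lambda>t. \<eta> (\<gamma> t)) has_vector_derivative 0) (at 0)" for \<gamma>
      using vel[OF that(1), of 0] that(2) z(1) by (simp add: zero_prod_def)
    have G: "subspace (FB \<times> K)" by (rule subspace_Times[OF FB(1) K(1)])
    have dG: "dim Fe = dim (FB \<times> K)" using dim_Times[OF FB(1) K(1)] K(2) by simp
    obtain D where D: "open D" "x0 \<in> D" "D \<subseteq> H" "inj_on \<eta> (S \<inter> D)" "openin (top_of_set (FB \<times> K)) (\<eta> ` (S \<inter> D))"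
      "smooth_map_on euclid P (\<eta> ` (S \<inter> D)) (inv_into (S \<inter> D) \<eta>)"
      by (rule local_diffeo[OF P e x0(1) Fe slS H s\<eta> \<eta>G G dG inj])
    have v0: "(0, v) \<in> FB \<times> K" using v subspace_0[OF FB(1)] by simp
    have "\<eta> x0 \<in> \<eta> ` (S \<inter> D)" using x0(1) D(2) by blast
    then obtain T where T: "open T" "0 \<in> T" "\<And>t. t \<in> T \<Longrightarrow> \<eta> x0 + t *\<^sub>R (0, v) \<in> \<eta> ` (S \<inter> D)"
      using openin_lineE[OF D(5) _ G v0] by metis
    \<comment> \<open>Moving in the \<open>K\<close> direction keeps the base coordinate at
      \<open>d y0\<close>, so the curve stays in the fibre over \<open>y0\<close>.\<close>
    define \<gamma> where "\<gamma> = (\<lambda>t. inv_into (S \<inter> D) \<eta> (\<eta> x0 + t *\<^sub>R (0, v)))"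
    have \<gamma>: "\<gamma> t \<in> S \<inter> D" "\<eta> (\<gamma> t) = \<eta> x0 + t *\<^sub>R (0, v)" if "t \<in> T" for t
      unfolding \<gamma>_def using T(3)[OF that] by (rule inv_into_into, rule f_inv_into_f)
    have \<gamma>F: "\<gamma> t \<in> {y0} \<times> F y0" if t: "t \<in> T" for t
    proof -
      have "fst (\<gamma> t) \<in> V" using \<gamma>(1)[OF t] D(3) by (auto simp: H_def)
      moreover have "d (fst (\<gamma> t)) = d y0" using \<gamma>(2)[OF t] by (simp add: \<eta>_def x0)
      ultimately have "fst (\<gamma> t) = y0" using inj_onD[OF chartsD(5)[OF d(1)]] d(2) by blast
      then show ?thesis using \<gamma>(1)[OF t] by (auto simp: S_def)
    qed
    have s\<gamma>: "smooth_map_on euclid P T \<gamma>"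
      unfolding \<gamma>_def
      by (rule smooth_map_on_compose[OF smooth_manifold_euclid smooth_manifold_euclid P
            smooth_map_on_euclid_iff[THEN iffD2, OF smooth_on_line] D(6)]) (use T(3) in blast)
    have \<gamma>0: "\<gamma> 0 = x0" unfolding \<gamma>_def scaleR_zero_left add_0_right
      using inv_into_f_f[OF D(4), of x0] x0(1) D(2) by blast
    have g: "curve_in P ({y0} \<times> F y0) x0 \<gamma>" by (rule curve_inI[OF s\<gamma> T(1,2) \<gamma>0 \<gamma>F])
    have gS: "curve_in P S x0 \<gamma>" by (rule curve_in_mono[OF g]) (use y0 in \<open>auto simp: S_def\<close>)
    have "((\<lambda>t. \<eta> (\<gamma> t)) has_vector_derivative (0, v)) (at 0)"
      by (rule has_vector_derivative_transform_within_open[OF line_has_vector_derivative T(1,2)]) (simp add: \<gamma>(2))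
    then have vv: "velocity P \<gamma> = ce v" using vel[OF gS] by blast
    have "velocity P \<gamma> \<in> tangent_space (N \<times>\<^sub>M N) ({y0} \<times> F y0) (y0, y0)"
      using g unfolding tangent_space_curves P_def x0_def by blast
    from pushforward_tangent(2)[OF N N this] have "pushforward snd (ce v) \<in> tangent_space N (F y0) y0"
      using vv by simp
    moreover have vP: "v \<in> model P" using v KP by blast
    ultimately have "cd' (A' v) \<in> cd' ` FF" unfolding TF Ap(2)[OF vP] by blast
    then obtain f where f: "f \<in> FF" "cd' (A' v) = cd' f" by blast
    then have "A' v = f" using inj_onD[OF icd'] A'(2)[OF vP] FF(2) by blast
    then show "A' v \<in> FF" using f by simp
  qed
  have A'K: "A' ` K = FF"
  proof (intro subset_antisym subsetI)
    fix f assume f: "f \<in> FF"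
    then have "cd' f \<in> tangent_space N (F y0) y0" unfolding TF by (rule imageI)
    then obtain \<delta> where "curve_in N (F y0) y0 \<delta>" "cd' f = velocity N \<delta>"
      unfolding tangent_space_curves by blast
    then have \<delta>: "curve_in N (F y0) y0 \<delta>" "velocity N \<delta> = cd' f" by simp_all
    have "curve_in P ({y0} \<times> F y0) x0 (\<lambda>t. (y0, \<delta> t))"
      unfolding P_def x0_def by (rule curve_in_Pair[OF N N curve_in_const[OF N] \<delta>(1)]) simp
    then have "curve_in P S x0 (\<lambda>t. (y0, \<delta> t))" by (rule curve_in_mono) (use y0 in \<open>auto simp: S_def\<close>)
    then have "velocity P (\<lambda>t. (y0, \<delta> t)) \<in> ce ` Fe" unfolding TS[symmetric] tangent_space_curves by blast
    then obtain w where w: "w \<in> Fe" "velocity P (\<lambda>t. (y0, \<delta> t)) = ce w" by blast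
    have wP: "w \<in> model P" using w Fe by blast
    have "cd (A w) = cd 0" using Ap(1)[OF wP] pv(1)[of "\<lambda>t. (y0, \<delta> t)"] w(2) z(2) velocity_const[OF N] by simp
    then have "A w = 0" using icd A(2)[OF wP] z0 by (auto dest: inj_onD)
    then have "w \<in> K" using w by (simp add: K_def)
    moreover have "cd' (A' w) = cd' f" using Ap(2)[OF wP] pv(2)[of "\<lambda>t. (y0, \<delta> t)"] w(2) \<delta>(2) by simp
    then have "A' w = f" using icd' A'(2)[OF wP] f FF by (auto dest: inj_onD)
    ultimately show "f \<in> A' ` K" by blast
  qed (use kernel in blast)
  have "inj_on A' K"
  proof (rule linear_inj_on_iff_eq_0[OF A'(1) K(1), THEN iffD2], intro ballI impI)
    fix v assume v: "v \<in> K" "A' v = 0"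
    have vP: "v \<in> model P" using v KP by blast
    have "ce v \<in> tangent_space P UNIV x0" unfolding ce_def by (rule coord_vector_tangent[OF P e vP])
    moreover have "pushforward fst (ce v) = (\<lambda>f. 0)" "pushforward snd (ce v) = (\<lambda>f. 0)"
      using Ap[OF vP] v z by (simp_all add: K_def)
    ultimately have "ce v = ce 0" using tangent_prod_eqI[OF N N, of "ce v" y0 y0] z(1) by (simp add: P_def x0_def)
    then show "v = 0" using ice vP z0 by (auto dest: inj_onD)
  qed
  then have "dim (A' ` K) = dim K"
    by (intro dim_image_eq[OF A'(1)]) (simp add: span_eq_iff[THEN iffD2, OF K(1)])
  \<comment> \<open>Base and fibre each contribute half the dimension of \<open>N\<close>.\<close>
  then have dFe: "dim Fe = dim (model N)" using A'K K(2) dFB dFF by simp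
  define H where "H = (snd -` V :: ('n \<times> 'n) set)"
  have H: "open H" "x0 \<in> H"
    unfolding H_def using open_vimage_snd[OF chartsD(1)[OF d(1)]] d(2) x0(3) by auto
  define \<eta> where "\<eta> = (\<lambda>x::'n \<times> 'n. d (snd x))"
  have s\<eta>: "smooth_map_on P euclid (S \<inter> H) \<eta>"
    unfolding \<eta>_def by (rule smooth_map_on_compose[OF P N smooth_manifold_euclid ssnd smooth_map_on_chart[OF N d(1)]])
      (auto simp: H_def)
  have \<eta>G: "\<eta> ` (S \<inter> H) \<subseteq> model N" using chart_in_model[OF d(1)] by (auto simp: \<eta>_def H_def)
  have inj: "velocity P \<gamma> = (\<lambda>f. 0)"
    if g: "curve_in P S x0 \<gamma>" and dg: "((\<lambda>t. \<eta> (\<gamma> t)) has_vector_derivative 0) (at 0)" for \<gamma>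
  proof -
    have g': "curve_in N UNIV y0 (\<lambda>t. snd (\<gamma> t))"
      using curve_in_compose[OF P N g open_UNIV UNIV_I ssnd] x0(3) by auto
    obtain b where b: "((\<lambda>t. d (snd (\<gamma> t))) has_vector_derivative b) (at 0)" "velocity N (\<lambda>t. snd (\<gamma> t)) = cd b"
      unfolding cd_def using curve_velocity[OF N d g'] by metis
    have "b = 0" using dg b(1) vector_derivative_unique_at unfolding \<eta>_def by blast
    then have vs: "pushforward snd (velocity P \<gamma>) = (\<lambda>f. 0)" using b(2) z(2) pv(2) by simp
    have gT: "velocity P \<gamma> \<in> tangent_space P S x0" using g unfolding tangent_space_curves by blast
    then obtain w where w: "w \<in> Fe" "velocity P \<gamma> = ce w" unfolding TS by blast
    have wP: "w \<in> model P" using w Fe by blast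
    have "cd' (A' w) = cd' 0" using vs w(2) Ap(2)[OF wP] z(3) by simp
    then have A'w: "A' w = 0" using icd' A'(2)[OF wP] z0 by (auto dest: inj_onD)
    define u where "u = pushforward fst (velocity P \<gamma>)"
    have uB: "u \<in> tangent_space N B y0" unfolding u_def using push[OF x0(1)] gT x0(2) by auto
    then obtain \<beta> where \<beta>: "curve_in N B y0 \<beta>" "u = velocity N \<beta>" unfolding tangent_space_curves by blast
    \<comment> \<open>The diagonal of \<open>B\<close> lies in the total space, hence
      \<open>(u, u)\<close> is tangent to it.\<close>
    have "curve_in P S (y0, y0) (\<lambda>t. (\<beta> t, \<beta> t))"
    proof (rule curve_in_compose[OF N P \<beta>(1) open_UNIV UNIV_I])
      show "smooth_map_on N P (B \<inter> UNIV) (\<lambda>y. (y, y))"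
        unfolding P_def by (intro smooth_map_on_Pair[OF N N N] smooth_map_on_id N)
    qed (use diag in auto)
    then have "velocity P (\<lambda>t. (\<beta> t, \<beta> t)) \<in> tangent_space P S x0" unfolding tangent_space_curves x0_def by blast
    then obtain w' where w': "w' \<in> Fe" "velocity P (\<lambda>t. (\<beta> t, \<beta> t)) = ce w'" unfolding TS by blast
    have wP': "w' \<in> model P" using w' Fe by blast
    have pb: "pushforward fst (ce w') = u" "pushforward snd (ce w') = u"
      unfolding w'(2)[symmetric] pv \<beta>(2) by simp_all
    have "cd (A w') = cd (A w)" using pb(1) Ap(1)[OF wP'] Ap(1)[OF wP] w(2) by (simp add: u_def)
    then have "A w' = A w" using icd A(2)[OF wP] A(2)[OF wP'] by (auto dest: inj_onD)
    \<comment> \<open>\<open>w\<close> stands for \<open>(u, 0)\<close> and \<open>w'\<close> for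
      \<open>(u, u)\<close>, so the difference is vertical with second component
      \<open>u\<close>.\<close>
    then have "w' - w \<in> K" using w(1) w'(1) Fe(1) by (simp add: K_def subspace_diff linear_diff[OF A(1)])
    then have "A' (w' - w) \<in> FF" by (rule kernel)
    then have "A' w' \<in> FF" using A'w by (simp add: linear_diff[OF A'(1)])
    then have uF: "u \<in> tangent_space N (F y0) y0" using pb(2) Ap(2)[OF wP'] TF by auto
    have "u = (\<lambda>f. 0)"
      by (rule lagrangian_transverse_Int[OF N symp lF lB rFy(3)[OF y0] uF uB])
    then show ?thesis using zeroI[OF g _ vs] by (simp add: u_def)
  qed
  obtain D where D: "open D" "x0 \<in> D" "D \<subseteq> H" "inj_on \<eta> (S \<inter> D)" "openin (top_of_set (model N)) (\<eta> ` (S \<inter> D))"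
    "smooth_map_on euclid P (\<eta> ` (S \<inter> D)) (inv_into (S \<inter> D) \<eta>)"
    by (rule local_diffeo[OF P e x0(1) Fe slS H s\<eta> \<eta>G subspace_model[OF N] dFe inj])
  have injs: "inj_on snd (S \<inter> D)" using D(4) unfolding inj_on_def \<eta>_def by metis
  obtain W where W: "open W" "\<eta> ` (S \<inter> D) = model N \<inter> W" using D(5) unfolding openin_open by (elim exE conjE)
  have im: "snd ` (S \<inter> D) = V \<inter> d -` W"
  proof (intro subset_antisym subsetI)
    fix q assume "q \<in> snd ` (S \<inter> D)"
    then obtain x where x: "x \<in> S \<inter> D" "q = snd x" by blast
    then have "d q \<in> W" using W(2) by (auto simp: \<eta>_def)
    then show "q \<in> V \<inter> d -` W" using x D(3) by (auto simp: H_def)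
  next
    fix q assume q: "q \<in> V \<inter> d -` W"
    then have "d q \<in> \<eta> ` (S \<inter> D)" unfolding W(2) using chart_in_model[OF d(1)] by blast
    then obtain x where x: "x \<in> S \<inter> D" "d q = d (snd x)" by (auto simp: \<eta>_def)
    then have "q = snd x" using q D(3) inj_onD[OF chartsD(5)[OF d(1)]] by (auto simp: H_def)
    then show "q \<in> snd ` (S \<inter> D)" using x by blast
  qed
  have op: "open (snd ` (S \<inter> D))"
    unfolding im by (rule continuous_open_preimage[OF chartsD(3)[OF d(1)] chartsD(1)[OF d(1)] W(1)])
  have "smooth_map_on N P (snd ` (S \<inter> D)) (\<lambda>q. inv_into (S \<inter> D) \<eta> (d q))"
  proof (rule smooth_map_on_compose[OF N smooth_manifold_euclid P
        smooth_map_on_subset[OF smooth_map_on_chart[OF N d(1)]] D(6)])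
    show "snd ` (S \<inter> D) \<subseteq> V" unfolding im by blast
    show "d ` snd ` (S \<inter> D) \<subseteq> \<eta> ` (S \<inter> D)" by (auto simp: \<eta>_def)
  qed
  then have "smooth_map_on N P (snd ` (S \<inter> D)) (inv_into (S \<inter> D) snd)"
  proof (rule smooth_map_on_cong[OF N P])
    fix q assume "q \<in> snd ` (S \<inter> D)"
    then obtain x where x: "x \<in> S \<inter> D" "q = snd x" by blast
    then have "inv_into (S \<inter> D) \<eta> (d q) = x" using inv_into_f_f[OF D(4) x(1)] by (simp add: \<eta>_def)
    then show "inv_into (S \<inter> D) \<eta> (d q) = inv_into (S \<inter> D) snd q" using x inv_into_f_f[OF injs x(1)] by simp
  qed
  then show ?thesis using that[OF D(1)] D(2) injs op unfolding S_def P_def x0_def by blast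
qed

section \<open>From local inverses to a retraction\<close>

lemma germ_eqI:
  assumes G: "open G" "C \<subseteq> G" "S \<inter> G = S' \<inter> G" shows "germ C S = germ C S'"
proof -
  have sub: "germ C X \<subseteq> germ C Y" if XY: "X \<inter> G = Y \<inter> G" for X Y
  proof
    fix T assume "T \<in> germ C X"
    then obtain W where W: "open W" "C \<subseteq> W" "X \<inter> W = T \<inter> W" unfolding germ_def by blast
    have "Y \<inter> (W \<inter> G) = T \<inter> (W \<inter> G)" using W(3) XY by blast
    then show "T \<in> germ C Y"
      unfolding germ_def using W(1,2) G(1,2) by (intro CollectI exI[of _ "W \<inter> G"]) auto
  qed
  show ?thesis using sub[OF G(3)] sub[OF G(3)[symmetric]] by (rule subset_antisym)
qed

text \<open>One open set \<open>Z\<close> of the product cuts the fibres for all \<open>y\<close> at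
  once, so the total space is merely restricted to an open part of itself and every condition is
  preserved; since \<open>Z\<close> contains the core, the germs do not change.\<close>

lemma lagrangian_fibration_rep_open:
  fixes M :: "('m::{t2_space,second_countable_topology}, 'e::euclidean_space) manifold"
    and N :: "('n::{t2_space,second_countable_topology}, 'f::euclidean_space) manifold"
  assumes rep: "lagrangian_fibration_rep M \<omega> A N B \<phi> F" and Z: "open Z"
    and core: "\<And>y. y \<in> B \<Longrightarrow> (y, \<phi> y) \<in> Z"
    and F': "\<And>y. y \<in> B \<Longrightarrow> F' y = {p \<in> F y. (y, p) \<in> Z}"
  shows "lagrangian_fibration_rep M \<omega> A N B \<phi> F'" "germs_along \<phi> B F = germs_along \<phi> B F'"
proof -
  note rep' = rep[unfolded lagrangian_fibration_rep_def lagrangian_submicrofold_def]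
  define Zy where "Zy y = {p. (y, p) \<in> Z}" for y
  have Zy: "open (Zy y)" for y
  proof -
    have "Zy y = Pair y -` Z" by (auto simp: Zy_def)
    moreover have "open (Pair y -` Z)" by (intro open_vimage Z) (auto intro!: continuous_intros)
    ultimately show ?thesis by simp
  qed
  have F'Z: "F' y = F y \<inter> Zy y" and coreZ: "\<phi> y \<in> Zy y" if "y \<in> B" for y
    using F'[OF that] core[OF that] by (auto simp: Zy_def)
  have fib: "lagrangian_submicrofold M \<omega> A (F' y) {\<phi> y} \<and>
      transverse_at M (\<phi> y) (tangent_space M (F' y) (\<phi> y)) (tangent_space M A (\<phi> y))" if y: "y \<in> B" for y
  proof -
    have r: "lagrangian M \<omega> (F y)" "submanifold M {\<phi> y}" "{\<phi> y} \<subseteq> A" "F y \<inter> A = {\<phi> y}"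
      "transverse_at M (\<phi> y) (tangent_space M (F y) (\<phi> y)) (tangent_space M A (\<phi> y))"
      using rep'[THEN conjunct1, rule_format, OF y] by simp_all
    have in': "\<phi> y \<in> F' y" using r(4) F'Z[OF y] coreZ[OF y] by blast
    have "closedin (top_of_set (F' y)) {\<phi> y}" using in' by (intro closed_subset) auto
    moreover have "lagrangian M \<omega> (F' y)" unfolding F'Z[OF y] by (rule lagrangian_open[OF r(1) Zy])
    moreover have "F' y \<inter> A = {\<phi> y}" using r(4) in' F'Z[OF y] by blast
    moreover have "tangent_space M (F' y) (\<phi> y) = tangent_space M (F y) (\<phi> y)"
      by (rule tangent_space_open[OF Zy coreZ[OF y]]) (use F'Z[OF y] in blast)
    ultimately show ?thesis using r(2,3,5) by (simp add: lagrangian_submicrofold_def)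
  qed
  have S: "Sigma B F' = Sigma B F \<inter> Z" using F' by auto
  have sub: "submanifold (N \<times>\<^sub>M M) (Sigma B F')"
    unfolding S by (rule submanifold_open[OF rep'[THEN conjunct2, THEN conjunct1] Z])
  have push: "pushforward fst ` tangent_space (N \<times>\<^sub>M M) (Sigma B F') p = tangent_space N B (fst p)"
    if p: "p \<in> Sigma B F'" for p
  proof -
    have pS: "p \<in> Sigma B F" "p \<in> Z" using p S by blast+
    have "tangent_space (N \<times>\<^sub>M M) (Sigma B F') p = tangent_space (N \<times>\<^sub>M M) (Sigma B F) p"
      by (rule tangent_space_open[OF Z pS(2)]) (use S in blast)
    then show ?thesis using bspec[OF rep'[THEN conjunct2, THEN conjunct2] pS(1)] by (simp only:)
  qed
  show "lagrangian_fibration_rep M \<omega> A N B \<phi> F'"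
    unfolding lagrangian_fibration_rep_def using fib sub push by blast
  show "germs_along \<phi> B F = germs_along \<phi> B F'"
    unfolding germs_along_def
  proof (rule restrict_ext)
    fix y assume y: "y \<in> B"
    have FZ: "F y \<inter> Zy y = F' y \<inter> Zy y" using F'Z[OF y] by blast
    show "germ {\<phi> y} (F y) = germ {\<phi> y} (F' y)"
      by (rule germ_eqI[OF Zy _ FZ]) (use coreZ[OF y] in simp)
  qed
qed

lemma top_embeddingI:
  assumes f: "continuous_on X f" and inj: "inj_on f X" and inv: "continuous_on (f ` X) (inv_into X f)"
  shows "top_embedding X f"
  unfolding top_embedding_def
proof (intro conjI ballI allI impI)
  fix x D assume x: "x \<in> X" and D: "open D \<and> x \<in> D"
  then obtain G where G: "open G" "inv_into X f -` D \<inter> f ` X = G \<inter> f ` X"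
    using inv unfolding continuous_on_open_invariant by metis
  have i: "inv_into X f (f y) = y" if "y \<in> X" for y using inj that by (rule inv_into_f_f)
  have "f x \<in> G" using G(2) x D i by blast
  moreover have "y \<in> D" if "y \<in> X" "f y \<in> G" for y
  proof -
    have "f y \<in> inv_into X f -` D" using G(2) that by blast
    then show ?thesis using i[OF that(1)] by simp
  qed
  ultimately show "\<exists>G. open G \<and> f x \<in> G \<and> X \<inter> f -` G \<subseteq> D" using G(1) by blast
qed (rule f)

text \<open>Once \<open>snd\<close> is injective on a neighbourhood of the diagonal in the total
  space, its inverse followed by \<open>fst\<close> is the retraction, and the sets
  \<open>{q \<in> W. r q = y}\<close> are the given fibres cut down by \<open>Z\<close>.\<close>

lemma fibration_retraction:
  fixes N :: "('n::{t2_space,second_countable_topology}, 'f::euclidean_space) manifold"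
  assumes N: "smooth_manifold N" and symp: "\<And>y. symplectic_at N \<omega> y" and B: "lagrangian N \<omega> B" "closed B"
    and rep: "lagrangian_fibration_rep N \<omega> B N B (\<lambda>y. y) F"
  obtains W r where "open W" "B \<subseteq> W" "smooth_map_on N N W r" "r ` W \<subseteq> B" "\<And>y. y \<in> B \<Longrightarrow> r y = y"
    "lagrangian_fibration_rep N \<omega> B N B (\<lambda>y. y) (\<lambda>y. {q \<in> W. r q = y})"
    "germs_along (\<lambda>y. y) B F = germs_along (\<lambda>y. y) B (\<lambda>y. {q \<in> W. r q = y})"
proof -
  define S where "S = Sigma B F"
  have P: "smooth_manifold (N \<times>\<^sub>M N)" by (rule smooth_manifold_prod[OF N N])
  have FB: "F y \<inter> B = {y}" if "y \<in> B" for y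
    using rep[unfolded lagrangian_fibration_rep_def lagrangian_submicrofold_def, THEN conjunct1, rule_format, OF that]
    by simp
  have "\<forall>y\<in>B. \<exists>D. open D \<and> (y, y) \<in> D \<and> inj_on snd (S \<inter> D) \<and> open (snd ` (S \<inter> D)) \<and>
      smooth_map_on N (N \<times>\<^sub>M N) (snd ` (S \<inter> D)) (inv_into (S \<inter> D) snd)"
    using fibration_local[OF N symp B(1) rep] unfolding S_def by metis
  then obtain D where D: "\<And>y. y \<in> B \<Longrightarrow> open (D y)" "\<And>y. y \<in> B \<Longrightarrow> (y, y) \<in> D y"
    "\<And>y. y \<in> B \<Longrightarrow> inj_on snd (S \<inter> D y)" "\<And>y. y \<in> B \<Longrightarrow> open (snd ` (S \<inter> D y))"
    "\<And>y. y \<in> B \<Longrightarrow> smooth_map_on N (N \<times>\<^sub>M N) (snd ` (S \<inter> D y)) (inv_into (S \<inter> D y) snd)"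
    by metis
  define C where "C = (\<lambda>y. (y, y)) ` B"
  have CS: "C \<subseteq> S" using FB by (auto simp: C_def S_def)
  have sC: "snd ` C = B" by (auto simp: C_def image_iff)
  have cs: "continuous_on X snd" for X :: "('n \<times> 'n) set" by (intro continuous_on_snd continuous_on_id)
  have eC: "top_embedding C snd"
    unfolding top_embedding_def
  proof (intro conjI ballI allI impI cs)
    fix x G assume x: "x \<in> C" and G: "open G \<and> x \<in> G"
    have "open ((\<lambda>y. (y, y)) -` G)" using G by (intro open_vimage) (auto intro!: continuous_intros)
    then show "\<exists>H. open H \<and> snd x \<in> H \<and> C \<inter> snd -` H \<subseteq> G"
      using x G by (intro exI[of _ "(\<lambda>y. (y, y)) -` G"]) (auto simp: C_def)
  qed
  have loc: "\<exists>D. open D \<and> x \<in> D \<and> top_embedding (S \<inter> D) snd" if x: "x \<in> C" for x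
  proof -
    obtain y where y: "y \<in> B" "x = (y, y)" using x unfolding C_def by blast
    have "top_embedding (S \<inter> D y) snd"
      by (rule top_embeddingI[OF cs D(3)[OF y(1)] smooth_map_on_continuous[OF D(5)[OF y(1)]]])
    then show ?thesis using D(1,2)[OF y(1)] y(2) by blast
  qed
  \<comment> \<open>Gluing along the diagonal, whose image under \<open>snd\<close> is the closed
    set \<open>B\<close>.\<close>
  obtain Z0 where Z0: "open Z0" "C \<subseteq> Z0" "top_embedding (S \<inter> Z0) snd"
    using embedding_neighbourhood[OF regular_manifold[OF N] cs CS _ eC loc] B(2) sC by metis
  \<comment> \<open>\<open>Z0\<close> provides injectivity on the whole neighbourhood, the sets
    \<open>D y\<close> provide openness of the image and smoothness of the inverse.\<close>
  define Z where "Z = Z0 \<inter> (\<Union>y\<in>B. D y)"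
  have Z: "open Z" unfolding Z_def using Z0(1) D(1) by (intro open_Int open_UN) auto
  have diagZ: "(y, y) \<in> S \<inter> Z" if "y \<in> B" for y
    using that D(2)[OF that] Z0(2) CS by (auto simp: Z_def C_def)
  have inj: "inj_on snd (S \<inter> Z)"
    using top_embedding_inj[OF Z0(3)] by (rule inj_on_subset) (auto simp: Z_def)
  define i where "i = inv_into (S \<inter> Z) snd"
  define r where "r q = fst (i q)" for q
  define W where "W = snd ` (S \<inter> Z)"
  have ii: "i (snd x) = x" if "x \<in> S \<inter> Z" for x unfolding i_def using inj that by (rule inv_into_f_f)
  have piece: "open (snd ` (S \<inter> D y \<inter> Z)) \<and> smooth_map_on N (N \<times>\<^sub>M N) (snd ` (S \<inter> D y \<inter> Z)) i" if y: "y \<in> B" for y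
  proof
    have ij: "inv_into (S \<inter> D y) snd (snd x) = x" if "x \<in> S \<inter> D y" for x
      using D(3)[OF y] that by (rule inv_into_f_f)
    have "snd ` (S \<inter> D y \<inter> Z) = snd ` (S \<inter> D y) \<inter> inv_into (S \<inter> D y) snd -` Z"
    proof (intro subset_antisym subsetI)
      fix q assume "q \<in> snd ` (S \<inter> D y) \<inter> inv_into (S \<inter> D y) snd -` Z"
      then obtain x where x: "x \<in> S \<inter> D y" "q = snd x" "inv_into (S \<inter> D y) snd q \<in> Z" by blast
      then have "x \<in> Z" using ij[OF x(1)] by simp
      then show "q \<in> snd ` (S \<inter> D y \<inter> Z)" using x by blast
    next
      fix q assume "q \<in> snd ` (S \<inter> D y \<inter> Z)"
      then obtain x where x: "x \<in> S \<inter> D y" "x \<in> Z" "q = snd x" by blast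
      then show "q \<in> snd ` (S \<inter> D y) \<inter> inv_into (S \<inter> D y) snd -` Z" using ij[OF x(1)] by simp
    qed
    then show "open (snd ` (S \<inter> D y \<inter> Z))"
      using continuous_open_preimage[OF smooth_map_on_continuous[OF D(5)[OF y]] D(4)[OF y] Z] by simp
    show "smooth_map_on N (N \<times>\<^sub>M N) (snd ` (S \<inter> D y \<inter> Z)) i"
    proof (rule smooth_map_on_cong[OF N P smooth_map_on_subset[OF D(5)[OF y]]])
      fix q assume "q \<in> snd ` (S \<inter> D y \<inter> Z)"
      then obtain x where x: "x \<in> S \<inter> D y" "x \<in> Z" "q = snd x" by blast
      then show "inv_into (S \<inter> D y) snd q = i q" using ij[OF x(1)] ii[of x] by simp
    qed auto
  qed
  have Wun: "W = (\<Union>y\<in>B. snd ` (S \<inter> D y \<inter> Z))" unfolding W_def by (auto simp: Z_def)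
  have W: "open W" unfolding Wun using piece by blast
  have BW: "B \<subseteq> W" unfolding W_def using diagZ by force
  have "smooth_map_on N (N \<times>\<^sub>M N) W i"
  proof (rule smooth_map_on_local[OF N P])
    fix q assume "q \<in> W"
    then obtain y where y: "y \<in> B" "q \<in> snd ` (S \<inter> D y \<inter> Z)" unfolding Wun by blast
    have "smooth_map_on N (N \<times>\<^sub>M N) (W \<inter> snd ` (S \<inter> D y \<inter> Z)) i"
      by (rule smooth_map_on_subset[OF piece[OF y(1), THEN conjunct2]]) blast
    then show "\<exists>G. open G \<and> q \<in> G \<and> smooth_map_on N (N \<times>\<^sub>M N) (W \<inter> G) i" using piece[OF y(1)] y(2) by blast
  qed
  then have sr: "smooth_map_on N N W r"
    unfolding r_def by (rule smooth_map_on_compose[OF N P N _ smooth_map_on_fst[OF N N] subset_UNIV])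
  have rB: "r ` W \<subseteq> B" unfolding r_def W_def using ii by (auto simp: S_def)
  have ry: "r y = y" if "y \<in> B" for y unfolding r_def using ii[OF diagZ[OF that]] by simp
  have fib: "{q \<in> W. r q = y} = {q \<in> F y. (y, q) \<in> Z}" if y: "y \<in> B" for y
  proof (intro subset_antisym subsetI)
    fix q assume q: "q \<in> {q \<in> W. r q = y}"
    then obtain x where x: "x \<in> S \<inter> Z" "q = snd x" unfolding W_def by blast
    then have "fst x = y" using q ii[OF x(1)] by (simp add: r_def)
    then have "(y, q) \<in> S \<inter> Z" using x by auto
    then show "q \<in> {q \<in> F y. (y, q) \<in> Z}" by (auto simp: S_def)
  next
    fix q assume "q \<in> {q \<in> F y. (y, q) \<in> Z}"
    then have x: "(y, q) \<in> S \<inter> Z" using y by (auto simp: S_def)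
    then have "q \<in> W" unfolding W_def by force
    moreover have "r q = y" using ii[OF x] by (simp add: r_def)
    ultimately show "q \<in> {q \<in> W. r q = y}" by simp
  qed
  have core: "(y, y) \<in> Z" if "y \<in> B" for y using diagZ[OF that] by blast
  show ?thesis
    by (rule that[OF W BW sr rB ry lagrangian_fibration_rep_open[OF rep Z core fib]])
qed

section \<open>Local structure of a symplectic micromorphism\<close>

lemma velocity_cong:
  fixes M :: "('m::topological_space, 'e::euclidean_space) manifold"
  assumes "open T" "0 \<in> T" "\<And>t. t \<in> T \<Longrightarrow> \<gamma> t = \<delta> t"
  shows "velocity M \<gamma> = velocity M \<delta>"
proof
  fix f :: "'m \<Rightarrow> real"
  have "\<forall>\<^sub>F t in nhds 0. f (\<gamma> t) = f (\<delta> t)" unfolding eventually_nhds using assms by metis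
  then have "deriv (\<lambda>t. f (\<gamma> t)) 0 = deriv (\<lambda>t. f (\<delta> t)) 0" by (rule deriv_cong_ev) simp
  then show "velocity M \<gamma> f = velocity M \<delta> f" unfolding velocity_def using assms(3)[OF assms(2)] by (simp only:)
qed

lemma velocity_apply_smooth:
  assumes "open W" "\<gamma> 0 \<in> W" "smooth_map_on M real_line W g"
  shows "velocity M \<gamma> g = deriv (\<lambda>t. g (\<gamma> t)) 0"
  unfolding velocity_def by (rule if_P) (use assms in blast)

text \<open>The tangent map of \<open>f\<close> is well defined: testing the composed curve on
  \<open>g\<close> amounts to testing the original curve on
  \<open>\<lambda>y. g (f y)\<close>.\<close>

lemma velocity_compose:
  assumes N: "smooth_manifold N" and M: "smooth_manifold M" and f: "smooth_map_on N M G f" and G: "open G" "x \<in> G"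
    and 0: "\<gamma> 0 = x" "\<delta> 0 = x" and eq: "velocity N \<gamma> = velocity N \<delta>"
  shows "velocity M (\<lambda>t. f (\<gamma> t)) = velocity M (\<lambda>t. f (\<delta> t))"
proof
  fix g
  show "velocity M (\<lambda>t. f (\<gamma> t)) g = velocity M (\<lambda>t. f (\<delta> t)) g"
  proof (cases "\<exists>W. open W \<and> f x \<in> W \<and> smooth_map_on M real_line W g")
    case True
    then obtain W where W: "open W" "f x \<in> W" "smooth_map_on M real_line W g" by blast
    have o: "open (G \<inter> f -` W)" by (rule continuous_open_preimage[OF smooth_map_on_continuous[OF f] G(1) W(1)])
    have s: "smooth_map_on N real_line (G \<inter> f -` W) (\<lambda>y. g (f y))"
      unfolding real_line_eq
      by (rule smooth_map_on_compose[OF N M smooth_manifold_euclid smooth_map_on_subset[OF f] W(3)[unfolded real_line_eq]]) auto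
    have "velocity N \<gamma> (\<lambda>y. g (f y)) = deriv (\<lambda>t. g (f (\<gamma> t))) 0"
      "velocity N \<delta> (\<lambda>y. g (f y)) = deriv (\<lambda>t. g (f (\<delta> t))) 0"
      by (rule velocity_apply_smooth[OF o _ s], use 0 G W in simp)+
    moreover have "velocity M (\<lambda>t. f (\<gamma> t)) g = deriv (\<lambda>t. g (f (\<gamma> t))) 0"
      "velocity M (\<lambda>t. f (\<delta> t)) g = deriv (\<lambda>t. g (f (\<delta> t))) 0"
      by (rule velocity_apply_smooth[OF W(1) _ W(3)], use 0 W in simp)+
    ultimately show ?thesis using eq by simp
  next
    case False
    show ?thesis
      using velocity_nonsmooth[of "\<lambda>t. f (\<gamma> t)" "f x" M g] velocity_nonsmooth[of "\<lambda>t. f (\<delta> t)" "f x" M g] 0 False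
      by simp
  qed
qed

lemma symplectic_at_anti:
  assumes "symplectic_at M \<omega> x" "u \<in> tangent_space M UNIV x" "v \<in> tangent_space M UNIV x"
  shows "\<omega> x u v = - \<omega> x v u"
  using assms(1)[unfolded symplectic_at_def, THEN conjunct1, rule_format, OF assms(2,3,2)] by blast

lemma symplectic_at_add_right:
  assumes w: "symplectic_at M \<omega> x" and u: "u \<in> tangent_space M UNIV x" and s: "s \<in> tangent_space M UNIV x"
    and t: "t \<in> tangent_space M UNIV x" and st: "(\<lambda>f. s f + t f) \<in> tangent_space M UNIV x"
  shows "\<omega> x u (\<lambda>f. s f + t f) = \<omega> x u s + \<omega> x u t"
proof -
  have "\<omega> x (\<lambda>f. 1 * s f + t f) u = 1 * \<omega> x s u + \<omega> x t u"
    using w[unfolded symplectic_at_def, THEN conjunct1, rule_format, OF s t u, of 1] by blast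
  then have "\<omega> x (\<lambda>f. s f + t f) u = \<omega> x s u + \<omega> x t u" by simp
  then show ?thesis
    using symplectic_at_anti[OF w u st] symplectic_at_anti[OF w u s] symplectic_at_anti[OF w u t] by simp
qed

text \<open>The chart coordinates of \<open>r q\<close> in \<open>B\<close> and the component of
  \<open>p\<close> transversal to \<open>A\<close> are shown to be coordinates on \<open>V\<close>
  near a core point. All reduces to \<open>local_diffeo\<close>, whose premise on curves is the
  kernel computation and whose premise on dimensions is a count of lagrangian halves.\<close>

lemma micromorphism_local:
  fixes M :: "('m::{t2_space,second_countable_topology}, 'e::euclidean_space) manifold"
    and N :: "('n::{t2_space,second_countable_topology}, 'f::euclidean_space) manifold"
  assumes M: "smooth_manifold M" and N: "smooth_manifold N"
    and wM: "\<And>x. symplectic_at M \<omega>\<^sub>M x" and wN: "\<And>y. symplectic_at N \<omega>\<^sub>N y"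
    and A: "lagrangian M \<omega>\<^sub>M A" and B: "lagrangian N \<omega>\<^sub>N B"
    and V: "lagrangian (M \<times>\<^sub>M N) (prod_form (opposite_form \<omega>\<^sub>M) \<omega>\<^sub>N) V" and grV: "gr \<phi> B \<subseteq> V"
    and \<phi>: "smooth_map_on N M B \<phi>" "\<phi> ` B \<subseteq> A" and y0: "y0 \<in> B"
    and tr: "transverse_at (M \<times>\<^sub>M N) (\<phi> y0, y0) (tangent_space (M \<times>\<^sub>M N) V (\<phi> y0, y0))
           {u \<in> tangent_space (M \<times>\<^sub>M N) UNIV (\<phi> y0, y0).
              pushforward fst u \<in> tangent_space M A (\<phi> y0) \<and> pushforward snd u \<in> K}"
    and W: "open W" "B \<subseteq> W" and r: "smooth_map_on N N W r" "r ` W \<subseteq> B" "\<And>y. y \<in> B \<Longrightarrow> r y = y"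
  obtains U c EA Y d FB p D where
    "(U, c) \<in> charts M" "subspace EA" "EA \<subseteq> model M" "c ` (U \<inter> A) = c ` U \<inter> EA"
    "(Y, d) \<in> charts N" "subspace FB" "FB \<subseteq> model N" "d ` (Y \<inter> B) = d ` Y \<inter> FB"
    "linear p" "p ` model M \<subseteq> model M" "\<And>z. p (p z) = p z" "\<And>z. z \<in> model M \<Longrightarrow> p z = 0 \<longleftrightarrow> z \<in> EA"
    "2 * dim (p ` model M) = dim (model M)"
    "open D" "(\<phi> y0, y0) \<in> D" "\<And>x y. (x, y) \<in> D \<Longrightarrow> x \<in> U \<and> y \<in> W \<and> r y \<in> Y"
    "inj_on (\<lambda>v. (d (r (snd v)), p (c (fst v)))) (V \<inter> D)"
    "openin (top_of_set (FB \<times> p ` model M)) ((\<lambda>v. (d (r (snd v)), p (c (fst v)))) ` (V \<inter> D))"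
    "smooth_map_on euclid (M \<times>\<^sub>M N) ((\<lambda>v. (d (r (snd v)), p (c (fst v)))) ` (V \<inter> D))
       (inv_into (V \<inter> D) (\<lambda>v. (d (r (snd v)), p (c (fst v)))))"
proof -
  define P where "P = M \<times>\<^sub>M N"
  define \<Omega> where "\<Omega> = prod_form (opposite_form \<omega>\<^sub>M) \<omega>\<^sub>N"
  define x0 where "x0 = (\<phi> y0, y0)"
  have P: "smooth_manifold P" unfolding P_def by (rule smooth_manifold_prod[OF M N])
  have wP: "symplectic_at P \<Omega> x0"
    unfolding P_def \<Omega>_def x0_def by (rule symplectic_at_prod[OF M N symplectic_at_opposite[OF wM] wN])
  have \<Omega>: "\<Omega> x0 u v = - \<omega>\<^sub>M (\<phi> y0) (pushforward fst u) (pushforward fst v) + \<omega>\<^sub>N y0 (pushforward snd u) (pushforward snd v)" for u v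
    by (simp add: \<Omega>_def x0_def prod_form_def opposite_form_def)
  have \<phi>A: "\<phi> y0 \<in> A" using \<phi>(2) y0 by blast
  have x0: "x0 \<in> V" using grV y0 by (auto simp: gr_def x0_def)
  obtain U c EA where c: "(U, c) \<in> charts M" "\<phi> y0 \<in> U" and EA: "subspace EA" "EA \<subseteq> model M"
    and slA: "c ` (U \<inter> A) = c ` U \<inter> EA"
    by (rule submanifoldE[OF A[unfolded lagrangian_def, THEN conjunct1] \<phi>A])
  obtain Y d FB where d: "(Y, d) \<in> charts N" "y0 \<in> Y" and FB: "subspace FB" "FB \<subseteq> model N"
    and slB: "d ` (Y \<inter> B) = d ` Y \<inter> FB"
    by (rule submanifoldE[OF B[unfolded lagrangian_def, THEN conjunct1] y0])
  obtain Ue e Fe where e: "(Ue, e) \<in> charts P" "x0 \<in> Ue" and Fe: "subspace Fe" "Fe \<subseteq> model P"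
    and slV: "e ` (Ue \<inter> V) = e ` Ue \<inter> Fe"
    by (rule submanifoldE[OF V[unfolded lagrangian_def, THEN conjunct1, folded P_def] x0])
  have TA: "tangent_space M A (\<phi> y0) = coord_vector M (U, c) (c (\<phi> y0)) ` EA"
    by (rule tangent_space_slice[OF M c \<phi>A EA slA])
  have TB: "tangent_space N B y0 = coord_vector N (Y, d) (d y0) ` FB"
    by (rule tangent_space_slice[OF N d y0 FB slB])
  have TV: "tangent_space P V x0 = coord_vector P (Ue, e) (e x0) ` Fe"
    by (rule tangent_space_slice[OF P e x0 Fe slV])
  have lA: "lagrangian_subspace M \<omega>\<^sub>M (\<phi> y0) (tangent_space M A (\<phi> y0))" using A \<phi>A unfolding lagrangian_def by blast
  have lB: "lagrangian_subspace N \<omega>\<^sub>N y0 (tangent_space N B y0)" using B y0 unfolding lagrangian_def by blast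
  have lV: "lagrangian_subspace P \<Omega> x0 (tangent_space P V x0)"
    using V x0 unfolding lagrangian_def P_def \<Omega>_def by blast
  have dA: "2 * dim EA = dim (model M)" by (rule lagrangian_subspace_dim[OF M wM c EA lA[unfolded TA]])
  have dB: "2 * dim FB = dim (model N)" by (rule lagrangian_subspace_dim[OF N wN d FB lB[unfolded TB]])
  have dV: "2 * dim Fe = dim (model M) + dim (model N)"
    using lagrangian_subspace_dim[OF P wP e Fe lV[unfolded TV]] dim_Times[OF subspace_model[OF M] subspace_model[OF N]]
    by (simp add: P_def model_prod)
  obtain q where q: "linear q" "\<And>x. q x \<in> EA" "\<And>x. x \<in> EA \<Longrightarrow> q x = x" using linear_projection[OF EA(1)] by metis
  \<comment> \<open>The range of \<open>p\<close> on the model is a complement of \<open>EA\<close>,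
    and \<open>p\<close> reads off the component in it.\<close>
  define p where "p = (\<lambda>z. z - q z)"
  have lp: "linear p" unfolding p_def by (intro linear_compose_sub linear_ident q(1))
  have bp: "bounded_linear p" using lp by (simp add: linear_conv_bounded_linear)
  have pE: "p ` model M \<subseteq> model M"
    using q(2) EA(2) subspace_model[OF M] by (auto simp: p_def intro!: subspace_diff)
  have pp: "p (p z) = p z" for z
  proof -
    have "q (z - q z) = q z - q (q z)" by (rule linear_diff[OF q(1)])
    then show ?thesis using q(3)[OF q(2)] by (simp add: p_def)
  qed
  have p0: "p z = 0 \<longleftrightarrow> z \<in> EA" for z unfolding p_def using q(2)[of z] q(3)[of z] by force
  have R: "subspace (p ` model M)" by (rule linear_subspace_image[OF lp subspace_model[OF M]])
  have dp: "dim (p ` model M) = dim EA"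
  proof -
    have "{v \<in> model M. p v = 0} = EA" using p0 EA(2) by blast
    then show ?thesis using rank_nullity_on(2)[OF lp subspace_model[OF M]] dA by simp
  qed
  define \<eta> where "\<eta> = (\<lambda>v. (d (r (snd v)), p (c (fst v))))"
  define Wr where "Wr = W \<inter> r -` Y"
  have Wr: "open Wr" unfolding Wr_def
    by (rule continuous_open_preimage[OF smooth_map_on_continuous[OF r(1)] W(1) chartsD(1)[OF d(1)]])
  define H where "H = U \<times> Wr"
  have H: "open H" "x0 \<in> H"
    unfolding H_def x0_def using Wr chartsD(1)[OF c(1)] c(2) d(2) y0 W(2) r(3)[OF y0] by (auto simp: open_Times Wr_def)
  have sfst: "smooth_map_on P M L fst" and ssnd: "smooth_map_on P N L snd" for L
    unfolding P_def by (rule smooth_map_on_fst[OF M N], rule smooth_map_on_snd[OF M N])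
  have srs: "smooth_map_on P N (L \<inter> H) (\<lambda>v. r (snd v))" for L
    by (rule smooth_map_on_compose[OF P N N ssnd r(1)]) (auto simp: H_def Wr_def)
  have s\<eta>: "smooth_map_on P euclid (V \<inter> H) \<eta>"
    unfolding \<eta>_def
  proof (rule smooth_map_on_euclid_Pair[OF P])
    show "smooth_map_on P euclid (V \<inter> H) (\<lambda>v. d (r (snd v)))"
      by (rule smooth_map_on_compose[OF P N smooth_manifold_euclid srs smooth_map_on_chart[OF N d(1)]])
        (auto simp: H_def Wr_def)
    have "smooth_map_on P euclid (V \<inter> H) (\<lambda>v. c (fst v))"
      by (rule smooth_map_on_compose[OF P M smooth_manifold_euclid sfst smooth_map_on_chart[OF M c(1)]])
        (auto simp: H_def)
    then show "smooth_map_on P euclid (V \<inter> H) (\<lambda>v. p (c (fst v)))"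
      by (rule smooth_map_on_euclid_linear[OF P _ lp])
  qed
  have \<eta>G: "\<eta> ` (V \<inter> H) \<subseteq> FB \<times> p ` model M"
  proof
    fix z assume "z \<in> \<eta> ` (V \<inter> H)"
    then obtain v where v: "v \<in> H" "z = \<eta> v" by blast
    have "r (snd v) \<in> B" "r (snd v) \<in> Y" "fst v \<in> U" using v(1) r(2) by (auto simp: H_def Wr_def)
    then have "d (r (snd v)) \<in> FB" "c (fst v) \<in> model M" using slice_mem[OF d(1) slB] chart_in_model[OF c(1)] by blast+
    then show "z \<in> FB \<times> p ` model M" unfolding v(2) \<eta>_def by (intro SigmaI imageI)
  qed
  have pv: "pushforward fst (velocity P \<gamma>) = velocity M (\<lambda>t. fst (\<gamma> t))"
    "pushforward snd (velocity P \<gamma>) = velocity N (\<lambda>t. snd (\<gamma> t))" for \<gamma>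
    unfolding P_def by (rule pushforward_fst_velocity[OF M N], rule pushforward_snd_velocity[OF M N])
  have pt: "pushforward fst u \<in> tangent_space M UNIV (\<phi> y0)" "pushforward snd u \<in> tangent_space N UNIV y0"
    if "u \<in> tangent_space P UNIV x0" for u
    using pushforward_tangent_UNIV[OF M N, of u "\<phi> y0" y0] that by (simp_all add: P_def x0_def)
  have inj: "velocity P \<gamma> = (\<lambda>f. 0)"
    if g: "curve_in P V x0 \<gamma>" and dg: "((\<lambda>t. \<eta> (\<gamma> t)) has_vector_derivative 0) (at 0)" for \<gamma>
  proof -
    define \<gamma>1 where "\<gamma>1 = (\<lambda>t. fst (\<gamma> t))"
    define \<gamma>2 where "\<gamma>2 = (\<lambda>t. snd (\<gamma> t))"
    have g1: "curve_in M UNIV (\<phi> y0) \<gamma>1"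
      using curve_in_compose[OF P M g open_UNIV UNIV_I sfst, of UNIV] by (simp add: x0_def \<gamma>1_def)
    have g2: "curve_in N UNIV y0 \<gamma>2"
      using curve_in_compose[OF P N g open_UNIV UNIV_I ssnd, of UNIV] by (simp add: x0_def \<gamma>2_def)
    have gT: "velocity P \<gamma> \<in> tangent_space P V x0" using g unfolding tangent_space_curves by blast
    have gU: "velocity P \<gamma> \<in> tangent_space P UNIV x0" using gT tangent_space_mono[OF subset_UNIV] by blast
    have g2T: "velocity N \<gamma>2 \<in> tangent_space N UNIV y0" using g2 unfolding tangent_space_curves by blast
    have dg': "((\<lambda>t. \<eta> (\<gamma> t)) has_vector_derivative (0, 0)) (at 0)" using dg by (simp add: zero_prod_def)
    have "((\<lambda>t. fst (\<eta> (\<gamma> t))) has_vector_derivative fst (0::'f, 0::'e)) (at 0)"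
      by (rule bounded_linear.has_vector_derivative[OF bounded_linear_fst dg'])
    then have dr: "((\<lambda>t. d (r (\<gamma>2 t))) has_vector_derivative 0) (at 0)" by (simp add: \<eta>_def \<gamma>2_def)
    have "((\<lambda>t. snd (\<eta> (\<gamma> t))) has_vector_derivative snd (0::'f, 0::'e)) (at 0)"
      by (rule bounded_linear.has_vector_derivative[OF bounded_linear_snd dg'])
    then have dp: "((\<lambda>t. p (c (\<gamma>1 t))) has_vector_derivative 0) (at 0)" by (simp add: \<eta>_def \<gamma>1_def)
    obtain a where a: "a \<in> model M" "((\<lambda>t. c (\<gamma>1 t)) has_vector_derivative a) (at 0)"
      "velocity M \<gamma>1 = coord_vector M (U, c) (c (\<phi> y0)) a" using curve_velocity[OF M c g1] by metis
    have "((\<lambda>t. p (c (\<gamma>1 t))) has_vector_derivative p a) (at 0)"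
      by (rule bounded_linear.has_vector_derivative[OF bp a(2)])
    then have "p a = 0" using dp vector_derivative_unique_at by blast
    then have v1A: "velocity M \<gamma>1 \<in> tangent_space M A (\<phi> y0)" unfolding TA a(3) using p0 by blast
    have "\<omega>\<^sub>N y0 (velocity N \<gamma>2) v = 0" if v: "v \<in> tangent_space N B y0" for v
    proof -
      obtain \<beta> where \<beta>: "curve_in N B y0 \<beta>" "v = velocity N \<beta>" using v unfolding tangent_space_curves by blast
      have \<phi>\<beta>: "curve_in M A (\<phi> y0) (\<lambda>t. \<phi> (\<beta> t))"
        by (rule curve_in_compose[OF N M \<beta>(1) open_UNIV UNIV_I]) (use \<phi> in auto)
      \<comment> \<open>A curve in \<open>B\<close> lifted to the graph of \<open>\<phi>\<close> has
        velocity tangent to \<open>V\<close>. The first components of this velocity and of the given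
        one are both tangent to \<open>A\<close>, so only the \<open>N\<close> part of the form
        survives.\<close>
      have "curve_in P V (\<phi> y0, y0) (\<lambda>t. (\<phi> (\<beta> t), \<beta> t))"
      proof (rule curve_in_compose[OF N P \<beta>(1) open_UNIV UNIV_I])
        show "smooth_map_on N P (B \<inter> UNIV) (\<lambda>y. (\<phi> y, y))"
          unfolding P_def using \<phi>(1) by (intro smooth_map_on_Pair[OF N M N] smooth_map_on_id N) simp
        show "(\<lambda>y. (\<phi> y, y)) ` (B \<inter> UNIV) \<subseteq> V" using grV by (simp add: gr_def)
      qed
      then have "velocity P (\<lambda>t. (\<phi> (\<beta> t), \<beta> t)) \<in> tangent_space P V x0"
        unfolding tangent_space_curves x0_def by blast
      then have "\<Omega> x0 (velocity P \<gamma>) (velocity P (\<lambda>t. (\<phi> (\<beta> t), \<beta> t))) = 0"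
        using lV gT unfolding lagrangian_subspace_def by blast
      moreover have "velocity M (\<lambda>t. \<phi> (\<beta> t)) \<in> tangent_space M A (\<phi> y0)"
        using \<phi>\<beta> unfolding tangent_space_curves by blast
      then have "\<omega>\<^sub>M (\<phi> y0) (velocity M \<gamma>1) (velocity M (\<lambda>t. \<phi> (\<beta> t))) = 0"
        using lA v1A unfolding lagrangian_subspace_def by blast
      ultimately show ?thesis unfolding \<Omega> pv using \<beta>(2) by (simp add: \<gamma>1_def \<gamma>2_def)
    qed
    then have "velocity N \<gamma>2 \<in> tangent_space N B y0" using lB g2T unfolding lagrangian_subspace_def by blast
    then obtain \<beta> where \<beta>: "curve_in N B y0 \<beta>" "velocity N \<gamma>2 = velocity N \<beta>" unfolding tangent_space_curves by blast
    obtain T where T: "open T" "0 \<in> T" "\<beta> ` T \<subseteq> B" "\<beta> 0 = y0"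
      using curve_inE[OF \<beta>(1) open_UNIV UNIV_I] by (metis Int_UNIV_right)
    have g20: "\<gamma>2 0 = y0" using g2 unfolding curve_in_def by blast
    have y0W: "y0 \<in> W" using y0 W by blast
    \<comment> \<open>The velocity of \<open>\<gamma>2\<close> is also that of a curve
      \<open>\<beta>\<close> in \<open>B\<close>, which \<open>r\<close> fixes pointwise; this is
      how the differential of \<open>r\<close> is seen to be the identity on
      \<open>TB\<close>.\<close>
    have "velocity N (\<lambda>t. r (\<gamma>2 t)) = velocity N (\<lambda>t. r (\<beta> t))"
      by (rule velocity_compose[OF N N r(1) W(1) y0W g20 T(4) \<beta>(2)])
    also have "\<dots> = velocity N \<beta>" by (rule velocity_cong[OF T(1,2)]) (use T(3) r(3) in blast)
    finally have v2: "velocity N (\<lambda>t. r (\<gamma>2 t)) = velocity N \<gamma>2" using \<beta>(2) by simp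
    have "curve_in N UNIV (r y0) (\<lambda>t. r (\<gamma>2 t))"
      by (rule curve_in_compose[OF N N g2 W(1) y0W]) (use r(1) in auto)
    then have "curve_in N UNIV y0 (\<lambda>t. r (\<gamma>2 t))" using r(3)[OF y0] by simp
    then obtain b where b: "((\<lambda>t. d (r (\<gamma>2 t))) has_vector_derivative b) (at 0)"
      "velocity N (\<lambda>t. r (\<gamma>2 t)) = coord_vector N (Y, d) (d y0) b" using curve_velocity[OF N d] by metis
    have "b = 0" using dr b(1) vector_derivative_unique_at by blast
    then have v20: "velocity N \<gamma>2 = (\<lambda>f. 0)" using b(2) v2 coord_vector_0[OF N d] by simp
    have "\<Omega> x0 (velocity P \<gamma>) v = 0" if v: "v \<in> tangent_space P UNIV x0" for v
    proof -
      obtain s t where st: "s \<in> tangent_space P V x0" "t \<in> tangent_space P UNIV x0"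
        "pushforward fst t \<in> tangent_space M A (\<phi> y0)" "v = (\<lambda>f. s f + t f)"
        using tr v unfolding transverse_at_def P_def[symmetric] x0_def[symmetric] by blast
      have sU: "s \<in> tangent_space P UNIV x0" using st(1) tangent_space_mono[OF subset_UNIV] by blast
      have "\<Omega> x0 (velocity P \<gamma>) s = 0" using lV gT st(1) unfolding lagrangian_subspace_def by blast
      moreover have "\<omega>\<^sub>M (\<phi> y0) (velocity M \<gamma>1) (pushforward fst t) = 0"
        using lA v1A st(3) unfolding lagrangian_subspace_def by blast
      \<comment> \<open>Both factors contribute zero: the first components lie in the lagrangian
        \<open>TA\<close>, and the second component of the given velocity vanishes.\<close>
      then have "\<Omega> x0 (velocity P \<gamma>) t = 0"
        unfolding \<Omega> pv using v20 symplectic_at_0(1)[OF N wN pt(2)[OF st(2)]] by (simp add: \<gamma>1_def \<gamma>2_def)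
      ultimately show ?thesis
        using symplectic_at_add_right[OF wP gU sU st(2)] v st(4) by simp
    qed
    then show ?thesis using wP gU unfolding symplectic_at_def by blast
  qed
  \<comment> \<open>All are halves: \<open>Fe\<close> of the product model, \<open>FB\<close> of
    \<open>model N\<close>, and the range of \<open>p\<close>, like \<open>EA\<close>, of
    \<open>model M\<close>.\<close>
  have dG: "dim Fe = dim (FB \<times> p ` model M)" using dim_Times[OF FB(1) R] dp dA dB dV by simp
  obtain D where D: "open D" "x0 \<in> D" "D \<subseteq> H" "inj_on \<eta> (V \<inter> D)"
    "openin (top_of_set (FB \<times> p ` model M)) (\<eta> ` (V \<inter> D))"
    "smooth_map_on euclid P (\<eta> ` (V \<inter> D)) (inv_into (V \<inter> D) \<eta>)"
    by (rule local_diffeo[OF P e x0 Fe slV H s\<eta> \<eta>G subspace_Times[OF FB(1) R] dG inj])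
  show ?thesis
  proof (rule that[OF c(1) EA slA d(1) FB slB lp pE pp p0 _ D(1)])
    show "(\<phi> y0, y0) \<in> D" using D(2) by (simp add: x0_def)
    show "x \<in> U \<and> y \<in> W \<and> r y \<in> Y" if "(x, y) \<in> D" for x y using that D(3) by (auto simp: H_def Wr_def)
    show "2 * dim (p ` model M) = dim (model M)" using dp dA by simp
  qed (use D(4,5,6) in \<open>simp_all add: \<eta>_def P_def\<close>)
qed

section \<open>The fibration induced on the source\<close>

text \<open>The linear map \<open>p\<close> projects along the subspace \<open>EA\<close> modelling \<open>A\<close>, and
  \<open>(x, q) \<mapsto> (r q, p x)\<close>, read in the charts, is a coordinate system of \<open>V \<inter> D\<close>.\<close>

definition adapted where
  "adapted M N A B r W V U c EA Y d FB p D \<longleftrightarrow>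
    (U, c) \<in> charts M \<and> subspace EA \<and> EA \<subseteq> model M \<and> c ` (U \<inter> A) = c ` U \<inter> EA \<and>
    (Y, d) \<in> charts N \<and> subspace FB \<and> FB \<subseteq> model N \<and> d ` (Y \<inter> B) = d ` Y \<inter> FB \<and>
    linear p \<and> p ` model M \<subseteq> model M \<and> (\<forall>z. p (p z) = p z) \<and> (\<forall>z\<in>model M. p z = 0 \<longleftrightarrow> z \<in> EA) \<and>
    2 * dim (p ` model M) = dim (model M) \<and>
    open D \<and> (\<forall>x y. (x, y) \<in> D \<longrightarrow> x \<in> U \<and> y \<in> W \<and> r y \<in> Y) \<and>
    inj_on (\<lambda>v. (d (r (snd v)), p (c (fst v)))) (V \<inter> D) \<and>
    openin (top_of_set (FB \<times> p ` model M)) ((\<lambda>v. (d (r (snd v)), p (c (fst v)))) ` (V \<inter> D)) \<and>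
    smooth_map_on euclid (M \<times>\<^sub>M N) ((\<lambda>v. (d (r (snd v)), p (c (fst v)))) ` (V \<inter> D))
       (inv_into (V \<inter> D) (\<lambda>v. (d (r (snd v)), p (c (fst v)))))"

lemma adapted_restrict:
  fixes M :: "('m::{t2_space,second_countable_topology}, 'e::euclidean_space) manifold"
    and N :: "('n::{t2_space,second_countable_topology}, 'f::euclidean_space) manifold"
  assumes M: "smooth_manifold M" and N: "smooth_manifold N"
    and ad: "adapted M N A B r W V U c EA Y d FB p D" and Z: "open Z"
  shows "adapted M N A B r W (V \<inter> Z) U c EA Y d FB p (D \<inter> Z)"
proof -
  define \<eta> where "\<eta> = (\<lambda>v. (d (r (snd v)), p (c (fst v))))"
  note ad' = ad[unfolded adapted_def, folded \<eta>_def]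
  define X where "X = V \<inter> D"
  define \<sigma> where "\<sigma> = inv_into X \<eta>"
  have inj: "inj_on \<eta> X" and op: "openin (top_of_set (FB \<times> p ` model M)) (\<eta> ` X)"
    and sm: "smooth_map_on euclid (M \<times>\<^sub>M N) (\<eta> ` X) \<sigma>" and D: "open D"
    using ad' unfolding X_def \<sigma>_def by simp_all
  have X': "V \<inter> Z \<inter> (D \<inter> Z) = X \<inter> Z" by (auto simp: X_def)
  have \<sigma>: "\<sigma> (\<eta> v) = v" if "v \<in> X" for v unfolding \<sigma>_def using inj that by (rule inv_into_f_f)
  have inj': "inj_on \<eta> (X \<inter> Z)" using inj by (rule inj_on_subset) auto
  have im: "\<eta> ` (X \<inter> Z) = \<eta> ` X \<inter> \<sigma> -` Z"
  proof (intro subset_antisym subsetI)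
    fix q assume "q \<in> \<eta> ` X \<inter> \<sigma> -` Z"
    then obtain v where v: "v \<in> X" "q = \<eta> v" "\<sigma> q \<in> Z" by blast
    then have "v \<in> Z" using \<sigma>[OF v(1)] by simp
    then show "q \<in> \<eta> ` (X \<inter> Z)" using v by blast
  next
    fix q assume "q \<in> \<eta> ` (X \<inter> Z)"
    then obtain v where v: "v \<in> X" "v \<in> Z" "q = \<eta> v" by blast
    then show "q \<in> \<eta> ` X \<inter> \<sigma> -` Z" using \<sigma>[OF v(1)] by simp
  qed
  have "openin (top_of_set (\<eta> ` X)) (\<eta> ` X \<inter> \<sigma> -` Z)"
    by (rule continuous_openin_preimage_gen[OF smooth_map_on_continuous[OF sm] Z])
  then have op': "openin (top_of_set (FB \<times> p ` model M)) (\<eta> ` (X \<inter> Z))"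
    unfolding im using op by (rule openin_trans)
  have sm': "smooth_map_on euclid (M \<times>\<^sub>M N) (\<eta> ` (X \<inter> Z)) (inv_into (X \<inter> Z) \<eta>)"
  proof (rule smooth_map_on_cong[OF smooth_manifold_euclid smooth_manifold_prod[OF M N] smooth_map_on_subset[OF sm]])
    fix q assume "q \<in> \<eta> ` (X \<inter> Z)"
    then obtain v where v: "v \<in> X \<inter> Z" "q = \<eta> v" by blast
    then show "\<sigma> q = inv_into (X \<inter> Z) \<eta> q" using \<sigma>[of v] inv_into_f_f[OF inj' v(1)] by simp
  qed auto
  have "open (D \<inter> Z)" using D Z by (rule open_Int)
  then show ?thesis
    unfolding adapted_def \<eta>_def[symmetric] X' using ad' inj' op' sm' by simp blast
qed

text \<open>The situation after all shrinking: \<open>V\<close> lies over the domain of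
  \<open>r\<close> and is embedded as a whole by \<open>(r q, x)\<close>. In \<open>loc\<close> the
  coordinate domain around \<open>v\<close> also contains the core point of the fibre through
  \<open>v\<close>; this isolates \<open>\<phi> y\<close> among the points of \<open>A\<close> in
  that fibre.\<close>

locale fibred_relation =
  fixes M :: "('m::{t2_space,second_countable_topology}, 'e::euclidean_space) manifold"
    and N :: "('n::{t2_space,second_countable_topology}, 'f::euclidean_space) manifold"
    and \<omega>\<^sub>M :: "'m two_form" and \<omega>\<^sub>N :: "'n two_form"
    and A :: "'m set" and B :: "'n set" and \<phi> :: "'n \<Rightarrow> 'm"
    and r :: "'n \<Rightarrow> 'n" and W :: "'n set" and V :: "('m \<times> 'n) set"
  assumes M: "smooth_manifold M" and N: "smooth_manifold N"
    and wM: "\<And>x. symplectic_at M \<omega>\<^sub>M x"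
    and A: "lagrangian M \<omega>\<^sub>M A" and B: "lagrangian N \<omega>\<^sub>N B"
    and V: "lagrangian (M \<times>\<^sub>M N) (prod_form (opposite_form \<omega>\<^sub>M) \<omega>\<^sub>N) V" and grV: "gr \<phi> B \<subseteq> V"
    and \<phi>A: "\<phi> ` B \<subseteq> A"
    and W: "open W" "B \<subseteq> W" and r: "smooth_map_on N N W r" "r ` W \<subseteq> B" "\<And>y. y \<in> B \<Longrightarrow> r y = y"
    and fibre: "\<And>y. y \<in> B \<Longrightarrow> lagrangian N \<omega>\<^sub>N {q \<in> W. r q = y}"
    and VW: "\<And>v. v \<in> V \<Longrightarrow> snd v \<in> W"
    and emb: "top_embedding V (\<lambda>v. (r (snd v), fst v))"
    and loc: "\<And>v. v \<in> V \<Longrightarrow> \<exists>U c EA Y d FB p D. adapted M N A B r W V U c EA Y d FB p D \<and>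
      v \<in> D \<and> (\<phi> (r (snd v)), r (snd v)) \<in> D"
begin

definition f :: "'m \<times> 'n \<Rightarrow> 'n \<times> 'm" where "f v = (r (snd v), fst v)"

definition FA :: "'n \<Rightarrow> 'm set" where "FA y = {x. \<exists>q. (x, q) \<in> V \<and> r q = y}"

text \<open>Determined on \<open>FA y\<close> because \<open>f\<close> is injective on
  \<open>V\<close>; elsewhere the value is arbitrary.\<close>

definition \<Psi> :: "'n \<Rightarrow> 'm \<Rightarrow> 'n" where "\<Psi> y x = snd (inv_into V f (y, x))"

lemma P: "smooth_manifold (M \<times>\<^sub>M N)" by (rule smooth_manifold_prod[OF M N])

lemma f_eq: "f = (\<lambda>v. (r (snd v), fst v))" by (rule ext) (rule f_def)

lemma inj_f: "inj_on f V" unfolding f_eq by (rule top_embedding_inj[OF emb])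

lemma FA_iff: "x \<in> FA y \<longleftrightarrow> (y, x) \<in> f ` V"
  unfolding FA_def f_def by force

lemma Sigma_FA: "Sigma B FA = f ` V"
proof (intro subset_antisym subsetI)
  fix z assume z: "z \<in> f ` V"
  then obtain v where v: "v \<in> V" "z = f v" by blast
  then have "fst z \<in> B" using VW[OF v(1)] r(2) by (auto simp: f_def)
  moreover have "snd z \<in> FA (fst z)" using z by (simp add: FA_iff)
  ultimately show "z \<in> Sigma B FA" by (metis SigmaI prod.collapse)
qed (auto simp: FA_iff)

lemma Psi:
  assumes "x \<in> FA y" shows "(x, \<Psi> y x) \<in> V" "r (\<Psi> y x) = y"
proof -
  have "(y, x) \<in> f ` V" using assms by (simp add: FA_iff)
  then have i: "inv_into V f (y, x) \<in> V" "f (inv_into V f (y, x)) = (y, x)" by (rule inv_into_into, rule f_inv_into_f)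
  then have "fst (inv_into V f (y, x)) = x" "r (snd (inv_into V f (y, x))) = y" by (simp_all add: f_def)
  then show "(x, \<Psi> y x) \<in> V" "r (\<Psi> y x) = y" using i(1) unfolding \<Psi>_def by (metis prod.collapse)+
qed

lemma Psi_eq: "(x, q) \<in> V \<Longrightarrow> r q = y \<Longrightarrow> \<Psi> y x = q"
  unfolding \<Psi>_def using inv_into_f_f[OF inj_f, of "(x, q)"] by (simp add: f_def)

lemma FA_I: "(x, q) \<in> V \<Longrightarrow> x \<in> FA (r q)" unfolding FA_def by blast

lemma core: "y \<in> B \<Longrightarrow> (\<phi> y, y) \<in> V" using grV by (auto simp: gr_def)

lemma core_FA: "y \<in> B \<Longrightarrow> \<phi> y \<in> FA y" using FA_I[OF core] r(3) by fastforce

lemma Psi_core: "y \<in> B \<Longrightarrow> \<Psi> y (\<phi> y) = y" using Psi_eq[OF core] r(3) by blast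

text \<open>Near \<open>f v1\<close> the image of \<open>V\<close> under \<open>f\<close> is a
  graph: a point of \<open>V\<close> is determined by the coordinate of \<open>r q\<close> and the
  \<open>p\<close> component of \<open>x\<close>, and \<open>\<alpha>\<close> gives the remaining
  component of \<open>x\<close> in terms of these. The inverse coordinates \<open>\<sigma>\<close>
  are kept because they recover \<open>q\<close>.\<close>

lemma neighbourhood:
  assumes ad: "adapted M N A B r W V U c EA Y d FB p D" and v1: "v1 \<in> V" "v1 \<in> D"
  obtains H Q \<sigma> \<alpha> where "open H" "f v1 \<in> H" "H \<subseteq> Y \<times> U"
    "openin (top_of_set (FB \<times> p ` model M)) Q" "smooth_map_on euclid (M \<times>\<^sub>M N) Q \<sigma>"
    "smooth_on Q \<alpha>" "\<And>q. q \<in> Q \<Longrightarrow> \<alpha> q \<in> model M \<and> p (\<alpha> q) = 0"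
    "\<And>q. q \<in> Q \<Longrightarrow> \<sigma> q \<in> V \<and> r (snd (\<sigma> q)) \<in> Y \<and> d (r (snd (\<sigma> q))) = fst q"
    "\<And>y x. (y, x) \<in> H \<Longrightarrow> (y, x) \<in> f ` V \<longleftrightarrow> y \<in> B \<and> (d y, p (c x)) \<in> Q \<and> c x - p (c x) = \<alpha> (d y, p (c x))"
    "\<And>v. v \<in> V \<Longrightarrow> f v \<in> H \<Longrightarrow> (d (r (snd v)), p (c (fst v))) \<in> Q \<and> \<sigma> (d (r (snd v)), p (c (fst v))) = v"
proof -
  define \<eta> where "\<eta> = (\<lambda>v. (d (r (snd v)), p (c (fst v))))"
  note ad' = ad[unfolded adapted_def, folded \<eta>_def]
  have c: "(U, c) \<in> charts M" and d: "(Y, d) \<in> charts N" and p: "linear p" "p ` model M \<subseteq> model M" "\<And>z. p (p z) = p z"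
    and D: "open D" "\<And>x y. (x, y) \<in> D \<Longrightarrow> x \<in> U \<and> y \<in> W \<and> r y \<in> Y"
    and inj: "inj_on \<eta> (V \<inter> D)" and op: "openin (top_of_set (FB \<times> p ` model M)) (\<eta> ` (V \<inter> D))"
    and sm: "smooth_map_on euclid (M \<times>\<^sub>M N) (\<eta> ` (V \<inter> D)) (inv_into (V \<inter> D) \<eta>)"
    using ad' by simp_all
  define Q where "Q = \<eta> ` (V \<inter> D)"
  define \<sigma> where "\<sigma> = inv_into (V \<inter> D) \<eta>"
  define g where "g = (\<lambda>q. c (fst (\<sigma> q)))"
  define \<alpha> where "\<alpha> = (\<lambda>q. g q - p (g q))"
  have \<sigma>: "\<sigma> q \<in> V \<inter> D" "\<eta> (\<sigma> q) = q" if "q \<in> Q" for q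
    using that unfolding Q_def \<sigma>_def by (rule inv_into_into, rule f_inv_into_f)
  have \<sigma>\<eta>: "\<sigma> (\<eta> v) = v" if "v \<in> V \<inter> D" for v unfolding \<sigma>_def using inj that by (rule inv_into_f_f)
  have \<sigma>D: "fst (\<sigma> q) \<in> U" "r (snd (\<sigma> q)) \<in> Y" if "q \<in> Q" for q
    using \<sigma>(1)[OF that] D(2)[of "fst (\<sigma> q)" "snd (\<sigma> q)"] by simp_all
  have \<sigma>q: "d (r (snd (\<sigma> q))) = fst q" "p (c (fst (\<sigma> q))) = snd q" if "q \<in> Q" for q
    using \<sigma>(2)[OF that] unfolding \<eta>_def by (metis fst_conv, metis snd_conv)
  have s\<sigma>: "smooth_map_on euclid (M \<times>\<^sub>M N) Q \<sigma>" using sm by (simp add: Q_def \<sigma>_def)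
  have "smooth_map_on euclid M Q (\<lambda>q. fst (\<sigma> q))"
    by (rule smooth_map_on_compose[OF smooth_manifold_euclid P M s\<sigma> smooth_map_on_fst[OF M N] subset_UNIV])
  then have "smooth_map_on euclid euclid Q g"
    unfolding g_def by (rule smooth_map_on_compose[OF smooth_manifold_euclid M smooth_manifold_euclid _ smooth_map_on_chart[OF M c]])
      (use \<sigma>D in auto)
  then have sg: "smooth_on Q g" by (simp add: smooth_map_on_euclid_iff)
  have s\<alpha>: "smooth_on Q \<alpha>" unfolding \<alpha>_def by (intro smooth_on_diff sg smooth_on_linear_comp[OF sg p(1)])
  have gE: "g q \<in> model M" if "q \<in> Q" for q unfolding g_def using chart_in_model[OF c \<sigma>D(1)[OF that]] .
  have \<alpha>E: "\<alpha> q \<in> model M \<and> p (\<alpha> q) = 0" if "q \<in> Q" for q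
  proof
    have "p (g q) \<in> model M" using gE[OF that] p(2) by blast
    then show "\<alpha> q \<in> model M" unfolding \<alpha>_def using gE[OF that] by (intro subspace_diff subspace_model[OF M])
    show "p (\<alpha> q) = 0" unfolding \<alpha>_def linear_diff[OF p(1)] p(3) by simp
  qed
  \<comment> \<open>The topological embedding ensures that points of \<open>V\<close> outside
    \<open>D\<close> are not mapped near \<open>f v1\<close>.\<close>
  obtain G where G: "open G" "f v1 \<in> G" "V \<inter> f -` G \<subseteq> D"
    using top_embeddingD[OF emb[folded f_eq] v1(1) D(1) v1(2)] by blast
  define H where "H = G \<inter> Y \<times> U"
  have H: "open H" unfolding H_def using G(1) chartsD(1)[OF c] chartsD(1)[OF d] by (intro open_Int open_Times)
  have "v1 = (fst v1, snd v1)" by simp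
  then have "fst v1 \<in> U" "r (snd v1) \<in> Y" using D(2) v1(2) by metis+
  then have fH: "f v1 \<in> H" using G(2) by (simp add: H_def f_def)
  have inverse: "\<eta> v \<in> Q \<and> \<sigma> (\<eta> v) = v" if "v \<in> V" "f v \<in> H" for v
  proof -
    have "v \<in> V \<inter> D" using that G(3) by (auto simp: H_def)
    then show ?thesis using \<sigma>\<eta> by (auto simp: Q_def)
  qed
  have iff: "(y, x) \<in> f ` V \<longleftrightarrow> y \<in> B \<and> (d y, p (c x)) \<in> Q \<and> c x - p (c x) = \<alpha> (d y, p (c x))" if h: "(y, x) \<in> H" for y x
  proof
    assume "(y, x) \<in> f ` V"
    then obtain v where v: "v \<in> V" "(y, x) = f v" by blast
    then have yx: "y = r (snd v)" "x = fst v" by (simp_all add: f_def)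
    have e: "\<eta> v = (d y, p (c x))" by (simp add: \<eta>_def yx)
    have b: "\<eta> v \<in> Q" "\<sigma> (\<eta> v) = v" using inverse[OF v(1)] h v(2) by auto
    have "\<alpha> (\<eta> v) = c x - p (c x)" unfolding \<alpha>_def g_def b(2) yx(2) ..
    moreover have "y \<in> B" using VW[OF v(1)] r(2) yx(1) by blast
    ultimately show "y \<in> B \<and> (d y, p (c x)) \<in> Q \<and> c x - p (c x) = \<alpha> (d y, p (c x))" using b(1) e by simp
  next
    assume a: "y \<in> B \<and> (d y, p (c x)) \<in> Q \<and> c x - p (c x) = \<alpha> (d y, p (c x))"
    define v where "v = \<sigma> (d y, p (c x))"
    have q: "(d y, p (c x)) \<in> Q" using a by blast
    have v: "v \<in> V" "fst v \<in> U" "r (snd v) \<in> Y" "d (r (snd v)) = d y" "p (c (fst v)) = p (c x)"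
      using \<sigma>(1)[OF q] \<sigma>D[OF q] \<sigma>q[OF q] by (simp_all add: v_def)
    have xy: "x \<in> U" "y \<in> Y" using h by (auto simp: H_def)
    \<comment> \<open>\<open>v\<close> has the same coordinates as \<open>(y, x)\<close>;
      injectivity of the two charts turns this into equality of points.\<close>
    have "r (snd v) = y" using inj_onD[OF chartsD(5)[OF d] v(4) v(3) xy(2)] .
    moreover have "c (fst v) - p (c (fst v)) = c x - p (c x)" using a by (simp add: \<alpha>_def g_def v_def)
    then have "c (fst v) = c x" using v(5) by simp
    then have "fst v = x" using inj_onD[OF chartsD(5)[OF c] _ v(2) xy(1)] by blast
    ultimately have "f v = (y, x)" by (simp add: f_def)
    then show "(y, x) \<in> f ` V" using v(1) by (metis imageI)
  qed
  show ?thesis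
    by (rule that[OF H fH _ op[folded Q_def] s\<sigma> s\<alpha> \<alpha>E _ iff inverse[unfolded \<eta>_def]])
      (use \<sigma>(1) \<sigma>D \<sigma>q in \<open>auto simp: H_def\<close>)
qed

text \<open>The graph description is completed in the \<open>N\<close> directions: with a projection
  \<open>b\<close> onto \<open>FB\<close> the condition \<open>y \<in> B\<close> becomes
  \<open>d y - b (d y) = 0\<close>, so the total space is locally the graph of
  \<open>(0, \<alpha>)\<close> over \<open>Q\<close>.\<close>

lemma Sigma_submanifold: "submanifold (N \<times>\<^sub>M M) (Sigma B FA)"
  unfolding submanifold_def
proof
  fix z assume z: "z \<in> Sigma B FA"
  then obtain v where v: "v \<in> V" "z = f v" using Sigma_FA by blast
  obtain U c EA Y d FB p D where ad: "adapted M N A B r W V U c EA Y d FB p D" and vD: "v \<in> D"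
    using loc[OF v(1)] by blast
  note ad' = ad[unfolded adapted_def]
  have c: "(U, c) \<in> charts M" and d: "(Y, d) \<in> charts N" and FB: "subspace FB" "FB \<subseteq> model N" "d ` (Y \<inter> B) = d ` Y \<inter> FB"
    and p: "linear p" "p ` model M \<subseteq> model M" "\<And>z. p (p z) = p z"
    using ad' by simp_all
  obtain H Q \<sigma> \<alpha> where n: "open H" "f v \<in> H" "H \<subseteq> Y \<times> U" "openin (top_of_set (FB \<times> p ` model M)) Q"
    "smooth_on Q \<alpha>" "\<And>q. q \<in> Q \<Longrightarrow> \<alpha> q \<in> model M \<and> p (\<alpha> q) = 0"
    "\<And>y x. (y, x) \<in> H \<Longrightarrow> (y, x) \<in> f ` V \<longleftrightarrow> y \<in> B \<and> (d y, p (c x)) \<in> Q \<and> c x - p (c x) = \<alpha> (d y, p (c x))"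
    by (rule neighbourhood[OF ad v(1) vD]) blast
  obtain b where b: "linear b" "\<And>x. b x \<in> FB" "\<And>x. x \<in> FB \<Longrightarrow> b x = x" using linear_projection[OF FB(1)] by metis
  define pp where "pp = (\<lambda>z. (b (fst z), p (snd z)))"
  have lpp: "linear pp" unfolding pp_def
    by (rule linearI) (simp_all add: linear_add[OF b(1)] linear_add[OF p(1)] linear_scale[OF b(1)] linear_scale[OF p(1)])
  have bN: "b ` model N = FB"
  proof (intro subset_antisym subsetI)
    fix z assume "z \<in> FB"
    then have "z \<in> model N" "b z = z" using FB(2) b(3) by blast+
    then show "z \<in> b ` model N" by (metis imageI)
  qed (use b(2) in blast)
  have im: "pp ` model (N \<times>\<^sub>M M) = FB \<times> p ` model M"
    unfolding model_prod pp_def bN[symmetric] by force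
  define \<beta> where "\<beta> = (\<lambda>q. (0 :: 'f, \<alpha> q))"
  have s\<beta>: "smooth_on Q \<beta>" unfolding \<beta>_def by (intro smooth_on_Pair smooth_on_const n(5))
  show "\<exists>(U, c)\<in>charts (N \<times>\<^sub>M M). z \<in> U \<and> (\<exists>F. subspace F \<and> F \<subseteq> model (N \<times>\<^sub>M M) \<and> c ` (U \<inter> Sigma B FA) = c ` U \<inter> F)"
  proof (rule graph_slice[OF smooth_manifold_prod[OF N M] prod_chart[OF N M d c] lpp, where \<alpha> = \<beta> and Q = Q and H = H])
    show "pp ` model (N \<times>\<^sub>M M) \<subseteq> model (N \<times>\<^sub>M M)" unfolding im unfolding model_prod using FB(2) p(2) by blast
    show "pp (pp z) = pp z" for z unfolding pp_def using b(2,3) p(3) by simp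
    show "openin (top_of_set (pp ` model (N \<times>\<^sub>M M))) Q" unfolding im by (rule n(4))
    show "smooth_on Q \<beta>" by (rule s\<beta>)
    show "\<beta> q \<in> model (N \<times>\<^sub>M M)" if "q \<in> Q" for q
      using n(6)[OF that] subspace_0[OF subspace_model[OF N]] by (simp add: \<beta>_def model_prod)
    show "pp (\<beta> q) = 0" if "q \<in> Q" for q
      using n(6)[OF that] by (simp add: \<beta>_def pp_def linear_0[OF b(1)] zero_prod_def)
    show "open H" "H \<subseteq> Y \<times> U" by (rule n)+
    show "z \<in> Sigma B FA" by (rule z)
    show "z \<in> H" using n(2) v(2) by simp
    fix w assume w: "w \<in> H"
    obtain y x where yx: "w = (y, x)" by fastforce
    have yxH: "(y, x) \<in> H" using w yx by simp
    have yY: "y \<in> Y" using yxH n(3) by blast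
    have yB: "y \<in> B \<longleftrightarrow> b (d y) = d y"
      unfolding slice_mem[OF d FB(3) yY] using b(2,3) by metis
    show "w \<in> Sigma B FA \<longleftrightarrow> pp (map_prod d c w) \<in> Q \<and> map_prod d c w - pp (map_prod d c w) = \<beta> (pp (map_prod d c w))"
      unfolding Sigma_FA yx n(7)[OF yxH] yB by (auto simp: pp_def \<beta>_def)
  qed
qed

text \<open>Fixing the coordinate \<open>d y\<close> in the graph description exhibits the fibre as
  a graph over the range of \<open>p\<close>, which has half the dimension of the model. The tangent
  data refer to one chart and one projection, hence the single elimination rule.\<close>

lemma FA_local:
  assumes v: "(x, q) \<in> V" and y: "r q = y"
  obtains U c EA p \<alpha>' where "(U, c) \<in> charts M" "x \<in> U" "subspace EA" "EA \<subseteq> model M" "c ` (U \<inter> A) = c ` U \<inter> EA"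
    "linear p" "p ` model M \<subseteq> model M" "\<And>z. p (p z) = p z" "\<And>z. z \<in> model M \<Longrightarrow> p z = 0 \<longleftrightarrow> z \<in> EA"
    "2 * dim (p ` model M) = dim (model M)"
    "linear \<alpha>'" "\<And>v. v \<in> p ` model M \<Longrightarrow> \<alpha>' v \<in> model M \<and> p (\<alpha>' v) = 0"
    "tangent_space M (FA y) x = coord_vector M (U, c) (c x) ` (\<lambda>v. v + \<alpha>' v) ` p ` model M"
    "subspace ((\<lambda>v. v + \<alpha>' v) ` p ` model M)" "dim ((\<lambda>v. v + \<alpha>' v) ` p ` model M) = dim (p ` model M)"
    "\<exists>(U, c)\<in>charts M. x \<in> U \<and> (\<exists>F. subspace F \<and> F \<subseteq> model M \<and> c ` (U \<inter> FA y) = c ` U \<inter> F)"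
    "\<exists>G. open G \<and> x \<in> G \<and> smooth_map_on M N (FA y \<inter> G) (\<Psi> y)"
proof -
  obtain U c EA Y d FB p D where ad: "adapted M N A B r W V U c EA Y d FB p D" and vD: "(x, q) \<in> D"
    using loc[OF v] by blast
  note ad' = ad[unfolded adapted_def]
  have c: "(U, c) \<in> charts M" and EA: "subspace EA" "EA \<subseteq> model M" "c ` (U \<inter> A) = c ` U \<inter> EA"
    and d: "(Y, d) \<in> charts N" and FB: "subspace FB" "FB \<subseteq> model N" "d ` (Y \<inter> B) = d ` Y \<inter> FB"
    and p: "linear p" "p ` model M \<subseteq> model M" "\<And>z. p (p z) = p z" "\<And>z. z \<in> model M \<Longrightarrow> p z = 0 \<longleftrightarrow> z \<in> EA"
    "2 * dim (p ` model M) = dim (model M)" and D: "\<And>x y. (x, y) \<in> D \<Longrightarrow> x \<in> U \<and> y \<in> W \<and> r y \<in> Y"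
    using ad' by simp_all
  obtain H Q \<sigma> \<alpha> where n: "open H" "f (x, q) \<in> H" "H \<subseteq> Y \<times> U" "openin (top_of_set (FB \<times> p ` model M)) Q"
    "smooth_map_on euclid (M \<times>\<^sub>M N) Q \<sigma>"
    "smooth_on Q \<alpha>" "\<And>q. q \<in> Q \<Longrightarrow> \<alpha> q \<in> model M \<and> p (\<alpha> q) = 0"
    "\<And>y x. (y, x) \<in> H \<Longrightarrow> (y, x) \<in> f ` V \<longleftrightarrow> y \<in> B \<and> (d y, p (c x)) \<in> Q \<and> c x - p (c x) = \<alpha> (d y, p (c x))"
    "\<And>v. v \<in> V \<Longrightarrow> f v \<in> H \<Longrightarrow> (d (r (snd v)), p (c (fst v))) \<in> Q \<and> \<sigma> (d (r (snd v)), p (c (fst v))) = v"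
    by (rule neighbourhood[OF ad v vD]) blast
  have yB: "y \<in> B" using VW[OF v] r(2) y by auto
  have yY: "y \<in> Y" using D[OF vD] y by simp
  have xU: "x \<in> U" using D[OF vD] by simp
  have dy: "d y \<in> FB" using slice_mem[OF d FB(3) yY] yB by simp
  define Hy where "Hy = Pair y -` H"
  have Hy: "open Hy" "x \<in> Hy" "Hy \<subseteq> U"
  proof -
    show "open Hy" unfolding Hy_def by (intro open_vimage n(1)) (auto intro!: continuous_intros)
    show "x \<in> Hy" using n(2) y by (simp add: Hy_def f_def)
    show "Hy \<subseteq> U" using n(3) by (auto simp: Hy_def)
  qed
  define Qy where "Qy = {k. (d y, k) \<in> Q}"
  define \<alpha>y where "\<alpha>y = (\<lambda>k. \<alpha> (d y, k))"
  obtain T where T: "open T" "Q = (FB \<times> p ` model M) \<inter> T" using n(4) unfolding openin_open by (elim exE conjE)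
  have Qy: "openin (top_of_set (p ` model M)) Qy"
  proof -
    have "open (Pair (d y) -` T)" by (intro open_vimage T(1)) (auto intro!: continuous_intros)
    moreover have "Qy = p ` model M \<inter> Pair (d y) -` T" unfolding Qy_def T(2) using dy by auto
    ultimately show ?thesis by auto
  qed
  have sP: "smooth_on Qy (\<lambda>k. (d y, k))" by (intro smooth_on_Pair smooth_on_const smooth_on_id)
  have s\<alpha>y: "smooth_on Qy \<alpha>y" unfolding \<alpha>y_def
    by (rule smooth_on_compose[OF sP n(6)]) (auto simp: Qy_def)
  have \<alpha>yE: "\<alpha>y k \<in> model M" "p (\<alpha>y k) = 0" if "k \<in> Qy" for k
    using that n(7) by (auto simp: Qy_def \<alpha>y_def)
  have LH: "x' \<in> FA y \<longleftrightarrow> p (c x') \<in> Qy \<and> c x' - p (c x') = \<alpha>y (p (c x'))" if "x' \<in> Hy" for x'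
    unfolding FA_iff using n(8)[of y x'] that yB by (simp add: Hy_def Qy_def \<alpha>y_def)
  have xFA: "x \<in> FA y" using FA_I[OF v] y by simp
  have sl: "\<exists>(U, c)\<in>charts M. x \<in> U \<and> (\<exists>F. subspace F \<and> F \<subseteq> model M \<and> c ` (U \<inter> FA y) = c ` U \<inter> F)"
    by (rule graph_slice[OF M c p(1-3) Qy s\<alpha>y \<alpha>yE Hy(1,3) LH xFA Hy(2)])
  have s1: "smooth_map_on M euclid (FA y \<inter> Hy) (\<lambda>x'. p (c x'))"
    by (rule smooth_map_on_euclid_linear[OF M smooth_map_on_subset[OF smooth_map_on_chart[OF M c]] p(1)]) (use Hy(3) in blast)
  have s2: "smooth_map_on M euclid (FA y \<inter> Hy) (\<lambda>x'. (d y, p (c x')))"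
    by (rule smooth_map_on_euclid_Pair[OF M smooth_map_on_const[OF M smooth_manifold_euclid] s1])
  have sub: "(\<lambda>x'. (d y, p (c x'))) ` (FA y \<inter> Hy) \<subseteq> Q" using LH by (auto simp: Qy_def)
  have s3: "smooth_map_on M (M \<times>\<^sub>M N) (FA y \<inter> Hy) (\<lambda>x'. \<sigma> (d y, p (c x')))"
    by (rule smooth_map_on_compose[OF M smooth_manifold_euclid P s2 n(5) sub])
  have s4: "smooth_map_on M N (FA y \<inter> Hy) (\<lambda>x'. snd (\<sigma> (d y, p (c x'))))"
    by (rule smooth_map_on_compose[OF M P N s3 smooth_map_on_snd[OF M N] subset_UNIV])
  \<comment> \<open>On the fibre \<open>\<Psi> y\<close> is the \<open>N\<close> component of the
    inverse coordinates \<open>\<sigma>\<close> at \<open>(d y, p (c x'))\<close>, a composite of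
    smooth maps.\<close>
  have "smooth_map_on M N (FA y \<inter> Hy) (\<Psi> y)"
  proof (rule smooth_map_on_cong[OF M N s4])
    fix x' assume x': "x' \<in> FA y \<inter> Hy"
    have V': "(x', \<Psi> y x') \<in> V" "r (\<Psi> y x') = y" using Psi x' by blast+
    have "f (x', \<Psi> y x') \<in> H" using x' V'(2) by (simp add: f_def Hy_def)
    from n(9)[OF V'(1) this] show "snd (\<sigma> (d y, p (c x'))) = \<Psi> y x'" by (simp add: V'(2))
  qed
  then have sm: "\<exists>G. open G \<and> x \<in> G \<and> smooth_map_on M N (FA y \<inter> G) (\<Psi> y)" using Hy by blast
  show ?thesis
  proof (rule graph_tangent[OF M c p(1-3) Qy s\<alpha>y \<alpha>yE Hy(1,3) LH xFA Hy(2)])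
    fix \<alpha>'
    assume \<alpha>': "linear \<alpha>'" "\<And>v. v \<in> p ` model M \<Longrightarrow> \<alpha>' v \<in> model M \<and> p (\<alpha>' v) = 0"
      "tangent_space M (FA y) x = coord_vector M (U, c) (c x) ` (\<lambda>v. v + \<alpha>' v) ` p ` model M"
      "subspace ((\<lambda>v. v + \<alpha>' v) ` p ` model M)" "dim ((\<lambda>v. v + \<alpha>' v) ` p ` model M) = dim (p ` model M)"
    show ?thesis by (rule that[OF c xU EA p \<alpha>' sl sm])
  qed
qed

lemma smooth_Psi: "smooth_map_on M N (FA y) (\<Psi> y)"
proof (rule smooth_map_on_local[OF M N])
  fix x assume "x \<in> FA y"
  then have "(x, \<Psi> y x) \<in> V" "r (\<Psi> y x) = y" by (rule Psi)+
  then show "\<exists>G. open G \<and> x \<in> G \<and> smooth_map_on M N (FA y \<inter> G) (\<Psi> y)" by (rule FA_local)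
qed

text \<open>Tangent vectors of the fibre lift through \<open>(x, \<Psi> y x)\<close> to tangent
  vectors of \<open>V\<close> whose second components are tangent to a lagrangian fibre in
  \<open>N\<close>. The product form vanishes on the lifts and so does its \<open>N\<close> part,
  hence also the \<open>M\<close> part.\<close>

lemma FA_isotropic:
  assumes y: "y \<in> B" and x: "x \<in> FA y" and u: "u \<in> tangent_space M (FA y) x" "u' \<in> tangent_space M (FA y) x"
  shows "\<omega>\<^sub>M x u u' = 0"
proof -
  define q where "q = \<Psi> y x"
  have q: "(x, q) \<in> V" "r q = y" unfolding q_def by (rule Psi[OF x])+
  have qW: "q \<in> W" using VW[OF q(1)] by simp
  have lift: "\<exists>w. w \<in> tangent_space (M \<times>\<^sub>M N) V (x, q) \<and> pushforward fst w = u \<and>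
      pushforward snd w \<in> tangent_space N {q \<in> W. r q = y} q" if u: "u \<in> tangent_space M (FA y) x" for u
  proof -
    obtain \<gamma> where g: "curve_in M (FA y) x \<gamma>" "u = velocity M \<gamma>" using u unfolding tangent_space_curves by blast
    have s: "smooth_map_on M (M \<times>\<^sub>M N) (FA y \<inter> UNIV) (\<lambda>x. (x, \<Psi> y x))"
      using smooth_Psi by (intro smooth_map_on_Pair[OF M M N] smooth_map_on_id M) simp
    have "curve_in (M \<times>\<^sub>M N) V (x, \<Psi> y x) (\<lambda>t. (\<gamma> t, \<Psi> y (\<gamma> t)))"
      by (rule curve_in_compose[OF M P g(1) open_UNIV UNIV_I s]) (use Psi in auto)
    then have 1: "velocity (M \<times>\<^sub>M N) (\<lambda>t. (\<gamma> t, \<Psi> y (\<gamma> t))) \<in> tangent_space (M \<times>\<^sub>M N) V (x, q)"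
      unfolding tangent_space_curves q_def by blast
    have "curve_in N {q \<in> W. r q = y} (\<Psi> y x) (\<lambda>t. \<Psi> y (\<gamma> t))"
    proof (rule curve_in_compose[OF M N g(1) open_UNIV UNIV_I])
      show "smooth_map_on M N (FA y \<inter> UNIV) (\<Psi> y)" using smooth_Psi by simp
      show "\<Psi> y ` (FA y \<inter> UNIV) \<subseteq> {q \<in> W. r q = y}" using Psi VW by fastforce
    qed
    then have 2: "velocity N (\<lambda>t. \<Psi> y (\<gamma> t)) \<in> tangent_space N {q \<in> W. r q = y} q"
      unfolding tangent_space_curves q_def by blast
    show ?thesis
      by (rule exI[of _ "velocity (M \<times>\<^sub>M N) (\<lambda>t. (\<gamma> t, \<Psi> y (\<gamma> t)))"])
        (use 1 2 g(2) in \<open>simp add: pushforward_fst_velocity[OF M N] pushforward_snd_velocity[OF M N]\<close>)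
  qed
  obtain w where w: "w \<in> tangent_space (M \<times>\<^sub>M N) V (x, q)" "pushforward fst w = u"
    "pushforward snd w \<in> tangent_space N {q \<in> W. r q = y} q" using lift[OF u(1)] by blast
  obtain w' where w': "w' \<in> tangent_space (M \<times>\<^sub>M N) V (x, q)" "pushforward fst w' = u'"
    "pushforward snd w' \<in> tangent_space N {q \<in> W. r q = y} q" using lift[OF u(2)] by blast
  have "lagrangian_subspace (M \<times>\<^sub>M N) (prod_form (opposite_form \<omega>\<^sub>M) \<omega>\<^sub>N) (x, q) (tangent_space (M \<times>\<^sub>M N) V (x, q))"
    using V q(1) unfolding lagrangian_def by blast
  then have "prod_form (opposite_form \<omega>\<^sub>M) \<omega>\<^sub>N (x, q) w w' = 0"
    using w(1) w'(1) unfolding lagrangian_subspace_def by blast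
  moreover have "lagrangian_subspace N \<omega>\<^sub>N q (tangent_space N {q \<in> W. r q = y} q)"
    using fibre[OF y] q qW unfolding lagrangian_def by blast
  then have "\<omega>\<^sub>N q (pushforward snd w) (pushforward snd w') = 0"
    using w(3) w'(3) unfolding lagrangian_subspace_def by blast
  ultimately show ?thesis using w(2) w'(2) by (simp add: prod_form_def opposite_form_def)
qed

lemma FA_lagrangian:
  assumes y: "y \<in> B" shows "lagrangian M \<omega>\<^sub>M (FA y)"
  unfolding lagrangian_def
proof (intro conjI ballI)
  show "submanifold M (FA y)"
    unfolding submanifold_def
  proof
    fix x assume "x \<in> FA y"
    then have "(x, \<Psi> y x) \<in> V" "r (\<Psi> y x) = y" by (rule Psi)+
    then show "\<exists>(U, c)\<in>charts M. x \<in> U \<and> (\<exists>F. subspace F \<and> F \<subseteq> model M \<and> c ` (U \<inter> FA y) = c ` U \<inter> F)"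
      by (rule FA_local)
  qed
  fix x assume x: "x \<in> FA y"
  show "lagrangian_subspace M \<omega>\<^sub>M x (tangent_space M (FA y) x)"
  proof (rule FA_local[OF Psi[OF x]])
    fix U c p \<alpha>'
    assume c: "(U, c) \<in> charts M" "x \<in> U" and p: "p ` model M \<subseteq> model M" "2 * dim (p ` model M) = dim (model M)"
      and \<alpha>': "\<And>v. v \<in> p ` model M \<Longrightarrow> \<alpha>' v \<in> model M \<and> p (\<alpha>' v) = 0"
      and T: "tangent_space M (FA y) x = coord_vector M (U, c) (c x) ` (\<lambda>v. v + \<alpha>' v) ` p ` model M"
      and S: "subspace ((\<lambda>v. v + \<alpha>' v) ` p ` model M)" "dim ((\<lambda>v. v + \<alpha>' v) ` p ` model M) = dim (p ` model M)"
    have sub: "(\<lambda>v. v + \<alpha>' v) ` p ` model M \<subseteq> model M"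
    proof
      fix z assume "z \<in> (\<lambda>v. v + \<alpha>' v) ` p ` model M"
      then obtain v where "v \<in> p ` model M" "z = v + \<alpha>' v" by blast
      then show "z \<in> model M" using \<alpha>' p(1) by (auto intro!: subspace_add subspace_model[OF M])
    qed
    show ?thesis
      by (rule lagrangian_subspace_isotropic[OF M wM c S(1) sub T FA_isotropic[OF y x]]) (use S(2) p(2) in simp_all)
  qed
qed

text \<open>The tangent space of the fibre is a graph over the range of \<open>p\<close>, a
  complement of \<open>EA\<close>: with \<open>v = p z\<close> the difference
  \<open>z - (v + \<alpha>' v)\<close> is killed by \<open>p\<close> and therefore lies in
  \<open>EA\<close>.\<close>

lemma FA_transverse:
  assumes y: "y \<in> B"
  shows "transverse_at M (\<phi> y) (tangent_space M (FA y) (\<phi> y)) (tangent_space M A (\<phi> y))"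
proof (rule FA_local[OF core[OF y] r(3)[OF y]])
  fix U c EA p \<alpha>'
  assume c: "(U, c) \<in> charts M" "\<phi> y \<in> U" and EA: "subspace EA" "EA \<subseteq> model M" "c ` (U \<inter> A) = c ` U \<inter> EA"
    and p: "linear p" "p ` model M \<subseteq> model M" "\<And>z. p (p z) = p z" "\<And>z. z \<in> model M \<Longrightarrow> p z = 0 \<longleftrightarrow> z \<in> EA"
    and \<alpha>': "\<And>v. v \<in> p ` model M \<Longrightarrow> \<alpha>' v \<in> model M \<and> p (\<alpha>' v) = 0"
    and T: "tangent_space M (FA y) (\<phi> y) = coord_vector M (U, c) (c (\<phi> y)) ` (\<lambda>v. v + \<alpha>' v) ` p ` model M"
  define k where "k = coord_vector M (U, c) (c (\<phi> y))"
  have E: "subspace (model M)" by (rule subspace_model[OF M])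
  have kadd: "k (a + b) = (\<lambda>f. k a f + k b f)" if "a \<in> model M" "b \<in> model M" for a b
    using coord_vector_linear[OF M c that, of 1] by (simp add: k_def)
  have TA: "tangent_space M A (\<phi> y) = k ` EA"
    unfolding k_def by (rule tangent_space_slice[OF M c _ EA(1,2,3)]) (use \<phi>A y in blast)
  have sub: "v + \<alpha>' v \<in> model M" if "v \<in> p ` model M" for v
    using that \<alpha>' p(2) by (auto intro!: subspace_add E)
  show ?thesis
    unfolding transverse_at_def tangent_space_coord[OF M c] T TA k_def[symmetric]
  proof (intro subset_antisym subsetI)
    fix w assume "w \<in> {(\<lambda>f. u f + v f) | u v. u \<in> k ` (\<lambda>v. v + \<alpha>' v) ` p ` model M \<and> v \<in> k ` EA}"
    then obtain v a where va: "v \<in> p ` model M" "a \<in> EA" "w = (\<lambda>f. k (v + \<alpha>' v) f + k a f)" by blast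
    have "w = k ((v + \<alpha>' v) + a)" using kadd[OF sub[OF va(1)], of a] va(2,3) EA(2) by auto
    moreover have "(v + \<alpha>' v) + a \<in> model M" using sub[OF va(1)] va(2) EA(2) by (auto intro!: subspace_add E)
    ultimately show "w \<in> k ` model M" by blast
  next
    fix w assume "w \<in> k ` model M"
    then obtain z where z: "z \<in> model M" "w = k z" by blast
    define v where "v = p z"
    have v: "v \<in> p ` model M" "p v = v" using z(1) p(3) by (auto simp: v_def)
    define a where "a = z - (v + \<alpha>' v)"
    have aE: "a \<in> model M" unfolding a_def by (rule subspace_diff[OF E z(1) sub[OF v(1)]])
    have "p a = p z - (p v + p (\<alpha>' v))" unfolding a_def linear_diff[OF p(1)] linear_add[OF p(1)] ..
    then have "p a = 0" using v \<alpha>'[OF v(1)] by (simp add: v_def[symmetric])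
    then have aA: "a \<in> EA" using p(4)[OF aE] by simp
    have "w = k ((v + \<alpha>' v) + a)" unfolding z(2) a_def by simp
    also have "\<dots> = (\<lambda>f. k (v + \<alpha>' v) f + k a f)" by (rule kadd[OF sub[OF v(1)] aE])
    finally show "w \<in> {(\<lambda>f. u f + v f) | u v. u \<in> k ` (\<lambda>v. v + \<alpha>' v) ` p ` model M \<and> v \<in> k ` EA}"
      using v(1) aA by blast
  qed
qed

text \<open>A point of \<open>V\<close> over the fibre and over \<open>A\<close> has the same
  coordinates as the core point, namely \<open>d y\<close> and 0; both lie in one \<open>D\<close>
  by \<open>loc\<close>, and injectivity there identifies them.\<close>

lemma FA_Int_A:
  assumes y: "y \<in> B" shows "FA y \<inter> A = {\<phi> y}"
proof (intro subset_antisym subsetI)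
  fix x assume x: "x \<in> FA y \<inter> A"
  then obtain q where q: "(x, q) \<in> V" "r q = y" unfolding FA_def by blast
  obtain U c EA Y d FB p D where ad: "adapted M N A B r W V U c EA Y d FB p D"
    and D: "(x, q) \<in> D" "(\<phi> (r (snd (x, q))), r (snd (x, q))) \<in> D" using loc[OF q(1)] by blast
  note ad' = ad[unfolded adapted_def]
  have c: "(U, c) \<in> charts M" and EA: "EA \<subseteq> model M" "c ` (U \<inter> A) = c ` U \<inter> EA"
    and p: "\<And>z. z \<in> model M \<Longrightarrow> p z = 0 \<longleftrightarrow> z \<in> EA"
    and DU: "\<And>x y. (x, y) \<in> D \<Longrightarrow> x \<in> U \<and> y \<in> W \<and> r y \<in> Y"
    and inj: "inj_on (\<lambda>v. (d (r (snd v)), p (c (fst v)))) (V \<inter> D)"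
    using ad' by simp_all
  have pc: "p (c z) = 0" if "z \<in> A" "z \<in> U" for z
    using slice_mem[OF c EA(2) that(2)] that p EA(1) by blast
  have D': "(\<phi> y, y) \<in> D" using D(2) q(2) by simp
  have "p (c x) = 0" "p (c (\<phi> y)) = 0"
    using pc x DU[OF D(1)] DU[OF D'] \<phi>A y by auto
  then have "(\<lambda>v. (d (r (snd v)), p (c (fst v)))) (x, q) = (\<lambda>v. (d (r (snd v)), p (c (fst v)))) (\<phi> y, y)"
    using q(2) r(3)[OF y] by simp
  then have "(x, q) = (\<phi> y, y)" by (rule inj_onD[OF inj]) (use q(1) D(1) D' core[OF y] in auto)
  then show "x \<in> {\<phi> y}" by simp
next
  fix x assume "x \<in> {\<phi> y}"
  then show "x \<in> FA y \<inter> A" using core_FA[OF y] \<phi>A y by blast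
qed

text \<open>Freezing the fibre coordinate \<open>k\<close> of \<open>z\<close> gives a local section
  of the total space over \<open>B\<close> through \<open>z\<close>; curves in \<open>B\<close> lift
  along it.\<close>

lemma FA_push:
  assumes z: "z \<in> Sigma B FA"
  shows "pushforward fst ` tangent_space (N \<times>\<^sub>M M) (Sigma B FA) z = tangent_space N B (fst z)"
proof (intro subset_antisym subsetI)
  have fS: "fst ` Sigma B FA \<subseteq> B" by auto
  fix u assume "u \<in> pushforward fst ` tangent_space (N \<times>\<^sub>M M) (Sigma B FA) z"
  then obtain w where w: "w \<in> tangent_space (N \<times>\<^sub>M M) (Sigma B FA) (fst z, snd z)" "u = pushforward fst w" by auto
  then show "u \<in> tangent_space N B (fst z)"
    using pushforward_tangent(1)[OF N M w(1)] tangent_space_mono[OF fS] by blast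
next
  fix u assume "u \<in> tangent_space N B (fst z)"
  then obtain \<beta> where \<beta>: "curve_in N B (fst z) \<beta>" "u = velocity N \<beta>" unfolding tangent_space_curves by blast
  obtain v where v: "v \<in> V" "z = f v" using z Sigma_FA by blast
  obtain U c EA Y d FB p D where ad: "adapted M N A B r W V U c EA Y d FB p D" and vD: "v \<in> D"
    using loc[OF v(1)] by blast
  note ad' = ad[unfolded adapted_def]
  have d: "(Y, d) \<in> charts N" and FB: "d ` (Y \<inter> B) = d ` Y \<inter> FB" and DU: "\<And>x y. (x, y) \<in> D \<Longrightarrow> x \<in> U \<and> y \<in> W \<and> r y \<in> Y"
    using ad' by simp_all
  obtain H Q \<sigma> where n: "f v \<in> H" "openin (top_of_set (FB \<times> p ` model M)) Q"
    "smooth_map_on euclid (M \<times>\<^sub>M N) Q \<sigma>"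
    "\<And>q. q \<in> Q \<Longrightarrow> \<sigma> q \<in> V \<and> r (snd (\<sigma> q)) \<in> Y \<and> d (r (snd (\<sigma> q))) = fst q"
    "\<And>v. v \<in> V \<Longrightarrow> f v \<in> H \<Longrightarrow> (d (r (snd v)), p (c (fst v))) \<in> Q \<and> \<sigma> (d (r (snd v)), p (c (fst v))) = v"
    by (rule neighbourhood[OF ad v(1) vD]) blast
  define k where "k = p (c (fst v))"
  have fz: "fst z = r (snd v)" using v(2) by (simp add: f_def)
  have q0: "(d (fst z), k) \<in> Q" "\<sigma> (d (fst z), k) = v" using n(5)[OF v(1) n(1)] by (simp_all add: k_def fz)
  have zY: "fst z \<in> Y" using DU[of "fst v" "snd v"] vD fz by simp
  obtain T where T: "open T" "Q = (FB \<times> p ` model M) \<inter> T" using n(2) unfolding openin_open by (elim exE conjE)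
  define G where "G = Y \<inter> d -` ((\<lambda>b. (b, k)) -` T)"
  have "open ((\<lambda>b. (b, k)) -` T)" by (intro open_vimage T(1)) (auto intro!: continuous_intros)
  then have G: "open G" unfolding G_def by (rule continuous_open_preimage[OF chartsD(3)[OF d] chartsD(1)[OF d]])
  have zG: "fst z \<in> G" using zY q0(1) T(2) by (auto simp: G_def)
  have GQ: "(d y, k) \<in> Q" if "y \<in> B \<inter> G" for y
    using that slice_mem[OF d FB, of y] q0(1) T(2) by (auto simp: G_def)
  define h where "h = (\<lambda>y. (y, fst (\<sigma> (d y, k))))"
  have s1: "smooth_map_on N euclid (B \<inter> G) (\<lambda>y. (d y, k))"
    by (rule smooth_map_on_euclid_Pair[OF N smooth_map_on_subset[OF smooth_map_on_chart[OF N d]]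
          smooth_map_on_const[OF N smooth_manifold_euclid]]) (auto simp: G_def)
  have s2: "smooth_map_on N (M \<times>\<^sub>M N) (B \<inter> G) (\<lambda>y. \<sigma> (d y, k))"
    by (rule smooth_map_on_compose[OF N smooth_manifold_euclid P s1 n(3)]) (use GQ in blast)
  have s3: "smooth_map_on N M (B \<inter> G) (\<lambda>y. fst (\<sigma> (d y, k)))"
    by (rule smooth_map_on_compose[OF N P M s2 smooth_map_on_fst[OF M N] subset_UNIV])
  have s4: "smooth_map_on N (N \<times>\<^sub>M M) (B \<inter> G) h"
    unfolding h_def by (rule smooth_map_on_Pair[OF N N M smooth_map_on_id[OF N] s3])
  have hS: "h y \<in> Sigma B FA" if y: "y \<in> B \<inter> G" for y
  proof -
    have s: "\<sigma> (d y, k) \<in> V" "r (snd (\<sigma> (d y, k))) \<in> Y" "d (r (snd (\<sigma> (d y, k)))) = d y"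
      using n(4)[OF GQ[OF y]] by simp_all
    have "r (snd (\<sigma> (d y, k))) = y"
      using inj_onD[OF chartsD(5)[OF d] s(3) s(2)] y by (auto simp: G_def)
    then have "h y = f (\<sigma> (d y, k))" by (simp add: h_def f_def)
    then show ?thesis unfolding Sigma_FA using s(1) by blast
  qed
  have "h (fst z) = z" unfolding h_def q0(2) using v(2) by (simp add: f_def)
  then have "curve_in (N \<times>\<^sub>M M) (Sigma B FA) z (\<lambda>t. h (\<beta> t))"
    using curve_in_compose[OF N smooth_manifold_prod[OF N M] \<beta>(1) G zG s4, of "Sigma B FA"] hS by (simp add: image_subset_iff)
  then have "velocity (N \<times>\<^sub>M M) (\<lambda>t. h (\<beta> t)) \<in> tangent_space (N \<times>\<^sub>M M) (Sigma B FA) z"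
    unfolding tangent_space_curves by blast
  moreover have "pushforward fst (velocity (N \<times>\<^sub>M M) (\<lambda>t. h (\<beta> t))) = u"
    unfolding pushforward_fst_velocity[OF N M] \<beta>(2) by (simp add: h_def)
  ultimately show "u \<in> pushforward fst ` tangent_space (N \<times>\<^sub>M M) (Sigma B FA) z" by blast
qed

lemma FA_rep: "lagrangian_fibration_rep M \<omega>\<^sub>M A N B \<phi> FA"
  unfolding lagrangian_fibration_rep_def
proof (intro conjI ballI)
  fix y assume y: "y \<in> B"
  have "closedin (top_of_set (FA y)) {\<phi> y}" using core_FA[OF y] by (intro closed_subset) auto
  then show "lagrangian_submicrofold M \<omega>\<^sub>M A (FA y) {\<phi> y}"
    unfolding lagrangian_submicrofold_def
    using FA_lagrangian[OF y] submanifold_point[OF M] FA_Int_A[OF y] \<phi>A y by blast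
  show "transverse_at M (\<phi> y) (tangent_space M (FA y) (\<phi> y)) (tangent_space M A (\<phi> y))" by (rule FA_transverse[OF y])
qed (rule Sigma_submanifold FA_push; assumption?)+

end

section \<open>Existence: shrinking \<open>V\<close> around the graph of
  \<open>\<phi>\<close>\<close>

text \<open>Supplies the closed image of the core that \<open>embedding_neighbourhood\<close>
  requires.\<close>

lemma closed_graph:
  fixes \<phi> :: "'n::topological_space \<Rightarrow> 'm::t2_space"
  assumes B: "closed B" and \<phi>: "continuous_on B \<phi>"
  shows "closed ((\<lambda>y. (y, \<phi> y)) ` B)"
  unfolding closed_def open_prod_def
proof
  fix z assume z: "z \<in> - (\<lambda>y. (y, \<phi> y)) ` B"
  obtain y x where yx: "z = (y, x)" by fastforce
  show "\<exists>S T. open S \<and> open T \<and> z \<in> S \<times> T \<and> S \<times> T \<subseteq> - (\<lambda>y. (y, \<phi> y)) ` B"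
  proof (cases "y \<in> B")
    case True
    then have "x \<noteq> \<phi> y" using z yx by blast
    then obtain S T where ST: "open S" "open T" "x \<in> S" "\<phi> y \<in> T" "S \<inter> T = {}" using hausdorff by metis
    obtain G where G: "open G" "\<phi> -` T \<inter> B = G \<inter> B" using \<phi> ST(2) unfolding continuous_on_open_invariant by metis
    have "y \<in> G" using G(2) True ST(4) by blast
    moreover have "G \<times> S \<subseteq> - (\<lambda>y. (y, \<phi> y)) ` B"
    proof
      fix w assume "w \<in> G \<times> S"
      then have w: "fst w \<in> G" "snd w \<in> S" by auto
      have "snd w \<noteq> \<phi> (fst w)" if "fst w \<in> B"
      proof -
        have "fst w \<in> \<phi> -` T \<inter> B" unfolding G(2) using w(1) that by simp
        then have "\<phi> (fst w) \<in> T" by simp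
        moreover have "snd w \<notin> T" using w(2) ST(5) by (simp add: disjoint_iff)
        ultimately show ?thesis by (intro notI) simp
      qed
      moreover have "fst w \<in> B \<and> snd w = \<phi> (fst w)" if "w \<in> (\<lambda>y. (y, \<phi> y)) ` B"
        using that by (rule imageE) simp
      ultimately show "w \<in> - (\<lambda>y. (y, \<phi> y)) ` B" by blast
    qed
    ultimately show ?thesis using G(1) ST(1,3) yx by blast
  next
    case False
    then show ?thesis using B yx by (intro exI[of _ "- B"] exI[of _ UNIV]) auto
  qed
qed

text \<open>The coordinates on \<open>V \<inter> D\<close> factor through \<open>(r q, x)\<close> by
  a continuous map built from \<open>d\<close> and \<open>p \<circ> c\<close>; as they have a
  continuous inverse, so has \<open>(r q, x)\<close>.\<close>

lemma adapted_top_embedding: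
  fixes M :: "('m::{t2_space,second_countable_topology}, 'e::euclidean_space) manifold"
    and N :: "('n::{t2_space,second_countable_topology}, 'f::euclidean_space) manifold"
  assumes ad: "adapted M N A B r W V U c EA Y d FB p D" and r: "continuous_on W r"
  shows "top_embedding (V \<inter> D) (\<lambda>v. (r (snd v), fst v))"
  unfolding top_embedding_def
proof (intro conjI ballI allI impI)
  define \<eta> where "\<eta> = (\<lambda>v. (d (r (snd v)), p (c (fst v))))"
  note ad' = ad[unfolded adapted_def, folded \<eta>_def]
  have c: "(U, c) \<in> charts M" and d: "(Y, d) \<in> charts N" and p: "linear p"
    and D: "\<And>x y. (x, y) \<in> D \<Longrightarrow> x \<in> U \<and> y \<in> W \<and> r y \<in> Y" and inj: "inj_on \<eta> (V \<inter> D)"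
    and sm: "smooth_map_on euclid (M \<times>\<^sub>M N) (\<eta> ` (V \<inter> D)) (inv_into (V \<inter> D) \<eta>)"
    using ad' by simp_all
  have DW: "snd v \<in> W" "fst v \<in> U" "r (snd v) \<in> Y" if "v \<in> D" for v
    using D[of "fst v" "snd v"] that by simp_all
  show "continuous_on (V \<inter> D) (\<lambda>v. (r (snd v), fst v))"
    by (intro continuous_on_Pair continuous_on_compose2[OF r] continuous_on_fst continuous_on_snd continuous_on_id)
      (use DW in auto)
  fix v G assume v: "v \<in> V \<inter> D" and G: "open G \<and> v \<in> G"
  have \<sigma>: "inv_into (V \<inter> D) \<eta> (\<eta> w) = w" if "w \<in> V \<inter> D" for w using inj that by (rule inv_into_f_f)
  obtain T where T: "open T" "inv_into (V \<inter> D) \<eta> -` G \<inter> \<eta> ` (V \<inter> D) = T \<inter> \<eta> ` (V \<inter> D)"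
    using smooth_map_on_continuous[OF sm] G unfolding continuous_on_open_invariant by metis
  have bp: "continuous_on UNIV p" using p by (simp add: linear_continuous_on linear_conv_bounded_linear)
  have cont: "continuous_on (Y \<times> U) (\<lambda>w. (d (fst w), p (c (snd w))))"
    by (intro continuous_on_Pair continuous_on_compose2[OF chartsD(3)[OF d]] continuous_on_compose2[OF bp]
        continuous_on_compose2[OF chartsD(3)[OF c]] continuous_on_fst continuous_on_snd continuous_on_id) auto
  let ?H = "(Y \<times> U) \<inter> (\<lambda>w. (d (fst w), p (c (snd w)))) -` T"
  have "open ?H"
    by (rule continuous_open_preimage[OF cont open_Times[OF chartsD(1)[OF d] chartsD(1)[OF c]] T(1)])
  moreover have "\<eta> v \<in> T" using T(2) v G \<sigma>[OF v] by blast
  then have "(r (snd v), fst v) \<in> ?H" using DW v by (auto simp: \<eta>_def)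
  moreover have "w \<in> G" if w: "w \<in> V \<inter> D" "(r (snd w), fst w) \<in> ?H" for w
  proof -
    have "\<eta> w \<in> T" using w(2) by (simp add: \<eta>_def)
    then have "inv_into (V \<inter> D) \<eta> (\<eta> w) \<in> G" using T(2) w(1) by blast
    then show ?thesis using \<sigma>[OF w(1)] by simp
  qed
  ultimately show "\<exists>H. open H \<and> (r (snd v), fst v) \<in> H \<and> V \<inter> D \<inter> (\<lambda>v. (r (snd v), fst v)) -` H \<subseteq> G"
    by (intro exI[of _ ?H]) blast
qed

text \<open>The representatives are produced together: \<open>FB\<close> consists of the fibres of
  \<open>r\<close>, and \<open>V\<close> is the original representative cut down to where
  \<open>r\<close>, the embedding and the coordinates are all available.\<close>

lemma fibration_exists:
  fixes M :: "('m::{t2_space,second_countable_topology}, 'e::euclidean_space) manifold"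
    and N :: "('n::{t2_space,second_countable_topology}, 'f::euclidean_space) manifold"
  assumes mM: "symplectic_microfold M \<omega>\<^sub>M A" and mN: "symplectic_microfold N \<omega>\<^sub>N B"
    and mor: "symplectic_micromorphism M \<omega>\<^sub>M A N \<omega>\<^sub>N B \<V> \<phi>"
    and fib: "lagrangian_fibration N \<omega>\<^sub>N B \<F>B"
  shows "\<exists>V FA FB \<Psi>.
       V \<in> \<V> \<and>
       lagrangian_submicrofold (M \<times>\<^sub>M N) (prod_form (opposite_form \<omega>\<^sub>M) \<omega>\<^sub>N) (A \<times> B) V (gr \<phi> B) \<and>
       lagrangian_fibration_rep M \<omega>\<^sub>M A N B \<phi> FA \<and>
       lagrangian_fibration_rep N \<omega>\<^sub>N B N B (\<lambda>y. y) FB \<and> \<F>B = germs_along (\<lambda>y. y) B FB \<and>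
       (\<forall>y\<in>B. smooth_map_on M N (FA y) (\<Psi> y) \<and> \<Psi> y ` FA y \<subseteq> FB y \<and> \<Psi> y (\<phi> y) = y \<and>
          {(p, \<Psi> y p) | p. p \<in> FA y} = V \<inter> (UNIV \<times> FB y)) \<and>
       V = (\<Union>y\<in>B. {(p, \<Psi> y p) | p. p \<in> FA y})"
proof -
  define \<Omega> where "\<Omega> = prod_form (opposite_form \<omega>\<^sub>M) \<omega>\<^sub>N"
  have M: "smooth_manifold M" and sM: "symplectic_form M \<omega>\<^sub>M" and A: "lagrangian M \<omega>\<^sub>M A"
    using mM by (simp_all add: symplectic_microfold_def)
  have N: "smooth_manifold N" and sN: "symplectic_form N \<omega>\<^sub>N" and B: "lagrangian N \<omega>\<^sub>N B" "closed B"
    using mN by (simp_all add: symplectic_microfold_def)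
  note wM = symplectic_form_at[OF sM] and wN = symplectic_form_at[OF sN]
  obtain V0 K where \<V>: "\<V> = germ (gr \<phi> B) V0" and V0: "lagrangian_submicrofold (M \<times>\<^sub>M N) \<Omega> (A \<times> B) V0 (gr \<phi> B)"
    and tr: "\<forall>y\<in>B. transverse_at (M \<times>\<^sub>M N) (\<phi> y, y) (tangent_space (M \<times>\<^sub>M N) V0 (\<phi> y, y))
           {u \<in> tangent_space (M \<times>\<^sub>M N) UNIV (\<phi> y, y).
              pushforward fst u \<in> tangent_space M A (\<phi> y) \<and> pushforward snd u \<in> K y}"
    using mor unfolding symplectic_micromorphism_def \<Omega>_def by blast
  have \<phi>: "smooth_map_on N M B \<phi>" "\<phi> ` B \<subseteq> A" using mor unfolding symplectic_micromorphism_def by blast+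
  have V0': "lagrangian (M \<times>\<^sub>M N) \<Omega> V0" "submanifold (M \<times>\<^sub>M N) (gr \<phi> B)"
    "closedin (top_of_set V0) (gr \<phi> B)" "gr \<phi> B \<subseteq> A \<times> B" "V0 \<inter> (A \<times> B) = gr \<phi> B"
    using V0 by (simp_all add: lagrangian_submicrofold_def)
  have grV0: "gr \<phi> B \<subseteq> V0" using V0'(5) by blast
  obtain F where F: "lagrangian_fibration_rep N \<omega>\<^sub>N B N B (\<lambda>y. y) F" "\<F>B = germs_along (\<lambda>y. y) B F"
    using fib unfolding lagrangian_fibration_def lagrangian_fibration_along_def by blast
  obtain W r where W: "open W" "B \<subseteq> W" and r: "smooth_map_on N N W r" "r ` W \<subseteq> B" "\<And>y. y \<in> B \<Longrightarrow> r y = y"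
    and FB: "lagrangian_fibration_rep N \<omega>\<^sub>N B N B (\<lambda>y. y) (\<lambda>y. {q \<in> W. r q = y})"
    "germs_along (\<lambda>y. y) B F = germs_along (\<lambda>y. y) B (\<lambda>y. {q \<in> W. r q = y})"
    by (rule fibration_retraction[OF N wN B F(1)]) blast
  have rc: "continuous_on W r" using r(1) by (rule smooth_map_on_continuous)
  have \<phi>c: "continuous_on B \<phi>" using \<phi>(1) by (rule smooth_map_on_continuous)
  have "\<exists>D. (\<phi> y, y) \<in> D \<and> (\<exists>U c EA Y d FB p. adapted M N A B r W V0 U c EA Y d FB p D)" if y: "y \<in> B" for y
  proof (rule micromorphism_local[OF M N wM wN A B(1) V0'(1)[unfolded \<Omega>_def] grV0 \<phi> y tr[rule_format, OF y] W r])
    fix U c EA Y d FB p D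
    assume a: "(U, c) \<in> charts M" "subspace EA" "EA \<subseteq> model M" "c ` (U \<inter> A) = c ` U \<inter> EA"
      "(Y, d) \<in> charts N" "subspace FB" "FB \<subseteq> model N" "d ` (Y \<inter> B) = d ` Y \<inter> FB"
      "linear p" "p ` model M \<subseteq> model M" "\<And>z. p (p z) = p z" "\<And>z. z \<in> model M \<Longrightarrow> p z = 0 \<longleftrightarrow> z \<in> EA"
      "2 * dim (p ` model M) = dim (model M)"
      "open D" "(\<phi> y, y) \<in> D" "\<And>x y. (x, y) \<in> D \<Longrightarrow> x \<in> U \<and> y \<in> W \<and> r y \<in> Y"
      "inj_on (\<lambda>v. (d (r (snd v)), p (c (fst v)))) (V0 \<inter> D)"
      "openin (top_of_set (FB \<times> p ` model M)) ((\<lambda>v. (d (r (snd v)), p (c (fst v)))) ` (V0 \<inter> D))"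
      "smooth_map_on euclid (M \<times>\<^sub>M N) ((\<lambda>v. (d (r (snd v)), p (c (fst v)))) ` (V0 \<inter> D))
         (inv_into (V0 \<inter> D) (\<lambda>v. (d (r (snd v)), p (c (fst v)))))"
    have ad: "adapted M N A B r W V0 U c EA Y d FB p D"
      unfolding adapted_def by (intro conjI allI ballI impI a)
    show ?thesis
      by (rule exI[of _ D], rule conjI[OF a(15)], rule exI[of _ U], rule exI[of _ c], rule exI[of _ EA],
          rule exI[of _ Y], rule exI[of _ d], rule exI[of _ FB], rule exI[of _ p], rule ad)
  qed
  then have "\<exists>D. \<forall>y\<in>B. (\<phi> y, y) \<in> D y \<and> (\<exists>U c EA Y d FB p. adapted M N A B r W V0 U c EA Y d FB p (D y))"
    by (intro bchoice ballI)
  then obtain D where D': "\<forall>y\<in>B. (\<phi> y, y) \<in> D y \<and> (\<exists>U c EA Y d FB p. adapted M N A B r W V0 U c EA Y d FB p (D y))"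
    by (rule exE)
  have D: "(\<phi> y, y) \<in> D y" "\<exists>U c EA Y d FB p. adapted M N A B r W V0 U c EA Y d FB p (D y)" if "y \<in> B" for y
    using D'[rule_format, OF that] by (rule conjunct1, rule conjunct2)
  have D_open: "open (D y)" and D_emb: "top_embedding (V0 \<inter> D y) (\<lambda>v. (r (snd v), fst v))" if y: "y \<in> B" for y
  proof -
    obtain U c EA Y d FB p where ad: "adapted M N A B r W V0 U c EA Y d FB p (D y)" using D(2)[OF y] by (elim exE)
    show "top_embedding (V0 \<inter> D y) (\<lambda>v. (r (snd v), fst v))" by (rule adapted_top_embedding[OF ad rc])
    show "open (D y)" using ad by (simp add: adapted_def)
  qed
  define f where "f = (\<lambda>v :: 'm \<times> 'n. (r (snd v), fst v))"
  \<comment> \<open>The part of \<open>V0\<close> over the domain of \<open>r\<close>, on which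
    \<open>f\<close> is continuous.\<close>
  define X where "X = V0 \<inter> (UNIV \<times> W)"
  have grX: "gr \<phi> B \<subseteq> X" using grV0 W(2) by (auto simp: X_def gr_def)
  have fX: "continuous_on X f"
    unfolding f_def
    by (intro continuous_on_Pair continuous_on_compose2[OF rc] continuous_on_fst continuous_on_snd continuous_on_id)
      (auto simp: X_def)
  have "f ` gr \<phi> B = (\<lambda>y. (y, \<phi> y)) ` B"
    unfolding gr_def image_image by (rule image_cong[OF refl]) (simp add: f_def r(3))
  then have fgr: "closed (f ` gr \<phi> B)" using closed_graph[OF B(2) \<phi>c] by simp
  have gre: "top_embedding (gr \<phi> B) f"
    unfolding top_embedding_def
  proof (intro conjI ballI allI impI)
    show "continuous_on (gr \<phi> B) f" using fX grX by (rule continuous_on_subset)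
    fix v G assume v: "v \<in> gr \<phi> B" and G: "open G \<and> v \<in> G"
    have "open (prod.swap -` G)" using G by (intro open_vimage continuous_on_swap) simp
    \<comment> \<open>On the core \<open>f\<close> is the exchange of the two factors, hence an
      embedding.\<close>
    moreover have fs: "f w = prod.swap w" if "w \<in> gr \<phi> B" for w using that r(3) by (auto simp: gr_def f_def)
    ultimately show "\<exists>H. open H \<and> f v \<in> H \<and> gr \<phi> B \<inter> f -` H \<subseteq> G"
      using G v by (intro exI[of _ "prod.swap -` G"]) (auto simp: fs)
  qed
  have loc: "\<exists>D. open D \<and> v \<in> D \<and> top_embedding (X \<inter> D) f" if v: "v \<in> gr \<phi> B" for v
  proof -
    obtain y where y: "y \<in> B" "v = (\<phi> y, y)" using v by (auto simp: gr_def)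
    have "X \<inter> D y \<subseteq> V0 \<inter> D y" by (auto simp: X_def)
    then have "top_embedding (X \<inter> D y) f" using D_emb[OF y(1)] unfolding f_def by (rule top_embedding_subset[rotated])
    then show ?thesis using D_open[OF y(1)] D(1)[OF y(1)] y(2) by blast
  qed
  obtain Z0 where Z0: "open Z0" "gr \<phi> B \<subseteq> Z0" "top_embedding (X \<inter> Z0) f"
    using embedding_neighbourhood[OF regular_manifold[OF smooth_manifold_prod[OF N M]] fX grX fgr gre loc] by blast
  \<comment> \<open>\<open>g v\<close> is the core point of the fibre through
    \<open>v\<close>.\<close>
  define g where "g = (\<lambda>v :: 'm \<times> 'n. (\<phi> (r (snd v)), r (snd v)))"
  have gc: "continuous_on (UNIV \<times> W) g"
    unfolding g_def
    by (intro continuous_on_Pair continuous_on_compose2[OF \<phi>c] continuous_on_compose2[OF rc] continuous_on_snd continuous_on_id)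
      (use r(2) in auto)
  \<comment> \<open>Requiring \<open>g v\<close> to lie in the same \<open>D y\<close> as
    \<open>v\<close> prepares the second membership in \<open>loc\<close>.\<close>
  define D' where "D' y = D y \<inter> ((UNIV \<times> W) \<inter> g -` D y)" for y
  have D': "open (D' y)" if "y \<in> B" for y
    unfolding D'_def using D_open[OF that] W(1)
    by (intro open_Int continuous_open_preimage[OF gc] open_Times) auto
  define Z where "Z = Z0 \<inter> (\<Union>y\<in>B. D' y)"
  have Z: "open Z" unfolding Z_def using Z0(1) D' by (intro open_Int open_UN) auto
  have coreZ: "(\<phi> y, y) \<in> Z" if y: "y \<in> B" for y
  proof -
    have "(\<phi> y, y) \<in> Z0" using Z0(2) y by (auto simp: gr_def)
    moreover have "(\<phi> y, y) \<in> D' y" using D(1)[OF y] r(3)[OF y] W(2) y by (auto simp: D'_def g_def)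
    ultimately show ?thesis using y by (auto simp: Z_def)
  qed
  define V where "V = V0 \<inter> Z"
  have grV: "gr \<phi> B \<subseteq> V" using grV0 coreZ by (auto simp: V_def gr_def)
  have VW: "snd v \<in> W" if "v \<in> V" for v using that by (auto simp: V_def Z_def D'_def)
  have VX: "V \<subseteq> X \<inter> Z0"
  proof
    fix v assume v: "v \<in> V"
    then have "v \<in> V0" "v \<in> Z0" by (auto simp: V_def Z_def)
    then show "v \<in> X \<inter> Z0" using VW[OF v] by (simp add: X_def mem_Times_iff)
  qed
  have lV: "lagrangian (M \<times>\<^sub>M N) \<Omega> V" unfolding V_def by (rule lagrangian_open[OF V0'(1) Z])
  interpret fibred_relation M N \<omega>\<^sub>M \<omega>\<^sub>N A B \<phi> r W V
  proof
    show "lagrangian (M \<times>\<^sub>M N) (prod_form (opposite_form \<omega>\<^sub>M) \<omega>\<^sub>N) V" using lV by (simp add: \<Omega>_def)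
    show "lagrangian N \<omega>\<^sub>N {q \<in> W. r q = y}" if "y \<in> B" for y
      using FB(1)[unfolded lagrangian_fibration_rep_def lagrangian_submicrofold_def, THEN conjunct1, rule_format, OF that]
      by blast
    show "top_embedding V (\<lambda>v. (r (snd v), fst v))" using top_embedding_subset[OF Z0(3) VX] by (simp add: f_def)
    fix v assume v: "v \<in> V"
    then obtain y where y: "y \<in> B" "v \<in> D' y" by (auto simp: V_def Z_def)
    obtain U c EA Y d FB p where ad: "adapted M N A B r W V0 U c EA Y d FB p (D y)" using D(2)[OF y(1)] by (elim exE)
    have "adapted M N A B r W V U c EA Y d FB p (D y \<inter> Z)" unfolding V_def by (rule adapted_restrict[OF M N ad Z])
    moreover have "v \<in> D y \<inter> Z" using y v by (auto simp: V_def D'_def)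
    moreover have "r (snd v) \<in> B" using r(2) VW[OF v] by blast
    then have "(\<phi> (r (snd v)), r (snd v)) \<in> D y \<inter> Z" using y(2) coreZ by (auto simp: D'_def g_def)
    ultimately show "\<exists>U c EA Y d FB p D. adapted M N A B r W V U c EA Y d FB p D \<and>
      v \<in> D \<and> (\<phi> (r (snd v)), r (snd v)) \<in> D" by blast
  qed (use M N wM A B grV \<phi> W r VW in blast)+
  have 1: "V \<in> \<V>" unfolding \<V> germ_def using Z coreZ by (intro CollectI exI[of _ Z]) (auto simp: V_def gr_def)
  have "closedin (top_of_set V) (gr \<phi> B)" by (rule closedin_subset_trans[OF V0'(3) grV]) (auto simp: V_def)
  moreover have "V \<inter> (A \<times> B) = gr \<phi> B" using V0'(5) grV by (auto simp: V_def)
  ultimately have 2: "lagrangian_submicrofold (M \<times>\<^sub>M N) (prod_form (opposite_form \<omega>\<^sub>M) \<omega>\<^sub>N) (A \<times> B) V (gr \<phi> B)"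
    using lV V0'(2,4) by (simp add: lagrangian_submicrofold_def \<Omega>_def)
  have PB: "\<Psi> y ` FA y \<subseteq> {q \<in> W. r q = y}" for y using Psi VW by fastforce
  have graph: "{(p, \<Psi> y p) | p. p \<in> FA y} = V \<inter> (UNIV \<times> {q \<in> W. r q = y})" for y
  proof (intro subset_antisym subsetI)
    fix v assume "v \<in> {(p, \<Psi> y p) | p. p \<in> FA y}"
    then show "v \<in> V \<inter> (UNIV \<times> {q \<in> W. r q = y})" using Psi(1) PB by blast
  next
    fix v assume "v \<in> V \<inter> (UNIV \<times> {q \<in> W. r q = y})"
    then obtain x q where v: "v = (x, q)" "(x, q) \<in> V" "r q = y" by blast
    have "x \<in> FA y" using FA_I[OF v(2)] v(3) by simp
    then show "v \<in> {(p, \<Psi> y p) | p. p \<in> FA y}"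
      unfolding v(1) Psi_eq[OF v(2,3), symmetric] by (intro CollectI exI[of _ x]) simp
  qed
  have un: "V = (\<Union>y\<in>B. {(p, \<Psi> y p) | p. p \<in> FA y})"
    unfolding graph
  proof (intro subset_antisym subsetI)
    fix v assume v: "v \<in> V"
    have "r (snd v) \<in> B" using r(2) VW[OF v] by blast
    moreover have "v \<in> V \<inter> (UNIV \<times> {q \<in> W. r q = r (snd v)})" using v VW[OF v] by (simp add: mem_Times_iff)
    ultimately show "v \<in> (\<Union>y\<in>B. V \<inter> (UNIV \<times> {q \<in> W. r q = y}))" by (rule UN_I)
  qed blast
  show ?thesis
    by (intro exI[of _ V] exI[of _ FA] exI[of _ "\<lambda>y. {q \<in> W. r q = y}"] exI[of _ \<Psi>] conjI ballI)
      (use 1 2 FA_rep FB F(2) smooth_Psi PB Psi_core graph un in simp_all)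
qed

section \<open>Uniqueness of the germs\<close>

text \<open>The representatives of \<open>V\<close> and of the fibre in \<open>N\<close> agree only
  near their cores. Since \<open>\<Psi>\<close> is continuous with
  \<open>\<Psi> (\<phi> y) = y\<close>, the points \<open>(p, \<Psi> p)\<close> stay in the region
  of agreement for \<open>p\<close> near \<open>\<phi> y\<close>, and hence lie on the graph of
  \<open>\<Psi>'\<close>.\<close>

lemma fibre_germ_subset:
  fixes M :: "('m::topological_space, 'e::euclidean_space) manifold"
    and N :: "('n::topological_space, 'f::euclidean_space) manifold"
  assumes V: "V \<in> germ (gr \<phi> B) V0" "V' \<in> germ (gr \<phi> B) V0" and y: "y \<in> B"
    and FB: "germ {y} FB = germ {y} FB'" and \<phi>: "\<phi> y \<in> FA"
    and \<Psi>: "continuous_on FA \<Psi>" "\<Psi> (\<phi> y) = y" "{(p, \<Psi> p) | p. p \<in> FA} = V \<inter> (UNIV \<times> FB)"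
    and \<Psi>': "{(p, \<Psi>' p) | p. p \<in> FA'} = V' \<inter> (UNIV \<times> FB')"
  obtains G where "open G" "\<phi> y \<in> G" "FA \<inter> G \<subseteq> FA'"
proof -
  obtain W1 where W1: "open W1" "gr \<phi> B \<subseteq> W1" "V0 \<inter> W1 = V \<inter> W1" using V(1) unfolding germ_def by blast
  obtain W2 where W2: "open W2" "gr \<phi> B \<subseteq> W2" "V0 \<inter> W2 = V' \<inter> W2" using V(2) unfolding germ_def by blast
  have "FB' \<in> germ {y} FB" unfolding FB unfolding germ_def by auto
  then obtain T where "open T" "{y} \<subseteq> T" "FB \<inter> T = FB' \<inter> T" unfolding germ_def by blast
  then have T: "open T" "y \<in> T" "FB \<inter> T = FB' \<inter> T" by simp_all
  define O' where "O' = W1 \<inter> W2 \<inter> (UNIV \<times> T)"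
  have O': "open O'" unfolding O'_def using W1 W2 T by (intro open_Int open_Times) auto
  have core: "(\<phi> y, \<Psi> (\<phi> y)) \<in> O'" using W1(2) W2(2) T(2) \<Psi>(2) y by (auto simp: O'_def gr_def)
  have "continuous_on FA (\<lambda>p. (p, \<Psi> p))" by (intro continuous_on_Pair continuous_on_id \<Psi>(1))
  then obtain G where G: "open G" "(\<lambda>p. (p, \<Psi> p)) -` O' \<inter> FA = G \<inter> FA"
    using O' unfolding continuous_on_open_invariant by metis
  have "FA \<inter> G \<subseteq> FA'"
  proof
    fix p assume p: "p \<in> FA \<inter> G"
    then have pO: "(p, \<Psi> p) \<in> O'" using G(2) by blast
    have "(p, \<Psi> p) \<in> V \<inter> (UNIV \<times> FB)" unfolding \<Psi>(3)[symmetric] using p by blast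
    then have "(p, \<Psi> p) \<in> V'" "\<Psi> p \<in> FB'" using pO W1(3) W2(3) T(3) by (auto simp: O'_def)
    then have "(p, \<Psi> p) \<in> {(p, \<Psi>' p) | p. p \<in> FA'}" unfolding \<Psi>' by blast
    then show "p \<in> FA'" by blast
  qed
  moreover have "\<phi> y \<in> G" using G(2) core \<phi> by blast
  ultimately show ?thesis using that G(1) by blast
qed

theorem theorem28:
  fixes M :: "('m::{t2_space,second_countable_topology}, 'e::euclidean_space) manifold"
    and N :: "('n::{t2_space,second_countable_topology}, 'f::euclidean_space) manifold"
    and \<omega>\<^sub>M :: "'m two_form" and \<omega>\<^sub>N :: "'n two_form"
    and A :: "'m set" and B :: "'n set"
    and \<V> :: "('m \<times> 'n) set set" and \<phi> :: "'n \<Rightarrow> 'm"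
    and \<F>B :: "'n \<Rightarrow> 'n set set"
  assumes "symplectic_microfold M \<omega>\<^sub>M A"
    and "symplectic_microfold N \<omega>\<^sub>N B"
    and "symplectic_micromorphism M \<omega>\<^sub>M A N \<omega>\<^sub>N B \<V> \<phi>"
    and "lagrangian_fibration N \<omega>\<^sub>N B \<F>B"
  shows "\<exists>!\<F>A. lagrangian_fibration_along M \<omega>\<^sub>M A N B \<phi> \<F>A \<and>
    (\<exists>V FA FB \<Psi>.
       V \<in> \<V> \<and>
       lagrangian_submicrofold (M \<times>\<^sub>M N) (prod_form (opposite_form \<omega>\<^sub>M) \<omega>\<^sub>N) (A \<times> B) V (gr \<phi> B) \<and>
       lagrangian_fibration_rep M \<omega>\<^sub>M A N B \<phi> FA \<and> \<F>A = germs_along \<phi> B FA \<and>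
       lagrangian_fibration_rep N \<omega>\<^sub>N B N B (\<lambda>y. y) FB \<and> \<F>B = germs_along (\<lambda>y. y) B FB \<and>
       (\<forall>y\<in>B. smooth_map_on M N (FA y) (\<Psi> y) \<and> \<Psi> y ` FA y \<subseteq> FB y \<and> \<Psi> y (\<phi> y) = y \<and>
          {(p, \<Psi> y p) | p. p \<in> FA y} = V \<inter> (UNIV \<times> FB y)) \<and>
       V = (\<Union>y\<in>B. {(p, \<Psi> y p) | p. p \<in> FA y}))"
    (is "\<exists>!\<F>A. ?L \<F>A \<and> ?C \<F>A")
proof (rule ex_ex1I)
  obtain V FA FB \<Psi> where *: "V \<in> \<V>"
    "lagrangian_submicrofold (M \<times>\<^sub>M N) (prod_form (opposite_form \<omega>\<^sub>M) \<omega>\<^sub>N) (A \<times> B) V (gr \<phi> B)"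
    "lagrangian_fibration_rep M \<omega>\<^sub>M A N B \<phi> FA"
    "lagrangian_fibration_rep N \<omega>\<^sub>N B N B (\<lambda>y. y) FB" "\<F>B = germs_along (\<lambda>y. y) B FB"
    "\<forall>y\<in>B. smooth_map_on M N (FA y) (\<Psi> y) \<and> \<Psi> y ` FA y \<subseteq> FB y \<and> \<Psi> y (\<phi> y) = y \<and>
          {(p, \<Psi> y p) | p. p \<in> FA y} = V \<inter> (UNIV \<times> FB y)"
    "V = (\<Union>y\<in>B. {(p, \<Psi> y p) | p. p \<in> FA y})"
    using fibration_exists[OF assms] by (elim exE conjE)
  have "?L (germs_along \<phi> B FA)" unfolding lagrangian_fibration_along_def using *(3) by blast
  moreover have "?C (germs_along \<phi> B FA)"
    by (intro exI[of _ V] exI[of _ FA] exI[of _ FB] exI[of _ \<Psi>] conjI refl *)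
  ultimately show "\<exists>\<F>A. ?L \<F>A \<and> ?C \<F>A" by (intro exI[of _ "germs_along \<phi> B FA"] conjI)
next
  fix \<F> \<F>' assume "?L \<F> \<and> ?C \<F>" and "?L \<F>' \<and> ?C \<F>'"
  then have C: "?C \<F>" and C': "?C \<F>'" by blast+
  obtain V FA FB \<Psi> where a: "V \<in> \<V>" "lagrangian_fibration_rep M \<omega>\<^sub>M A N B \<phi> FA" "\<F> = germs_along \<phi> B FA"
    "\<F>B = germs_along (\<lambda>y. y) B FB"
    "\<forall>y\<in>B. smooth_map_on M N (FA y) (\<Psi> y) \<and> \<Psi> y ` FA y \<subseteq> FB y \<and> \<Psi> y (\<phi> y) = y \<and>
          {(p, \<Psi> y p) | p. p \<in> FA y} = V \<inter> (UNIV \<times> FB y)"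
    using C by (elim exE conjE)
  obtain V' FA' FB' \<Psi>' where a': "V' \<in> \<V>" "lagrangian_fibration_rep M \<omega>\<^sub>M A N B \<phi> FA'" "\<F>' = germs_along \<phi> B FA'"
    "\<F>B = germs_along (\<lambda>y. y) B FB'"
    "\<forall>y\<in>B. smooth_map_on M N (FA' y) (\<Psi>' y) \<and> \<Psi>' y ` FA' y \<subseteq> FB' y \<and> \<Psi>' y (\<phi> y) = y \<and>
          {(p, \<Psi>' y p) | p. p \<in> FA' y} = V' \<inter> (UNIV \<times> FB' y)"
    using C' by (elim exE conjE)
  \<comment> \<open>\<open>V\<close> and \<open>V'\<close> may be different representatives of one
    germ, so both are compared with a fixed \<open>V0\<close>.\<close>
  obtain V0 where V0: "\<V> = germ (gr \<phi> B) V0" using assms(3) unfolding symplectic_micromorphism_def by blast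
  show "\<F> = \<F>'"
    unfolding a(3) a'(3) germs_along_def
  proof (rule restrict_ext)
    fix y assume y: "y \<in> B"
    have FB: "germ {y} (FB y) = germ {y} (FB' y)"
      using fun_cong[OF a(4)[unfolded a'(4) germs_along_def], of y] y by simp
    have "FA y \<inter> A = {\<phi> y}" "FA' y \<inter> A = {\<phi> y}"
      using a(2)[unfolded lagrangian_fibration_rep_def lagrangian_submicrofold_def, THEN conjunct1, rule_format, OF y]
        a'(2)[unfolded lagrangian_fibration_rep_def lagrangian_submicrofold_def, THEN conjunct1, rule_format, OF y]
      by simp_all
    then have \<phi>: "\<phi> y \<in> FA y" "\<phi> y \<in> FA' y" by blast+
    have \<Psi>: "continuous_on (FA y) (\<Psi> y)" "\<Psi> y (\<phi> y) = y" "{(p, \<Psi> y p) | p. p \<in> FA y} = V \<inter> (UNIV \<times> FB y)"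
      by (rule smooth_map_on_continuous[OF a(5)[rule_format, OF y, THEN conjunct1]])
        (use a(5)[rule_format, OF y] in simp_all)
    have \<Psi>': "continuous_on (FA' y) (\<Psi>' y)" "\<Psi>' y (\<phi> y) = y" "{(p, \<Psi>' y p) | p. p \<in> FA' y} = V' \<inter> (UNIV \<times> FB' y)"
      by (rule smooth_map_on_continuous[OF a'(5)[rule_format, OF y, THEN conjunct1]])
        (use a'(5)[rule_format, OF y] in simp_all)
    obtain G where G: "open G" "\<phi> y \<in> G" "FA y \<inter> G \<subseteq> FA' y"
      by (rule fibre_germ_subset[OF a(1)[unfolded V0] a'(1)[unfolded V0] y FB \<phi>(1) \<Psi> \<Psi>'(3)])
    obtain G' where G': "open G'" "\<phi> y \<in> G'" "FA' y \<inter> G' \<subseteq> FA y"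
      by (rule fibre_germ_subset[OF a'(1)[unfolded V0] a(1)[unfolded V0] y FB[symmetric] \<phi>(2) \<Psi>' \<Psi>(3)])
    show "germ {\<phi> y} (FA y) = germ {\<phi> y} (FA' y)"
      by (rule germ_eqI[of "G \<inter> G'"]) (use G G' in auto)
  qed
qed

end
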